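(* Let $N\ge2$, let $\rho_\pm$ be positive constants, let $q\in(1,\infty)$, $q'=q/(q-1)$, and let $r\in(N,\infty)$ with $\max(q,q')\le r$. Let $M_1\in(0,1/2)$ and $C'$ be the constants specified in the context, let $M_2\ge1$, let $(\Phi,\widetilde\Omega_\pm,\widetilde\Sigma,\widetilde{\mathbf{n}})$ be a bent-interface configuration with parameters $M_1,M_2,r$ (see context), and let $\rho=\rho_+\mathbf{1}_{\widetilde\Omega_+}+\rho_-\mathbf{1}_{\widetilde\Omega_-}$. (1) Existence. Let $\mathbf{f}\in L_q(\mathbb{R}^N\setminus\widetilde\Sigma)^N$. Then there is $u\in\widehat H_q^1(\mathbb{R}^N)$ such that $$(\rho^{-1}\nabla u,\nabla\varphi)_{\mathbb{R}^N\setminus\widetilde\Sigma}=(\mathbf{f},\nabla\varphi)_{\mathbb{R}^N\setminus\widetilde\Sigma}\quad\text{for any }\varphi\in\widehat H_{q'}^1(\mathbb{R}^N),$$ satisfying $$\|\nabla u\|_{L_q(\mathbb{R}^N)}\le2C'(\rho_++\rho_-)\|\mathbf{f}\|_{L_q(\mathbb{R}^N\setminus\widetilde\Sigma)}.$$ (2) Uniqueness. If $u\in\widehat H_q^1(\mathbb{R}^N)$ satisfies $$(\rho^{-1}\nabla u,\nabla\varphi)_{\mathbb{R}^N\setminus\widetilde\Sigma}=0\quad\text{for any }\varphi\in\widehat H_{q'}^1(\mathbb{R}^N),$$ then $u=c$ for some constant $c$.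
   Context: $\mathbb{R}_\pm^N=\{x:\pm x_N>0\}$, $\mathbb{R}_0^N=\{x:x_N=0\}$; $(\mathbf{u},\mathbf{v})_G=\int_G\mathbf{u}\cdot\mathbf{v}\,dx$; $\mathbf{1}_A$ is the indicator function of $A$. Bent-interface configuration with parameters $M_1\in(0,1/2]$, $M_2\ge1$, $r\in(N,\infty)$: $\Phi:\mathbb{R}_x^N\to\mathbb{R}_y^N$ is a bijection of class $C^1$ with inverse $\Phi^{-1}=(\Phi_{-1,1},\dots,\Phi_{-1,N})$, such that $(\nabla_x\Phi)(x)=\mathcal{A}+\mathbf{B}(x)$ and $(\nabla_y\Phi^{-1})(\Phi(x))=\mathcal{A}_{-1}+\mathbf{B}_{-1}(x)$ (Jacobian matrices; the $(l,j)$ entry of $\nabla_y\Phi^{-1}$ is $\partial\Phi_{-1,l}/\partial y_j$), where $\mathcal{A},\mathcal{A}_{-1}$ are constant orthonormal matrices with $\det\mathcal{A}=\det\mathcal{A}_{-1}=1$, and $\mathbf{B},\mathbf{B}_{-1}$ are matrix-valued functions in $H_r^1(\mathbb{R}^N)$ with $\|(\mathbf{B},\mathbf{B}_{-1})\|_{L_\infty(\mathbb{R}^N)}\le M_1$ and $\|(\nabla\mathbf{B},\nabla\mathbf{B}_{-1})\|_{L_r(\mathbb{R}^N)}\le M_2$. Set $\widetilde\Omega_\pm=\Phi(\mathbb{R}_\pm^N)$, $\widetilde\Sigma=\Phi(\mathbb{R}_0^N)$, and let $\widetilde{\mathbf{n}}$ be the unit normal on $\widetilde\Sigma$ pointing from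 $\widetilde\Omega_+$ into $\widetilde\Omega_-$, extended to $\mathbb{R}^N$ by $\widetilde{\mathbf{n}}(\Phi(x))=\frac{(\mathcal{A}_{-1}+\mathbf{B}_{-1}(x))^{\mathsf T}\mathbf{n}_0}{|(\mathcal{A}_{-1}+\mathbf{B}_{-1}(x))^{\mathsf T}\mathbf{n}_0|}$, $\mathbf{n}_0=(0,\dots,0,-1)^{\mathsf T}$. Function spaces: $\widehat H_q^1(G)=\{f\in L_{q,\mathrm{loc}}(\overline G):\nabla f\in L_q(G)^N\}$, $\widehat H_q^2(G)=\{f\in L_{1,\mathrm{loc}}(G):\nabla f\in\widehat H_q^1(G)^N\}$; $E_q(D)=\{\mathbf{f}\in L_q(D)^N:\operatorname{div}\mathbf{f}\in L_q(D)\}$ with $\|\mathbf{f}\|_{E_q(D)}=\|\mathbf{f}\|_{L_q(D)}+\|\operatorname{div}\mathbf{f}\|_{L_q(D)}$; $F_q(\widetilde\Omega_\pm)=\{\widetilde{\mathbf{f}}_\pm\in E_q(\widetilde\Omega_\pm):\widetilde{\mathbf{n}}\cdot\widetilde{\mathbf{f}}_\pm\in H_q^1(\widetilde\Omega_\pm)\}$. The constants: $M_1\in(0,1/2)$, depending only on $N,q,\rho_+,\rho_-$, is small enough that for the exponent $q$ (and likewise for the exponent $q'$, with its own constants) the following holds for all $r\in(N,\infty)$ with $\max(q,q')\le r$, all $M_2\ge1$ and all bent-interface configurations with parameters $M_1,M_2,r$, with constants $C=C(M_2,r,N,q,\rho_+,\rho_-)$ and $C'=C'(N,q,\rho_+,\rho_-)$.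 (i) For any $\widetilde{\mathbf{f}}_\pm\in F_q(\widetilde\Omega_\pm)$ there are $\widetilde v_\pm\in\widehat H_q^1(\widetilde\Omega_\pm)\cap\widehat H_q^2(\widetilde\Omega_\pm)$ with $\Delta\widetilde v_\pm=\operatorname{div}\widetilde{\mathbf{f}}_\pm$ in $\widetilde\Omega_\pm$, $\rho_+\widetilde v_+=\rho_-\widetilde v_-$ and $\widetilde{\mathbf{n}}\cdot\nabla(\widetilde v_+-\widetilde v_-)=\widetilde{\mathbf{n}}\cdot(\widetilde{\mathbf{f}}_+-\widetilde{\mathbf{f}}_-)$ on $\widetilde\Sigma$, satisfying $\|\nabla^2\widetilde v_\pm\|_{L_q(\widetilde\Omega_\pm)}\le C\sum_{\mathfrak{s}\in\{+,-\}}(\|\widetilde{\mathbf{f}}_{\mathfrak{s}}\|_{E_q(\widetilde\Omega_{\mathfrak{s}})}+\|\widetilde{\mathbf{n}}\cdot\widetilde{\mathbf{f}}_{\mathfrak{s}}\|_{H_q^1(\widetilde\Omega_{\mathfrak{s}})})$ and $\|\nabla\widetilde v_\pm\|_{L_q(\widetilde\Omega_\pm)}\le C'\sum_{\mathfrak{s}\in\{+,-\}}\|\widetilde{\mathbf{f}}_{\mathfrak{s}}\|_{L_q(\widetilde\Omega_{\mathfrak{s}})}$, and, if $\widetilde{\mathbf{n}}\cdot(\widetilde{\mathbf{f}}_+-\widetilde{\mathbf{f}}_-)=0$ on $\widetilde\Sigma$, also $\|\nabla^2\widetilde v_\pm\|_{L_q(\widetilde\Omega_\pm)}\le C\sum_{\mathfrak{s}}\|\widetilde{\mathbf{f}}_{\mathfrak{s}}\|_{E_q(\widetilde\Omega_{\mathfrak{s}})}$.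 (ii) The corresponding homogeneous problem has in this class only the solutions $\widetilde v_\pm=\rho_\pm^{-1}c$ with $c$ constant. (Such constants exist.) *)

theory Defs
  imports "HOL-Analysis.Analysis"
begin

text \<open>
  The space dimension is \<open>N = CARD('n)\<close>.  Functions are real valued and represent their classes
  modulo Lebesgue null sets; a function on \<open>G\<close> is a total function whose values outside \<open>G\<close> are
  irrelevant.  Vectors, matrices and pairs carry the Euclidean norm pointwise.
\<close>

section \<open>Test functions\<close>

definition pd :: "'n \<Rightarrow> (real^'n \<Rightarrow> real) \<Rightarrow> real^'n \<Rightarrow> real" where
  "pd i f x = frechet_derivative f (at x) (axis i 1)"

primrec Ck :: "nat \<Rightarrow> (real^'n \<Rightarrow> real) \<Rightarrow> bool" where
  "Ck 0 f \<longleftrightarrow> continuous_on UNIV f"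
| "Ck (Suc k) f \<longleftrightarrow> (\<forall>x. f differentiable (at x)) \<and> (\<forall>i. Ck k (pd i f))"

definition test_fun :: "(real^'n) set \<Rightarrow> (real^'n \<Rightarrow> real) \<Rightarrow> bool" where
  "test_fun G \<phi> \<longleftrightarrow> (\<forall>k. Ck k \<phi>) \<and> compact (closure {x. \<phi> x \<noteq> 0}) \<and> closure {x. \<phi> x \<noteq> 0} \<subseteq> G"

section \<open>Lebesgue spaces\<close>

definition Lq :: "real \<Rightarrow> (real^'n) set \<Rightarrow> (real^'n \<Rightarrow> 'b::euclidean_space) set" where
  "Lq q G = {f. f \<in> borel_measurable (lebesgue_on G) \<and>
                integrable (lebesgue_on G) (\<lambda>x. norm (f x) powr q)}"

definition Lq_norm :: "real \<Rightarrow> (real^'n) set \<Rightarrow> (real^'n \<Rightarrow> 'b::euclidean_space) \<Rightarrow> real" where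
  "Lq_norm q G f = (LINT x|lebesgue_on G. norm (f x) powr q) powr (1 / q)"

definition L1_loc :: "(real^'n) set \<Rightarrow> (real^'n \<Rightarrow> 'b::euclidean_space) set" where
  "L1_loc G = {f. \<forall>K. compact K \<and> K \<subseteq> G \<longrightarrow> integrable (lebesgue_on K) f}"

text \<open>\<open>L\<^sub>q\<^sub>,\<^sub>l\<^sub>o\<^sub>c\<close> of the closure of \<open>G\<close>: integrability up to the boundary, on bounded parts of \<open>G\<close>.\<close>

definition Lq_loc_closure ::
  "real \<Rightarrow> (real^'n) set \<Rightarrow> (real^'n \<Rightarrow> 'b::euclidean_space) set" where
  "Lq_loc_closure q G = {f. \<forall>K. compact K \<and> K \<subseteq> closure G \<longrightarrow> f \<in> Lq q (G \<inter> K)}"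

definition pairing ::
  "(real^'n) set \<Rightarrow> (real^'n \<Rightarrow> real^'n) \<Rightarrow> (real^'n \<Rightarrow> real^'n) \<Rightarrow> real" where
  "pairing G u v = (LINT x|lebesgue_on G. u x \<bullet> v x)"

section \<open>Weak derivatives\<close>

definition has_weak_grad ::
  "(real^'n) set \<Rightarrow> (real^'n \<Rightarrow> real) \<Rightarrow> (real^'n \<Rightarrow> real^'n) \<Rightarrow> bool" where
  "has_weak_grad G u g \<longleftrightarrow> u \<in> L1_loc G \<and> g \<in> L1_loc G \<and>
     (\<forall>\<phi> i. test_fun G \<phi> \<longrightarrow>
        (LINT x|lebesgue_on G. u x * pd i \<phi> x) = - (LINT x|lebesgue_on G. g x $ i * \<phi> x))"

definition has_weak_div ::
  "(real^'n) set \<Rightarrow> (real^'n \<Rightarrow> real^'n) \<Rightarrow> (real^'n \<Rightarrow> real) \<Rightarrow> bool" where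
  "has_weak_div G F d \<longleftrightarrow> F \<in> L1_loc G \<and> d \<in> L1_loc G \<and>
     (\<forall>\<phi>. test_fun G \<phi> \<longrightarrow>
        (LINT x|lebesgue_on G. (\<Sum>i\<in>UNIV. F x $ i * pd i \<phi> x)) =
          - (LINT x|lebesgue_on G. d x * \<phi> x))"

text \<open>
  For open \<open>G\<close>, the weak gradient and divergence are unique up to null sets; \<open>wgrad\<close> and
  \<open>wdiv\<close> pick a representative, and are meaningful only where one exists.
\<close>

definition wgrad :: "(real^'n) set \<Rightarrow> (real^'n \<Rightarrow> real) \<Rightarrow> real^'n \<Rightarrow> real^'n" where
  "wgrad G u = (SOME g. has_weak_grad G u g)"

definition wdiv :: "(real^'n) set \<Rightarrow> (real^'n \<Rightarrow> real^'n) \<Rightarrow> real^'n \<Rightarrow> real" where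
  "wdiv G F = (SOME d. has_weak_div G F d)"

definition wgrad_vec ::
  "(real^'n) set \<Rightarrow> (real^'n \<Rightarrow> real^'n) \<Rightarrow> real^'n \<Rightarrow> real^'n^'n" where
  "wgrad_vec G F x = (\<chi> i. wgrad G (\<lambda>y. F y $ i) x)"

definition wgrad_mat ::
  "(real^'n) set \<Rightarrow> (real^'n \<Rightarrow> real^'n^'n) \<Rightarrow> real^'n \<Rightarrow> real^'n^'n^'n" where
  "wgrad_mat G B x = (\<chi> i. wgrad_vec G (\<lambda>y. B y $ i) x)"

definition hess :: "(real^'n) set \<Rightarrow> (real^'n \<Rightarrow> real) \<Rightarrow> real^'n \<Rightarrow> real^'n^'n" where
  "hess G v = wgrad_vec G (wgrad G v)"

definition lapl :: "(real^'n) set \<Rightarrow> (real^'n \<Rightarrow> real) \<Rightarrow> real^'n \<Rightarrow> real" where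
  "lapl G v = wdiv G (wgrad G v)"

section \<open>Function spaces\<close>

definition H1 :: "real \<Rightarrow> (real^'n) set \<Rightarrow> (real^'n \<Rightarrow> real) set" where
  "H1 q G = {f. f \<in> Lq q G \<and> (\<exists>g. has_weak_grad G f g \<and> g \<in> Lq q G)}"

definition H1_norm :: "real \<Rightarrow> (real^'n) set \<Rightarrow> (real^'n \<Rightarrow> real) \<Rightarrow> real" where
  "H1_norm q G f = Lq_norm q G f + Lq_norm q G (wgrad G f)"

definition hatH1 :: "real \<Rightarrow> (real^'n) set \<Rightarrow> (real^'n \<Rightarrow> real) set" where
  "hatH1 q G = {f. f \<in> Lq_loc_closure q G \<and> (\<exists>g. has_weak_grad G f g \<and> g \<in> Lq q G)}"

definition hatH2 :: "real \<Rightarrow> (real^'n) set \<Rightarrow> (real^'n \<Rightarrow> real) set" where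
  "hatH2 q G = {f. f \<in> L1_loc G \<and>
                  (\<exists>g. has_weak_grad G f g \<and> (\<forall>i. (\<lambda>x. g x $ i) \<in> hatH1 q G))}"

definition E_space :: "real \<Rightarrow> (real^'n) set \<Rightarrow> (real^'n \<Rightarrow> real^'n) set" where
  "E_space q D = {f. f \<in> Lq q D \<and> (\<exists>d. has_weak_div D f d \<and> d \<in> Lq q D)}"

definition E_norm :: "real \<Rightarrow> (real^'n) set \<Rightarrow> (real^'n \<Rightarrow> real^'n) \<Rightarrow> real" where
  "E_norm q D f = Lq_norm q D f + Lq_norm q D (wdiv D f)"

section \<open>Bent interfaces\<close>

text \<open>
  Synonyms for \<open>real^'n\<close> and \<open>real^'n^'n\<close>: that notation fixes the sort of \<open>'n\<close> to \<open>finite\<close>, while the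
  last coordinate needs a linear order on the index type.
\<close>

type_synonym 'n rvec = "(real, 'n) vec"
type_synonym 'n rmat = "((real, 'n) vec, 'n) vec"

text \<open>The index \<open>N\<close> of the last coordinate.\<close>

definition last_ix :: "'n::{finite,linorder}" where
  "last_ix = Max UNIV"

datatype phase = Plus | Minus

primrec half_space :: "phase \<Rightarrow> ('n::{finite,linorder} rvec) set" where
  "half_space Plus = {x. x $ last_ix > 0}"
| "half_space Minus = {x. x $ last_ix < 0}"

definition bent_interface :: "real \<Rightarrow> real \<Rightarrow> real \<Rightarrow>
    ('n::{finite,linorder} rvec \<Rightarrow> 'n rvec) \<Rightarrow>
    'n rmat \<Rightarrow> ('n rvec \<Rightarrow> 'n rmat) \<Rightarrow> 'n rmat \<Rightarrow> ('n rvec \<Rightarrow> 'n rmat) \<Rightarrow> bool" where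
  "bent_interface M1 M2 r \<Phi> A B A' B' \<longleftrightarrow>
     bij \<Phi> \<and>
     (\<forall>x. (\<Phi> has_derivative (\<lambda>h. (A + B x) *v h)) (at x)) \<and>
     continuous_on UNIV (\<lambda>x. A + B x) \<and>
     (\<forall>x. (inv \<Phi> has_derivative (\<lambda>h. (A' + B' x) *v h)) (at (\<Phi> x))) \<and>
     orthogonal_matrix A \<and> det A = 1 \<and> orthogonal_matrix A' \<and> det A' = 1 \<and>
     (\<forall>i j. (\<lambda>x. B x $ i $ j) \<in> H1 r UNIV) \<and> (\<forall>i j. (\<lambda>x. B' x $ i $ j) \<in> H1 r UNIV) \<and>
     (AE x in lebesgue. norm (B x, B' x) \<le> M1) \<and>
     Lq_norm r UNIV (\<lambda>x. (wgrad_mat UNIV B x, wgrad_mat UNIV B' x)) \<le> M2"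

definition Omega :: "('n::{finite,linorder} rvec \<Rightarrow> 'n rvec) \<Rightarrow> phase \<Rightarrow> ('n rvec) set" where
  "Omega \<Phi> s = \<Phi> ` half_space s"

definition Sigma_tilde :: "('n::{finite,linorder} rvec \<Rightarrow> 'n rvec) \<Rightarrow> ('n rvec) set" where
  "Sigma_tilde \<Phi> = \<Phi> ` {x. x $ last_ix = 0}"

definition bent_normal :: "('n::{finite,linorder} rvec \<Rightarrow> 'n rvec) \<Rightarrow>
    'n rmat \<Rightarrow> ('n rvec \<Rightarrow> 'n rmat) \<Rightarrow> 'n rvec \<Rightarrow> 'n rvec" where
  "bent_normal \<Phi> A' B' y =
     (let w = transpose (A' + B' (inv \<Phi> y)) *v (- axis last_ix 1) in w /\<^sub>R norm w)"

definition F_space :: "real \<Rightarrow> (real^'n) set \<Rightarrow> (real^'n \<Rightarrow> real^'n) \<Rightarrow>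
    (real^'n \<Rightarrow> real^'n) set" where
  "F_space q D n = {f. f \<in> E_space q D \<and> (\<lambda>x. n x \<bullet> f x) \<in> H1 q D}"

section \<open>Traces on the interface\<close>

text \<open>
  The push-forward of \<open>(N - 1)\<close>-dimensional Lebesgue measure on the hyperplane \<open>x\<^sub>N = 0\<close>
  (itself the projection of \<open>N\<close>-dimensional Lebesgue measure on the slab \<open>0 < x\<^sub>N < 1\<close>) under \<open>\<Phi>\<close>.
  For a bent interface with \<open>M\<^sub>1 \<le> 1/2\<close> it differs from the surface measure by a density bounded
  above and away from zero, so null sets and \<open>L\<^sub>1\<^sub>,\<^sub>l\<^sub>o\<^sub>c\<close> convergence are those of the surface measure.
\<close>

definition interface_measure ::
  "('n::{finite,linorder} rvec \<Rightarrow> 'n rvec) \<Rightarrow> ('n rvec) measure" where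
  "interface_measure \<Phi> = distr (restrict_space lborel {x. 0 < x $ last_ix \<and> x $ last_ix < 1}) borel
     (\<lambda>x. \<Phi> (x - (x $ last_ix) *\<^sub>R axis last_ix 1))"

text \<open>
  The trace operator as the continuous extension of restriction to the interface: \<open>g\<close> is the trace
  of \<open>w\<close> if functions of class \<open>C\<^sup>1\<close> up to the boundary converge to \<open>w\<close> in \<open>W\<^sup>1\<^sub>1\<close> on bounded parts
  of the domain, and their restrictions to the interface converge to \<open>g\<close> in \<open>L\<^sub>1\<^sub>,\<^sub>l\<^sub>o\<^sub>c\<close>.
\<close>

definition has_trace :: "('n::{finite,linorder} rvec \<Rightarrow> 'n rvec) \<Rightarrow> phase \<Rightarrow>
    ('n rvec \<Rightarrow> real) \<Rightarrow> ('n rvec \<Rightarrow> real) \<Rightarrow> bool" where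
  "has_trace \<Phi> s w g \<longleftrightarrow>
     w \<in> Lq_loc_closure 1 (Omega \<Phi> s) \<and>
     (\<exists>dw. has_weak_grad (Omega \<Phi> s) w dw \<and> dw \<in> Lq_loc_closure 1 (Omega \<Phi> s) \<and>
       (\<forall>R. set_integrable (interface_measure \<Phi>) (ball 0 R) g) \<and>
       (\<exists>W. (\<forall>k::nat. Ck 1 (W k)) \<and>
         (\<forall>R.
           (\<lambda>k. Lq_norm 1 (Omega \<Phi> s \<inter> ball 0 R) (\<lambda>x. W k x - w x)) \<longlonglongrightarrow> 0 \<and>
           (\<lambda>k. Lq_norm 1 (Omega \<Phi> s \<inter> ball 0 R) (\<lambda>x. (\<chi> i. pd i (W k) x) - dw x)) \<longlonglongrightarrow> 0 \<and>
           (\<lambda>k. LINT y:ball 0 R|interface_measure \<Phi>. \<bar>W k y - g y\<bar>) \<longlonglongrightarrow> 0)))"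

section \<open>The strong transmission problem\<close>

definition strong_solution :: "real \<Rightarrow> (phase \<Rightarrow> real) \<Rightarrow>
    ('n::{finite,linorder} rvec \<Rightarrow> 'n rvec) \<Rightarrow> ('n rvec \<Rightarrow> 'n rvec) \<Rightarrow>
    (phase \<Rightarrow> 'n rvec \<Rightarrow> 'n rvec) \<Rightarrow> (phase \<Rightarrow> 'n rvec \<Rightarrow> real) \<Rightarrow> bool" where
  "strong_solution q \<rho> \<Phi> n f v \<longleftrightarrow>
     (\<forall>s. v s \<in> hatH1 q (Omega \<Phi> s) \<inter> hatH2 q (Omega \<Phi> s)) \<and>
     (\<forall>s. AE x in lebesgue_on (Omega \<Phi> s). lapl (Omega \<Phi> s) (v s) x = wdiv (Omega \<Phi> s) (f s) x) \<and>
     (\<exists>g. (\<forall>s. has_trace \<Phi> s (v s) (g s)) \<and>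
        (AE y in interface_measure \<Phi>. \<rho> Plus * g Plus y = \<rho> Minus * g Minus y)) \<and>
     (\<exists>g h. (\<forall>s. has_trace \<Phi> s (\<lambda>x. n x \<bullet> wgrad (Omega \<Phi> s) (v s) x) (g s)) \<and>
        (\<forall>s. has_trace \<Phi> s (\<lambda>x. n x \<bullet> f s x) (h s)) \<and>
        (AE y in interface_measure \<Phi>. g Plus y - g Minus y = h Plus y - h Minus y))"

definition no_normal_jump :: "('n::{finite,linorder} rvec \<Rightarrow> 'n rvec) \<Rightarrow> ('n rvec \<Rightarrow> 'n rvec) \<Rightarrow>
    (phase \<Rightarrow> 'n rvec \<Rightarrow> 'n rvec) \<Rightarrow> bool" where
  "no_normal_jump \<Phi> n f \<longleftrightarrow>
     (\<exists>h. (\<forall>s. has_trace \<Phi> s (\<lambda>x. n x \<bullet> f s x) (h s)) \<and>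
        (AE y in interface_measure \<Phi>. h Plus y - h Minus y = 0))"

definition strong_existence :: "real \<Rightarrow> (phase \<Rightarrow> real) \<Rightarrow>
    ('n::{finite,linorder} rvec \<Rightarrow> 'n rvec) \<Rightarrow> ('n rvec \<Rightarrow> 'n rvec) \<Rightarrow> real \<Rightarrow> real \<Rightarrow> bool" where
  "strong_existence q \<rho> \<Phi> n C C' \<longleftrightarrow>
     (\<forall>f. (\<forall>s. f s \<in> F_space q (Omega \<Phi> s) n) \<longrightarrow>
       (\<exists>v. strong_solution q \<rho> \<Phi> n f v \<and>
         (\<forall>s. Lq_norm q (Omega \<Phi> s) (hess (Omega \<Phi> s) (v s))
               \<le> C * (\<Sum>t\<in>{Plus, Minus}. E_norm q (Omega \<Phi> t) (f t)
                        + H1_norm q (Omega \<Phi> t) (\<lambda>x. n x \<bullet> f t x))) \<and>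
         (\<forall>s. Lq_norm q (Omega \<Phi> s) (wgrad (Omega \<Phi> s) (v s))
               \<le> C' * (\<Sum>t\<in>{Plus, Minus}. Lq_norm q (Omega \<Phi> t) (f t))) \<and>
         (no_normal_jump \<Phi> n f \<longrightarrow>
           (\<forall>s. Lq_norm q (Omega \<Phi> s) (hess (Omega \<Phi> s) (v s))
               \<le> C * (\<Sum>t\<in>{Plus, Minus}. E_norm q (Omega \<Phi> t) (f t))))))"

definition strong_uniqueness :: "real \<Rightarrow> (phase \<Rightarrow> real) \<Rightarrow>
    ('n::{finite,linorder} rvec \<Rightarrow> 'n rvec) \<Rightarrow> ('n rvec \<Rightarrow> 'n rvec) \<Rightarrow> bool" where
  "strong_uniqueness q \<rho> \<Phi> n \<longleftrightarrow>
     (\<forall>v. strong_solution q \<rho> \<Phi> n (\<lambda>s x. 0) v \<longrightarrow>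
       (\<exists>c. \<forall>s. AE x in lebesgue_on (Omega \<Phi> s). v s x = inverse (\<rho> s) * c))"

text \<open>
  \<open>C\<close> may depend on \<open>r\<close> and \<open>M\<^sub>2\<close> but not on the configuration; \<open>C'\<close> depends on neither.  The
  condition on \<open>r\<close> is symmetric in the exponent and its dual.
\<close>

definition admissible_constants ::
  "'n::{finite,linorder} itself \<Rightarrow> (phase \<Rightarrow> real) \<Rightarrow> real \<Rightarrow> real \<Rightarrow> real \<Rightarrow> bool" where
  "admissible_constants _ \<rho> q M1 C' \<longleftrightarrow>
     (\<forall>r M2. real CARD('n) < r \<and> max q (q / (q - 1)) \<le> r \<and> 1 \<le> M2 \<longrightarrow>
       (\<exists>C. \<forall>(\<Phi> :: 'n rvec \<Rightarrow> 'n rvec) A B A' B'. bent_interface M1 M2 r \<Phi> A B A' B' \<longrightarrow>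
          strong_existence q \<rho> \<Phi> (bent_normal \<Phi> A' B') C C' \<and>
          strong_uniqueness q \<rho> \<Phi> (bent_normal \<Phi> A' B')))"

section \<open>The weak transmission problem\<close>

definition piecewise_density :: "(phase \<Rightarrow> real) \<Rightarrow> ('n::{finite,linorder} rvec \<Rightarrow> 'n rvec) \<Rightarrow>
    'n rvec \<Rightarrow> real" where
  "piecewise_density \<rho> \<Phi> x =
     \<rho> Plus * indicator (Omega \<Phi> Plus) x + \<rho> Minus * indicator (Omega \<Phi> Minus) x"

end

(* A strong solution for a smooth right-hand side f supported away from the interface is, after
   multiplication by the densities, a weak solution: the Gauss formula, which holds for every field
   whose normal component has a trace, turns the transmission conditions into a distributional
   identity on the whole space, and the L^q bound on the gradient of the strong solution becomes the
   bound of the theorem.  Testing with a Poincare-type cut-off extends the identity to all test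
   functions with gradient in L^q'.  Uniqueness for the exponent q follows by duality from existence
   for q', and existence for general f by density: gradients of solutions form a Cauchy sequence, and
   L^q-limits of gradients are gradients. *)
theory Submission
  imports Defs
begin

text \<open>Interface data are available only through \<open>has_trace\<close>, that is through C^1
  approximants, and of a field only the normal component has a trace. The cut-offs at the interface
  are therefore functions of the last coordinate of \<open>inv \<Phi>\<close>: their gradients are
  parallel to the normal, so a boundary layer sees nothing but the normal component. Like \<Phi>
  they are only of class C^1, hence the C^1 tests. The surface density is never computed: the two
  phases give the same boundary expression with opposite signs, and only the cancellation counts.
  Solutions are not chosen linearly in f. The Cauchy property therefore needs weak uniqueness first:
  it identifies the difference of two solutions with the solution for the difference of the data, to
  which the estimate applies. In the constant, 2 comes from bounding the norm of f on each phase by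
  its norm on both, and \<rho>_+ + \<rho>_- from gluing the fields \<rho>_s grad v_s. Passing to the
  limit must not enlarge it, so sums are estimated with a free weight that finally tends to
  1.\<close>

abbreviation lmeas :: "('a::euclidean_space => 'b::topological_space) set" where "lmeas == borel_measurable lebesgue"
abbreviation bmeas :: "('a::topological_space => 'b::topological_space) set" where "bmeas == borel_measurable borel"
abbreviation intg :: "('a::euclidean_space => 'b::{banach, second_countable_topology}) => bool" where "intg == integrable lebesgue"
abbreviation ctn :: "('a::topological_space => 'b::topological_space) => bool" where "ctn == continuous_on UNIV"
abbreviation nnl :: "('a::euclidean_space => ennreal) => ennreal" (binder "NL " 10) where "nnl == nn_integral lebesgue"
abbreviation nnb :: "('a::euclidean_space => ennreal) => ennreal" (binder "NB " 10) where "nnb == nn_integral lborel"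
abbreviation lintl :: "('a::euclidean_space => 'b::{banach, second_countable_topology}) => 'b" (binder "LL " 10) where "lintl == integral\<^sup>L lebesgue"
abbreviation lintb :: "('a::euclidean_space => 'b::{banach, second_countable_topology}) => 'b" (binder "LB " 10) where "lintb == integral\<^sup>L lborel"
abbreviation ind where "ind == indicator"
abbreviation en where "en == ennreal"
abbreviation inft :: ennreal where "inft == \<infinity>"
abbreviation scR :: "real => 'a::real_vector => 'a" (infixr "*R" 75) where "a *R x == a *\<^sub>R x"
abbreviation lims :: "(nat => 'a::topological_space) => 'a => bool" ("(_/ ~~> _)" [60, 60] 60) where "f ~~> l == f \<longlonglongrightarrow> l"

lemmas bi_bound = Bochner_Integration.integrable_bound
lemmas bi_cong = Bochner_Integration.integral_cong
lemmas bi_int_diff = Bochner_Integration.integral_diff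
lemmas bi_int_add = Bochner_Integration.integral_add
lemmas bi_int_sum = Bochner_Integration.integral_sum
lemmas bi_diff = Bochner_Integration.integrable_diff
lemmas bi_norm_bound = Bochner_Integration.integral_norm_bound_integral
lemmas bi_nonneg = Bochner_Integration.integral_nonneg
lemmas cont_bmeas = borel_measurable_continuous_onI
lemmas lm_compact = lmeasurable_compact
lemmas cont_comp2 = continuous_on_compose2
lemmas ev_seq = eventually_sequentially
lemmas compact_cont_image = compact_continuous_image
lemmas cont_subset = continuous_on_subset
lemmas meas_restrict1 = measurable_restrict_space1
lemmas cmp_closed = compact_imp_closed

section \<open>Test functions\<close>

lemma has_derivative_pd:
 fixes f :: "real^'n => real"
 assumes "f differentiable (at x)"
 shows "(f has_derivative (%h. \<Sum>i\<in>UNIV. pd i f x * h $ i)) (at x)"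
proof -
 have 1: "(f has_derivative frechet_derivative f (at x)) (at x)"
  using assms frechet_derivative_works by blast
 have "frechet_derivative f (at x) h = (\<Sum>i\<in>UNIV. pd i f x * h $ i)" for h
 proof -
  have lin: "linear (frechet_derivative f (at x))"
   using 1 has_derivative_linear by blast
  have "frechet_derivative f (at x) h = frechet_derivative f (at x) (\<Sum>i\<in>UNIV. h $ i *R axis i 1)"
   using basis_expansion[of h] by (simp add: scalar_mult_eq_scaleR)
  also have "... = (\<Sum>i\<in>UNIV. h $ i *R frechet_derivative f (at x) (axis i 1))"
   using lin by (simp add: linear_sum linear_scale)
  finally show ?thesis by (simp add: pd_def mult.commute)
 qed
 then show ?thesis using 1 by (metis (no_types, lifting) ext)
qed

lemma pd_eqI:
 fixes f :: "real^'n => real"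
 assumes "(f has_derivative f') (at x)" shows "pd i f x = f' (axis i 1)"
 using assms frechet_derivative_at unfolding pd_def by metis

lemma Ck_SucD: "Ck (Suc k) f ==> Ck k f"
proof (induction k arbitrary: f)
 case 0
 then show ?case
  by (auto simp: continuous_on_eq_continuous_at intro: differentiable_imp_continuous_within)
qed auto

lemma Ck_le: "m <= k ==> Ck k f ==> Ck m f"
 by (induction k rule: dec_induct) (auto dest: Ck_SucD simp del: Ck.simps)

lemma Ck_continuous: "Ck k f ==> ctn f"
 using Ck_le[of 0 k f] by simp

lemma Ck1D:
 assumes "Ck 1 f"
 shows "f differentiable (at x)" "ctn (pd i f)" "ctn f"
 using assms Ck_continuous[of 1 f] by auto

lemma Ck1I:
 assumes "!!x. (f has_derivative f' x) (at x)" "!!i. ctn (%x. f' x (axis i 1))"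
 shows "Ck 1 f"
proof -
 have "pd i f = (%x. f' x (axis i 1))" for i using assms(1) pd_eqI by blast
 then show ?thesis using assms by (auto simp: differentiable_def)
qed

lemma pd_const [simp]: "pd i (%x. c) = (%x. 0)"
 by (rule ext) (simp add: pd_eqI[OF has_derivative_const])

lemma Ck_const [simp]: "Ck k (%x. c)"
 by (induction k arbitrary: c) auto

lemma pd_coord: "pd i (%x. x $ j) = (%x. if i = j then 1 else 0)"
 by (rule ext)
  (subst pd_eqI[OF bounded_linear_imp_has_derivative[OF bounded_linear_vec_nth]], simp add: axis_def)

lemma Ck_coord [simp]: "Ck k (%x. x $ j)"
proof (cases k)
 case 0
 then show ?thesis by (simp add: continuous_on_component continuous_on_id)
next
 case (Suc m)
 have "(%x. x $ j) differentiable (at x)" for x :: "real^'a"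
  using bounded_linear_imp_has_derivative[OF bounded_linear_vec_nth] by (auto simp: differentiable_def)
 then show ?thesis using Suc by (simp add: pd_coord)
qed

lemma pd_add:
 assumes "f differentiable (at x)" "g differentiable (at x)"
 shows "pd i (%x. f x + g x) x = pd i f x + pd i g x"
 by (subst pd_eqI[OF has_derivative_add[OF has_derivative_pd[OF assms(1)] has_derivative_pd[OF assms(2)]]])
  (simp add: axis_def if_distrib[of "(*) _"] cong: if_cong)

lemma pd_mult:
 assumes "f differentiable (at x)" "g differentiable (at x)"
 shows "pd i (%x. f x * g x) x = f x * pd i g x + pd i f x * g x"
 by (subst pd_eqI[OF has_derivative_mult[OF has_derivative_pd[OF assms(1)] has_derivative_pd[OF assms(2)]]])
  (simp add: axis_def if_distrib[of "(*) _"] cong: if_cong)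

lemma Ck_add: "Ck k f ==> Ck k g ==> Ck k (%x. f x + g x)"
proof (induction k arbitrary: f g)
 case 0 then show ?case by (auto intro: continuous_intros)
next
 case (Suc k)
 then have "pd i (%x. f x + g x) = (%x. pd i f x + pd i g x)" for i
  by (auto simp: pd_add)
 with Suc show ?case by auto
qed

lemma Ck_mult: "Ck k f ==> Ck k g ==> Ck k (%x. f x * g x)"
proof (induction k arbitrary: f g)
 case 0 then show ?case by (auto intro: continuous_intros)
next
 case (Suc k)
 then have "pd i (%x. f x * g x) = (%x. f x * pd i g x + pd i f x * g x)" for i
  by (auto simp: pd_mult)
 moreover have "Ck k f" "Ck k g" using Suc.prems Ck_SucD by blast+
 ultimately show ?case using Suc by (auto intro!: Ck_add)
qed

lemma Ck_cmult: "Ck k f ==> Ck k (%x. c * f x)"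
 by (intro Ck_mult Ck_const)

lemma pd_cmult: "f differentiable (at x) ==> pd i (%x. c * f x) x = c * pd i f x"
 by (subst pd_mult) auto

lemma Ck_diff: "Ck k f ==> Ck k g ==> Ck k (%x. f x - g x)"
 using Ck_add[of k f "%x. (-1) * g x"] Ck_cmult[of k g "-1"] by simp

lemma pd_diff:
 assumes "f differentiable (at x)" "g differentiable (at x)"
 shows "pd i (%x. f x - g x) x = pd i f x - pd i g x"
 using pd_add[OF assms(1), of "%x. (-1) * g x" i] pd_cmult[OF assms(2), of i "-1"] assms(2)
 by (simp add: differentiable_minus)

lemma Ck_sum: "finite I ==> (!!i. i : I ==> Ck k (f i)) ==> Ck k (%x. \<Sum>i\<in>I. f i x)"
 by (induction I rule: finite_induct) (auto intro: Ck_add)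

lemma Ck_norm_sq: "Ck k (%x. x \<bullet> x)"
 unfolding inner_vec_def by (auto intro!: Ck_sum Ck_mult)

lemma pd_comp_real:
 assumes "f differentiable (at x)" "(h has_real_derivative d) (at (f x))"
 shows "((%x. h (f x)) has_derivative (%v. d * (\<Sum>i\<in>UNIV. pd i f x * v $ i))) (at x)"
  "pd i (%x. h (f x)) x = d * pd i f x"
proof -
 show 1: "((%x. h (f x)) has_derivative (%v. d * (\<Sum>i\<in>UNIV. pd i f x * v $ i))) (at x)"
  using diff_chain_at[OF has_derivative_pd[OF assms(1)] assms(2)[unfolded has_field_derivative_def]]
  by (simp add: o_def)
 show "pd i (%x. h (f x)) x = d * pd i f x"
  using pd_eqI[OF 1] by (simp add: axis_def if_distrib[of "(*) _"] cong: if_cong)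
qed

lemma Ck_scale: "Ck k f ==> Ck k (%x. f (c *R x))"
 and pd_scale: "f differentiable (at (c *R x)) ==> pd i (%x. f (c *R x)) x = c * pd i f (c *R x)"
proof -
 have der: "((%x. f (c *R x)) has_derivative (%h. \<Sum>i\<in>UNIV. pd i f (c *R x) * (c *R h) $ i)) (at x)"
  if "f differentiable (at (c *R x))" for f :: "real^'a => real" and x
  using diff_chain_at[OF bounded_linear_imp_has_derivative[OF bounded_linear_scaleR_right[of c]]
    has_derivative_pd[OF that]]
  by (simp add: o_def)
 show *: "pd i (%x. f (c *R x)) x = c * pd i f (c *R x)"
  if "f differentiable (at (c *R x))" for f :: "real^'a => real" and x i
  using pd_eqI[OF der[OF that]] by (simp add: axis_def if_distrib[of "(*) _"] cong: if_cong)
 show "Ck k (%x. f (c *R x))" if "Ck k f" for f :: "real^'a => real"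
  using that
 proof (induction k arbitrary: f)
  case 0
  then show ?case by (auto intro!: cont_comp2[of UNIV f] continuous_intros)
 next
  case (Suc k)
  then have "pd i (%x. f (c *R x)) = (%x. c * pd i f (c *R x))" for i by (auto simp: *)
  then show ?case using Suc der by (auto intro!: Ck_cmult simp: differentiable_def; blast)
 qed
qed

text \<open>The derivatives of \<open>exp (- 1 / t)\<close> are combinations of members of this family.\<close>

definition flat :: "nat => real => real" where
 "flat n t = (if t > 0 then inverse t ^ n * exp (- inverse t) else 0)"

lemma flat_nonneg: "0 <= flat n t" by (simp add: flat_def)

text \<open>With s = 1/t, the single term s^(n+2)/(n+2)! of the exponential series is at most exp s.
  The quadratic bound makes the difference quotients at 0 tend to zero.\<close>

lemma flat_le_sq: "flat n t <= fact (n + 2) * t\<^sup>2"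
proof (cases "t > 0")
 case True
 define s where "s = inverse t"
 have s: "s > 0" using True s_def by simp
 have "s ^ (n + 2) / fact (n + 2) <= exp s"
 proof -
  have sm: "summable (%m. s ^ m /\<^sub>R fact m)" by (rule summable_exp_generic)
  have "(\<Sum>m\<in>{n+2}. s ^ m /\<^sub>R fact m) <= (\<Sum>m. s ^ m /\<^sub>R fact m)"
   using s sm by (intro sum_le_suminf) auto
  then show ?thesis by (simp add: exp_def divide_inverse mult.commute)
 qed
 then have "s ^ (n + 2) * exp (- s) <= fact (n + 2)"
  by (simp add: exp_minus field_simps del: fact_Suc power_Suc power_add)
 then have "s ^ n * exp (- s) <= fact (n + 2) * inverse (s ^ 2)"
  using s by (simp add: field_simps power_add power2_eq_square)
 then show ?thesis using True by (simp add: flat_def s_def power_inverse)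
qed (simp add: flat_def)

text \<open>For t > 0 this is the product rule. For t <= 0 the right-hand side is zero, and at t = 0
  \<open>flat_le_sq\<close> bounds the difference quotient by a multiple of |h|.\<close>

lemma flat_has_derivative:
 "(flat n has_real_derivative (flat (n + 2) t - n * flat (n + 1) t)) (at t)"
proof -
 consider "t > 0" | "t < 0" | "t = 0" by linarith
 then show ?thesis
 proof cases
  case 1
  have "((%t. inverse t ^ n * exp (- inverse t)) has_real_derivative
    (flat (n + 2) t - n * flat (n + 1) t)) (at t)"
  proof (cases n)
   case 0
   then show ?thesis using 1
    by (auto intro!: derivative_eq_intros simp: flat_def power2_eq_square)
  next
   case (Suc m)
   have i: "(inverse has_real_derivative - (inverse t * inverse t)) (at t)"
    using DERIV_inverse[of t] 1 by (simp add: power2_eq_square)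
   have e: "((%t. exp (- inverse t)) has_real_derivative exp (- inverse t) * (inverse t * inverse t)) (at t)"
    using 1 by (auto intro!: derivative_eq_intros simp: power2_eq_square)
   show ?thesis unfolding Suc
    by (rule DERIV_cong[OF DERIV_mult[OF DERIV_power_Suc[OF i] e]])
     (use 1 in \<open>simp add: flat_def algebra_simps\<close>)
  qed
  then show ?thesis
   by (rule has_field_derivative_transform_within_open[of _ _ _ "{0<..}"]) (use 1 in \<open>auto simp: flat_def\<close>)
 next
  case 2
  have "((%t. 0) has_real_derivative (flat (n + 2) t - n * flat (n + 1) t)) (at t)"
   using 2 by (simp add: flat_def)
  then show ?thesis
   by (rule has_field_derivative_transform_within_open[of _ _ _ "{..<0}"]) (use 2 in \<open>auto simp: flat_def\<close>)
 next
  case 3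
  have "((%h. (flat n (0 + h) - flat n 0) / h) \<longlongrightarrow> 0) (at 0)"
  proof (rule Lim_null_comparison)
   show "\<forall>\<^sub>F h in at 0. norm ((flat n (0 + h) - flat n 0) / h) <= fact (n + 2) * \<bar>h\<bar>"
   proof (rule eventuallyI)
    fix h :: real
    show "norm ((flat n (0 + h) - flat n 0) / h) <= fact (n + 2) * \<bar>h\<bar>"
    proof (cases "h = 0")
     case False
     have "\<bar>flat n h\<bar> <= fact (n + 2) * \<bar>h\<bar> * \<bar>h\<bar>"
      using flat_le_sq[of n h] flat_nonneg[of n h]
      by (simp add: power2_eq_square abs_mult_self_eq mult.assoc)
     then show ?thesis using False by (simp add: divide_le_eq flat_def[of n 0])
    qed (simp)
   qed
   show "((%h. fact (n + 2) * \<bar>h\<bar>) \<longlongrightarrow> 0) (at (0::real))"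
    by (auto intro!: tendsto_eq_intros)
  qed
  then show ?thesis using 3 by (simp add: DERIV_def flat_def)
 qed
qed

text \<open>The induction on k has to range over all n, since each derivative raises the
  index.\<close>

lemma Ck_flat: "(!!k. Ck k p) ==> Ck k (%x. flat n (p x))"
proof (induction k arbitrary: n)
 case 0
 have "ctn (flat n)"
  by (intro continuous_at_imp_continuous_on ballI DERIV_isCont[OF flat_has_derivative])
 moreover have "ctn p" using 0 Ck_continuous by blast
 ultimately show ?case by (auto intro: cont_comp2)
next
 case (Suc k)
 have d: "p differentiable (at x)" for x using Suc.prems[of 1] Ck1D by blast
 have Ckp: "Ck k (pd i p)" for i using Suc.prems[of "Suc k"] by simp
 have *: "pd i (%x. flat n (p x)) = (%x. (flat (n + 2) (p x) - real n * flat (n + 1) (p x)) * pd i p x)" for i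
  by (rule ext, subst pd_comp_real(2)[OF d flat_has_derivative]) simp
 have "Ck k (pd i (%x. flat n (p x)))" for i
  unfolding * by (intro Ck_mult Ck_diff Ck_cmult Ckp Suc)
 moreover have "(%x. flat n (p x)) differentiable (at x)" for x
  using pd_comp_real(1)[OF d flat_has_derivative] by (auto simp: differentiable_def)
 ultimately show ?case by simp
qed

text \<open>The C^1 counterpart of \<open>test_fun\<close>: cut-offs built from the inverse of
  \<Phi> have no more regularity. \<open>weak_div_c1\<close> shows that weak divergences may be
  tested with such functions.\<close>

definition c1_test :: "(real^'n) set => (real^'n => real) => bool" where
 "c1_test G ph \<longleftrightarrow> Ck 1 ph \<and> compact (closure {x. ph x ~= 0}) \<and> closure {x. ph x ~= 0} \<subseteq> G"

lemma test_fun_c1: "test_fun G ph ==> c1_test G ph"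
 by (simp add: test_fun_def c1_test_def del: Ck.simps)

lemma support_subset:
 fixes ph :: "'a::metric_space => real"
 assumes "compact K" "\<forall>x. x ~: K --> ph x = 0"
 shows "compact (closure {x. ph x ~= 0})" "closure {x. ph x ~= 0} \<subseteq> K"
proof -
 show 1: "closure {x. ph x ~= 0} \<subseteq> K"
  using assms by (intro closure_minimal) (auto dest: cmp_closed)
 then show "compact (closure {x. ph x ~= 0})"
  using assms(1) by (metis closed_closure compact_Int_closed inf.absorb_iff2)
qed

lemma test_funI:
 assumes "!!k. Ck k ph" "compact K" "K \<subseteq> G" "\<forall>x. x ~: K --> ph x = 0"
 shows "test_fun G ph"
 using support_subset[OF assms(2,4)] assms(1,3) unfolding test_fun_def by auto

lemma c1_testI:
 assumes "Ck 1 ph" "compact K" "K \<subseteq> G" "\<forall>x. x ~: K --> ph x = 0"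
 shows "c1_test G ph"
 using support_subset[OF assms(2,4)] assms(1,3) unfolding c1_test_def by auto

lemma c1_testD:
 assumes "c1_test G ph"
 shows "\<exists>K. compact K \<and> K \<subseteq> G \<and> (\<forall>x. x ~: K --> ph x = 0)" "Ck 1 ph"
proof -
 have "\<forall>x. x ~: closure {x. ph x ~= 0} --> ph x = 0"
  using closure_subset[of "{x. ph x ~= 0}"] by auto
 then show "\<exists>K. compact K \<and> K \<subseteq> G \<and> (\<forall>x. x ~: K --> ph x = 0)" "Ck 1 ph"
  using assms unfolding c1_test_def by blast+
qed

lemma test_fun_mono: "test_fun G ph ==> G \<subseteq> H ==> test_fun H ph"
 unfolding test_fun_def by blast

lemma c1_test_mono: "c1_test G ph ==> G \<subseteq> H ==> c1_test H ph"
 unfolding c1_test_def by blast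

lemma pd_support:
 assumes "closed K" "\<forall>x. x ~: K --> ph x = 0" "x ~: K"
 shows "pd i ph x = 0"
proof -
 have "((%x. 0) has_derivative (%h. 0)) (at x)" by (rule has_derivative_const)
 then have "(ph has_derivative (%h. 0)) (at x)"
  by (rule has_derivative_transform_within_open[of _ _ _ _ "- K"]) (use assms in auto)
 then show ?thesis by (simp add: pd_eqI)
qed

lemma test_fun_pd:
 assumes "test_fun G ph" shows "test_fun G (pd i ph)"
proof -
 obtain K where K: "compact K" "K \<subseteq> G" "\<forall>x. x ~: K --> ph x = 0"
  using c1_testD(1)[OF test_fun_c1[OF assms]] by blast
 have "Ck k (pd i ph)" for k using assms Ck.simps(2)[of k ph] unfolding test_fun_def by blast
 then show ?thesis
  using K pd_support[OF cmp_closed[OF K(1)] K(3)] by (intro test_funI[of _ K]) auto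
qed

lemma c1_test_mult:
 assumes "c1_test G ph" "Ck 1 ps" shows "c1_test G (%x. ps x * ph x)"
proof -
 obtain K where K: "compact K" "K \<subseteq> G" "\<forall>x. x ~: K --> ph x = 0"
  using c1_testD(1)[OF assms(1)] by blast
 show ?thesis
  by (rule c1_testI[OF Ck_mult[OF assms(2) c1_testD(2)[OF assms(1)]] K(1,2)]) (use K(3) in simp)
qed

lemma test_fun_mult:
 assumes "test_fun G ph" "!!k. Ck k ps" shows "test_fun G (%x. ps x * ph x)"
proof -
 obtain K where K: "compact K" "K \<subseteq> G" "\<forall>x. x ~: K --> ph x = 0"
  using c1_testD(1)[OF test_fun_c1[OF assms(1)]] by blast
 have "Ck k ph" for k using assms(1) unfolding test_fun_def by blast
 then show ?thesis
  by (intro test_funI[OF Ck_mult[OF assms(2)] K(1,2)]) (use K(3) in simp_all)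
qed

section \<open>Integral norms and density of continuous functions\<close>

lemma LINT_lebesgue_on:
 fixes f :: "'a::euclidean_space => 'b::euclidean_space"
 assumes "G : sets lebesgue"
 shows "integral\<^sup>L (lebesgue_on G) f = (LL x. ind G x *R f x)"
  "integrable (lebesgue_on G) f \<longleftrightarrow> intg (%x. ind G x *R f x)"
  "f : borel_measurable (lebesgue_on G) \<longleftrightarrow> (%x. ind G x *R f x) : lmeas"
 using assms by (auto simp: integral_restrict_space integrable_restrict_space
   borel_measurable_restrict_space_iff scaleR_conv_of_real)

lemma AE_lebesgue_on:
 assumes "G : sets lebesgue"
 shows "(AE x in lebesgue_on G. P x) \<longleftrightarrow> (AE x in lebesgue. x : G --> P x)"
 using assms by (simp add: AE_restrict_space_iff)

text \<open>The p-th power of the L_p norm, without the root and with extended values: Tonelli,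
  Fatou and dominated convergence apply directly, and finiteness becomes a separate statement. The
  price is that the triangle inequality acquires constants.\<close>

definition lpn :: "real => 'a::euclidean_space set => ('a => 'b::euclidean_space) => ennreal" where
 "lpn p S f = (NL x. ind S x * en (norm (f x) powr p))"

lemma lpn_mono:
 assumes "0 <= p" "!!x. x : S ==> x : T \<and> norm (f x) <= norm (g x)"
 shows "lpn p S f <= lpn p T g"
 unfolding lpn_def using assms
 by (intro nn_integral_mono) (auto simp: indicator_def powr_mono2 split: if_splits)

lemma lpn_cong_AE:
 assumes "AE x in lebesgue. x : S --> norm (f x) = norm (g x)"
 shows "lpn p S f = lpn p S g"
 unfolding lpn_def by (intro nn_integral_cong_AE) (use assms in \<open>auto simp: indicator_def elim: eventually_mono\<close>)

lemma lpn_cong: "(!!x. x : S ==> norm (f x) = norm (g x)) ==> lpn p S f = lpn p S g"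
 by (intro lpn_cong_AE) auto

lemma lpn_scaleR:
 assumes [measurable]: "f : lmeas" "S : sets lebesgue" and "0 <= p"
 shows "lpn p S (%x. c *R f x) = en (\<bar>c\<bar> powr p) * lpn p S f"
proof -
 have "ind S x * en (norm (c *R f x) powr p) =
  en (\<bar>c\<bar> powr p) * (ind S x * en (norm (f x) powr p))" for x
  by (simp add: powr_mult ennreal_mult mult_ac)
 then show ?thesis unfolding lpn_def by (simp add: nn_integral_cmult)
qed

text \<open>The graph of t^p lies above its tangent at a. In this rearranged form it is Young's
  inequality for t and a^(p-1).\<close>

lemma powr_tangent:
 assumes "1 < p" "0 <= a" "0 <= (t::real)"
 shows "p * (a powr (p - 1) * t) <= t powr p + (p - 1) * a powr p"
proof -
 define p' where "p' = p / (p - 1)"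
 have p': "p' > 1" "1 / p + 1 / p' = 1" "(p - 1) * p' = p" using assms(1) by (auto simp: p'_def field_simps)
 have "t * a powr (p - 1) <= t powr p / p + (a powr (p - 1)) powr p' / p'"
  by (rule Youngs_inequality) (use assms p' in auto)
 also have "(a powr (p - 1)) powr p' = a powr p" using p' by (simp add: powr_powr)
 finally have "p * (t * a powr (p - 1)) <= p * (t powr p / p + a powr p / p')"
  using assms(1) by (intro mult_left_mono) auto
 also have "... = t powr p + (p - 1) * a powr p"
  using assms(1) by (simp add: p'_def field_simps)
 finally show ?thesis by (simp add: mult_ac)
qed

text \<open>Convexity for a + b = l (a/l) + (1-l) (b/(1-l)): the tangent inequalities at s = a + b
  are added with weights l and 1 - l. The weight stays free so that \<open>lpn_bound_limit\<close>
  can let it tend to 1.\<close>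

lemma powr_sum_le:
 assumes "1 < p" "0 < l" "l < 1" "0 <= a" "0 <= (b::real)"
 shows "(a + b) powr p <= l powr (1 - p) * a powr p + (1 - l) powr (1 - p) * b powr p"
proof -
 define s where "s = a + b"
 have 1: "l * (p * (s powr (p - 1) * (a / l))) <= l * ((a / l) powr p + (p - 1) * s powr p)"
  using assms by (intro mult_left_mono powr_tangent) (auto simp: s_def)
 have 2: "(1 - l) * (p * (s powr (p - 1) * (b / (1 - l)))) <= (1 - l) * ((b / (1 - l)) powr p + (p - 1) * s powr p)"
  using assms by (intro mult_left_mono powr_tangent) (auto simp: s_def)
 have s: "s powr (p - 1) * s = s powr p"
  using assms by (cases "s = 0") (auto simp: s_def powr_diff)
 have e: "m * (c / m) powr p = m powr (1 - p) * c powr p" if "m > 0" "c >= 0" for m c :: real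
  using that by (simp add: powr_divide powr_diff)
 have 3: "l * (p * (s powr (p - 1) * (a / l))) + (1 - l) * (p * (s powr (p - 1) * (b / (1 - l)))) = p * s powr p"
 proof -
  have "l * (p * (s powr (p - 1) * (a / l))) = p * (s powr (p - 1) * a)"
   "(1 - l) * (p * (s powr (p - 1) * (b / (1 - l)))) = p * (s powr (p - 1) * b)"
   using assms by auto
  then show ?thesis using s by (simp add: s_def flip: distrib_left)
 qed
 have 4: "l * ((a / l) powr p + (p - 1) * s powr p) + (1 - l) * ((b / (1 - l)) powr p + (p - 1) * s powr p)
  = l powr (1 - p) * a powr p + (1 - l) powr (1 - p) * b powr p + (p - 1) * s powr p"
  using e[of l a] e[of "1 - l" b] assms by (simp add: algebra_simps)
 have "p * s powr p <= l powr (1 - p) * a powr p + (1 - l) powr (1 - p) * b powr p + (p - 1) * s powr p"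
  using add_mono[OF 1 2] unfolding 3 4 .
 then show ?thesis by (simp add: s_def algebra_simps)
qed

lemma lpn_add_le:
 assumes [measurable]: "f : lmeas" "g : lmeas" "S : sets lebesgue"
  and "1 < p" "0 < l" "l < 1"
 shows "lpn p S (%x. f x + g x)
  <= en (l powr (1 - p)) * lpn p S f + en ((1 - l) powr (1 - p)) * lpn p S g"
proof -
 have "norm (f x + g x) powr p <= l powr (1 - p) * norm (f x) powr p + (1 - l) powr (1 - p) * norm (g x) powr p" for x
  using powr_sum_le[of p l "norm (f x)" "norm (g x)"] powr_mono2[of p "norm (f x + g x)" "norm (f x) + norm (g x)"]
   norm_triangle_ineq[of "f x" "g x"] assms by simp
 then have "en (norm (f x + g x) powr p) <=
   en (l powr (1 - p)) * en (norm (f x) powr p) + en ((1 - l) powr (1 - p)) * en (norm (g x) powr p)" for x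
  by (metis (no_types, lifting) ennreal_leI ennreal_mult ennreal_plus mult_nonneg_nonneg powr_ge_zero)
 then have "ind S x * en (norm (f x + g x) powr p) <=
   en (l powr (1 - p)) * (ind S x * en (norm (f x) powr p))
  + en ((1 - l) powr (1 - p)) * (ind S x * en (norm (g x) powr p))" for x
  by (simp add: indicator_def)
 then have "lpn p S (%x. f x + g x) <= (NL x. en (l powr (1 - p)) * (ind S x * en (norm (f x) powr p))
  + en ((1 - l) powr (1 - p)) * (ind S x * en (norm (g x) powr p)))"
  unfolding lpn_def by (intro nn_integral_mono)
 also have "... = en (l powr (1 - p)) * lpn p S f + en ((1 - l) powr (1 - p)) * lpn p S g"
  unfolding lpn_def by (simp add: nn_integral_add nn_integral_cmult)
 finally show ?thesis .
qed

lemma lpn_add_le2: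
 assumes [measurable]: "f : lmeas" "g : lmeas" "S : sets lebesgue"
  and "1 < p"
 shows "lpn p S (%x. f x + g x) <= en (2 powr p) * (lpn p S f + lpn p S g)"
proof -
 have 1: "(1/2::real) powr (1 - p) <= 2 powr p"
  by (simp add: powr_divide powr_diff)
 have "lpn p S (%x. f x + g x) <= en ((1/2) powr (1 - p)) * lpn p S f + en ((1/2) powr (1 - p)) * lpn p S g"
  using lpn_add_le[of f g S p "1/2"] assms by simp
 also have "... = en ((1/2) powr (1 - p)) * (lpn p S f + lpn p S g)" by (simp add: distrib_left)
 also have "... <= en (2 powr p) * (lpn p S f + lpn p S g)"
  using 1 by (intro mult_right_mono ennreal_leI) auto
 finally show ?thesis .
qed

lemma lpn_diff_commute: "lpn p S (%x. f x - g x) = lpn p S (%x. g x - f x)"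
 by (intro lpn_cong) (simp add: norm_minus_commute)

lemma lpn_triangle:
 assumes [measurable]: "f : lmeas" "g : lmeas"
  "h : lmeas" "S : sets lebesgue" and "1 < p"
 shows "lpn p S (%x. f x - h x) <= en (2 powr p) * (lpn p S (%x. f x - g x) + lpn p S (%x. g x - h x))"
 using lpn_add_le2[of "%x. f x - g x" "%x. g x - h x" S p] assms by simp

lemma lpn_componentwise:
 fixes f :: "'a::euclidean_space => real^'n"
 assumes [measurable]: "f : lmeas" "S : sets lebesgue" and "0 <= p"
 shows "lpn p S f <= en (real CARD('n) powr p) * (\<Sum>i\<in>UNIV. lpn p S (%x. f x $ i))"
  "lpn p S (%x. f x $ i) <= lpn p S f"
proof -
 have "norm (f x) powr p <= real CARD('n) powr p * (\<Sum>i\<in>UNIV. norm (f x $ i) powr p)" for x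
 proof -
  define m where "m = Max (range (%i. \<bar>f x $ i\<bar>))"
  have "m : range (%i. \<bar>f x $ i\<bar>)" unfolding m_def by (rule Max_in) auto
  then obtain j where j: "m = \<bar>f x $ j\<bar>" by auto
  have "norm (f x) <= (\<Sum>i\<in>UNIV. \<bar>f x $ i\<bar>)" by (rule norm_le_l1_cart)
  also have "... <= (\<Sum>i\<in>(UNIV::'n set). m)" unfolding m_def by (intro sum_mono Max_ge) auto
  finally have "norm (f x) powr p <= (real CARD('n) * m) powr p"
   using assms by (intro powr_mono2) auto
  also have "... = real CARD('n) powr p * norm (f x $ j) powr p"
   using j by (simp add: powr_mult)
  also have "... <= real CARD('n) powr p * (\<Sum>i\<in>UNIV. norm (f x $ i) powr p)"
   by (intro mult_left_mono member_le_sum) auto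
  finally show ?thesis .
 qed
 then have "en (norm (f x) powr p) <= en (real CARD('n) powr p) * (\<Sum>i\<in>UNIV. en (norm (f x $ i) powr p))" for x
 proof -
  have "en (norm (f x) powr p) <= en (real CARD('n) powr p * (\<Sum>i\<in>UNIV. norm (f x $ i) powr p))"
   by (intro ennreal_leI) fact
  then show ?thesis by (simp add: ennreal_mult' sum_ennreal sum_nonneg)
 qed
 then have "lpn p S f <= (NL x. en (real CARD('n) powr p) * (\<Sum>i\<in>UNIV. ind S x * en (norm (f x $ i) powr p)))"
  unfolding lpn_def by (intro nn_integral_mono) (auto simp: indicator_def)
 also have "... = en (real CARD('n) powr p) * (\<Sum>i\<in>UNIV. lpn p S (%x. f x $ i))"
  unfolding lpn_def by (subst nn_integral_cmult, measurable, subst nn_integral_sum, measurable)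
 finally show "lpn p S f <= en (real CARD('n) powr p) * (\<Sum>i\<in>UNIV. lpn p S (%x. f x $ i))" .
 show "lpn p S (%x. f x $ i) <= lpn p S f"
  using assms component_le_norm_cart by (intro lpn_mono) auto
qed

lemma Lq_iff_lpn:
 fixes f :: "real^'n => 'b::euclidean_space"
 assumes "G : sets lebesgue"
 shows "f : Lq p G \<longleftrightarrow> f : borel_measurable (lebesgue_on G) \<and> lpn p G f < inft"
proof -
 have "integrable (lebesgue_on G) (%x. norm (f x) powr p) \<longleftrightarrow> lpn p G f < inft"
  if [measurable]: "f : borel_measurable (lebesgue_on G)"
  using assms unfolding integrable_iff_bounded lpn_def
  by (simp add: nn_integral_restrict_space mult.commute)
 then show ?thesis by (auto simp: Lq_def)
qed

lemma Lq_norm_lpn: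
 fixes f :: "real^'n => 'b::euclidean_space"
 assumes "G : sets lebesgue" "f : Lq p G"
 shows "en (LINT x|lebesgue_on G. norm (f x) powr p) = lpn p G f"
  "Lq_norm p G f = (enn2real (lpn p G f)) powr (1 / p)"
proof -
 have "(\<integral>\<^sup>+x. en (norm (f x) powr p) \<partial>lebesgue_on G) = en (LINT x|lebesgue_on G. norm (f x) powr p)"
  using assms by (intro nn_integral_eq_integral) (auto simp: Lq_def)
 then show 1: "en (LINT x|lebesgue_on G. norm (f x) powr p) = lpn p G f"
  using assms by (simp add: lpn_def nn_integral_restrict_space mult.commute)
 show "Lq_norm p G f = (enn2real (lpn p G f)) powr (1 / p)"
  unfolding 1[symmetric] by (simp add: Lq_norm_def integral_nonneg)
qed

lemma Lq_norm_nonneg: "0 <= Lq_norm p G f"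
 by (simp add: Lq_norm_def)

lemma Lq_norm_powr:
 fixes f :: "real^'n => 'b::euclidean_space"
 assumes "G : sets lebesgue" "f : Lq p G" "0 < p"
 shows "lpn p G f = en (Lq_norm p G f powr p)"
proof -
 have "lpn p G f < inft" using assms Lq_iff_lpn by blast
 then have "lpn p G f = en (enn2real (lpn p G f))" by simp
 also have "enn2real (lpn p G f) = Lq_norm p G f powr p"
  unfolding Lq_norm_lpn(2)[OF assms(1,2)] using assms(3) by (simp add: powr_powr)
 finally show ?thesis .
qed

lemma Lq_norm_leI:
 fixes f :: "real^'n => 'b::euclidean_space"
 assumes "G : sets lebesgue" "f : Lq p G" "0 < p" "lpn p G f <= en (c powr p)" "0 <= c"
 shows "Lq_norm p G f <= c"
 using assms(4) unfolding Lq_norm_powr[OF assms(1-3)]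
 using assms(3,5) by (smt (verit) Lq_norm_nonneg ennreal_le_iff powr_ge_zero powr_less_mono2)

lemma Lq_cmult_indicator:
 fixes f :: "real^'n => 'b::euclidean_space"
 assumes "f : Lq p G" "H \<subseteq> G" "G : sets lebesgue" "H : sets lebesgue" "0 <= p"
 shows "f : Lq p H" "lpn p H f <= lpn p G f"
proof -
 show 1: "lpn p H f <= lpn p G f" using assms by (intro lpn_mono) auto
 have "f : borel_measurable (lebesgue_on H)"
  using assms by (meson Lq_iff_lpn measurable_restrict_mono)
 then show "f : Lq p H" using 1 assms(1) by (auto simp: Lq_iff_lpn assms(3,4))
qed

subsection \<open>Continuous cutoff functions\<close>

lemma compact_exhaustion_cutoff:
 fixes G :: "'a::euclidean_space set"
 assumes "open G"
 obtains ch K where "!!m. ctn (ch m :: 'a => real)" "!!m x. 0 <= ch m x" "!!m x. ch m x <= 1"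
  "!!m. compact (K m)" "!!m. K m \<subseteq> G" "!!m x. x ~: K m ==> ch m x = (0::real)"
  "!!x. x : G ==> eventually (%m::nat. ch m x = 1) sequentially"
proof
 define T where "T m = G \<inter> ball 0 (real m)" for m :: nat
 define d where "d m x = infdist x (- T m)" for m x
 \<comment> \<open>The cut-off vanishes up to distance 1/m from the complement of \<open>T m\<close>
   and equals 1 from distance 2/m on.\<close>
 define ch where "ch m x = max 0 (min 1 (real m * d m x - 1))" for m x
 define K where "K m = {x. real m * d m x >= 1}" for m
 \<comment> \<open>\<open>infdist\<close> from the empty set is 0 by convention, so the distance is
   informative only if the complement is nonempty.\<close>
 have ne: "- T m ~= {}" for m
 proof -
  have "bounded (T m)" unfolding T_def by (rule bounded_subset[OF bounded_ball]) auto
  then show ?thesis using not_bounded_UNIV[where 'a='a] by (metis Compl_eq_Diff_UNIV Diff_eq_empty_iff UNIV_I subsetI subset_antisym top_greatest)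
 qed
 have cd: "ctn (d m)" for m unfolding d_def by (intro continuous_intros)
 show "ctn (ch m)" for m unfolding ch_def by (intro continuous_intros cd)
 show "0 <= ch m x" "ch m x <= 1" for m x by (auto simp: ch_def)
 show "ch m x = 0" if "x ~: K m" for m x using that by (auto simp: K_def ch_def)
 have sub: "K m \<subseteq> T m" for m
 proof
  fix x assume "x : K m"
  then have "d m x ~= 0" by (auto simp: K_def)
  then show "x : T m" unfolding d_def using infdist_zero by (metis ComplI)
 qed
 then show "K m \<subseteq> G" for m by (auto simp: T_def)
 have "closed (K m)" for m unfolding K_def by (intro closed_Collect_le continuous_intros cd)
 moreover have "bounded (K m)" for m
  using sub[of m] by (rule bounded_subset[rotated]) (auto simp: T_def intro: bounded_subset[OF bounded_ball])
 ultimately show "compact (K m)" for m by (simp add: compact_eq_bounded_closed)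
 show "eventually (%m. ch m x = 1) sequentially" if "x : G" for x
 proof -
  obtain m0 where m0: "norm x < real m0" using reals_Archimedean2 by blast
  have "closed (- T m0)" using assms by (auto simp: T_def)
  then have pos: "d m0 x > 0"
   unfolding d_def by (rule infdist_pos_not_in_closed[OF _ ne]) (use that m0 in \<open>auto simp: T_def\<close>)
  obtain m1 :: nat where m1: "2 / d m0 x < real m1" using reals_Archimedean2 by blast
  have "ch m x = 1" if "m >= max m0 m1" for m
  proof -
   have "- T m \<subseteq> - T m0" using that by (auto simp: T_def)
   then have "d m0 x <= d m x" unfolding d_def using ne by (intro infdist_mono)
   moreover have "2 <= real m * d m0 x"
   proof -
    have "2 < real m1 * d m0 x" using m1 pos by (simp add: divide_less_eq)
    also have "... <= real m * d m0 x" using that pos by (intro mult_right_mono) auto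
    finally show ?thesis by simp
   qed
   ultimately have "2 <= real m * d m x"
    by (smt (verit) mult_left_mono of_nat_0_le_iff)
   then show ?thesis by (simp add: ch_def)
  qed
  then show ?thesis unfolding ev_seq by blast
 qed
qed

lemma cont_supp_bounded:
 fixes v :: "'a::euclidean_space => real"
 assumes "ctn v" "compact K" "\<forall>x. x ~: K --> v x = 0"
 obtains B where "B > 0" "!!x. \<bar>v x\<bar> <= B"
proof -
 have "bounded (v ` K)" using assms by (meson compact_cont_image compact_imp_bounded cont_subset top_greatest)
 then obtain B where B: "B > 0" "!!x. x : K ==> \<bar>v x\<bar> <= B" by (auto simp: bounded_pos)
 have "\<bar>v x\<bar> <= B" for x using B assms(3) by (cases "x : K") auto
 with B(1) show ?thesis using that by blast
qed

lemma cont_lmeas: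
 "ctn (f :: 'a::euclidean_space => 'b::euclidean_space) ==> f : lmeas"
 by (simp add: cont_bmeas measurable_completion)

lemma supp_int:
 fixes v :: "'a::euclidean_space => real"
 assumes "v : lmeas" "compact K" "\<forall>x. x ~: K --> v x = 0" "!!x. \<bar>v x\<bar> <= B"
 shows "intg v"
proof (rule bi_bound)
 have "emeasure lborel K < inft" using assms(2) emeasure_compact_finite by blast
 then show "intg (%x. B * ind K x :: real)"
  using assms(2) lm_compact[OF assms(2)] by (auto simp: fmeasurable_def)
 show "AE x in lebesgue. norm (v x) <= norm (B * ind K x)"
  using assms(3,4) by (intro AE_I2) (fastforce simp: indicator_def intro: order_trans[OF _ abs_ge_self])
qed fact

lemma nn_integral_tendsto_0:
 fixes f :: "nat => 'a => ennreal"
 assumes "!!n. f n : borel_measurable M" "w : borel_measurable M" "(\<integral>\<^sup>+x. w x \<partial>M) < inft"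
  "!!n. AE x in M. f n x <= w x" "AE x in M. (%n. f n x) ~~> 0"
 shows "(%n. \<integral>\<^sup>+x. f n x \<partial>M) ~~> 0"
 using nn_integral_dominated_convergence[of f M "%x. 0" w] assms by simp

text \<open>Two approximations: \<open>U m\<close> truncates u in value and in support and converges
  with u itself as dominating function; then u is replaced by continuous functions converging almost
  everywhere. The same truncation bounds these by m on the fixed compact set \<open>K m\<close>,
  which gives domination again.\<close>

lemma Lp_dense_continuous:
 fixes u :: "'a::euclidean_space => real"
 assumes u[measurable]: "u : lmeas" and fin: "lpn p UNIV u < inft" and p: "1 < p"
  and G: "open G" "!!x. x ~: G ==> u x = 0" and e: "0 < (e::real)"
 obtains v K where "ctn v" "compact K" "K \<subseteq> G" "\<forall>x. x ~: K --> v x = 0"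
  "lpn p UNIV (%x. u x - v x) < en e"
proof -
 obtain ch K where chs: "!!m. ctn (ch m :: 'a => real)" "!!m x. 0 <= ch m x" "!!m x. ch m x <= 1"
  and K: "!!m. compact (K m)" "!!m. K m \<subseteq> G" "!!m x. x ~: K m ==> ch m x = (0::real)"
  and chi1: "!!x. x : G ==> eventually (%m::nat. ch m x = 1) sequentially"
  using compact_exhaustion_cutoff[OF G(1)] by metis
 have mchi[measurable]: "ch m : lmeas" for m
  using chs(1) by (rule cont_lmeas)
 define cl where "cl m t = max (- real m) (min (real m) t)" for m :: nat and t :: real
 have ccl: "ctn (cl m)" for m unfolding cl_def by (intro continuous_intros)
 have [measurable]: "cl m : bmeas" for m unfolding cl_def by measurable
 define U where "U m x = cl m (u x) * ch m x" for m x
 have mU[measurable]: "U m : lmeas" for m unfolding U_def by measurable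
 have clle: "\<bar>cl m t\<bar> <= \<bar>t\<bar>" "\<bar>cl m t\<bar> <= real m" "cl m t * t >= 0" for m t
  by (auto simp: cl_def min_def max_def mult_nonneg_nonneg mult_nonpos_nonpos intro: mult_nonneg_nonpos)
 have cldiff: "\<bar>t - cl m t * c\<bar> <= \<bar>t\<bar>" if "0 <= c" "c <= 1" for t c m
 proof -
  have 0: "\<bar>cl m t * c\<bar> <= \<bar>t\<bar> * 1" unfolding abs_mult
   using that clle(1)[of m t] by (intro mult_mono) auto
  have "0 <= (cl m t * c) * t" using clle(3)[of m t] that by (metis mult.assoc mult.commute mult_nonneg_nonneg)
  then show ?thesis using 0 by (smt (verit) mult_neg_pos mult_pos_neg)
 qed
 have "(%m. lpn p UNIV (%x. u x - U m x)) ~~> 0"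
  unfolding lpn_def
 proof (rule nn_integral_tendsto_0)
  show "(NL x. ind UNIV x * en (norm (u x) powr p)) < inft" using fin by (simp add: lpn_def)
  show "AE x in lebesgue. ind UNIV x * en (norm (u x - U n x) powr p)
    <= ind UNIV x * en (norm (u x) powr p)" for n
   unfolding U_def using cldiff chs p
   by (intro AE_I2) (auto intro!: ennreal_leI powr_mono2)
  show "AE x in lebesgue. (%n. ind UNIV x * en (norm (u x - U n x) powr p)) ~~> 0"
  proof (rule AE_I2, rule tendsto_eventually)
   fix x
   obtain m0 :: nat where m0: "\<bar>u x\<bar> < real m0" using reals_Archimedean2 by blast
   have 1: "eventually (%m. cl m (u x) = u x) sequentially"
    using m0 unfolding ev_seq by (intro exI[of _ m0]) (auto simp: cl_def)
   show "eventually (%n. ind UNIV x * en (norm (u x - U n x) powr p) = 0) sequentially"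
   proof (cases "x : G")
    case True
    show ?thesis using 1 chi1[OF True] by eventually_elim (simp add: U_def)
   next
    case False
    then have "x ~: K n" for n using K(2) by blast
    then show ?thesis using K(3) G(2)[OF False] p by (simp add: U_def)
   qed
  qed
 qed measurable
 \<comment> \<open>\<open>lpn_triangle\<close> turns two errors below e' into at most 2^p (2 e') =
   2e/3, strictly below e.\<close>
 moreover define e' where "e' = e / (2 powr p * 3)"
 have e': "e' > 0" using e by (simp add: e'_def)
 ultimately obtain m where m: "lpn p UNIV (%x. u x - U m x) < en e'"
  by (metis (no_types, lifting) ennreal_0 ennreal_less_zero_iff ev_seq linorder_not_less order.refl order_tendstoD(2) zero_less_iff_neq_zero)
 have "u measurable_on UNIV" by (rule lebesgue_measurable_imp_measurable_on) auto
 then obtain N g where N: "negligible N" and g: "!!n. ctn (g n)"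
  "!!x. x ~: N ==> (%n. g n x) ~~> u x"
  unfolding measurable_on_def by auto
 have [measurable]: "g n : lmeas" for n using g(1) by (rule cont_lmeas)
 have AEN: "AE x in lebesgue. x ~: N"
  using N by (simp add: AE_not_in negligible_iff_null_sets)
 define V where "V n x = cl m (g n x) * ch m x" for n x
 have cV: "ctn (V n)" for n unfolding V_def
  by (intro continuous_on_mult chs cont_comp2[OF ccl g(1)]) auto
 have mV[measurable]: "V n : lmeas" for n using cV by (rule cont_lmeas)
 have "(%n. lpn p UNIV (%x. U m x - V n x)) ~~> 0"
  unfolding lpn_def
 proof (rule nn_integral_tendsto_0)
  have [measurable]: "K m : sets lebesgue" using lm_compact[OF K(1)] by blast
  show "(%x. en ((2 * real m) powr p) * ind (K m) x) : lmeas" by measurable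
  have "emeasure lebesgue (K m) < inft" using emeasure_compact_finite[OF K(1)[of m]] K(1)[of m] by (simp add: borel_compact)
  then show "(NL x. en ((2 * real m) powr p) * ind (K m) x) < inft"
   by (simp add: nn_integral_cmult ennreal_mult_less_top)
  show "AE x in lebesgue. ind UNIV x * en (norm (U m x - V n x) powr p)
    <= en ((2 * real m) powr p) * ind (K m) x" for n
  proof (rule AE_I2)
   fix x
   have "\<bar>U m x - V n x\<bar> <= 2 * real m"
   proof -
    have "\<bar>cl m t * ch m x\<bar> <= real m * 1" for t unfolding abs_mult
     using chs clle(2)[of m t] by (intro mult_mono) auto
    from this[of "u x"] this[of "g n x"] show ?thesis unfolding U_def V_def by linarith
   qed
   moreover have "U m x - V n x = 0" if "x ~: K m" using K(3)[OF that] by (simp add: U_def V_def)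
   ultimately show "ind UNIV x * en (norm (U m x - V n x) powr p)
    <= en ((2 * real m) powr p) * ind (K m) x"
    using p by (cases "x : K m") (auto intro!: ennreal_leI powr_mono2)
  qed
  show "AE x in lebesgue. (%n. ind UNIV x * en (norm (U m x - V n x) powr p)) ~~> 0"
   using AEN
  proof eventually_elim
   case (elim x)
   have "isCont (cl m) (u x)" using ccl continuous_on_eq_continuous_at open_UNIV by blast
   then have "(%n. cl m (g n x)) ~~> cl m (u x)" using g(2)[OF elim] isCont_tendsto_compose by blast
   then have "(%n. U m x - V n x) ~~> U m x - U m x" unfolding U_def V_def by (intro tendsto_intros)
   then have "(%n. norm (U m x - V n x) powr p) ~~> 0 powr p"
    using p by (intro tendsto_powr' tendsto_norm_zero) auto
   then show ?case using p by (simp add: tendsto_ennreal_iff flip: ennreal_0)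
  qed
 qed measurable
 then obtain n where n: "lpn p UNIV (%x. U m x - V n x) < en e'"
  using e' by (metis (no_types, lifting) ennreal_0 ennreal_less_zero_iff ev_seq linorder_not_less order.refl order_tendstoD(2) zero_less_iff_neq_zero)
 show ?thesis
 proof
  show "ctn (V n)" "compact (K m)" "K m \<subseteq> G" "\<forall>x. x ~: K m --> V n x = 0"
   using cV K by (auto simp: V_def)
  have "lpn p UNIV (%x. u x - V n x) <= en (2 powr p) * (lpn p UNIV (%x. u x - U m x) + lpn p UNIV (%x. U m x - V n x))"
   by (rule lpn_triangle) (use p in auto)
  also have "... <= en (2 powr p) * (en e' + en e')"
   using m n by (intro mult_left_mono add_mono) auto
  also have "... = en (2 powr p * (2 * e'))" using e' by (simp add: ennreal_mult' flip: ennreal_plus)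
  also have "... < en e" using e by (intro ennreal_lessI) (auto simp: e'_def)
  finally show "lpn p UNIV (%x. u x - V n x) < en e" .
 qed
qed

section \<open>Mollification\<close>

lemma distr_lborel_reflect: "distr lborel borel (%y. x - y) = (lborel :: 'a::euclidean_space measure)"
 using lborel_affine[of "-1" x] by (simp add: density_1)

lemma LINT_reflect:
 fixes f :: "'a::euclidean_space => real"
 assumes "f : bmeas"
 shows "(LL y. f (x - y)) = (LL y. f y)"
proof -
 have "(LB y. f y) = (LINT y|distr lborel borel (%y. x - y). f y)"
  by (simp only: distr_lborel_reflect)
 also have "... = (LB y. f (x - y))" by (rule integral_distr) (use assms in auto)
 finally show ?thesis using assms by (simp add: integral_completion)
qed

lemma LINT_translate:
 fixes f :: "'a::euclidean_space => real"
 assumes "f : bmeas"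
 shows "(LL y. f (y + a)) = (LL y. f y)"
 using LINT_reflect[of "%z. f (- z)" "- a"] LINT_reflect[of f 0] assms
 by (simp add: add.commute)

text \<open>The classical function exp(-1/(r^2 - |x|^2)) on the ball of radius r, extended by
  zero.\<close>

definition bump :: "real => real^'n => real" where
 "bump r x = flat 0 (r\<^sup>2 - x \<bullet> x)"

lemma bump_pos_iff: "0 < r ==> 0 < bump r x \<longleftrightarrow> norm x < r"
 by (auto simp: bump_def flat_def dot_square_norm power_mono_iff abs_square_less_1
   intro: power_strict_mono) (smt (verit) norm_ge_zero power_mono)

lemma bump_nonneg: "0 <= bump r x" by (simp add: bump_def flat_nonneg)

lemma bump_zero: "0 < r ==> r <= norm x ==> bump r x = 0"
 using bump_pos_iff[of r x] bump_nonneg[of r x] by simp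

lemma Ck_bump: "Ck k (bump r)"
 unfolding bump_def by (intro Ck_flat Ck_diff Ck_const Ck_norm_sq)

lemma test_bump: "0 < r ==> test_fun UNIV (bump r)"
 by (rule test_funI[OF Ck_bump compact_cball[of 0 r]]) (auto simp: bump_zero)

lemma bump_integral_pos:
 assumes "0 < r" shows "0 < (LL x. bump r x)"
proof -
 have c: "ctn (bump r :: real^'n => real)" using Ck_bump Ck_continuous by blast
 then have m: "bump r : lmeas" by (rule cont_lmeas)
 obtain B where B: "!!x::real^'n. \<bar>bump r x\<bar> <= B"
  using cont_supp_bounded[OF c compact_cball[of 0 r]] bump_zero[OF assms] by (metis less_le_not_le linorder_not_le mem_cball_0)
 have int: "intg (bump r :: real^'n => real)"
  by (rule supp_int[OF m compact_cball[of 0 r] _ B])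
   (use assms in \<open>auto simp: bump_zero\<close>)
 have "(LL x. bump r (x::real^'n)) ~= 0"
 proof
  assume "(LL x. bump r (x::real^'n)) = 0"
  then have "AE x::real^'n in lebesgue. bump r x = 0"
   using integral_nonneg_eq_0_iff_AE[OF int] bump_nonneg by auto
  then have "AE x::real^'n in lebesgue. x ~: ball 0 r"
   by eventually_elim (use bump_pos_iff[OF assms] in \<open>force\<close>)
  then have "negligible (ball (0::real^'n) r)"
   by (simp add: AE_iff_null_sets negligible_iff_null_sets)
  then show False using assms content_ball_pos[of r "0::real^'n"] negligible_imp_measure0 by fastforce
 qed
 moreover have "0 <= (LL x. bump r (x::real^'n))" by (intro bi_nonneg bump_nonneg)
 ultimately show "0 < (LL x. bump r (x::real^'n))" by simp
qed

definition mol :: "nat => real^'n => real" where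
 "mol n x = inverse (LL z. bump (inverse (real (Suc n))) (z::real^'n)) * bump (inverse (real (Suc n))) x"

lemma mol_test: "test_fun UNIV (mol n)"
 unfolding mol_def by (intro test_fun_mult[OF test_bump]) auto

lemma mol_continuous: "ctn (mol n)"
 using mol_test unfolding test_fun_def using Ck_continuous by blast

lemma mol_nonneg: "0 <= mol n x"
 unfolding mol_def by (intro mult_nonneg_nonneg bump_nonneg) (simp add: bump_integral_pos less_imp_le)

lemma mol_zero: "inverse (real (Suc n)) <= norm x ==> mol n x = 0"
 unfolding mol_def by (subst bump_zero) auto

lemma mol_integral: "(LL x. mol n (x::real^'n)) = 1"
proof -
 have "0 < (LL z. bump (inverse (real (Suc n))) (z::real^'n))" by (rule bump_integral_pos) simp
 then show ?thesis unfolding mol_def by simp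
qed

text \<open>Outside G the values of h are arbitrary, so measurability of the product is taken from h
  cut off to K.\<close>

lemma L1_loc_mult_integrable:
 fixes h v :: "real^'n => real"
 assumes h: "h : L1_loc G" and K: "compact K" "K \<subseteq> G" "\<forall>x. x ~: K --> v x = 0"
  and v[measurable]: "v : lmeas" and B: "!!x. \<bar>v x\<bar> <= B"
 shows "intg (%x. h x * v x)"
proof -
 have KS: "K : sets lebesgue" using lm_compact[OF K(1)] by blast
 have "integrable (lebesgue_on K) h" using h K by (auto simp: L1_loc_def)
 then have i: "intg (%x. ind K x *R h x)" by (simp add: LINT_lebesgue_on KS)
 have m: "(%x. ind K x *R h x) : lmeas" using i by simp
 have e: "h x * v x = (ind K x *R h x) * v x" for x using K(3) by (auto simp: indicator_def)
 have "intg (%x. (ind K x *R h x) * v x)"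
 proof (rule bi_bound)
  show "intg (%x. B * (ind K x *R h x))" using i by simp
  show "(%x. ind K x *R h x * v x) : lmeas" using m v by (rule borel_measurable_times)
  have "\<bar>v x\<bar> <= \<bar>B\<bar>" for x using B[of x] by simp
  then show "AE x in lebesgue. norm (ind K x *R h x * v x) <= norm (B * (ind K x *R h x))"
   by (intro AE_I2) (simp add: abs_mult mult.commute mult_mono)
 qed
 then show ?thesis unfolding e .
qed

lemma L1_loc_cont_int:
 fixes h v :: "real^'n => real"
 assumes h: "h : L1_loc G" and K: "compact K" "K \<subseteq> G" "\<forall>x. x ~: K --> v x = 0"
  and v: "ctn v"
 shows "intg (%x. h x * v x)"
proof -
 obtain B where "!!x. \<bar>v x\<bar> <= B" using cont_supp_bounded[OF v K(1,3)] by blast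
 then show ?thesis by (intro L1_loc_mult_integrable[OF h K] cont_lmeas v)
qed

lemma LINT_supported:
 fixes f :: "'a::euclidean_space => real"
 assumes "G : sets lebesgue" "!!x. x ~: G ==> f x = 0"
 shows "(LINT x|lebesgue_on G. f x) = (LL x. f x)"
 unfolding LINT_lebesgue_on[OF assms(1)] using assms(2)
 by (intro bi_cong) (auto simp: indicator_def)

lemma L1_loc_measurable:
 fixes u :: "real^'n => 'b::euclidean_space"
 assumes "u : L1_loc UNIV" shows "u : lmeas"
proof (rule borel_measurable_LIMSEQ_metric)
 fix n :: nat
 have c: "cball (0::real^'n) (real n) : sets lebesgue" by simp
 have "integrable (lebesgue_on (cball 0 (real n))) u" using assms by (auto simp: L1_loc_def)
 then show "(%x. ind (cball 0 (real n)) x *R u x) : lmeas"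
  by (simp add: LINT_lebesgue_on[OF c] borel_measurable_integrable)
next
 fix x :: "real^'n"
 obtain m :: nat where "norm x < real m" using reals_Archimedean2 by blast
 then have "\<forall>\<^sub>F n in sequentially. ind (cball 0 (real n)) x *R u x = u x"
  unfolding ev_seq by (intro exI[of _ m]) auto
 then show "(%n. ind (cball 0 (real n)) x *R u x) ~~> u x" by (rule tendsto_eventually)
qed

text \<open>On a set of finite measure t <= 1 + t^p does the work of Hoelder's inequality.\<close>

lemma L1_locI_lpn:
 fixes u :: "real^'n => 'b::euclidean_space"
 assumes "!!K. compact K ==> K \<subseteq> G ==> u : borel_measurable (lebesgue_on K) \<and> lpn p K u < inft" "1 <= p"
 shows "u : L1_loc G"
 unfolding L1_loc_def
proof (safe)
 fix K assume K: "compact K" "K \<subseteq> G"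
 have KS[measurable]: "K : sets lebesgue" using lm_compact[OF K(1)] by blast
 note m = assms(1)[OF K]
 have mm[measurable]: "(%x. ind K x *R u x) : lmeas"
  using m LINT_lebesgue_on(3)[OF KS] by blast
 have le: "t <= 1 + t powr p" if "t >= 0" for t :: real
 proof (cases "t <= 1")
  case False
  then have "t powr 1 <= t powr p" using assms(2) by (intro powr_mono) auto
  then show ?thesis using False by simp
 qed (auto intro: order_trans[of _ 1])
 have "(NL x. en (norm (ind K x *R u x)))
  <= (NL x. ind K x + ind K x * en (norm (u x) powr p))"
 proof (rule nn_integral_mono)
  fix x
  have "en (norm (u x)) <= en (1 + norm (u x) powr p)" by (intro ennreal_leI le) simp
  then show "en (norm (ind K x *R u x)) <= ind K x + ind K x * en (norm (u x) powr p)"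
   by (simp add: indicator_def ennreal_plus del: ennreal_plus[symmetric])
 qed
 also have "... = emeasure lebesgue K + lpn p K u"
 proof -
  have "(%x. ind K x * en (norm (ind K x *R u x) powr p)) : lmeas"
   by measurable
  also have "(%x. ind K x * en (norm (ind K x *R u x) powr p))
    = (%x. ind K x * en (norm (u x) powr p))" by (auto simp: indicator_def)
  finally show ?thesis unfolding lpn_def by (subst nn_integral_add) auto
 qed
 also have "... < inft"
  using m lm_compact[OF K(1)] by (auto simp: fmeasurable_def)
 finally show "integrable (lebesgue_on K) u"
  unfolding LINT_lebesgue_on(2)[OF KS] by (intro integrableI_bounded mm)
qed

lemma L1_loc_lpn_UNIV:
 fixes u :: "real^'n => 'b::euclidean_space"
 assumes "u : lmeas" "lpn p UNIV u < inft" "1 <= p"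
 shows "u : L1_loc UNIV"
proof (rule L1_locI_lpn[OF _ assms(3)])
 fix K :: "(real^'n) set"
 have "lpn p K u <= lpn p UNIV u" using assms(3) by (intro lpn_mono) auto
 then show "u : borel_measurable (lebesgue_on K) \<and> lpn p K u < inft"
  using assms by (auto intro: meas_restrict1 order_le_less_trans)
qed

lemma supp_unif_cont:
 fixes v :: "'a::euclidean_space => real"
 assumes "ctn v" "compact K" "\<forall>x. x ~: K --> v x = 0"
 shows "uniformly_continuous_on UNIV v"
 unfolding uniformly_continuous_on_def
proof (intro allI impI)
 fix e :: real assume e: "e > 0"
 define K' where "K' = {x + y | x y. x : K \<and> y : cball 0 1}"
 have "compact K'" unfolding K'_def by (rule compact_sums[OF assms(2) compact_cball])
 then have "uniformly_continuous_on K' v"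
  using assms(1) by (meson compact_uniformly_continuous cont_subset top_greatest)
 then obtain d where d: "d > 0" "!!x y. x : K' ==> y : K' ==> dist y x < d ==> dist (v y) (v x) < e"
  unfolding uniformly_continuous_on_def using e by metis
 have inK: "y : K'" if "x : K" "dist y x < 1" for x y
 proof -
  have "y = x + (y - x)" "y - x : cball 0 1" using that by (auto simp: dist_norm norm_minus_commute)
  then show ?thesis unfolding K'_def using that(1) by blast
 qed
 show "\<exists>d>0. \<forall>x\<in>UNIV. \<forall>y\<in>UNIV. dist y x < d --> dist (v y) (v x) < e"
 proof (intro exI conjI ballI impI)
  show "min d 1 > 0" using d by simp
  fix x y :: 'a assume xy: "dist y x < min d 1"
  show "dist (v y) (v x) < e"
  proof (cases "x : K \<or> y : K")
   case True
   then have "x : K'" "y : K'" using inK[of x x] inK[of x y] inK[of y y] inK[of y x] xy by (auto simp: dist_commute)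
   then show ?thesis using d xy by auto
  qed (use assms(3) e in auto)
 qed
qed

text \<open>Compact support makes the partial derivatives uniformly continuous, and the mean value
  inequality is applied to the function minus its linear part at z. A single d for all z allows the
  remainder to be integrated, in \<open>conv_has_derivative\<close> and in
  \<open>integral_pd_zero\<close>.\<close>

lemma c1_uniform_derivative:
 fixes ka :: "real^'n => real"
 assumes ka: "c1_test UNIV ka" and e: "e > 0"
 obtains d where "d > 0" "!!z h. norm h < d ==>
  \<bar>ka (z + h) - ka z - (\<Sum>i\<in>UNIV. pd i ka z * h $ i)\<bar> <= e * norm h"
proof -
 obtain K where K: "compact K" "\<forall>x. x ~: K --> ka x = 0" using c1_testD(1)[OF ka] by blast
 note C = Ck1D[OF c1_testD(2)[OF ka]]
 define e' where "e' = e / real CARD('n)"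
 have e': "e' > 0" using e by (simp add: e'_def)
 have "\<exists>d>0. \<forall>x y. dist y x < d --> \<bar>pd i ka y - pd i ka x\<bar> < e'" for i
  using supp_unif_cont[OF C(2)[of i] K(1)]
   pd_support[OF cmp_closed[OF K(1)] K(2)] e'
  unfolding uniformly_continuous_on_def by (simp add: dist_real_def)
 then obtain D where D: "!!i. D i > 0" "!!i x y. dist y x < D i ==> \<bar>pd i ka y - pd i ka x\<bar> < e'"
  by metis
 define d where "d = Min (range D)"
 have d: "d > 0" "!!i. d <= D i" using D(1) by (auto simp: d_def)
 show thesis
 proof (rule that[OF d(1)])
  fix z h :: "real^'n" assume h: "norm h < d"
  define f where "f w = ka w - (\<Sum>i\<in>UNIV. pd i ka z * w $ i)" for w
  define f' where "f' w k = (\<Sum>i\<in>UNIV. pd i ka w * k $ i) - (\<Sum>i\<in>UNIV. pd i ka z * k $ i)" for w k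
  have "norm (f (z + h) - f z) <= e * norm (z + h - z)"
  proof (rule differentiable_bound[where f' = f' and S = "ball z d"])
   show "(f has_derivative f' w) (at w within ball z d)" for w
   proof -
    have l: "((%w. \<Sum>i\<in>UNIV. pd i ka z * w $ i) has_derivative (%k. \<Sum>i\<in>UNIV. pd i ka z * k $ i)) (at w within ball z d)"
     by (intro bounded_linear_imp_has_derivative bounded_linear_sum bounded_linear_compose[OF bounded_linear_mult_right] bounded_linear_vec_nth)
    show ?thesis unfolding f_def f'_def
     by (intro has_derivative_diff l has_derivative_at_withinI[OF has_derivative_pd] C)
   qed
   show "onorm (f' w) <= e" if w: "w : ball z d" for w
   proof (rule onorm_le)
    fix k :: "real^'n"
    have "norm (f' w k) = \<bar>\<Sum>i\<in>UNIV. (pd i ka w - pd i ka z) * k $ i\<bar>"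
     by (simp add: f'_def sum_subtractf left_diff_distrib)
    also have "... <= (\<Sum>i\<in>(UNIV::'n set). e' * norm k)"
    proof (rule order_trans[OF sum_abs], rule sum_mono)
     fix i
     have "\<bar>pd i ka w - pd i ka z\<bar> <= e'" using D(2)[of w z i] w d(2)[of i] by (simp add: dist_commute)
     then show "\<bar>(pd i ka w - pd i ka z) * k $ i\<bar> <= e' * norm k"
      unfolding abs_mult using component_le_norm_cart e' by (intro mult_mono) auto
    qed
    also have "... = e * norm k" by (simp add: e'_def)
    finally show "norm (f' w k) <= e * norm k" .
   qed
  qed (use h d in \<open>auto simp: dist_norm\<close>)
  then show "\<bar>ka (z + h) - ka z - (\<Sum>i\<in>UNIV. pd i ka z * h $ i)\<bar> <= e * norm h"
   by (simp add: f_def algebra_simps sum.distrib)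
 qed
qed

definition conv :: "(real^'n => real) => (real^'n => real) => real^'n => real" where
 "conv u ka x = (LL y. u y * ka (x - y))"

lemma conv_kernel_support:
 fixes ka :: "real^'n => real" and x :: "real^'n"
 assumes "compact K" "\<forall>z. z ~: K --> ka z = 0"
 shows "compact ((%z. x - z) ` K)" "\<forall>y. y ~: (%z. x - z) ` K --> ka (x - y) = 0"
proof -
 show "compact ((%z. x - z) ` K)" by (intro compact_cont_image continuous_intros assms(1))
 show "\<forall>y. y ~: (%z. x - z) ` K --> ka (x - y) = 0"
 proof (intro allI impI)
  fix y assume y: "y ~: (%z. x - z) ` K"
  have "x - y ~: K"
  proof
   assume "x - y : K"
   then have "x - (x - y) : (%z. x - z) ` K" by (rule imageI)
   then show False using y by simp
  qed
  then show "ka (x - y) = 0" using assms(2) by simp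
 qed
qed

lemma conv_integrable:
 fixes ka :: "real^'n => real"
 assumes "u : L1_loc UNIV" "ctn ka" "compact K" "\<forall>z. z ~: K --> ka z = 0"
 shows "intg (%y. u y * ka (x - y))"
 by (rule L1_loc_cont_int[OF assms(1) conv_kernel_support(1)[OF assms(3,4)] _ conv_kernel_support(2)[OF assms(3,4)]])
  (auto intro!: cont_comp2[OF assms(2)] continuous_intros)

lemma conv_has_derivative:
 fixes ka :: "real^'n => real"
 assumes u: "u : L1_loc UNIV" and ka: "c1_test UNIV ka"
 shows "(conv u ka has_derivative (%h. \<Sum>i\<in>UNIV. conv u (pd i ka) x * h $ i)) (at x)"
 unfolding has_derivative_at_alt
proof (intro conjI allI impI)
 show "bounded_linear (%h. \<Sum>i\<in>UNIV. conv u (pd i ka) x * h $ i)"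
  by (intro bounded_linear_sum bounded_linear_compose[OF bounded_linear_mult_right] bounded_linear_vec_nth)
 fix e :: real assume e: "e > 0"
 obtain K where K: "compact K" "\<forall>x. x ~: K --> ka x = 0" using c1_testD(1)[OF ka] by blast
 note C = Ck1D[OF c1_testD(2)[OF ka]]
 have pK: "\<forall>x. x ~: K --> pd i ka x = 0" for i using pd_support[OF cmp_closed[OF K(1)] K(2)] by blast
 \<comment> \<open>For every y within distance 1 of x the kernel w |-> ka (y - w) is supported in
   \<open>L\<close>, so the remainder is at most a uniform constant times the integral of |u| over
   \<open>L\<close>.\<close>
 define L where "L = {a + b | a b. a : (%z. x - z) ` K \<and> b : cball 0 1}"
 have L: "compact L" unfolding L_def by (intro compact_sums conv_kernel_support(1)[OF K] compact_cball)
 have LS[measurable]: "L : sets lebesgue" using lm_compact[OF L] by blast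
 have iL: "intg (%y. ind L y *R u y)"
  using u L unfolding L1_loc_def LINT_lebesgue_on(2)[OF LS, symmetric] by blast
 define M where "M = (LL y. \<bar>ind L y *R u y\<bar>)"
 have M: "M >= 0" unfolding M_def by (intro bi_nonneg) auto
 define e' where "e' = e / (M + 1)"
 have e': "e' > 0" using e M by (simp add: e'_def)
 obtain d where d: "d > 0" "!!z h. norm h < d ==>
  \<bar>ka (z + h) - ka z - (\<Sum>i\<in>UNIV. pd i ka z * h $ i)\<bar> <= e' * norm h"
  using c1_uniform_derivative[OF ka e'] by blast
 show "\<exists>d>0. \<forall>y. norm (y - x) < d -->
   norm (conv u ka y - conv u ka x - (\<Sum>i\<in>UNIV. conv u (pd i ka) x * (y - x) $ i)) <= e * norm (y - x)"
 proof (intro exI conjI allI impI)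
  show "min d 1 > 0" using d by simp
  fix y assume y: "norm (y - x) < min d 1"
  define h where "h = y - x"
  define f where "f w = ka (y - w) - ka (x - w) - (\<Sum>i\<in>UNIV. pd i ka (x - w) * h $ i)" for w
  have i1: "intg (%w. u w * ka (y - w))" "intg (%w. u w * ka (x - w))"
   by (intro conv_integrable[OF u C(3) K])+
  have i2: "intg (%w. u w * pd i ka (x - w))" for i
   by (intro conv_integrable[OF u C(2) K(1) pK])
  have uf: "u w * f w = u w * ka (y - w) - u w * ka (x - w) - (\<Sum>i\<in>UNIV. u w * pd i ka (x - w) * h $ i)" for w
   by (simp add: f_def right_diff_distrib sum_distrib_left mult.assoc)
  have "conv u ka y - conv u ka x - (\<Sum>i\<in>UNIV. conv u (pd i ka) x * h $ i) = (LL w. u w * f w)"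
   unfolding uf conv_def by (simp add: i1 i2 bi_int_sum)
  also have "norm ... <= (LL w. (e' * norm h) * \<bar>ind L w *R u w\<bar>)"
  proof (rule bi_norm_bound)
   show "intg (%w. u w * f w)" unfolding uf using i1 i2 by auto
   show "intg (%w. (e' * norm h) * \<bar>ind L w *R u w\<bar>)" using iL by auto
   fix w
   have 1: "\<bar>f w\<bar> <= e' * norm h"
    using d(2)[of h "x - w"] y by (simp add: f_def h_def)
   have 2: "f w = 0" if "w ~: L"
   proof -
    have a: "x - w ~: K"
    proof
     assume "x - w : K"
     then have "w : L" unfolding L_def by (intro CollectI exI[of _ w] exI[of _ 0]) force
     then show False using that by simp
    qed
    have b: "y - w ~: K"
    proof
     assume "y - w : K"
     then have "x - (y - w) : (%z. x - z) ` K" by (rule imageI)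
     moreover have "w = x - (y - w) + (y - x)" "y - x : cball 0 1" using y by auto
     ultimately have "w : L" unfolding L_def by blast
     then show False using that by simp
    qed
    show ?thesis using a b K(2) pK by (simp add: f_def)
   qed
   show "norm (u w * f w) <= (e' * norm h) * \<bar>ind L w *R u w\<bar>"
    using mult_right_mono[OF 1, of "\<bar>u w\<bar>"] 2 by (cases "w : L") (auto simp: abs_mult mult.commute)
  qed
  also have "... = e' * norm h * M" by (simp add: M_def)
  also have "... = e' * M * norm h" by simp
  also have "... <= e * norm h" using e M by (intro mult_right_mono) (auto simp: e'_def field_simps)
  finally show "norm (conv u ka y - conv u ka x - (\<Sum>i\<in>UNIV. conv u (pd i ka) x * (y - x) $ i)) <= e * norm (y - x)"
   by (simp add: h_def)
 qed
qed

lemma pd_conv: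
 assumes "u : L1_loc UNIV" "c1_test UNIV ka"
 shows "pd i (conv u ka) = conv u (pd i ka)"
 by (rule ext) (subst pd_eqI[OF conv_has_derivative[OF assms]],
  simp add: axis_def if_distrib[of "(*) _"] cong: if_cong)

lemma Ck_conv:
 assumes "u : L1_loc UNIV" "test_fun UNIV ka"
 shows "Ck k (conv u ka)"
 using assms(2)
proof (induction k arbitrary: ka)
 case 0
 then show ?case using conv_has_derivative[OF assms(1) test_fun_c1]
  by (auto intro!: continuous_at_imp_continuous_on has_derivative_continuous)
next
 case (Suc k)
 have "Ck k (conv u (pd i ka))" for i by (rule Suc.IH[OF test_fun_pd[OF Suc.prems]])
 then show ?case using conv_has_derivative[OF assms(1) test_fun_c1[OF Suc.prems]]
  by (auto simp: pd_conv[OF assms(1) test_fun_c1[OF Suc.prems]] differentiable_def)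
qed

text \<open>The derivative falls on the kernel. As a function of the integration variable the
  reflected kernel is a test function whose derivatives change sign, so the definition of the weak
  gradient moves the derivative onto u.\<close>

lemma pd_conv_weak:
 fixes ka :: "real^'n => real"
 assumes g: "has_weak_grad UNIV u g" and ka: "test_fun UNIV ka"
 shows "pd i (conv u ka) = conv (%y. g y $ i) ka"
proof
 fix x :: "real^'n"
 have u: "u : L1_loc UNIV" using g by (simp add: has_weak_grad_def)
 have ck: "Ck k ka" for k using ka by (simp add: test_fun_def)
 have der: "((%y. f (x - y)) has_derivative (%h. \<Sum>i\<in>UNIV. pd i f (x - y) * (- h) $ i)) (at y)"
  if "f differentiable (at (x - y))" for f y
 proof -
  have "((%y. x - y) has_derivative uminus) (at y)" by (auto intro!: derivative_eq_intros)
  from diff_chain_at[OF this has_derivative_pd[OF that]] show ?thesis by (simp add: o_def)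
 qed
 have pdr': "pd i (%y. f (x - y)) = (%y. - pd i f (x - y))" if "!!y. f differentiable (at y)" for f i
  using pd_eqI[OF der[OF that]]
  by (auto simp: axis_def if_distrib[of "(*) _"] if_distrib[of "uminus"] cong: if_cong)
 have sc: "Ck k (%y. f (x - y))" if "Ck k f" for k f
  using that
 proof (induction k arbitrary: f)
  case 0
  then show ?case by (auto intro!: cont_comp2[of UNIV f] continuous_intros)
 next
  case (Suc k)
  have "Ck k (%y. (-1) * pd i f (x - y))" for i
   using Suc.IH[of "pd i f"] Suc.prems by (intro Ck_cmult) auto
  then show ?case using pdr'[of f] der[of f] Suc.prems by (auto simp: differentiable_def)
 qed
 have pdr: "pd i (%y. ka (x - y)) = (%y. - pd i ka (x - y))" using pdr' ck[of 1] by simp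
 obtain K where K: "compact K" "\<forall>x. x ~: K --> ka x = 0" using c1_testD(1)[OF test_fun_c1[OF ka]] by blast
 have "test_fun UNIV (%y. ka (x - y))"
  by (rule test_funI[OF _ conv_kernel_support(1)[OF K] _ conv_kernel_support(2)[OF K]]) (use sc ck in auto)
 then have "(LL y. u y * pd i (%y. ka (x - y)) y) = - (LL y. g y $ i * ka (x - y))"
  using g unfolding has_weak_grad_def lebesgue_on_UNIV_eq by blast
 then show "pd i (conv u ka) x = conv (%y. g y $ i) ka x"
  unfolding pd_conv[OF u test_fun_c1[OF ka]] pdr by (simp add: conv_def)
qed

lemma mol_kernel: "\<forall>z. z ~: cball 0 (inverse (real (Suc n))) --> mol n z = 0"
 by (auto intro!: mol_zero simp: not_le)

lemma mol_shift_integral: "(LL y. mol n (x - y)) = 1" "intg (%y. mol n (x - y))"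
proof -
 have m: "mol n : bmeas" by (intro cont_bmeas mol_continuous)
 show 1: "(LL y. mol n (x - y)) = 1"
  using LINT_reflect[OF m, of x] mol_integral by simp
 then show "intg (%y. mol n (x - y))" using not_integrable_integral_eq by fastforce
qed

text \<open>Stated at a single point, so that it serves uniform limits, locally uniform limits and,
  with d = 1 and e = 0, the cut-off in \<open>radial_cutoff\<close>.\<close>

lemma conv_mol_near:
 assumes u: "u : L1_loc UNIV" and near: "!!y. dist x y < d ==> \<bar>u y - u x\<bar> <= e"
  and n: "inverse (real (Suc n)) <= d" and e: "0 <= e"
 shows "\<bar>conv u (mol n) x - u x\<bar> <= e"
proof -
 have i: "intg (%y. u y * mol n (x - y))"
  by (rule conv_integrable[OF u mol_continuous compact_cball mol_kernel])
 have i2: "intg (%y. u x * mol n (x - y))"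
  by (intro integrable_mult_right mol_shift_integral)
 have "conv u (mol n) x - u x = (LL y. u y * mol n (x - y) - u x * mol n (x - y))"
  by (subst bi_int_diff[OF i i2]) (simp add: conv_def mol_shift_integral)
 also have "norm ... <= (LL y. e * mol n (x - y))"
 proof (rule bi_norm_bound)
  fix y
  have "\<bar>u y - u x\<bar> * mol n (x - y) <= e * mol n (x - y)"
  proof (cases "dist x y < d")
   case True
   then show ?thesis using near mol_nonneg by (intro mult_right_mono) auto
  next
   case False
   then have "mol n (x - y) = 0" using n by (intro mol_zero) (simp add: dist_norm)
   then show ?thesis by simp
  qed
  then show "norm (u y * mol n (x - y) - u x * mol n (x - y)) <= e * mol n (x - y)"
   by (simp add: abs_mult mol_nonneg flip: left_diff_distrib)
 qed (intro bi_diff i i2 integrable_mult_right mol_shift_integral)+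
 also have "... = e" by (simp add: mol_shift_integral)
 finally show ?thesis by simp
qed

lemma conv_mol_support:
 assumes "\<forall>x. x ~: K --> u x = 0" "!!y. y : K ==> inverse (real (Suc n)) <= dist x y"
 shows "conv u (mol n) x = 0"
proof -
 have "u y * mol n (x - y) = 0" for y
  using assms mol_zero[of n "x - y"] by (cases "y : K") (auto simp: dist_norm)
 then show ?thesis unfolding conv_def by (simp only: Bochner_Integration.integral_zero)
qed

lemma conv_mol_measurable: "u : L1_loc UNIV ==> conv u (mol n) : lmeas"
 using Ck_continuous[OF Ck_conv[OF _ mol_test, of u 0 n]] by (intro cont_lmeas)

text \<open>Jensen's inequality for the probability density k: the tangent inequality is integrated
  at a, the k-mean of |u|, and the terms in a combine to a^p. If the integrand on the right is not
  integrable, that side is infinite.\<close>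

lemma jensen_powr:
 fixes u k :: "'a => real"
 assumes i: "integrable M (%y. u y * k y)" and um[measurable]: "u : borel_measurable M"
  and k: "!!y. 0 <= k y" "integrable M k" "(LINT y|M. k y) = 1" and p: "1 < p"
 shows "en (\<bar>LINT y|M. u y * k y\<bar> powr p) <= (\<integral>\<^sup>+y. en (\<bar>u y\<bar> powr p * k y) \<partial>M)"
proof -
 have [measurable]: "k : borel_measurable M" using k(2) by blast
 define a where "a = (LINT y|M. \<bar>u y\<bar> * k y)"
 have ia: "integrable M (%y. \<bar>u y\<bar> * k y)"
  using integrable_abs[OF i] k(1) by (simp add: abs_mult)
 have a0: "0 <= a" unfolding a_def by (intro bi_nonneg) (simp add: k)
 have ca: "\<bar>LINT y|M. u y * k y\<bar> <= a"
  unfolding a_def using integral_abs_bound[of M "%y. u y * k y"] k(1) by (simp add: abs_mult)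
 show ?thesis
 proof (cases "integrable M (%y. \<bar>u y\<bar> powr p * k y)")
  case True
  have "(LINT y|M. p * (a powr (p - 1) * \<bar>u y\<bar>) * k y) <=
   (LINT y|M. (\<bar>u y\<bar> powr p + (p - 1) * a powr p) * k y)"
  proof (rule integral_mono)
   show "integrable M (%y. p * (a powr (p - 1) * \<bar>u y\<bar>) * k y)"
    using integrable_mult_right[OF ia, of "p * a powr (p - 1)"] by (simp add: mult.assoc)
   show "integrable M (%y. (\<bar>u y\<bar> powr p + (p - 1) * a powr p) * k y)"
    unfolding distrib_right by (intro Bochner_Integration.integrable_add True integrable_mult_right k)
   show "p * (a powr (p - 1) * \<bar>u y\<bar>) * k y <= (\<bar>u y\<bar> powr p + (p - 1) * a powr p) * k y" for y
    using powr_tangent[OF p a0, of "\<bar>u y\<bar>"] k(1) by (intro mult_right_mono) auto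
  qed
  moreover have "(LINT y|M. p * (a powr (p - 1) * \<bar>u y\<bar>) * k y) = p * a powr (p - 1) * a"
   unfolding a_def by (simp add: mult.assoc)
  moreover have "(LINT y|M. (\<bar>u y\<bar> powr p + (p - 1) * a powr p) * k y)
   = (LINT y|M. \<bar>u y\<bar> powr p * k y) + (p - 1) * a powr p"
   unfolding distrib_right
   by (subst bi_int_add[OF True integrable_mult_right[OF k(2)]]) (simp add: k(3))
  moreover have "a powr (p - 1) * a = a powr p"
   using a0 by (cases "a = 0") (auto simp: powr_diff)
  ultimately have "p * a powr p <= (LINT y|M. \<bar>u y\<bar> powr p * k y) + (p - 1) * a powr p"
   by (simp only: mult.assoc)
  then have "a powr p <= (LINT y|M. \<bar>u y\<bar> powr p * k y)"
   by (simp add: left_diff_distrib)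
  moreover have "\<bar>LINT y|M. u y * k y\<bar> powr p <= a powr p" using ca p by (intro powr_mono2) auto
  ultimately have "en (\<bar>LINT y|M. u y * k y\<bar> powr p) <= en (LINT y|M. \<bar>u y\<bar> powr p * k y)"
   by (intro ennreal_leI) simp
  then show ?thesis using True k(1) by (subst nn_integral_eq_integral) auto
 next
  case False
  then have "(\<integral>\<^sup>+y. en (norm (\<bar>u y\<bar> powr p * k y)) \<partial>M) = \<infinity>"
   unfolding integrable_iff_bounded by (simp add: less_top[symmetric])
  then show ?thesis using k(1) by simp
 qed
qed

lemma conv_jensen:
 assumes u: "u : L1_loc UNIV" and p: "1 < p"
 shows "en (\<bar>conv u (mol n) x\<bar> powr p) <= (NL y. en (\<bar>u y\<bar> powr p * mol n (x - y)))"
 unfolding conv_def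
 by (rule jensen_powr[OF conv_integrable[OF u mol_continuous compact_cball mol_kernel]
    L1_loc_measurable[OF u] mol_nonneg mol_shift_integral(2,1) p])

text \<open>Jensen's inequality at each point, then Tonelli. The kernel is even, so it also has
  integral 1 as a function of x.\<close>

lemma conv_Lp_bound:
 fixes u :: "real^'n => real"
 assumes u: "u : L1_loc UNIV" and p: "1 < p"
 shows "lpn p UNIV (conv u (mol n)) <= lpn p UNIV u"
proof -
 have um: "u : lmeas" using u by (rule L1_loc_measurable)
 \<comment> \<open>Tonelli's theorem is applied to products of \<open>lborel\<close>, which asks for
   a Borel representative of u.\<close>
 then obtain u' where u'[measurable]: "u' : borel_measurable lborel" and ae: "AE x in lborel. u x = u' x"
  using completion_ex_borel_measurable_real[OF um] by blast
 have ae': "AE x in lebesgue. u x = u' x" using ae by (rule AE_completion)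
 have [measurable]: "mol n : bmeas" by (intro cont_bmeas mol_continuous)
 have "lpn p UNIV (conv u (mol n)) <= (NL x. (NL y. en (\<bar>u y\<bar> powr p * mol n (x - y))))"
  unfolding lpn_def using conv_jensen[OF u p] by (intro nn_integral_mono) simp
 also have "... = (NB x. (NB y. en (\<bar>u' y\<bar> powr p * mol n (x - y))))"
 proof -
  have "(NL y. en (\<bar>u y\<bar> powr p * mol n (x - y))) = (NL y. en (\<bar>u' y\<bar> powr p * mol n (x - y)))" for x
   using ae' by (intro nn_integral_cong_AE) (auto elim: eventually_mono)
  then show ?thesis by (simp add: nn_integral_completion)
 qed
 also have "... = (NB y. (NB x. en (\<bar>u' y\<bar> powr p * mol n (x - y))))"
  by (rule lborel_pair.Fubini') measurable
 also have "... = (NB y. en (\<bar>u' y\<bar> powr p) * (NB x. en (mol n (x - y))))"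
  by (intro nn_integral_cong, subst ennreal_mult) (auto simp: mol_nonneg nn_integral_cmult)
 also have "... = (NB y. en (\<bar>u' y\<bar> powr p))"
 proof -
  have "(NB x. en (mol n (x - y))) = 1" for y :: "real^'n"
  proof -
   have "mol n (x - y) = mol n (y - x)" for x
    by (simp add: mol_def bump_def dot_square_norm norm_minus_commute)
   then have "(NB x. en (mol n (x - y))) = (NB x. en (mol n (y - x)))" by simp
   also have "... = (NL x. en (mol n (y - x)))" by (simp add: nn_integral_completion)
   also have "... = en 1"
    using mol_shift_integral[of n y] by (subst nn_integral_eq_integral) (auto simp: mol_nonneg)
   finally show ?thesis by simp
  qed
  then show ?thesis by simp
 qed
 also have "... = lpn p UNIV u'" by (simp add: lpn_def nn_integral_completion)
 also have "... = lpn p UNIV u" by (rule lpn_cong_AE) (use ae' in \<open>auto elim: eventually_mono\<close>)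
 finally show ?thesis .
qed

lemma conv_diff:
 assumes "u : L1_loc UNIV" "v : L1_loc UNIV"
 shows "conv (%x. u x - v x) (mol n) x = conv u (mol n) x - conv v (mol n) x"
 using conv_integrable[OF assms(1) mol_continuous compact_cball mol_kernel, of n x]
  conv_integrable[OF assms(2) mol_continuous compact_cball mol_kernel, of n x]
 by (simp add: conv_def left_diff_distrib)

lemma L1_loc_diff: "u : L1_loc G ==> v : L1_loc G ==> (%x. u x - v x) : L1_loc G"
 unfolding L1_loc_def by auto

lemma continuous_L1_loc: "ctn (v :: real^'n => real) ==> v : L1_loc G"
 unfolding L1_loc_def
proof (safe)
 fix K :: "(real^'n) set" assume v: "ctn v" and K: "compact K"
 have KS[measurable]: "K : sets lebesgue" using lm_compact[OF K(1)] by blast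
 have [measurable]: "v : lmeas" using v by (rule cont_lmeas)
 have "bounded (v ` K)" using v K by (meson compact_cont_image compact_imp_bounded cont_subset top_greatest)
 then obtain B where "!!x. x : K ==> \<bar>v x\<bar> <= B" "B > 0" by (auto simp: bounded_pos)
 then show "integrable (lebesgue_on K) v" unfolding LINT_lebesgue_on[OF KS]
  by (intro supp_int[OF _ K, of _ B]) (auto simp: indicator_def)
qed

lemma ennreal_tendsto_0I:
 fixes X :: "nat => ennreal"
 assumes "!!e::real. e > 0 ==> \<exists>N. ALL n>=N. X n <= en e"
 shows "X ~~> 0"
proof (rule order_tendstoI)
 fix a :: ennreal assume "0 < a"
 then obtain b where b: "0 < b" "b < a" using dense by blast
 then obtain e where e: "b = en e" "e > 0"
  by (cases b) (auto simp: ennreal_less_zero_iff)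
 with assms[of e] b show "\<forall>\<^sub>F x in sequentially. X x < a"
  unfolding ev_seq by (metis order_le_less_trans)
qed simp

text \<open>The three-term estimate: u is replaced by a continuous v of compact support,
  \<open>conv_Lp_bound\<close> controls the convolution of u - v, and uniform continuity handles
  v.\<close>

lemma conv_Lp_tendsto:
 fixes u :: "real^'n => real"
 assumes um[measurable]: "u : lmeas" and fin: "lpn p UNIV u < inft" and p: "1 < p"
 shows "(%n. lpn p UNIV (%x. conv u (mol n) x - u x)) ~~> 0"
proof -
 have u: "u : L1_loc UNIV" using L1_loc_lpn_UNIV[OF um fin] p by simp
 note [measurable] = conv_mol_measurable[OF u]
 have "\<exists>N. ALL n>=N. lpn p UNIV (%x. conv u (mol n) x - u x) <= en e" if e: "e > 0" for e :: real
 proof -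
  define C where "C = (2::real) powr p"
  have C: "C > 0" by (simp add: C_def)
  \<comment> \<open>Two nested uses of \<open>lpn_triangle\<close> add up to C (C (e' + e') + e'),
    which is e for this choice.\<close>
  define e' where "e' = e / (C + C * C + C * C)"
  have den: "C + C * C + C * C > 0" using C by (simp add: add_pos_pos)
  have e': "e' > 0" using e den by (simp add: e'_def)
  obtain v K where v: "ctn v" and K: "compact K" "\<forall>x. x ~: K --> v x = 0"
   and uv: "lpn p UNIV (%x. u x - v x) < en e'"
   using Lp_dense_continuous[OF um fin p open_UNIV _ e'] by auto
  have vL: "v : L1_loc UNIV" using v by (rule continuous_L1_loc)
  have [measurable]: "v : lmeas" using v by (rule cont_lmeas)
  note [measurable] = conv_mol_measurable[OF vL]
  define L where "L = {a + b | a b. a : K \<and> b : cball 0 1}"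
  have L: "compact L" unfolding L_def by (rule compact_sums[OF K(1) compact_cball])
  have LS[measurable]: "L : sets lebesgue" using lm_compact[OF L] by blast
  define m where "m = measure lebesgue L"
  have m: "emeasure lebesgue L = en m" "m >= 0"
   using lm_compact[OF L] by (auto simp: m_def emeasure_eq_measure2)
  \<comment> \<open>Makes a^p times the measure m of \<open>L\<close> at most e'; the summand 1
    avoids division by zero. The same device recurs below.\<close>
  define a where "a = (e' / (m + 1)) powr (1 / p)"
  have a: "a > 0" "a powr p * m <= e'" using e' m(2) p by (auto simp: a_def powr_powr field_simps)
  have "uniformly_continuous_on UNIV v" by (rule supp_unif_cont[OF v K])
  then obtain d where d: "d > 0" "!!x y. dist y x < d ==> dist (v y) (v x) < a"
   unfolding uniformly_continuous_on_def using a by (metis UNIV_I)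
  obtain N where N: "inverse (real (Suc N)) < d" using reals_Archimedean[OF d(1)] by auto
  have "lpn p UNIV (%x. conv u (mol n) x - u x) <= en e" if n: "n >= N" for n
  proof -
   have nd: "inverse (real (Suc n)) <= d"
    using N n by (smt (verit) inverse_le_imp_le le_imp_inverse_le of_nat_0_less_iff of_nat_le_iff Suc_le_mono zero_less_Suc)
   have vv: "\<bar>conv v (mol n) x - v x\<bar> <= a" for x
    by (rule conv_mol_near[OF vL _ nd]) (use d(2) a in \<open>force simp: dist_real_def dist_commute\<close>)+
   have v0: "conv v (mol n) x - v x = 0" if "x ~: L" for x
   proof -
    have far: "1 < dist x y" if "y : K" for y
    proof (rule ccontr)
     assume "\<not> 1 < dist x y"
     then have "x = y + (x - y)" "x - y : cball 0 1" by (auto simp: dist_norm norm_minus_commute)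
     then have "x : L" unfolding L_def using that by blast
     then show False using \<open>x ~: L\<close> by simp
    qed
    have "inverse (real (Suc n)) <= 1" by (simp add: inverse_eq_divide)
    then have "conv v (mol n) x = 0" using far by (intro conv_mol_support[OF K(2)]) force
    moreover have "x ~: K" using far[of x] by auto
    ultimately show ?thesis using K(2) by simp
   qed
   have B: "lpn p UNIV (%x. conv v (mol n) x - v x) <= en e'"
   proof -
    have "lpn p UNIV (%x. conv v (mol n) x - v x) <= (NL x. en (a powr p) * ind L x)"
     unfolding lpn_def
    proof (rule nn_integral_mono)
     fix x :: "real^'n"
     show "ind UNIV x * en (norm (conv v (mol n) x - v x) powr p) <= en (a powr p) * ind L x"
      using vv[of x] v0[of x] p by (cases "x : L") (auto intro!: ennreal_leI powr_mono2)
    qed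
    also have "... = en (a powr p * m)"
     using m by (simp add: nn_integral_cmult ennreal_mult')
    also have "... <= en e'" using a by (intro ennreal_leI)
    finally show ?thesis .
   qed
   have A: "lpn p UNIV (%x. conv u (mol n) x - conv v (mol n) x) <= en e'"
    using conv_Lp_bound[OF L1_loc_diff[OF u vL] p, of n] uv
    unfolding conv_diff[OF u vL, abs_def] by (simp add: less_imp_le order_trans)
   have "lpn p UNIV (%x. conv u (mol n) x - v x) <= en C * (en e' + en e')"
    unfolding C_def
    by (rule order_trans[OF lpn_triangle[where g = "conv v (mol n)"]]) (use p A B in \<open>auto intro!: mult_left_mono add_mono\<close>)
   moreover have "lpn p UNIV (%x. v x - u x) <= en e'"
    using uv unfolding lpn_diff_commute[of p UNIV v u] by (rule less_imp_le)
   ultimately have "lpn p UNIV (%x. conv u (mol n) x - u x) <= en C * (en C * (en e' + en e') + en e')"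
    unfolding C_def
    by (intro order_trans[OF lpn_triangle[where g = v]]) (use p in \<open>auto intro!: mult_left_mono add_mono\<close>)
   also have "... = en (C * (C * (e' + e') + e'))"
    using C e' by (simp only: ennreal_plus[symmetric] ennreal_mult[symmetric] less_imp_le
      add_nonneg_nonneg mult_nonneg_nonneg)
   also have "C * (C * (e' + e') + e') = e' * (C + C * C + C * C)" by (simp add: algebra_simps)
   also have "... = e" using den by (simp add: e'_def)
   finally show ?thesis .
  qed
  then show ?thesis by blast
 qed
 then show ?thesis
  by (intro ennreal_tendsto_0I) auto
qed

section \<open>Weak derivatives\<close>

text \<open>Translation invariance: ps (x + h) - ps x has integral zero and differs from t times the
  derivative by at most e t on a fixed bounded set. Division by t bounds the integral by a fixed
  multiple of every e > 0.\<close>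

lemma integral_pd_zero:
 fixes ps :: "real^'n => real"
 assumes ps: "c1_test UNIV ps" shows "(LL x. pd i ps x) = 0"
proof -
 obtain K where K: "compact K" "\<forall>x. x ~: K --> ps x = 0" using c1_testD(1)[OF ps] by blast
 note C = Ck1D[OF c1_testD(2)[OF ps]]
 have pK: "\<forall>x. x ~: K --> pd i ps x = 0" using pd_support[OF cmp_closed[OF K(1)] K(2)] by blast
 define L where "L = {a + b | a b. a : K \<and> b : cball (0::real^'n) 1}"
 have L: "compact L" unfolding L_def by (intro compact_sums K compact_cball)
 have KL: "x : L" if "x + b : K" "norm b <= 1" for x b
 proof -
  have "x = (x + b) + (- b)" "- b : cball 0 1" using that by auto
  then show ?thesis unfolding L_def using that(1) by blast
 qed
 have iL: "intg (ind L :: _ => real)"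
  using lm_compact[OF L] by (auto simp: fmeasurable_def)
 have int: "intg f" if "ctn f" "\<forall>x. x ~: K --> f x = 0" for f :: "real^'n => real"
  using L1_loc_cont_int[OF continuous_L1_loc[of "%x. 1"] K(1) _ that(2,1), of UNIV] by simp
 define m where "m = (LL x. ind L x :: real)"
 have m: "m >= 0" unfolding m_def by (intro bi_nonneg) auto
 have "\<bar>LL x. pd i ps x\<bar> <= e * m" if e: "e > 0" for e
 proof -
  obtain d where d: "d > 0" "!!z h. norm h < d ==>
   \<bar>ps (z + h) - ps z - (\<Sum>i\<in>UNIV. pd i ps z * h $ i)\<bar> <= e * norm h"
   using c1_uniform_derivative[OF ps e] by blast
  define t where "t = min 1 (d / 2)"
  have t: "0 < t" "t < d" "t <= 1" using d by (auto simp: t_def)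
  define h where "h = t *R (axis i 1 :: real^'n)"
  have nh: "norm h = t" using t by (simp add: h_def)
  have sh: "(\<Sum>j\<in>UNIV. pd j ps z * h $ j) = t * pd i ps z" for z
   by (simp add: h_def axis_def if_distrib[of "(*) _"] cong: if_cong)
  have i1: "intg (%x. ps (x + h))"
  proof -
   have "compact ((%x. x - h) ` K)" by (intro compact_cont_image continuous_intros K)
   moreover have "\<forall>x. x ~: (%x. x - h) ` K --> ps (x + h) = 0"
    using K(2) by (metis add_diff_cancel_right' image_eqI)
   moreover have "ctn (%x. ps (x + h))"
    by (intro cont_comp2[OF C(3)] continuous_intros) auto
   ultimately show ?thesis
    using L1_loc_cont_int[OF continuous_L1_loc[of "%x. 1"], of _ UNIV "%x. ps (x + h)"] by simp
  qed
  have z: "(LL x. ps (x + h) - ps x) = 0"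
   using LINT_translate[OF cont_bmeas[OF C(3)], of h] i1 int[OF C(3) K(2)] by simp
  have ipd: "intg (pd i ps)" by (rule int[OF C(2) pK])
  have "t * \<bar>LL x. pd i ps x\<bar> = \<bar>LL x. (ps (x + h) - ps x) - t * pd i ps x\<bar>"
   using t z i1 int[OF C(3) K(2)] ipd by (simp add: abs_mult)
  also have "... <= (LL x. e * t * ind L x)"
   unfolding real_norm_def[symmetric]
  proof (rule bi_norm_bound)
   show "norm (ps (x + h) - ps x - t * pd i ps x) <= e * t * ind L x" for x
   proof (cases "x : L")
    case True
    then show ?thesis using d(2)[of h x] nh t sh by simp
   next
    case False
    then have "x + h ~: K" "x ~: K" using KL[of x h] KL[of x 0] nh t by auto
    then show ?thesis using False K(2) pK by simp
   qed
  qed (use i1 int[OF C(3) K(2)] ipd iL in auto)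
  also have "... = t * (e * m)" by (simp add: m_def)
  finally show ?thesis using t by simp
 qed
 then have "\<bar>LL x. pd i ps x\<bar> <= 0 + e" if "e > 0" for e
 proof -
  have "e / (m + 1) * m <= e" using that m by (simp add: field_simps)
  moreover have "\<bar>LL x. pd i ps x\<bar> <= e / (m + 1) * m"
   using that m by (intro \<open>!!e. 0 < e ==> \<bar>LL x. pd i ps x\<bar> <= e * m\<close>) simp
  ultimately show ?thesis by simp
 qed
 then have "\<bar>LL x. pd i ps x\<bar> <= 0" by (rule field_le_epsilon)
 then show "(LL x. pd i ps x) = 0" by simp
qed

lemma L1_loc_vec_iff:
 fixes g :: "real^'n => real^'m"
 shows "g : L1_loc G \<longleftrightarrow> (\<forall>i. (%x. g x $ i) : L1_loc G)"
proof
 assume "g : L1_loc G"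
 then show "\<forall>i. (%x. g x $ i) : L1_loc G"
  unfolding L1_loc_def by (auto intro: integrable_bounded_linear[OF bounded_linear_vec_nth])
next
 assume *: "\<forall>i. (%x. g x $ i) : L1_loc G"
 have "g x = (\<Sum>i\<in>UNIV. g x $ i *R axis i 1)" for x
  using basis_expansion[of "g x"] by (simp add: scalar_mult_eq_scaleR)
 then have "g = (%x. \<Sum>i\<in>UNIV. g x $ i *R axis i 1)" by auto
 moreover have "(%x. \<Sum>i\<in>UNIV. g x $ i *R (axis i 1 :: real^'m)) : L1_loc G"
  unfolding L1_loc_def
 proof safe
  fix K assume "compact K" "K \<subseteq> G"
  then have "integrable (lebesgue_on K) (%x. g x $ i)" for i using * by (auto simp: L1_loc_def)
  then show "integrable (lebesgue_on K) (%x. \<Sum>i\<in>UNIV. g x $ i *R (axis i 1 :: real^'m))"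
   by (intro Bochner_Integration.integrable_sum integrable_scaleR_left)
 qed
 ultimately show "g : L1_loc G" by simp
qed

lemma c1_by_parts:
 fixes u ph :: "real^'n => real"
 assumes u: "Ck 1 u" and ph: "c1_test G ph" and G: "G : sets lebesgue"
 shows "(LINT x|lebesgue_on G. u x * pd i ph x) = - (LINT x|lebesgue_on G. pd i u x * ph x)"
proof -
 obtain K where K: "compact K" "K \<subseteq> G" "\<forall>x. x ~: K --> ph x = 0" using c1_testD(1)[OF ph] by blast
 note C = Ck1D[OF c1_testD(2)[OF ph]] and U = Ck1D[OF u]
 have pK: "\<forall>x. x ~: K --> pd i ph x = 0" using pd_support[OF cmp_closed[OF K(1)] K(3)] by blast
 have t: "c1_test UNIV (%x. u x * ph x)" by (rule c1_test_mult[OF c1_test_mono[OF ph] u]) simp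
 have i1: "intg (%x. u x * pd i ph x)"
  by (rule L1_loc_cont_int[OF continuous_L1_loc[OF U(3)] K(1,2) pK C(2)])
 have i2: "intg (%x. pd i u x * ph x)"
  by (rule L1_loc_cont_int[OF continuous_L1_loc[OF U(2)] K C(3)])
 have "0 = (LL x. u x * pd i ph x + pd i u x * ph x)"
  using integral_pd_zero[OF t, of i] U(1) C(1) by (simp add: pd_mult)
 also have "... = (LL x. u x * pd i ph x) + (LL x. pd i u x * ph x)"
  by (rule bi_int_add[OF i1 i2])
 finally show ?thesis
  using K pK by (subst (1 2) LINT_supported[OF G]) auto
qed

lemma c1_weak_grad:
 fixes u :: "real^'n => real"
 assumes "Ck 1 u" "G : sets lebesgue"
 shows "has_weak_grad G u (%x. \<chi> i. pd i u x)"
 unfolding has_weak_grad_def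
 using c1_by_parts[OF assms(1) test_fun_c1 assms(2)] Ck1D[OF assms(1)]
 by (auto simp: L1_loc_vec_iff intro!: continuous_L1_loc)

lemma mollify_support:
 fixes G :: "(real^'n) set"
 assumes K: "compact K" "K \<subseteq> G" and G: "open G"
 obtains L N where "compact L" "L \<subseteq> G" "K \<subseteq> L"
  "!!n v x. n >= N ==> \<forall>x. x ~: K --> v x = 0 ==> x ~: L ==> conv v (mol n) x = 0"
proof -
 obtain r where r: "r > 0" "(\<Union>x\<in>K. cball x r) \<subseteq> G"
  using compact_subset_open_imp_cball_epsilon_subset[OF K(1) G K(2)] by blast
 define L where "L = {a + b | a b. a : K \<and> b : cball (0::real^'n) r}"
 have L: "compact L" unfolding L_def by (intro compact_sums K compact_cball)
 have Lsub: "L \<subseteq> G"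
 proof
  fix x assume "x : L"
  then obtain a b where ab: "x = a + b" "a : K" "norm b <= r" unfolding L_def by auto
  then have "x : cball a r" by (simp add: dist_norm)
  then show "x : G" using r ab by blast
 qed
 have KL: "K \<subseteq> L" unfolding L_def using r by force
 obtain N where N: "inverse (real (Suc N)) < r" using reals_Archimedean[OF r(1)] by auto
 show thesis
 proof (rule that[OF L Lsub KL])
  fix n v x assume n: "n >= N" and v: "\<forall>x. x ~: K --> v x = (0::real)" and x: "x ~: L"
  have nr: "inverse (real (Suc n)) <= r"
   using N n by (smt (verit) le_imp_inverse_le of_nat_0_less_iff of_nat_le_iff Suc_le_mono zero_less_Suc)
  have "inverse (real (Suc n)) <= dist x y" if "y : K" for y
  proof (rule ccontr)
   assume "\<not> inverse (real (Suc n)) <= dist x y"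
   then have "x = y + (x - y)" "x - y : cball 0 r" using nr by (auto simp: dist_norm norm_minus_commute)
   then show False using x that unfolding L_def by blast
  qed
  then show "conv v (mol n) x = 0" by (rule conv_mol_support[OF v])
 qed
qed

lemma mollify_uniform:
 fixes v :: "real^'n => real"
 assumes v: "ctn v" and K: "compact K" "\<forall>x. x ~: K --> v x = 0"
 shows "uniform_limit UNIV (%n. conv v (mol n)) v sequentially"
 unfolding uniform_limit_iff
proof (intro allI impI)
 fix e :: real assume e: "e > 0"
 have "uniformly_continuous_on UNIV v" by (rule supp_unif_cont[OF v K])
 then obtain d where d: "d > 0" "!!x y. dist y x < d ==> dist (v y) (v x) < e / 2"
  unfolding uniformly_continuous_on_def using e by (metis UNIV_I half_gt_zero)
 obtain N where N: "inverse (real (Suc N)) < d" using reals_Archimedean[OF d(1)] by auto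
 have "dist (conv v (mol n) x) (v x) < e" if "n >= N" for n x
 proof -
  have nr: "inverse (real (Suc n)) <= d"
   using N that by (smt (verit) le_imp_inverse_le of_nat_0_less_iff of_nat_le_iff Suc_le_mono zero_less_Suc)
  have "\<bar>conv v (mol n) x - v x\<bar> <= e / 2"
   by (rule conv_mol_near[OF continuous_L1_loc[OF v] _ nr])
    (use d(2) e in \<open>force simp: dist_real_def dist_commute\<close>)+
  then show ?thesis using e by (simp add: dist_real_def)
 qed
 then show "\<forall>\<^sub>F n in sequentially. \<forall>x\<in>UNIV. dist (conv v (mol n) x) (v x) < e"
  unfolding ev_seq by blast
qed

lemma LINT_uniform_tendsto:
 fixes h :: "real^'n => real"
 assumes h: "h : L1_loc G" and L: "compact L" "L \<subseteq> G"
  and w: "!!n. ctn (w n)" "\<forall>\<^sub>F n in sequentially. \<forall>x. x ~: L --> w n x = 0"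
  and v: "ctn v" "\<forall>x. x ~: L --> v x = 0"
  and lim: "uniform_limit UNIV w v sequentially"
 shows "(%n. LL x. h x * w n x) ~~> (LL x. h x * v x)"
proof (rule metric_LIMSEQ_I)
 fix e :: real assume e: "e > 0"
 have LS[measurable]: "L : sets lebesgue" using lm_compact[OF L(1)] by blast
 have iL: "intg (%x. ind L x *R h x)"
  using h L unfolding L1_loc_def LINT_lebesgue_on(2)[OF LS, symmetric] by blast
 define M where "M = (LL x. \<bar>ind L x *R h x\<bar>)"
 have M: "M >= 0" unfolding M_def by (intro bi_nonneg) auto
 define e' where "e' = e / (2 * (M + 1))"
 have e': "e' > 0" "e' * M < e" using e M by (auto simp: e'_def field_simps add_pos_pos add_strict_increasing)
 have "\<forall>\<^sub>F n in sequentially. \<forall>x. dist (w n x) (v x) < e'"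
  using lim e'(1) unfolding uniform_limit_iff by auto
 with w(2) have "\<forall>\<^sub>F n in sequentially. dist (LL x. h x * w n x) (LL x. h x * v x) < e"
 proof eventually_elim
  case (elim n)
  have i1: "intg (%x. h x * w n x)"
   by (rule L1_loc_cont_int[OF h L elim(1) w(1)])
  have i2: "intg (%x. h x * v x)"
   by (rule L1_loc_cont_int[OF h L v(2,1)])
  have "norm (LL x. h x * w n x - h x * v x) <= (LL x. e' * \<bar>ind L x *R h x\<bar>)"
  proof (rule bi_norm_bound)
   fix x
   show "norm (h x * w n x - h x * v x) <= e' * \<bar>ind L x *R h x\<bar>"
   proof (cases "x : L")
    case True
    have "\<bar>h x * w n x - h x * v x\<bar> = \<bar>w n x - v x\<bar> * \<bar>h x\<bar>"
     by (simp add: abs_mult[symmetric] algebra_simps)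
    also have "... <= e' * \<bar>h x\<bar>" using elim(2) by (intro mult_right_mono) (auto simp: dist_real_def less_imp_le)
    finally show ?thesis using True by simp
   qed (use elim(1) v(2) in simp)
  qed (use i1 i2 iL in auto)
  also have "... = e' * M" by (simp add: M_def)
  finally show ?case using e' i1 i2 by (simp add: dist_real_def)
 qed
 then show "\<exists>N. ALL n>=N. dist (LL x. h x * w n x) (LL x. h x * v x) < e"
  by (simp add: ev_seq)
qed

lemma conv_continuous: "u : L1_loc UNIV ==> ctn (conv u (mol n))"
 by (rule Ck_continuous[OF Ck_conv[OF _ mol_test, of u 0 n]])

lemma test_conv:
 assumes "v : L1_loc UNIV" "compact L" "L \<subseteq> G" "!!x. x ~: L ==> conv v (mol n) x = 0"
 shows "test_fun G (conv v (mol n))"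
 by (rule test_funI[OF Ck_conv[OF assms(1) mol_test] assms(2,3)]) (use assms(4) in auto)

lemma test_zero_continuous:
 fixes h v :: "real^'n => real"
 assumes h: "h : L1_loc G" and G: "open G" and 0: "!!ph. test_fun G ph ==> (LINT x|lebesgue_on G. h x * ph x) = 0"
  and v: "ctn v" and K: "compact K" "K \<subseteq> G" "\<forall>x. x ~: K --> v x = 0"
 shows "(LL x. h x * v x) = 0"
proof -
 obtain L N where L: "compact L" "L \<subseteq> G" "K \<subseteq> L"
  "!!n v x. n >= N ==> \<forall>x. x ~: K --> v x = 0 ==> x ~: L ==> conv v (mol n) x = 0"
  using mollify_support[OF K(1,2) G] by metis
 have vL: "v : L1_loc UNIV" by (rule continuous_L1_loc[OF v])
 have vz: "\<forall>x. x ~: L --> v x = 0" using K L(3) by blast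
 have ev: "\<forall>\<^sub>F n in sequentially. \<forall>x. x ~: L --> conv v (mol n) x = 0"
  using L(4)[OF _ K(3)] unfolding ev_seq by blast
 have "(%n. LL x. h x * conv v (mol n) x) ~~> (LL x. h x * v x)"
  by (rule LINT_uniform_tendsto[OF h L(1,2) conv_continuous[OF vL] ev v vz mollify_uniform[OF v K(1,3)]])
 moreover have "(LL x. h x * conv v (mol n) x) = 0" if "n >= N" for n
 proof -
  have z: "!!x. x ~: L ==> conv v (mol n) x = 0" using L(4)[OF that K(3)] .
  have "(LINT x|lebesgue_on G. h x * conv v (mol n) x) = (LL x. h x * conv v (mol n) x)"
   by (rule LINT_supported) (use z L(2) G in \<open>auto simp: borel_open\<close>)
  then show ?thesis using 0[OF test_conv[OF vL L(1,2) z]] by simp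
 qed
 then have "(%n. LL x. h x * conv v (mol n) x) ~~> 0"
  by (intro tendsto_eventually) (auto simp: ev_seq)
 ultimately show ?thesis using LIMSEQ_unique by blast
qed

lemma L1_loc_indicator_measurable:
 fixes u :: "real^'n => real"
 assumes u: "u : L1_loc G" and G: "open G"
 shows "(%x. ind G x * u x) : lmeas"
proof -
 obtain ch K where ch: "!!m. ctn (ch m :: real^'n => real)"
  and K: "!!m. compact (K m)" "!!m. K m \<subseteq> G" "!!m x. x ~: K m ==> ch m x = (0::real)"
  and ch1: "!!x. x : G ==> eventually (%m::nat. ch m x = 1) sequentially"
  using compact_exhaustion_cutoff[OF G] by metis
 show ?thesis
 proof (rule borel_measurable_LIMSEQ_metric)
  show "(%x. u x * ch m x) : lmeas" for m
   by (rule borel_measurable_integrable, rule L1_loc_cont_int[OF u K(1,2) _ ch]) (use K(3) in auto)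
  show "(%m. u x * ch m x) ~~> ind G x * u x" for x
  proof (cases "x : G")
   case True
   then show ?thesis by (intro tendsto_eventually eventually_mono[OF ch1]) auto
  next
   case False
   then have "ch m x = 0" for m using K by blast
   then show ?thesis using False by simp
  qed
 qed
qed

text \<open>Continuous functions converging almost everywhere to sgn h, clamped to [-1, 1] and
  multiplied by a cut-off, are admissible by \<open>test_zero_continuous\<close>. Dominated
  convergence shows that |h| times each cut-off has integral zero.\<close>

lemma du_bois_reymond:
 fixes h :: "real^'n => real"
 assumes h: "h : L1_loc G" and G: "open G" and 0: "!!ph. test_fun G ph ==> (LINT x|lebesgue_on G. h x * ph x) = 0"
 shows "AE x in lebesgue. x : G --> h x = 0"
proof -
 obtain ch K where ch: "!!m. ctn (ch m :: real^'n => real)" "!!m x. 0 <= ch m x" "!!m x. ch m x <= 1"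
  and K: "!!m. compact (K m)" "!!m. K m \<subseteq> G" "!!m x. x ~: K m ==> ch m x = (0::real)"
  and ch1: "!!x. x : G ==> eventually (%m::nat. ch m x = 1) sequentially"
  using compact_exhaustion_cutoff[OF G] by metis
 have m0[measurable]: "(%x. ind G x * h x) : lmeas"
  by (rule L1_loc_indicator_measurable[OF h G])
 have "(%x. sgn (ind G x * h x)) : lmeas" by measurable
 then have "(%x. sgn (ind G x * h x)) measurable_on UNIV"
  by (rule lebesgue_measurable_imp_measurable_on) simp
 then obtain N g where N: "negligible N" and g: "!!n. ctn (g n)"
  "!!x. x ~: N ==> (%n. g n x) ~~> sgn (ind G x * h x)"
  unfolding measurable_on_def by auto
 have AEN: "AE x in lebesgue. x ~: N" using N by (simp add: AE_not_in negligible_iff_null_sets)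
 define cl where "cl t = max (- 1) (min 1 t)" for t :: real
 have ccl: "ctn cl" unfolding cl_def by (intro continuous_intros)
 have "AE x in lebesgue. h x * (sgn (h x) * ch m x) = 0" for m
 proof -
  have cv: "ctn (%x. cl (g n x) * ch m x)" for n
   by (intro continuous_on_mult ch(1) cont_comp2[OF ccl g(1)]) auto
  have v0: "\<forall>x. x ~: K m --> cl (g n x) * ch m x = 0" for n using K(3) by auto
  have int: "intg (%x. h x * (cl (g n x) * ch m x))" for n
   by (rule L1_loc_cont_int[OF h K(1,2) v0 cv])
  have ich: "intg (%x. h x * ch m x)"
   by (rule L1_loc_cont_int[OF h K(1,2) _ ch(1)]) (use K(3) in auto)
  have sg: "h x * (sgn (h x) * ch m x) = \<bar>h x * ch m x\<bar>" for x
   using ch(2)[of m x] by (simp add: abs_mult sgn_real_def)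
  have "(%n. LL x. h x * (cl (g n x) * ch m x)) ~~> (LL x. h x * (sgn (h x) * ch m x))"
  proof (rule integral_dominated_convergence[where w = "%x. \<bar>h x * ch m x\<bar>"])
   show "(%x. h x * (sgn (h x) * ch m x)) : lmeas"
    unfolding sg using ich by (intro borel_measurable_abs borel_measurable_integrable)
   show "(%x. h x * (cl (g n x) * ch m x)) : lmeas" for n
    using int by (rule borel_measurable_integrable)
   show "intg (%x. \<bar>h x * ch m x\<bar>)" using ich by auto
   show "AE x in lebesgue. (%n. h x * (cl (g n x) * ch m x)) ~~> h x * (sgn (h x) * ch m x)"
    using AEN
   proof eventually_elim
    case (elim x)
    show ?case
    proof (cases "x : G")
     case True
     have "isCont cl (sgn (h x))" using ccl continuous_on_eq_continuous_at open_UNIV by blast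
     moreover have "(%n. g n x) ~~> sgn (h x)" using g(2)[OF elim] True by simp
     ultimately have "(%n. cl (g n x)) ~~> cl (sgn (h x))" using isCont_tendsto_compose by blast
     moreover have "cl (sgn (h x)) = sgn (h x)" by (simp add: cl_def sgn_real_def)
     ultimately show ?thesis by (intro tendsto_intros) simp
    next
     case False
     then have "ch m x = 0" using K by blast
     then show ?thesis by simp
    qed
   qed
   show "AE x in lebesgue. norm (h x * (cl (g n x) * ch m x)) <= \<bar>h x * ch m x\<bar>" for n
   proof (rule AE_I2)
    fix x
    have "\<bar>cl (g n x)\<bar> <= 1" by (simp add: cl_def)
    then have "\<bar>h x\<bar> * (\<bar>cl (g n x)\<bar> * \<bar>ch m x\<bar>) <= \<bar>h x\<bar> * (1 * \<bar>ch m x\<bar>)"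
     by (intro mult_left_mono mult_right_mono) auto
    then show "norm (h x * (cl (g n x) * ch m x)) <= \<bar>h x * ch m x\<bar>" by (simp add: abs_mult)
   qed
  qed
  moreover have "(LL x. h x * (cl (g n x) * ch m x)) = 0" for n
   by (rule test_zero_continuous[OF h G 0 cv K(1,2) v0])
  ultimately have "(LL x. h x * (sgn (h x) * ch m x)) = 0" by (simp add: LIMSEQ_const_iff)
  moreover have "intg (%x. h x * (sgn (h x) * ch m x))" unfolding sg using ich by auto
  ultimately show ?thesis unfolding sg by (subst (asm) integral_nonneg_eq_0_iff_AE) auto
 qed
 then have "AE x in lebesgue. \<forall>m. h x * (sgn (h x) * ch m x) = 0" unfolding AE_all_countable by blast
 then show ?thesis
 proof eventually_elim
  case (elim x)
  show ?case
  proof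
   assume "x : G"
   then obtain m where "ch m x = 1"
    using eventually_happens[OF ch1] trivial_limit_sequentially by blast
   then show "h x = 0" using spec[OF elim, of m] by (simp add: sgn_zero_iff)
  qed
 qed
qed

text \<open>The mollifications of ph are smooth, for large n supported in one compact subset of G,
  and converge uniformly together with their first derivatives, so the identity passes to the
  limit.\<close>

lemma weak_div_c1:
 fixes F :: "real^'n => real^'n"
 assumes F: "has_weak_div G F d" and G: "open G" and ph: "c1_test G ph"
 shows "(LL x. (\<Sum>i\<in>UNIV. F x $ i * pd i ph x) + d x * ph x) = 0"
  and "intg (%x. (\<Sum>i\<in>UNIV. F x $ i * pd i ph x) + d x * ph x)"
proof -
 obtain K where K: "compact K" "K \<subseteq> G" "\<forall>x. x ~: K --> ph x = 0" using c1_testD(1)[OF ph] by blast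
 note C = Ck1D[OF c1_testD(2)[OF ph]]
 have pK: "\<forall>x. x ~: K --> pd i ph x = 0" for i using pd_support[OF cmp_closed[OF K(1)] K(3)] by blast
 have Fl: "(%x. F x $ i) : L1_loc G" for i using F by (simp add: has_weak_div_def L1_loc_vec_iff)
 have dl: "d : L1_loc G" using F by (simp add: has_weak_div_def)
 have GS: "G : sets lebesgue" using G by (simp add: borel_open)
 obtain L N where L: "compact L" "L \<subseteq> G" "K \<subseteq> L"
  "!!n v x. n >= N ==> \<forall>x. x ~: K --> v x = 0 ==> x ~: L ==> conv v (mol n) x = 0"
  using mollify_support[OF K(1,2) G] by metis
 have lim: "(%n. LL x. h x * conv v (mol n) x) ~~> (LL x. h x * v x)"
  if h: "h : L1_loc G" and v: "ctn v" "\<forall>x. x ~: K --> v x = 0" for h v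
 proof (rule LINT_uniform_tendsto[OF h L(1,2) conv_continuous _ v(1) _ mollify_uniform[OF v(1) K(1) v(2)]])
  show "v : L1_loc UNIV" by (rule continuous_L1_loc[OF v(1)])
  show "\<forall>\<^sub>F n in sequentially. \<forall>x. x ~: L --> conv v (mol n) x = 0"
   using L(4)[OF _ v(2)] unfolding ev_seq by blast
  show "\<forall>x. x ~: L --> v x = 0" using v(2) L(3) by blast
 qed
 have ii: "intg (%x. F x $ i * pd i ph x)" for i
  by (rule L1_loc_cont_int[OF Fl K(1,2) pK C(2)])
 have id: "intg (%x. d x * ph x)" by (rule L1_loc_cont_int[OF dl K C(3)])
 show "intg (%x. (\<Sum>i\<in>UNIV. F x $ i * pd i ph x) + d x * ph x)" using ii id by auto
 have phl: "ph : L1_loc UNIV" by (rule continuous_L1_loc[OF C(3)])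
 define I where "I n = (\<Sum>i\<in>UNIV. LL x. F x $ i * conv (pd i ph) (mol n) x) + (LL x. d x * conv ph (mol n) x)" for n
 have "I ~~> (\<Sum>i\<in>UNIV. LL x. F x $ i * pd i ph x) + (LL x. d x * ph x)"
  unfolding I_def using lim[OF Fl C(2) pK] lim[OF dl C(3) K(3)] by (intro tendsto_intros)
 moreover have "I n = 0" if n: "n >= N" for n
 proof -
  have z: "!!x. x ~: L ==> conv ph (mol n) x = 0" "!!x. x ~: L ==> conv (pd i ph) (mol n) x = 0" for i
   using L(4)[OF n K(3)] L(4)[OF n pK] by auto
  have t: "test_fun G (conv ph (mol n))" by (rule test_conv[OF phl L(1,2) z(1)])
  have p: "pd i (conv ph (mol n)) = conv (pd i ph) (mol n)" for i
   using pd_conv_weak[OF c1_weak_grad[OF c1_testD(2)[OF ph], of UNIV] mol_test] by simp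
  have int: "intg (%x. F x $ i * conv (pd i ph) (mol n) x)" for i
   by (rule L1_loc_cont_int[OF Fl L(1,2) _ conv_continuous[OF continuous_L1_loc[OF C(2)]]]) (use z in auto)
  have "(LINT x|lebesgue_on G. (\<Sum>i\<in>UNIV. F x $ i * pd i (conv ph (mol n)) x)) = - (LINT x|lebesgue_on G. d x * conv ph (mol n) x)"
   using F t unfolding has_weak_div_def by blast
  then show ?thesis unfolding p I_def
  proof -
   have zG: "conv ph (mol n) x = 0" "conv (pd i ph) (mol n) x = 0" if "x ~: G" for x i
    using z L(2) that by blast+
   have "(LINT x|lebesgue_on G. (\<Sum>i\<in>UNIV. F x $ i * conv (pd i ph) (mol n) x))
    = (LL x. (\<Sum>i\<in>UNIV. F x $ i * conv (pd i ph) (mol n) x))"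
    by (rule LINT_supported[OF GS]) (simp add: zG)
   also have "... = (\<Sum>i\<in>UNIV. LL x. F x $ i * conv (pd i ph) (mol n) x)"
    by (rule bi_int_sum) (rule int)
   finally have e1: "(LINT x|lebesgue_on G. (\<Sum>i\<in>UNIV. F x $ i * conv (pd i ph) (mol n) x)) = ..." .
   have e2: "(LINT x|lebesgue_on G. d x * conv ph (mol n) x) = (LL x. d x * conv ph (mol n) x)"
    by (rule LINT_supported[OF GS]) (simp add: zG)
   show "(LINT x|lebesgue_on G. (\<Sum>i\<in>UNIV. F x $ i * conv (pd i ph) (mol n) x)) =
     - (LINT x|lebesgue_on G. d x * conv ph (mol n) x) ==>
    (\<Sum>i\<in>UNIV. LL x. F x $ i * conv (pd i ph) (mol n) x) + (LL x. d x * conv ph (mol n) x) = 0"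
    unfolding e1 e2 by simp
  qed
 qed
 then have "I ~~> 0" by (intro tendsto_eventually) (auto simp: ev_seq)
 ultimately have "(\<Sum>i\<in>UNIV. LL x. F x $ i * pd i ph x) + (LL x. d x * ph x) = 0"
  using LIMSEQ_unique by blast
 then show "(LL x. (\<Sum>i\<in>UNIV. F x $ i * pd i ph x) + d x * ph x) = 0"
  using ii id by (simp add: bi_int_sum)
qed

text \<open>A partial derivative of u is the divergence of u times a unit vector. Uniqueness, and
  later the Gauss formula, need therefore be proved for divergences only.\<close>

lemma weak_grad_imp_div:
 assumes "has_weak_grad G u g"
 shows "has_weak_div G (%x. u x *R axis i 1) (%x. g x $ i)"
proof -
 have *: "(\<Sum>j\<in>UNIV. (u x *R axis i 1) $ j * f j) = u x * f i" for x and f :: "'a => real"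
 proof -
  have "(u x *R axis i 1) $ j * f j = (if j = i then u x * f i else 0)" for j by (simp add: axis_def)
  then show ?thesis by simp
 qed
 have "(%x. (u x *R axis i 1) $ j) : L1_loc G" for j
  using assms unfolding has_weak_grad_def L1_loc_def by (auto simp: axis_def)
 then have "(%x. u x *R (axis i 1 :: real^'a)) : L1_loc G" unfolding L1_loc_vec_iff by blast
 moreover have "(%x. g x $ i) : L1_loc G" using assms unfolding has_weak_grad_def L1_loc_vec_iff by blast
 ultimately show ?thesis using assms unfolding has_weak_div_def * has_weak_grad_def by blast
qed

lemma weak_div_unique:
 assumes G: "open G" and d: "has_weak_div G F d" "has_weak_div G F d'"
 shows "AE x in lebesgue_on G. d x = d' x"
proof -
 have GS: "G : sets lebesgue" using G by (simp add: borel_open)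
 have l: "d : L1_loc G" "d' : L1_loc G" using d by (auto simp: has_weak_div_def)
 have "AE x in lebesgue. x : G --> d x - d' x = 0"
 proof (rule du_bois_reymond[OF L1_loc_diff[OF l] G])
  fix ph assume t: "test_fun G ph"
  obtain K where K: "compact K" "K \<subseteq> G" "\<forall>x. x ~: K --> ph x = 0" using c1_testD(1)[OF test_fun_c1[OF t]] by blast
  have c: "ctn ph" using Ck1D(3)[OF c1_testD(2)[OF test_fun_c1[OF t]]] .
  have i: "intg (%x. d x * ph x)" "intg (%x. d' x * ph x)"
   using L1_loc_cont_int[OF _ K c] l by auto
  have "- (LINT x|lebesgue_on G. d x * ph x) = - (LINT x|lebesgue_on G. d' x * ph x)"
  proof -
   have "(LINT x|lebesgue_on G. (\<Sum>i\<in>UNIV. F x $ i * pd i ph x)) = - (LINT x|lebesgue_on G. d x * ph x)"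
    using d(1) t unfolding has_weak_div_def by blast
   moreover have "(LINT x|lebesgue_on G. (\<Sum>i\<in>UNIV. F x $ i * pd i ph x)) = - (LINT x|lebesgue_on G. d' x * ph x)"
    using d(2) t unfolding has_weak_div_def by blast
   ultimately show ?thesis by simp
  qed
  then have eq: "(LINT x|lebesgue_on G. d x * ph x) = (LINT x|lebesgue_on G. d' x * ph x)" by simp
  have z: "ph x = 0" if "x ~: G" for x using K that by blast
  have "(LINT x|lebesgue_on G. (d x - d' x) * ph x) = (LL x. (d x - d' x) * ph x)"
   by (rule LINT_supported[OF GS]) (simp add: z)
  also have "... = (LL x. d x * ph x) - (LL x. d' x * ph x)"
   using i by (simp add: left_diff_distrib)
  also have "... = (LINT x|lebesgue_on G. d x * ph x) - (LINT x|lebesgue_on G. d' x * ph x)"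
   by (simp add: LINT_supported[OF GS] z)
  finally show "(LINT x|lebesgue_on G. (d x - d' x) * ph x) = 0" using eq by simp
 qed
 then show ?thesis by (simp add: AE_lebesgue_on[OF GS])
qed

lemma weak_grad_unique:
 fixes g g' :: "real^'n => real^'n"
 assumes G: "open G" and g: "has_weak_grad G u g" "has_weak_grad G u g'"
 shows "AE x in lebesgue_on G. g x = g' x"
proof -
 have "AE x in lebesgue_on G. g x $ i = g' x $ i" for i
  by (rule weak_div_unique[OF G weak_grad_imp_div weak_grad_imp_div]) fact+
 then have "AE x in lebesgue_on G. \<forall>i. g x $ i = g' x $ i" by (simp add: AE_all_countable AE_finite_all)
 then show ?thesis by eventually_elim (simp add: vec_eq_iff)
qed

lemma wgrad_works:
 assumes "open G" "has_weak_grad G u g"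
 shows "has_weak_grad G u (wgrad G u)" "AE x in lebesgue_on G. wgrad G u x = g x"
proof -
 show 1: "has_weak_grad G u (wgrad G u)" unfolding wgrad_def by (rule someI[of "has_weak_grad G u", OF assms(2)])
 show "AE x in lebesgue_on G. wgrad G u x = g x" by (rule weak_grad_unique[OF assms(1) 1 assms(2)])
qed

lemma wdiv_works:
 assumes "open G" "has_weak_div G F d"
 shows "has_weak_div G F (wdiv G F)" "AE x in lebesgue_on G. wdiv G F x = d x"
proof -
 show 1: "has_weak_div G F (wdiv G F)" unfolding wdiv_def by (rule someI[of "has_weak_div G F", OF assms(2)])
 show "AE x in lebesgue_on G. wdiv G F x = d x" by (rule weak_div_unique[OF assms(1) 1 assms(2)])
qed

section \<open>Convergence in the mean\<close>

lemma ennreal_tendsto_0D: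
 fixes X :: "nat => ennreal"
 assumes "X ~~> 0" "0 < (e::real)" shows "\<forall>\<^sub>F n in sequentially. X n < en e"
 using order_tendstoD(2)[OF assms(1), of "en e"] assms(2) by simp

lemma ennreal_tendsto_0_le:
 fixes X Y :: "nat => ennreal"
 assumes "Y ~~> 0" "\<forall>\<^sub>F n in sequentially. X n <= Y n" shows "X ~~> 0"
 by (rule tendsto_sandwich[OF _ assms(2) tendsto_const assms(1)]) simp

lemma ennreal_tendsto_0_cmult:
 fixes X :: "nat => ennreal"
 assumes "X ~~> 0" "c < inft" shows "(%n. c * X n) ~~> 0"
 using ennreal_tendsto_cmult[of c X 0] assms by simp

text \<open>Up to d the first term suffices; beyond it t^(q-r) <= d^(q-r). On sets of finite measure
  this replaces Hoelder's inequality: the first term is small with d, the second carries the L_r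
  integral.\<close>

lemma powr_interp:
 assumes "0 <= t" "0 < d" "0 <= q" "q <= r"
 shows "t powr q <= d powr q + d powr (q - r) * t powr (r::real)"
proof (cases "t <= d")
 case True
 then have "t powr q <= d powr q" using assms by (intro powr_mono2) auto
 then show ?thesis by (simp add: add_increasing2)
next
 case False
 have "t powr q = t powr (q - r) * t powr r" by (simp flip: powr_add)
 also have "... <= d powr (q - r) * t powr r"
  using assms False by (intro mult_right_mono powr_mono2') auto
 finally show ?thesis by (simp add: add_increasing)
qed

lemma lpn_interp:
 assumes [measurable]: "f : lmeas" "K : sets lebesgue" and "0 < d" "0 <= q" "q <= r"
 shows "lpn q K f <= en (d powr q) * emeasure lebesgue K + en (d powr (q - r)) * lpn r K f"
proof -
 have "en (norm (f x) powr q) <= en (d powr q) + en (d powr (q - r)) * en (norm (f x) powr r)" for x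
  using powr_interp[of "norm (f x)" d q r] assms
  by (metis ennreal_leI ennreal_mult' ennreal_plus mult_nonneg_nonneg norm_ge_zero powr_ge_zero)
 then have "lpn q K f <= (NL x. en (d powr q) * ind K x +
   en (d powr (q - r)) * (ind K x * en (norm (f x) powr r)))"
  unfolding lpn_def by (intro nn_integral_mono) (auto simp: indicator_def)
 also have "... = en (d powr q) * emeasure lebesgue K + en (d powr (q - r)) * lpn r K f"
  unfolding lpn_def by (simp add: nn_integral_add nn_integral_cmult)
 finally show ?thesis .
qed

lemma lpn_lower_finite:
 assumes "f : lmeas" "K : lmeasurable" "0 <= q" "q <= r" "lpn r K f < inft"
 shows "lpn q K f < inft"
 using lpn_interp[of f K 1 q r] assms by (auto simp: fmeasurable_def intro: order_le_less_trans)

lemma lpn_lower_tendsto: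
 assumes f: "!!n. f n : lmeas" and K: "K : lmeasurable" and qr: "0 < q" "q <= r"
  and lim: "(%n. lpn r K (f n)) ~~> 0"
 shows "(%n. lpn q K (f n)) ~~> 0"
proof (rule ennreal_tendsto_0I)
 fix e :: real assume e: "e > 0"
 define m where "m = measure lebesgue K"
 have m: "emeasure lebesgue K = en m" "m >= 0" using K by (auto simp: m_def emeasure_eq_measure2)
 define d where "d = (e / (2 * (m + 1))) powr (1 / q)"
 have d: "d > 0" "d powr q * m <= e / 2" using e m(2) qr by (auto simp: d_def powr_powr field_simps)
 define c where "c = d powr (q - r)"
 have c: "c > 0" using d by (simp add: c_def)
 have "\<forall>\<^sub>F n in sequentially. lpn r K (f n) < en (e / (2 * c))"
  using ennreal_tendsto_0D[OF lim] e c by simp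
 then have "\<forall>\<^sub>F n in sequentially. lpn q K (f n) <= en e"
 proof eventually_elim
  case (elim n)
  have "lpn q K (f n) <= en (d powr q) * en m + en c * lpn r K (f n)"
   unfolding m(1)[symmetric] c_def by (rule lpn_interp[OF f]) (use K d qr in auto)
  also have "... <= en (d powr q) * en m + en c * en (e / (2 * c))"
   using elim by (intro add_left_mono mult_left_mono) auto
  also have "... = en (d powr q * m + c * (e / (2 * c)))"
   using m c e by (simp only: ennreal_plus[symmetric] ennreal_mult[symmetric] less_imp_le
      add_nonneg_nonneg mult_nonneg_nonneg powr_ge_zero divide_nonneg_nonneg zero_le_numeral)
  also have "... <= en e" using d c by (intro ennreal_leI) simp
  finally show ?case .
 qed
 then show "\<exists>N. ALL n>=N. lpn q K (f n) <= en e" by (simp add: ev_seq)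
qed

lemma lpn_mult_le:
 fixes a f :: "'a::euclidean_space => real"
 assumes [measurable]: "f : lmeas" "K : sets lebesgue"
  and "!!x. x : K ==> \<bar>a x\<bar> <= B" "0 <= B" "0 <= p"
 shows "lpn p K (%x. a x * f x) <= en (B powr p) * lpn p K f"
proof -
 have "lpn p K (%x. a x * f x) <= lpn p K (%x. B *R f x)"
  using assms by (intro lpn_mono) (auto simp: abs_mult intro: mult_right_mono)
 also have "... = en (B powr p) * lpn p K f" using assms by (subst lpn_scaleR) auto
 finally show ?thesis .
qed

lemma lpn_tendsto_add:
 assumes [measurable]: "!!n. f n : lmeas" "!!n. g n : lmeas" "K : sets lebesgue"
  and p: "1 < p" and lim: "(%n. lpn p K (f n)) ~~> 0" "(%n. lpn p K (g n)) ~~> 0"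
 shows "(%n. lpn p K (%x. f n x + g n x)) ~~> 0"
proof (rule ennreal_tendsto_0_le)
 show "(%n. en (2 powr p) * (lpn p K (f n) + lpn p K (g n))) ~~> 0"
  using tendsto_add[OF lim] by (intro ennreal_tendsto_0_cmult) auto
 show "\<forall>\<^sub>F n in sequentially. lpn p K (%x. f n x + g n x) <= en (2 powr p) * (lpn p K (f n) + lpn p K (g n))"
  using p by (intro always_eventually allI lpn_add_le2) auto
qed

lemma lpn_tendsto_sum:
 assumes "finite I" "!!i n. i : I ==> f i n : lmeas" "K : sets lebesgue" "1 < p"
  "!!i. i : I ==> (%n. lpn p K (f i n)) ~~> 0"
 shows "(%n. lpn p K (%x. \<Sum>i\<in>I. f i n x)) ~~> 0"
 using assms
proof (induction I rule: finite_induct)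
 case empty
 then show ?case by (simp add: lpn_def)
next
 case (insert i I)
 have "(%n. lpn p K (%x. f i n x + (\<Sum>i\<in>I. f i n x))) ~~> 0"
  by (rule lpn_tendsto_add) (use insert in auto)
 then show ?case using insert by simp
qed

text \<open>In A H - a h = A (H - h) + (A - a) h, uniform convergence bounds A in the first term and
  makes the factor A - a small in the second.\<close>

lemma lpn_tendsto_mult:
 fixes a h :: "'a::euclidean_space => real"
 assumes [measurable]: "!!n. A n : lmeas" "a : lmeas"
  "!!n. H n : lmeas" "h : lmeas" "K : sets lebesgue"
  and p: "1 < p" and A: "uniform_limit K A a sequentially" and B: "!!x. x : K ==> \<bar>a x\<bar> <= B" "0 <= B"
  and fin: "lpn p K h < inft" and lim: "(%n. lpn p K (%x. H n x - h x)) ~~> 0"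
 shows "(%n. lpn p K (%x. A n x * H n x - a x * h x)) ~~> 0"
proof -
 have 1: "(%n. lpn p K (%x. A n x * (H n x - h x))) ~~> 0"
 proof (rule ennreal_tendsto_0_le)
  show "(%n. en ((B + 1) powr p) * lpn p K (%x. H n x - h x)) ~~> 0"
   by (rule ennreal_tendsto_0_cmult[OF lim]) simp
  have "\<forall>\<^sub>F n in sequentially. \<forall>x\<in>K. dist (A n x) (a x) < 1" using A unfolding uniform_limit_iff by auto
  then show "\<forall>\<^sub>F n in sequentially. lpn p K (%x. A n x * (H n x - h x)) <= en ((B + 1) powr p) * lpn p K (%x. H n x - h x)"
  proof eventually_elim
   case (elim n)
   then show ?case using B p by (intro lpn_mult_le) (force simp: dist_real_def)+
  qed
 qed
 have 2: "(%n. lpn p K (%x. (A n x - a x) * h x)) ~~> 0"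
 proof (rule ennreal_tendsto_0I)
  fix e :: real assume e: "e > 0"
  obtain M where M: "lpn p K h = en M" "M >= 0" using fin by (cases "lpn p K h") auto
  define d where "d = (e / (M + 1)) powr (1 / p)"
  have d: "d > 0" "d powr p * M <= e" using e M(2) p by (auto simp: d_def powr_powr field_simps)
  have "\<forall>\<^sub>F n in sequentially. \<forall>x\<in>K. dist (A n x) (a x) < d" using A d unfolding uniform_limit_iff by auto
  then have "\<forall>\<^sub>F n in sequentially. lpn p K (%x. (A n x - a x) * h x) <= en e"
  proof eventually_elim
   case (elim n)
   have "lpn p K (%x. (A n x - a x) * h x) <= en (d powr p) * en M" unfolding M(1)[symmetric]
    by (rule lpn_mult_le) (use elim d p in \<open>auto simp: dist_real_def less_imp_le\<close>)
   also have "... <= en e" using d(2) M(2) by (simp add: ennreal_leI flip: ennreal_mult')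
   finally show ?case .
  qed
  then show "\<exists>N. ALL n>=N. lpn p K (%x. (A n x - a x) * h x) <= en e" by (simp add: ev_seq)
 qed
 have "A n x * H n x - a x * h x = A n x * (H n x - h x) + (A n x - a x) * h x" for n x
  by (simp add: algebra_simps)
 then show ?thesis using lpn_tendsto_add[OF _ _ _ p 1 2] by simp
qed

lemma uniform_imp_lpn_tendsto:
 fixes u :: "'a::euclidean_space => real"
 assumes K: "K : lmeasurable" and p: "0 < p" and lim: "uniform_limit K U u sequentially"
 shows "(%n. lpn p K (%x. U n x - u x)) ~~> 0"
proof (rule ennreal_tendsto_0I)
 fix e :: real assume e: "e > 0"
 define m where "m = measure lebesgue K"
 have m: "emeasure lebesgue K = en m" "m >= 0" using K by (auto simp: m_def emeasure_eq_measure2)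
 define d where "d = (e / (m + 1)) powr (1 / p)"
 have d: "d > 0" "d powr p * m <= e" using e m(2) p by (auto simp: d_def powr_powr field_simps)
 have "\<forall>\<^sub>F n in sequentially. \<forall>x\<in>K. dist (U n x) (u x) < d" using lim d unfolding uniform_limit_iff by auto
 then have "\<forall>\<^sub>F n in sequentially. lpn p K (%x. U n x - u x) <= en e"
 proof eventually_elim
  case (elim n)
  have "lpn p K (%x. U n x - u x) <= lpn p K (%x. d)"
   using elim p d by (intro lpn_mono) (auto simp: dist_real_def less_imp_le)
  also have "... = en (d powr p * m)"
   using K m d unfolding lpn_def by (simp add: nn_integral_multc ennreal_mult' mult.commute fmeasurable_def)
  also have "... <= en e" using d by (intro ennreal_leI)
  finally show ?case .
 qed
 then show "\<exists>N. ALL n>=N. lpn p K (%x. U n x - u x) <= en e" by (simp add: ev_seq)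
qed

lemma LINT_lpn_tendsto:
 fixes h w :: "real^'n => real"
 assumes H: "!!k. H k : L1_loc UNIV" and h: "h : L1_loc UNIV" and w: "ctn w"
  and K: "compact K" "\<forall>x. x ~: K --> w x = 0" and p: "1 <= p"
  and lim: "(%k. lpn p K (%x. H k x - h x)) ~~> 0"
 shows "(%k. LL x. H k x * w x) ~~> (LL x. h x * w x)"
proof -
 obtain B where B: "B > 0" "!!x. \<bar>w x\<bar> <= B" using cont_supp_bounded[OF w K] by blast
 have [measurable]: "H k : lmeas" "h : lmeas" for k
  using H h L1_loc_measurable by auto
 have Km: "K : lmeasurable" by (rule lm_compact[OF K(1)])
 have lim1: "(%k. lpn 1 K (%x. H k x - h x)) ~~> 0"
  by (rule lpn_lower_tendsto[OF _ Km _ p lim]) auto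
 have i: "intg (%x. H k x * w x)" "intg (%x. h x * w x)" for k
  by (auto intro: L1_loc_cont_int[OF _ K(1) _ K(2) w] H h)
 have le: "en (norm ((LL x. H k x * w x) - (LL x. h x * w x)))
   <= en B * lpn 1 K (%x. H k x - h x)" for k
 proof -
  have "(LL x. H k x * w x) - (LL x. h x * w x) = (LL x. H k x * w x - h x * w x)"
   using i by simp
  then have "en (norm ((LL x. H k x * w x) - (LL x. h x * w x)))
   <= (NL x. en (norm (H k x * w x - h x * w x)))"
   using integral_norm_bound_ennreal[of lebesgue "%x. H k x * w x - h x * w x"] i by auto
  also have "... <= (NL x. en B * (ind K x * en (norm (H k x - h x) powr 1)))"
  proof (rule nn_integral_mono)
   fix x
   have "\<bar>H k x * w x - h x * w x\<bar> <= B * \<bar>H k x - h x\<bar>"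
    using mult_right_mono[OF B(2)[of x], of "\<bar>H k x - h x\<bar>"]
    by (simp add: abs_mult[symmetric] algebra_simps)
   then have "en \<bar>H k x * w x - h x * w x\<bar> <= en B * en \<bar>H k x - h x\<bar>"
    using B by (simp add: ennreal_leI flip: ennreal_mult)
   then show "en (norm (H k x * w x - h x * w x)) <= en B * (ind K x * en (norm (H k x - h x) powr 1))"
    using K(2) by (cases "x : K") auto
  qed
  also have "... = en B * lpn 1 K (%x. H k x - h x)"
   using Km unfolding lpn_def by (subst nn_integral_cmult) (auto simp: fmeasurable_def)
  finally show ?thesis .
 qed
 have "(%k. en (norm ((LL x. H k x * w x) - (LL x. h x * w x)))) ~~> 0"
  by (rule ennreal_tendsto_0_le[OF ennreal_tendsto_0_cmult[OF lim1]]) (use le in \<open>auto intro: always_eventually\<close>)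
 then have "(%k. norm ((LL x. H k x * w x) - (LL x. h x * w x))) ~~> 0"
  by (simp flip: ennreal_0)
 then show ?thesis using LIM_zero_cancel tendsto_norm_zero_iff by blast
qed

text \<open>Convergence on compact sets is the right hypothesis, because each test function sees one
  compact set.\<close>

lemma has_weak_grad_limit:
 fixes u :: "real^'n => real"
 assumes w: "!!k. has_weak_grad UNIV (U k) (G k)" and u: "u : L1_loc UNIV" and g: "g : L1_loc UNIV" and p: "1 <= p"
  and lim: "!!K. compact K ==> (%k. lpn p K (%x. U k x - u x)) ~~> 0"
   "!!K i. compact K ==> (%k. lpn p K (%x. G k x $ i - g x $ i)) ~~> 0"
 shows "has_weak_grad UNIV u g"
 unfolding has_weak_grad_def
proof (intro conjI allI impI u g)
 fix ph :: "real^'n => real" and i assume t: "test_fun UNIV ph"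
 obtain K where K: "compact K" "\<forall>x. x ~: K --> ph x = 0" using c1_testD(1)[OF test_fun_c1[OF t]] by blast
 note C = Ck1D[OF c1_testD(2)[OF test_fun_c1[OF t]]]
 have pK: "\<forall>x. x ~: K --> pd i ph x = 0" using pd_support[OF cmp_closed[OF K(1)] K(2)] by blast
 have UL: "U k : L1_loc UNIV" "(%x. G k x $ i) : L1_loc UNIV" for k
  using w unfolding has_weak_grad_def L1_loc_vec_iff by auto
 have gi: "(%x. g x $ i) : L1_loc UNIV" using g unfolding L1_loc_vec_iff by simp
 have "(%k. LL x. U k x * pd i ph x) ~~> (LL x. u x * pd i ph x)"
  by (rule LINT_lpn_tendsto[OF UL(1) u C(2) K(1) pK p lim(1)[OF K(1)]])
 moreover have "(%k. LL x. G k x $ i * ph x) ~~> (LL x. g x $ i * ph x)"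
  by (rule LINT_lpn_tendsto[OF UL(2) gi C(3) K p lim(2)[OF K(1)]])
 moreover have "(LL x. U k x * pd i ph x) = - (LL x. G k x $ i * ph x)" for k
  using w[of k] t unfolding has_weak_grad_def lebesgue_on_UNIV_eq by blast
 ultimately have "(%k. - (LL x. G k x $ i * ph x)) ~~> (LL x. u x * pd i ph x)"
  "(%k. - (LL x. G k x $ i * ph x)) ~~> - (LL x. g x $ i * ph x)"
  by (auto intro: tendsto_minus)
 then show "(LINT x|lebesgue_on UNIV. u x * pd i ph x) = - (LINT x|lebesgue_on UNIV. g x $ i * ph x)"
  unfolding lebesgue_on_UNIV_eq by (rule LIMSEQ_unique)
qed

section \<open>Continuous Sobolev functions\<close>

lemma borel_measurable_nth:
 fixes g :: "'a => real^'n"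
 assumes "g : borel_measurable M" shows "(%x. g x $ i) : borel_measurable M"
 using borel_measurable_inner[OF assms borel_measurable_const[of "axis i 1"]] by (simp add: inner_axis)

text \<open>Continuous functions that are limits of \<open>C\<^sup>1\<close> functions, locally uniformly and with gradients
 converging in \<open>L\<^sub>p\<close> locally; the usual calculus rules pass to the limit.\<close>

definition c1_approx :: "real => (real^'n => real) => ('n => real^'n => real) => bool" where
 "c1_approx p u g \<longleftrightarrow> ctn u \<and> (\<forall>i. g i : lmeas) \<and>
  (\<forall>i K. compact K --> lpn p K (g i) < inft) \<and>
  (\<exists>U. (\<forall>k::nat. Ck 1 (U k)) \<and> (\<forall>K. compact K --> uniform_limit K U u sequentially) \<and>
   (\<forall>i K. compact K --> (%k. lpn p K (%x. pd i (U k) x - g i x)) ~~> 0))"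

lemma c1_approxE:
 assumes "c1_approx p u g"
 obtains U where "!!k::nat. Ck 1 (U k)" "!!K. compact K ==> uniform_limit K U u sequentially"
  "!!i K. compact K ==> (%k. lpn p K (%x. pd i (U k) x - g i x)) ~~> 0"
proof -
 from assms obtain U where "\<forall>k::nat. Ck 1 (U k)" "\<forall>K. compact K --> uniform_limit K U u sequentially"
  "\<forall>i K. compact K --> (%k. lpn p K (%x. pd i (U k) x - g i x)) ~~> 0"
  unfolding c1_approx_def by (elim conjE exE)
 then show ?thesis by (intro that[of U]) (simp_all del: Ck.simps)
qed

lemma cont_bounded:
 assumes "ctn (u :: 'a::euclidean_space => real)" "compact K"
 obtains B where "0 <= B" "!!x. x : K ==> \<bar>u x\<bar> <= B"
proof -
 have "bounded (u ` K)" using assms by (meson compact_cont_image compact_imp_bounded cont_subset top_greatest)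
 then obtain B where "0 < B" "\<forall>x\<in>K. \<bar>u x\<bar> <= B" by (auto simp: bounded_pos)
 then show ?thesis by (intro that[of B]) auto
qed

lemma lpn_continuous_finite:
 assumes "ctn (u :: 'a::euclidean_space => real)" "compact K" "0 <= p"
 shows "lpn p K u < inft"
proof -
 obtain B where B: "0 <= B" "!!x. x : K ==> \<bar>u x\<bar> <= B" using cont_bounded[OF assms(1,2)] by blast
 have Km: "K : lmeasurable" by (rule lm_compact[OF assms(2)])
 have "lpn p K u <= lpn p K (%x. B)" using B assms by (intro lpn_mono) auto
 also have "... = emeasure lebesgue K * en (B powr p)"
  using Km B unfolding lpn_def by (subst nn_integral_multc) (auto simp: fmeasurable_def)
 also have "... < inft"
  using Km unfolding fmeasurable_def infinity_ennreal_def ennreal_mult_less_top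
  by (simp del: emeasure_completion)
 finally show ?thesis .
qed

lemma c1_approx_c1:
 assumes "Ck 1 u" "0 <= p" shows "c1_approx p u (%i. pd i u)"
 unfolding c1_approx_def
proof (intro conjI allI impI exI[of _ "%k. u"])
 show "pd i u : lmeas" for i by (intro cont_lmeas Ck1D assms)
 show "lpn p K (pd i u) < inft" if "compact K" for i K
  by (rule lpn_continuous_finite[OF Ck1D(2)[OF assms(1)] that assms(2)])
 show "(%k. lpn p K (%x. pd i u x - pd i u x)) ~~> 0" for i K by (simp add: lpn_def)
qed (intro Ck1D assms uniform_limit_const)+

lemma c1_approx_add:
 assumes u: "c1_approx p u g" and v: "c1_approx p v h" and p: "1 < p"
 shows "c1_approx p (%x. u x + v x) (%i x. g i x + h i x)"
proof -
 obtain U where U: "!!k. Ck 1 (U k)" "!!K. compact K ==> uniform_limit K U u sequentially"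
  "!!i K. compact K ==> (%k. lpn p K (%x. pd i (U k) x - g i x)) ~~> 0"
  by (rule c1_approxE[OF u]) (rule that)
 obtain V where V: "!!k. Ck 1 (V k)" "!!K. compact K ==> uniform_limit K V v sequentially"
  "!!i K. compact K ==> (%k. lpn p K (%x. pd i (V k) x - h i x)) ~~> 0"
  by (rule c1_approxE[OF v]) (rule that)
 have [measurable]: "g i : lmeas" "h i : lmeas" for i
  using u v unfolding c1_approx_def by auto
 have [measurable]: "pd i (U k) : lmeas" "pd i (V k) : lmeas" for i k
  using Ck1D(2)[OF U(1)] Ck1D(2)[OF V(1)] by (auto intro: cont_lmeas)
 have KS[measurable]: "K : sets lebesgue" if "compact K" for K :: "(real^'a) set" using lm_compact[OF that] by blast
 show ?thesis unfolding c1_approx_def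
 proof (intro conjI allI impI exI[of _ "%k x. U k x + V k x"])
  show "ctn (%x. u x + v x)" using u v unfolding c1_approx_def by (auto intro: continuous_intros)
  show "Ck 1 (%x. U k x + V k x)" for k by (rule Ck_add[OF U(1) V(1)])
  fix K :: "(real^'a) set" and i assume K: "compact K"
  note [measurable] = KS[OF K]
  show "uniform_limit K (%k x. U k x + V k x) (%x. u x + v x) sequentially"
   by (intro uniform_limit_add U V K)
  have "lpn p K (%x. g i x + h i x) <= en (2 powr p) * (lpn p K (g i) + lpn p K (h i))"
   by (rule lpn_add_le2) (use p in auto)
  also have "... < inft" using u v K unfolding c1_approx_def by (simp add: ennreal_mult_less_top)
  finally show "lpn p K (%x. g i x + h i x) < inft" .
  have "(%k. lpn p K (%x. (pd i (U k) x - g i x) + (pd i (V k) x - h i x))) ~~> 0"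
   by (rule lpn_tendsto_add[OF _ _ _ p U(3)[OF K] V(3)[OF K]]) measurable
  then show "(%k. lpn p K (%x. pd i (%x. U k x + V k x) x - (g i x + h i x))) ~~> 0"
   by (simp add: pd_add[OF Ck1D(1)[OF U(1)] Ck1D(1)[OF V(1)]] algebra_simps)
 qed measurable
qed

lemma c1_approx_mult:
 assumes u: "c1_approx p u g" and v: "c1_approx p v h" and p: "1 < p"
 shows "c1_approx p (%x. u x * v x) (%i x. u x * h i x + v x * g i x)"
proof -
 obtain U where U: "!!k. Ck 1 (U k)" "!!K. compact K ==> uniform_limit K U u sequentially"
  "!!i K. compact K ==> (%k. lpn p K (%x. pd i (U k) x - g i x)) ~~> 0"
  by (rule c1_approxE[OF u]) (rule that)
 obtain V where V: "!!k. Ck 1 (V k)" "!!K. compact K ==> uniform_limit K V v sequentially"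
  "!!i K. compact K ==> (%k. lpn p K (%x. pd i (V k) x - h i x)) ~~> 0"
  by (rule c1_approxE[OF v]) (rule that)
 have [measurable]: "g i : lmeas" "h i : lmeas" for i
  using u v unfolding c1_approx_def by auto
 have cuv: "ctn u" "ctn v" using u v unfolding c1_approx_def by auto
 have [measurable]: "u : lmeas" "v : lmeas"
  using cuv by (auto intro: cont_lmeas)
 have [measurable]: "pd i (U k) : lmeas" "pd i (V k) : lmeas"
  "U k : lmeas" "V k : lmeas" for i k
  using Ck1D(2,3)[OF U(1)] Ck1D(2,3)[OF V(1)] by (auto intro: cont_lmeas)
 have KS: "K : sets lebesgue" if "compact K" for K :: "(real^'a) set" using lm_compact[OF that] by blast
 show ?thesis unfolding c1_approx_def
 proof (intro conjI allI impI exI[of _ "%k x. U k x * V k x"])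
  show "ctn (%x. u x * v x)" using cuv by (auto intro: continuous_intros)
  show "Ck 1 (%x. U k x * V k x)" for k by (rule Ck_mult[OF U(1) V(1)])
  fix K :: "(real^'a) set" and i assume K: "compact K"
  note [measurable] = KS[OF K]
  obtain B where B: "0 <= B" "!!x. x : K ==> \<bar>u x\<bar> <= B" using cont_bounded[OF cuv(1) K] by blast
  obtain D where D: "0 <= D" "!!x. x : K ==> \<bar>v x\<bar> <= D" using cont_bounded[OF cuv(2) K] by blast
  have fin: "lpn p K (g i) < inft" "lpn p K (h i) < inft" using u v K unfolding c1_approx_def by auto
  show "uniform_limit K (%k x. U k x * V k x) (%x. u x * v x) sequentially"
  proof (intro uniform_lim_mult U V K)
   show "bounded (u ` K)" "bounded (v ` K)"
    using B D by (auto simp: bounded_iff)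
  qed
  have "lpn p K (%x. u x * h i x + v x * g i x) <= en (2 powr p) * (lpn p K (%x. u x * h i x) + lpn p K (%x. v x * g i x))"
   by (rule lpn_add_le2) (use p in auto)
  also have "... <= en (2 powr p) * (en (B powr p) * lpn p K (h i) + en (D powr p) * lpn p K (g i))"
   using B D p by (intro mult_left_mono add_mono lpn_mult_le) auto
  also have "... < inft" using fin by (simp add: ennreal_mult_less_top)
  finally show "lpn p K (%x. u x * h i x + v x * g i x) < inft" .
  have "(%k. lpn p K (%x. (U k x * pd i (V k) x - u x * h i x) + (V k x * pd i (U k) x - v x * g i x))) ~~> 0"
   by (rule lpn_tendsto_add[OF _ _ _ p
      lpn_tendsto_mult[OF _ _ _ _ _ p U(2)[OF K] B(2,1) fin(2) V(3)[OF K]]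
      lpn_tendsto_mult[OF _ _ _ _ _ p V(2)[OF K] D(2,1) fin(1) U(3)[OF K]]]) measurable
  then show "(%k. lpn p K (%x. pd i (%x. U k x * V k x) x - (u x * h i x + v x * g i x))) ~~> 0"
   by (simp add: pd_mult[OF Ck1D(1)[OF U(1)] Ck1D(1)[OF V(1)]] algebra_simps)
 qed measurable
qed

lemma c1_approx_sum:
 assumes "finite I" "!!j. j : I ==> c1_approx p (u j) (g j)" "1 < p"
 shows "c1_approx p (%x. \<Sum>j\<in>I. u j x) (%i x. \<Sum>j\<in>I. g j i x)"
 using assms
proof (induction I rule: finite_induct)
 case empty
 then show ?case using c1_approx_c1[of "%x. 0" p] by simp
next
 case (insert j I)
 then show ?case using c1_approx_add[of p "u j" "g j" "%x. \<Sum>j\<in>I. u j x" "%i x. \<Sum>j\<in>I. g j i x"] by simp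
qed

lemma uniform_limit_compose_continuous:
 fixes u :: "'a::euclidean_space => real" and th :: "real => real"
 assumes lim: "uniform_limit K U u sequentially" and u: "ctn u" and K: "compact K"
  and th: "ctn th"
 shows "uniform_limit K (%k x. th (U k x)) (%x. th (u x)) sequentially"
 unfolding uniform_limit_iff
proof (intro allI impI)
 fix e :: real assume e: "e > 0"
 obtain B where B: "0 <= B" "!!x. x : K ==> \<bar>u x\<bar> <= B" using cont_bounded[OF u K] by blast
 have "uniformly_continuous_on {-(B+1)..B+1} th"
  using th by (intro compact_uniformly_continuous) (auto intro: cont_subset)
 then obtain d where d: "d > 0" "!!s t. s : {-(B+1)..B+1} ==> t : {-(B+1)..B+1} ==> dist t s < d ==> dist (th t) (th s) < e"
  unfolding uniformly_continuous_on_def using e by metis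
 have "0 < min d 1" using d by simp
 then have "\<forall>\<^sub>F k in sequentially. \<forall>x\<in>K. dist (U k x) (u x) < min d 1"
  using lim unfolding uniform_limit_iff by blast
 then show "\<forall>\<^sub>F k in sequentially. \<forall>x\<in>K. dist (th (U k x)) (th (u x)) < e"
 proof eventually_elim
  case (elim k)
  show ?case
  proof
   fix x assume x: "x : K"
   have "dist (U k x) (u x) < min d 1" using elim x by blast
   then show "dist (th (U k x)) (th (u x)) < e"
    using B(2)[OF x] by (intro d(2)) (auto simp: dist_real_def)
  qed
 qed
qed

lemma c1_approx_comp:
 assumes u: "c1_approx p u g" and p: "1 < p"
  and th: "!!t. (th has_real_derivative th' t) (at t)" "ctn th'"
 shows "c1_approx p (%x. th (u x)) (%i x. th' (u x) * g i x)"
proof -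
 obtain U where U: "!!k. Ck 1 (U k)" "!!K. compact K ==> uniform_limit K U u sequentially"
  "!!i K. compact K ==> (%k. lpn p K (%x. pd i (U k) x - g i x)) ~~> 0"
  by (rule c1_approxE[OF u]) (rule that)
 have [measurable]: "g i : lmeas" for i using u unfolding c1_approx_def by auto
 have cu: "ctn u" using u unfolding c1_approx_def by auto
 have cth: "ctn th"
  by (intro continuous_at_imp_continuous_on ballI DERIV_isCont[OF th(1)])
 have cth': "ctn (%x. th' (v x))" if "ctn v" for v :: "real^'a => real"
  by (rule cont_comp2[OF th(2) that]) simp
 have [measurable]: "(%x. th' (u x)) : lmeas"
  by (intro cont_lmeas cth' cu)
 have [measurable]: "pd i (U k) : lmeas" "(%x. th' (U k x)) : lmeas" for i k
  by (intro cont_lmeas cth' Ck1D(2,3)[OF U(1)])+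
 have pd: "pd i (%x. th (U k x)) = (%x. th' (U k x) * pd i (U k) x)" for i k
  using pd_comp_real(2)[OF Ck1D(1)[OF U(1)] th(1)] by blast
 show ?thesis unfolding c1_approx_def
 proof (intro conjI allI impI exI[of _ "%k x. th (U k x)"])
  show "ctn (%x. th (u x))" by (rule cont_comp2[OF cth cu]) simp
  show "Ck 1 (%x. th (U k x))" for k
   using pd_comp_real(1)[OF Ck1D(1)[OF U(1)] th(1)] Ck1D(2,3)[OF U(1)]
   by (auto simp: pd differentiable_def intro!: continuous_on_mult cth')
  fix K :: "(real^'a) set" and i assume K: "compact K"
  have [measurable]: "K : sets lebesgue" using lm_compact[OF K] by blast
  obtain B where B: "0 <= B" "!!x. x : K ==> \<bar>th' (u x)\<bar> <= B"
   using cont_bounded[OF cth'[OF cu] K] by blast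
  have fin: "lpn p K (g i) < inft" using u K unfolding c1_approx_def by auto
  show "uniform_limit K (%k x. th (U k x)) (%x. th (u x)) sequentially"
   by (rule uniform_limit_compose_continuous[OF U(2)[OF K] cu K cth])
  have "lpn p K (%x. th' (u x) * g i x) <= en (B powr p) * lpn p K (g i)"
   by (rule lpn_mult_le) (use B p in auto)
  also have "... < inft" using fin by (simp add: ennreal_mult_less_top)
  finally show "lpn p K (%x. th' (u x) * g i x) < inft" .
  show "(%k. lpn p K (%x. pd i (%x. th (U k x)) x - th' (u x) * g i x)) ~~> 0"
   unfolding pd
   by (rule lpn_tendsto_mult[OF _ _ _ _ _ p uniform_limit_compose_continuous[OF U(2)[OF K] cu K th(2)] B(2,1) fin U(3)[OF K]]) measurable
 qed measurable
qed

lemma c1_approx_weak_grad: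
 fixes u :: "real^'n => real"
 assumes u: "c1_approx p u g" and p: "1 < p"
 shows "has_weak_grad UNIV u (%x. \<chi> i. g i x)"
proof -
 obtain U where U: "!!k. Ck 1 (U k)" "!!K. compact K ==> uniform_limit K U u sequentially"
  "!!i K. compact K ==> (%k. lpn p K (%x. pd i (U k) x - g i x)) ~~> 0"
  by (rule c1_approxE[OF u]) (rule that)
 show ?thesis
 proof (rule has_weak_grad_limit[where p = p and G = "%k x. \<chi> i. pd i (U k) x"])
  show "has_weak_grad UNIV (U k) (%x. \<chi> i. pd i (U k) x)" for k by (rule c1_weak_grad[OF U(1)]) simp
  show "u : L1_loc UNIV" using u unfolding c1_approx_def by (auto intro: continuous_L1_loc)
  have "g i : L1_loc UNIV" for i
   by (rule L1_locI_lpn[of _ _ p]) (use u p in \<open>auto simp: c1_approx_def intro: meas_restrict1\<close>)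
  then show "(%x. \<chi> i. g i x) : L1_loc UNIV" unfolding L1_loc_vec_iff by simp
  show "(%k. lpn p K (%x. U k x - u x)) ~~> 0" if "compact K" for K
   by (rule uniform_imp_lpn_tendsto[OF lm_compact[OF that] _ U(2)[OF that]]) (use p in simp)
  show "(%k. lpn p K (%x. (\<chi> i. pd i (U k) x) $ i - (\<chi> i. g i x) $ i)) ~~> 0" if "compact K" for K i
   using U(3)[OF that] by simp
 qed (use p in simp)
qed

text \<open>The mollifications are the approximants: they converge locally uniformly because u is
  continuous, and their gradients converge in L_r, hence in L_p on compact sets as p <= r. This
  brings the entries of \<open>B'\<close> into the calculus.\<close>

lemma c1_approx_H1:
 fixes u :: "real^'n => real"
 assumes u: "ctn u" and g: "has_weak_grad UNIV u g" "g : Lq r UNIV" and pr: "1 < p" "p <= r"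
 shows "c1_approx p u (%i x. g x $ i)"
proof -
 have uL: "u : L1_loc UNIV" by (rule continuous_L1_loc[OF u])
 have gm[measurable]: "g : lmeas" and gf: "lpn r UNIV g < inft"
  using g(2) by (auto simp: Lq_iff_lpn lebesgue_on_UNIV_eq)
 have gim[measurable]: "(%x. g x $ i) : lmeas" for i by (rule borel_measurable_nth[OF gm])
 have gif: "lpn r UNIV (%x. g x $ i) < inft" for i
  using lpn_componentwise(2)[OF gm _ , of UNIV r i] gf pr by (auto intro: order_le_less_trans)
 have giL: "(%x. g x $ i) : L1_loc UNIV" for i
  using g unfolding has_weak_grad_def L1_loc_vec_iff by auto
 have r: "1 < r" using pr by simp
 have pd: "pd i (conv u (mol k)) = conv (%x. g x $ i) (mol k)" for i k
  by (rule pd_conv_weak[OF g(1) mol_test])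
 note [measurable] = conv_mol_measurable[OF giL]
 show ?thesis unfolding c1_approx_def
 proof (intro conjI allI impI exI[of _ "%k. conv u (mol k)"] u gim)
  show "Ck 1 (conv u (mol k))" for k by (rule Ck_conv[OF uL mol_test])
  fix K :: "(real^'n) set" assume K: "compact K"
  have Km: "K : lmeasurable" by (rule lm_compact[OF K])
  show "lpn p K (%x. g x $ i) < inft" for i
  proof (rule lpn_lower_finite[OF gim Km _ pr(2)])
   show "lpn r K (%x. g x $ i) < inft"
    by (rule order_le_less_trans[OF lpn_mono gif[of i]]) (use pr in auto)
  qed (use pr in auto)
  show "(%k. lpn p K (%x. pd i (conv u (mol k)) x - g x $ i)) ~~> 0" for i
  proof (rule lpn_lower_tendsto[OF _ Km _ pr(2)])
   have "(%k. lpn r UNIV (%x. conv (%x. g x $ i) (mol k) x - g x $ i)) ~~> 0"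
    by (rule conv_Lp_tendsto[OF gim gif r])
   then show "(%k. lpn r K (%x. pd i (conv u (mol k)) x - g x $ i)) ~~> 0"
    unfolding pd by (rule ennreal_tendsto_0_le) (use pr in \<open>auto intro!: always_eventually lpn_mono\<close>)
  qed (use pr in \<open>auto simp: pd\<close>)
  show "uniform_limit K (%k. conv u (mol k)) u sequentially"
   unfolding uniform_limit_iff
  proof (intro allI impI)
   fix e :: real assume e: "e > 0"
   define K' where "K' = {a + b | a b. a : K \<and> b : cball (0::real^'n) 1}"
   have "compact K'" unfolding K'_def by (intro compact_sums K compact_cball)
   then have "uniformly_continuous_on K' u"
    using u by (meson compact_uniformly_continuous cont_subset top_greatest)
   then obtain d where d: "d > 0" "!!x y. x : K' ==> y : K' ==> dist y x < d ==> dist (u y) (u x) < e / 2"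
    unfolding uniformly_continuous_on_def using e by (metis half_gt_zero)
   have inK: "y : K'" if "x : K" "dist x y < 1" for x y
   proof -
    have "y = x + (y - x)" "y - x : cball 0 1" using that by (auto simp: dist_norm norm_minus_commute)
    then show ?thesis unfolding K'_def using that(1) by blast
   qed
   obtain N where N: "inverse (real (Suc N)) < min d 1" using reals_Archimedean[of "min d 1"] d by auto
   have "dist (conv u (mol n) x) (u x) < e" if n: "n >= N" and x: "x : K" for n x
   proof -
    have nr: "inverse (real (Suc n)) <= min d 1"
     using N n by (smt (verit) le_imp_inverse_le of_nat_0_less_iff of_nat_le_iff Suc_le_mono zero_less_Suc)
    have "\<bar>conv u (mol n) x - u x\<bar> <= e / 2"
    proof (rule conv_mol_near[OF uL _ nr])
     fix y assume y: "dist x y < min d 1"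
     have "dist (u y) (u x) < e / 2"
      using y x by (intro d(2) inK[of x]) (auto simp: dist_commute)
     then show "\<bar>u y - u x\<bar> <= e / 2" by (simp add: dist_real_def)
    qed (use e in simp)
    then show ?thesis using e by (simp add: dist_real_def)
   qed
   then show "\<forall>\<^sub>F n in sequentially. \<forall>x\<in>K. dist (conv u (mol n) x) (u x) < e"
    unfolding ev_seq by blast
  qed
 qed
qed

section \<open>The Poincare inequality on balls\<close>

lemma nn_integral_affine:
 fixes f :: "'a::euclidean_space => ennreal"
 assumes [measurable]: "f : bmeas" and c: "0 < c"
 shows "(NB x. f (a + c *R x)) = en (1 / c ^ DIM('a)) * (NB x. f x)"
proof -
 have "(NB x. f x) = (\<integral>\<^sup>+x. f x \<partial>density (distr lborel borel (%x. a + c *R x)) (%_. en (\<bar>c\<bar> ^ DIM('a))))"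
  using lborel_affine[of c a] c by simp
 also have "... = en (c ^ DIM('a)) * (NB x. f (a + c *R x))"
  using c by (simp add: nn_integral_density nn_integral_distr nn_integral_cmult)
 finally have "en (1 / c ^ DIM('a)) * (NB x. f x) =
   en (1 / c ^ DIM('a)) * en (c ^ DIM('a)) * (NB x. f (a + c *R x))"
  by (simp add: mult.assoc)
 also have "en (1 / c ^ DIM('a)) * en (c ^ DIM('a)) = 1"
  using c by (simp flip: ennreal_mult)
 finally show ?thesis by simp
qed

text \<open>For y in B the map x |-> y + t (x - y) sends the convex set B into itself, and its
  Jacobian t^N is at least 2^(-N) when t >= 1/2.\<close>

lemma segment_integral_bound:
 fixes f :: "'a::euclidean_space => ennreal"
 assumes [measurable]: "f : bmeas" "B : sets borel" and B: "convex B"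
  and t: "1/2 <= t" "t <= 1"
 shows "(NB y. ind B y * (NB x. ind B x * f (y + t *R (x - y))))
  <= 2 ^ DIM('a) * emeasure lborel B * (NB x. ind B x * f x)"
proof -
 have inner: "(NB x. ind B x * f (y + t *R (x - y))) <= 2 ^ DIM('a) * (NB x. ind B x * f x)"
  if y: "y : B" for y
 proof -
  have e: "y + t *R (x - y) = (1 - t) *R y + t *R x" for x by (simp add: algebra_simps)
  have "(NB x. ind B x * f (y + t *R (x - y))) <=
   (NB x. ind B ((1 - t) *R y + t *R x) * f ((1 - t) *R y + t *R x))"
   unfolding e
  proof (rule nn_integral_mono)
   fix x
   have "(1 - t) *R y + t *R x : B" if "x : B"
    using convexD_alt[OF B y that, of t] t by simp
   then show "ind B x * f ((1 - t) *R y + t *R x) <=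
    ind B ((1 - t) *R y + t *R x) * f ((1 - t) *R y + t *R x)"
    by (cases "x : B") auto
  qed
  also have "... = en (1 / t ^ DIM('a)) * (NB x. ind B x * f x)"
   by (rule nn_integral_affine[where f = "%z. ind B z * f z"]) (use t in auto)
  also have "... <= 2 ^ DIM('a) * (NB x. ind B x * f x)"
  proof (rule mult_right_mono)
   have "1 / t ^ DIM('a) = (1 / t) ^ DIM('a)" by (simp add: power_divide)
   also have "... <= 2 ^ DIM('a)" using t by (intro power_mono) (auto simp: field_simps)
   finally have "en (1 / t ^ DIM('a)) <= en (2 ^ DIM('a))" by (rule ennreal_leI)
   then show "en (1 / t ^ DIM('a)) <= 2 ^ DIM('a)" by (simp add: ennreal_power[symmetric])
  qed simp
  finally show ?thesis .
 qed
 have "(NB y. ind B y * (NB x. ind B x * f (y + t *R (x - y))))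
  <= (NB y. ind B y * (2 ^ DIM('a) * (NB x. ind B x * f x)))"
 proof (rule nn_integral_mono)
  fix y show "ind B y * (NB x. ind B x * f (y + t *R (x - y)))
   <= ind B y * (2 ^ DIM('a) * (NB x. ind B x * f x))"
   using inner[of y] by (cases "y : B") auto
 qed
 also have "... = 2 ^ DIM('a) * emeasure lborel B * (NB x. ind B x * f x)"
  by (subst nn_integral_multc) (auto simp: mult_ac)
 finally show ?thesis .
qed

definition grad :: "(real^'n => real) => real^'n => real^'n" where
 "grad w x = (\<chi> i. pd i w x)"

lemma grad_nth [simp]: "grad w x $ i = pd i w x" by (simp add: grad_def)

lemma continuous_grad: "Ck 1 w ==> ctn (grad w)"
 unfolding grad_def by (rule continuous_on_vec_lambda) (rule Ck1D(2))

text \<open>The fundamental theorem of calculus along the segment from y to x, followed by Jensen's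
  inequality on [0, 1] with density 1.\<close>

lemma c1_difference_bound:
 fixes w :: "real^'n => real"
 assumes w: "Ck 1 w" and p: "1 < p"
 shows "en (\<bar>w x - w y\<bar> powr p) <=
  en (norm (x - y) powr p) * (NB t. ind {0..1} t * en (norm (grad w (y + t *R (x - y))) powr p))"
proof -
 define u where "u t = grad w (y + t *R (x - y)) \<bullet> (x - y)" for t
 have cg: "ctn (%t. grad w (y + t *R (x - y)))"
  by (intro cont_comp2[OF continuous_grad[OF w]] continuous_intros) auto
 have cu: "ctn u" unfolding u_def by (intro continuous_intros cg)
 have der: "((%t. w (y + t *R (x - y))) has_real_derivative u t) (at t)" for t
 proof -
  have 1: "((%t. y + t *R (x - y)) has_derivative (%s. s *R (x - y))) (at t)"
   by (auto intro!: derivative_eq_intros)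
  have "((%t. w (y + t *R (x - y))) has_derivative (%s. \<Sum>i\<in>UNIV. pd i w (y + t *R (x - y)) * (s *R (x - y)) $ i)) (at t)"
   using diff_chain_at[OF 1 has_derivative_pd[OF Ck1D(1)[OF w]]] by (simp add: o_def)
  moreover have "(%s. \<Sum>i\<in>UNIV. pd i w (y + t *R (x - y)) * (s *R (x - y)) $ i) = (*) (u t)"
   by (rule ext) (simp add: u_def inner_vec_def sum_distrib_left sum_distrib_right mult_ac)
  ultimately show ?thesis by (simp add: has_field_derivative_def)
 qed
 have I: "(LB t. u t * ind {0..1} t) = w x - w y"
  using integral_FTC_Icc_real[of 0 1 "%t. w (y + t *R (x - y))" u] der cu
  by (simp add: continuous_on_eq_continuous_at)
 have int: "integrable lborel (%t. u t * ind {0..1} t)"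
  using borel_integrable_atLeastAtMost'[of 0 1 u] cont_subset[OF cu]
  by (simp add: set_integrable_def mult.commute)
 have [measurable]: "u : bmeas" using cu by (rule cont_bmeas)
 have "en (\<bar>w x - w y\<bar> powr p) <= (NB t. en (\<bar>u t\<bar> powr p * ind {0..1} t))"
  unfolding I[symmetric] by (rule jensen_powr[OF int]) (use p in auto)
 also have "... <= (NB t. en (norm (x - y) powr p) * (ind {0..1} t * en (norm (grad w (y + t *R (x - y))) powr p)))"
 proof (rule nn_integral_mono)
  fix t
  have "\<bar>u t\<bar> powr p <= (norm (grad w (y + t *R (x - y))) * norm (x - y)) powr p"
   unfolding u_def using p Cauchy_Schwarz_ineq2 by (intro powr_mono2) auto
  also have "... = norm (x - y) powr p * norm (grad w (y + t *R (x - y))) powr p"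
   by (simp add: powr_mult mult.commute)
  finally show "en (\<bar>u t\<bar> powr p * ind {0..1} t) <=
    en (norm (x - y) powr p) * (ind {0..1} t * en (norm (grad w (y + t *R (x - y))) powr p))"
   by (auto simp: indicator_def ennreal_leI simp flip: ennreal_mult)
 qed
 also have "... = en (norm (x - y) powr p) * (NB t. ind {0..1} t * en (norm (grad w (y + t *R (x - y))) powr p))"
 proof (rule nn_integral_cmult)
  have [measurable]: "(%t. grad w (y + t *R (x - y))) : bmeas"
   using cg by (rule cont_bmeas)
  show "(%t. ind {0..1} t * en (norm (grad w (y + t *R (x - y))) powr p)) : borel_measurable lborel"
   by measurable
 qed
 finally show ?thesis .
qed

text \<open>The segment bound is integrated over x, y and t by Tonelli.
  \<open>segment_integral_bound\<close> covers t >= 1/2; for smaller t, exchanging x and y replaces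
  t by 1 - t.\<close>

lemma poincare_double:
 fixes w :: "real^'n => real"
 assumes w: "Ck 1 w" and p: "1 < p" and R: "0 < R"
 shows "(NB x. ind (ball 0 R) x * (NB y. ind (ball 0 R) y * en (\<bar>w x - w y\<bar> powr p)))
  <= en ((2 * R) powr p) * (2 ^ CARD('n) * emeasure lborel (ball (0::real^'n) R) * lpn p (ball 0 R) (grad w))"
proof -
 define B where "B = ball (0::real^'n) R"
 define k where "k x = en (norm (grad w x) powr p)" for x
 have [measurable]: "grad w : bmeas"
  using continuous_grad[OF w] by (rule cont_bmeas)
 have [measurable]: "k : bmeas" unfolding k_def by measurable
 have [measurable]: "w : bmeas" using Ck1D(3)[OF w] by (rule cont_bmeas)
 have [measurable]: "B : sets borel" unfolding B_def by simp
 have cB: "convex B" unfolding B_def by simp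
 define D where "D = 2 ^ DIM(real^'n) * emeasure lborel B * (NB x. ind B x * k x)"
 define I where "I t = (NB x. ind B x * (NB y. ind B y * k (y + t *R (x - y))))" for t
 have I: "I t <= D" if t: "0 <= t" "t <= 1" for t
 proof (cases "1/2 <= t")
  case True
  have "I t = (NB x. (NB y. ind B x * (ind B y * k (y + t *R (x - y)))))"
   unfolding I_def by (subst nn_integral_cmult) auto
  also have "... = (NB y. (NB x. ind B x * (ind B y * k (y + t *R (x - y)))))"
   by (rule lborel_pair.Fubini') measurable
  also have "... = (NB y. (NB x. ind B y * (ind B x * k (y + t *R (x - y)))))"
   by (simp add: mult_ac)
  also have "... = (NB y. ind B y * (NB x. ind B x * k (y + t *R (x - y))))"
   by (subst nn_integral_cmult) auto
  also have "... <= D" unfolding D_def by (rule segment_integral_bound) (use t True cB in auto)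
  finally show ?thesis .
 next
  case False
  have e: "y + t *R (x - y) = x + (1 - t) *R (y - x)" for x y :: "real^'n" by (simp add: algebra_simps)
  show ?thesis unfolding I_def D_def e by (rule segment_integral_bound) (use t False cB in auto)
 qed
 have "(NB x. ind B x * (NB y. ind B y * en (\<bar>w x - w y\<bar> powr p)))
  <= (NB x. (NB y. (NB t. en ((2 * R) powr p) * (ind {0..1} t * (ind B x * (ind B y * k (y + t *R (x - y))))))))"
 proof -
  have "ind B x * (ind B y * en (\<bar>w x - w y\<bar> powr p)) <=
   (NB t. en ((2 * R) powr p) * (ind {0..1} t * (ind B x * (ind B y * k (y + t *R (x - y))))))" for x y
  proof (cases "x : B \<and> y : B")
   case True
   have "norm (x - y) <= 2 * R" using True norm_triangle_ineq4[of x y] by (auto simp: B_def)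
   then have "en (norm (x - y) powr p) <= en ((2 * R) powr p)" using p by (intro ennreal_leI powr_mono2) auto
   then have "en (\<bar>w x - w y\<bar> powr p) <= en ((2 * R) powr p) * (NB t. ind {0..1} t * k (y + t *R (x - y)))"
    using c1_difference_bound[OF w p, of x y] unfolding k_def by (meson mult_right_mono order_trans zero_le)
   also have "... = (NB t. en ((2 * R) powr p) * (ind {0..1} t * k (y + t *R (x - y))))"
    by (subst nn_integral_cmult) auto
   finally show ?thesis using True by simp
  qed auto
  then show ?thesis
   by (intro nn_integral_mono, subst nn_integral_cmult[symmetric]) (auto intro!: nn_integral_mono)
 qed
 also have "... = (NB x. (NB t. (NB y. en ((2 * R) powr p) * (ind {0..1} t * (ind B x * (ind B y * k (y + t *R (x - y))))))))"
  by (intro nn_integral_cong lborel_pair.Fubini') measurable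
 also have "... = (NB t. (NB x. (NB y. en ((2 * R) powr p) * (ind {0..1} t * (ind B x * (ind B y * k (y + t *R (x - y))))))))"
  by (rule lborel_pair.Fubini') measurable
 also have "... = (\<integral>\<^sup>+t. en ((2 * R) powr p) * (ind {0..1} t * I t) \<partial>(lborel :: real measure))"
  unfolding I_def by (intro nn_integral_cong) (simp add: nn_integral_cmult)
 also have "... <= (\<integral>\<^sup>+t. en ((2 * R) powr p) * D * ind {0..1} t \<partial>(lborel :: real measure))"
 proof (rule nn_integral_mono)
  fix t :: real
  show "en ((2 * R) powr p) * (ind {0..1} t * I t) <= en ((2 * R) powr p) * D * ind {0..1} t"
   using I[of t] by (cases "t : {0..1}") (auto intro: mult_left_mono)
 qed
 also have "... = en ((2 * R) powr p) * D" by (subst nn_integral_cmult_indicator) auto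
 finally show ?thesis unfolding D_def B_def[symmetric] lpn_def k_def nn_integral_completion by simp
qed

text \<open>At each x, w minus its mean is the mean of w x - w y over y, so Jensen's inequality
  leads to \<open>poincare_double\<close>. The mean may be over a smaller ball, because
  \<open>weak_grads_closed\<close> normalises a sequence once for balls of every radius.\<close>

lemma poincare_ball:
 fixes w :: "real^'n => real"
 assumes w: "Ck 1 w" and p: "1 < p" and R: "0 < \<rho>" "\<rho> <= R"
 shows "lpn p (ball 0 R) (%x. w x - (LB y. w y * (ind (ball 0 \<rho>) y / measure lborel (ball (0::real^'n) \<rho>))))
  <= en ((2 * R) powr p * 2 ^ CARD('n) * measure lborel (ball (0::real^'n) R) / measure lborel (ball (0::real^'n) \<rho>))
   * lpn p (ball 0 R) (grad w)"
proof -
 define B where "B = ball (0::real^'n) R"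
 define T where "T = ball (0::real^'n) \<rho>"
 define m where "m = measure lborel T"
 have mpos: "m > 0" unfolding m_def T_def using R content_ball_pos by simp
 have [measurable]: "w : bmeas" using Ck1D(3)[OF w] by (rule cont_bmeas)
 have [measurable]: "B : sets borel" "T : sets borel" unfolding B_def T_def by auto
 have em: "emeasure lborel T = en m" unfolding m_def T_def
  using emeasure_eq_ennreal_measure[of lborel "ball (0::real^'n) \<rho>"] emeasure_lborel_ball_finite[of "0::real^'n" \<rho>] by (simp add: less_top)
 have emB: "emeasure lborel B = en (measure lborel B)" unfolding B_def
  using emeasure_eq_ennreal_measure[of lborel "ball (0::real^'n) R"] emeasure_lborel_ball_finite[of "0::real^'n" R] by (simp add: less_top)
 have iT: "integrable lborel (%y. ind T y / m)" using em by auto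
 have kT: "(LB y. ind T y / m) = 1" using mpos em by (simp add: m_def)
 have iw: "integrable lborel (%y. w y * (ind T y / m))"
 proof -
  obtain b where b: "0 <= b" "!!x. x : cball 0 \<rho> ==> \<bar>w x\<bar> <= b"
   using cont_bounded[OF Ck1D(3)[OF w] compact_cball] by blast
  show ?thesis
  proof (rule bi_bound)
   show "integrable lborel (%y. b * (ind T y / m))" using iT by (rule integrable_mult_right)
   have "\<bar>w x\<bar> <= b" if "x : T" for x using that b by (auto simp: T_def)
   then show "AE y in lborel. norm (w y * (ind T y / m)) <= norm (b * (ind T y / m))"
    using mpos b(1) by (intro AE_I2) (auto simp: indicator_def intro!: divide_right_mono)
  qed measurable
 qed
 define c where "c = (LB y. w y * (ind T y / m))"
 have "en (\<bar>w x - c\<bar> powr p) <= en (1 / m) * (NB y. ind B y * en (\<bar>w x - w y\<bar> powr p))" for x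
 proof -
  have "integrable lborel (%y. w x * (ind T y / m))" using iT by (rule integrable_mult_right)
  then have i: "integrable lborel (%y. (w x - w y) * (ind T y / m))"
   using iw unfolding left_diff_distrib by (rule bi_diff)
  have "w x - c = (LB y. w x * (ind T y / m)) - c"
   using kT by (simp only: Bochner_Integration.integral_mult_right_zero mult_1_right)
  also have "... = (LB y. (w x - w y) * (ind T y / m))"
   unfolding c_def left_diff_distrib
   by (rule bi_int_diff[symmetric]) (rule integrable_mult_right[OF iT], rule iw)
  finally have "en (\<bar>w x - c\<bar> powr p) <= (NB y. en (\<bar>w x - w y\<bar> powr p * (ind T y / m)))"
   using jensen_powr[OF i _ _ iT kT p] mpos by simp
  also have "... <= (NB y. en (1 / m) * (ind B y * en (\<bar>w x - w y\<bar> powr p)))"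
  proof (rule nn_integral_mono)
   fix y
   have "y : B" if "y : T" using that R by (auto simp: B_def T_def)
   then show "en (\<bar>w x - w y\<bar> powr p * (ind T y / m)) <= en (1 / m) * (ind B y * en (\<bar>w x - w y\<bar> powr p))"
    using mpos by (cases "y : T") (auto simp: ennreal_leI mult.commute simp flip: ennreal_mult)
  qed
  also have "... = en (1 / m) * (NB y. ind B y * en (\<bar>w x - w y\<bar> powr p))"
   by (rule nn_integral_cmult) measurable
  finally show ?thesis .
 qed
 then have "lpn p B (%x. w x - c) <= (NB x. en (1 / m) * (ind B x * (NB y. ind B y * en (\<bar>w x - w y\<bar> powr p))))"
  unfolding lpn_def nn_integral_completion
  by (intro nn_integral_mono) (auto simp: indicator_def)
 also have "... = en (1 / m) * (NB x. ind B x * (NB y. ind B y * en (\<bar>w x - w y\<bar> powr p)))"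
  by (rule nn_integral_cmult) measurable
 also have "... <= en (1 / m) * (en ((2 * R) powr p) * (2 ^ CARD('n) * emeasure lborel B * lpn p B (grad w)))"
  unfolding B_def by (intro mult_left_mono poincare_double w p) (use R in auto)
 also have "... = en ((2 * R) powr p * 2 ^ CARD('n) * measure lborel B / m) * lpn p B (grad w)"
 proof -
  have "en ((2 * R) powr p * 2 ^ CARD('n) * measure lborel B / m) =
   en (1 / m) * (en ((2 * R) powr p) * (2 ^ CARD('n) * en (measure lborel B)))"
  proof -
   have "(2::ennreal) ^ CARD('n) = en (2 ^ CARD('n))" by (simp add: ennreal_power[symmetric])
   then show ?thesis using mpos by (simp add: field_simps flip: ennreal_mult)
  qed
  then show ?thesis unfolding emB by (simp add: mult_ac)
 qed
 finally show ?thesis unfolding c_def B_def T_def m_def .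
qed

section \<open>Divergence-free fields and homogeneous Sobolev functions\<close>

lemma dual_exponent:
 assumes "1 < q" "p = q / (q - 1)"
 shows "1 < p" "1 / q + 1 / (p::real) = 1" "q = p / (p - 1)"
 unfolding assms(2) using assms(1) by (auto simp: field_simps)

text \<open>Young's inequality for l a and b / l, with the factors 1/q and 1/p discarded. The free l
  takes the place of Hoelder's inequality: it makes one term small, and convergence then makes the
  other small.\<close>

lemma young_scaled:
 assumes "1 < q" "p = q / (q - 1)" "0 < l" "0 <= a" "0 <= (b::real)"
 shows "a * b <= l powr q * a powr q + l powr (- p) * b powr p"
proof -
 note p = dual_exponent[OF assms(1,2)]
 have "a * b = (l * a) * (b / l)" using assms(3) by simp
 also have "... <= (l * a) powr q / q + (b / l) powr p / p"
  by (rule Youngs_inequality) (use assms(1,3-5) p in simp_all)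
 also have "... <= (l * a) powr q + (b / l) powr p"
 proof -
  have "x / c <= x" if "0 <= x" "1 < c" for x c :: real
   using that mult_left_mono[of 1 c x] by (simp add: divide_le_eq)
  then show ?thesis using assms(1) p(1) by (intro add_mono) simp_all
 qed
 also have "... = l powr q * a powr q + l powr (- p) * b powr p"
  using assms(3-5) by (simp add: powr_mult powr_divide powr_minus_divide)
 finally show ?thesis .
qed

lemma young_nn_integral:
 fixes f :: "'a::euclidean_space => 'b::euclidean_space" and g :: "'a => 'c::euclidean_space"
 assumes [measurable]: "f : lmeas" "g : lmeas" "S : sets lebesgue"
  and q: "1 < q" "p = q / (q - 1)" "0 < l"
 shows "(NL x. ind S x * en (norm (f x) * norm (g x)))
  <= en (l powr q) * lpn q S f + en (l powr (- p)) * lpn p S g"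
proof -
 have "en (norm (f x) * norm (g x)) <= en (l powr q) * en (norm (f x) powr q)
  + en (l powr (- p)) * en (norm (g x) powr p)" for x
  using young_scaled[OF q, of "norm (f x)" "norm (g x)"]
  by (simp flip: ennreal_mult ennreal_plus add: ennreal_leI)
 then have "(NL x. ind S x * en (norm (f x) * norm (g x)))
  <= (NL x. en (l powr q) * (ind S x * en (norm (f x) powr q))
  + en (l powr (- p)) * (ind S x * en (norm (g x) powr p)))"
  by (intro nn_integral_mono) (auto simp: indicator_def)
 also have "... = en (l powr q) * lpn q S f + en (l powr (- p)) * lpn p S g"
  unfolding lpn_def by (simp add: nn_integral_add nn_integral_cmult)
 finally show ?thesis .
qed

lemma integrable_inner_dual:
 fixes f g :: "'a::euclidean_space => 'b::euclidean_space"
 assumes [measurable]: "f : lmeas" "g : lmeas"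
  and q: "1 < q" "p = q / (q - 1)" and fin: "lpn q UNIV f < inft" "lpn p UNIV g < inft"
 shows "intg (%x. f x \<bullet> g x)"
proof (rule integrableI_bounded)
 have "(NL x. en (norm (f x \<bullet> g x))) <= (NL x. ind UNIV x * en (norm (f x) * norm (g x)))"
  by (intro nn_integral_mono) (simp add: ennreal_leI Cauchy_Schwarz_ineq2)
 also have "... <= en (1 powr q) * lpn q UNIV f + en (1 powr (- p)) * lpn p UNIV g"
  by (rule young_nn_integral) (use q in auto)
 also have "... < inft" using fin by simp
 finally show "(NL x. en (norm (f x \<bullet> g x))) < inft" .
qed measurable

lemma inner_dual_tendsto:
 fixes f :: "'a::euclidean_space => 'b::euclidean_space"
 assumes [measurable]: "f : lmeas" "!!n. G n : lmeas" "g : lmeas"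
  and q: "1 < q" "p = q / (q - 1)" and fin: "lpn q UNIV f < inft" "lpn p UNIV g < inft" "!!n. lpn p UNIV (G n) < inft"
  and lim: "(%n. lpn p UNIV (%x. G n x - g x)) ~~> 0"
 shows "(%n. LL x. f x \<bullet> G n x) ~~> (LL x. f x \<bullet> g x)"
proof -
 have p: "1 < p" by (rule dual_exponent(1)[OF q])
 have i: "intg (%x. f x \<bullet> g x)" "intg (%x. f x \<bullet> G n x)" for n
  by (rule integrable_inner_dual[OF _ _ q fin(1)]; use fin in simp)+
 have "(%n. en (norm ((LL x. f x \<bullet> G n x) - (LL x. f x \<bullet> g x)))) ~~> 0"
 proof (rule ennreal_tendsto_0I)
  fix e :: real assume e: "e > 0"
  obtain M where M: "lpn q UNIV f = en M" "M >= 0" using fin(1) by (cases "lpn q UNIV f") auto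
  define l where "l = (e / (2 * (M + 1))) powr (1 / q)"
  have l: "l > 0" "l powr q * M <= e / 2" using e M(2) q by (auto simp: l_def powr_powr field_simps)
  define c where "c = l powr (- p)"
  have c: "c > 0" using l by (simp add: c_def)
  have "\<forall>\<^sub>F n in sequentially. lpn p UNIV (%x. G n x - g x) < en (e / (2 * c))"
   by (rule ennreal_tendsto_0D[OF lim]) (use e c in simp)
  then have "\<forall>\<^sub>F n in sequentially. en (norm ((LL x. f x \<bullet> G n x) - (LL x. f x \<bullet> g x))) <= en e"
  proof eventually_elim
   case (elim n)
   have "(LL x. f x \<bullet> G n x) - (LL x. f x \<bullet> g x) = (LL x. f x \<bullet> G n x - f x \<bullet> g x)"
    using i by simp
   then have "en (norm ((LL x. f x \<bullet> G n x) - (LL x. f x \<bullet> g x)))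
    <= (NL x. en (norm (f x \<bullet> G n x - f x \<bullet> g x)))"
    using integral_norm_bound_ennreal[of lebesgue "%x. f x \<bullet> G n x - f x \<bullet> g x"] i by simp
   also have "... <= (NL x. ind UNIV x * en (norm (f x) * norm (G n x - g x)))"
    by (intro nn_integral_mono) (simp add: ennreal_leI Cauchy_Schwarz_ineq2 flip: inner_diff_right)
   also have "... <= en (l powr q) * en M + en c * lpn p UNIV (%x. G n x - g x)"
    unfolding M(1)[symmetric] c_def by (rule young_nn_integral) (use q l in auto)
   also have "... <= en (l powr q) * en M + en c * en (e / (2 * c))"
    using elim by (intro add_left_mono mult_left_mono) auto
   also have "... = en (l powr q * M + c * (e / (2 * c)))"
    using M c e by (simp only: ennreal_plus[symmetric] ennreal_mult[symmetric] less_imp_le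
      add_nonneg_nonneg mult_nonneg_nonneg powr_ge_zero divide_nonneg_nonneg zero_le_numeral)
   also have "... <= en e" using l c by (intro ennreal_leI) simp
   finally show ?case .
  qed
  then show "\<exists>N. ALL n>=N. en (norm ((LL x. f x \<bullet> G n x) - (LL x. f x \<bullet> g x))) <= en e"
   by (simp add: ev_seq)
 qed
 then have "(%n. norm ((LL x. f x \<bullet> G n x) - (LL x. f x \<bullet> g x))) ~~> 0"
  by (simp flip: ennreal_0)
 then show ?thesis using LIM_zero_cancel tendsto_norm_zero_iff by blast
qed

text \<open>The indicator of the ball of radius 2 convolved with \<open>mol 0\<close>, whose kernel
  lives in the unit ball.\<close>

lemma radial_cutoff:
 obtains et :: "real^'n => real" where "Ck 1 et" "!!x. norm x <= 1 ==> et x = 1" "!!x. 3 <= norm x ==> et x = 0"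
proof
 define u :: "real^'n => real" where "u = ind (cball 0 2)"
 have u: "u : L1_loc UNIV"
 proof (rule L1_loc_lpn_UNIV[of _ 2])
  show "u : lmeas" unfolding u_def by (intro borel_measurable_indicator) simp
  have "lpn 2 UNIV u = (NL x. ind (cball (0::real^'n) 2) x)"
   unfolding lpn_def u_def by (intro nn_integral_cong) (auto simp: indicator_def)
  also have "... < inft" using lm_compact[OF compact_cball[of "0::real^'n" 2]] by (simp add: fmeasurable_def)
  finally show "lpn 2 UNIV u < inft" .
 qed simp
 show "Ck 1 (conv u (mol 0))" by (rule Ck_conv[OF u mol_test])
 show "conv u (mol 0) x = 1" if "norm x <= 1" for x
 proof -
  have "\<bar>u y - u x\<bar> <= 0" if "dist x y < 1" for y
  proof -
   have "norm y <= 2" using that \<open>norm x <= 1\<close> norm_triangle_ineq2[of y x] by (simp add: dist_norm norm_minus_commute)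
   then show ?thesis using \<open>norm x <= 1\<close> by (simp add: u_def)
  qed
  then have "\<bar>conv u (mol 0) x - u x\<bar> <= 0" by (rule conv_mol_near[OF u, of _ 1]) auto
  then show ?thesis using that by (simp add: u_def)
 qed
 show "conv u (mol 0) x = 0" if "3 <= norm x" for x
 proof (rule conv_mol_support[of "cball 0 2"])
  fix y :: "real^'n" assume "y : cball 0 2"
  then show "inverse (real (Suc 0)) <= dist x y" using that norm_triangle_ineq2[of x y] by (simp add: dist_norm)
 qed (simp add: u_def)
qed

text \<open>Tested with (w - c n) h n, the identity splits into two parts. The one with h n grad w
  converges to the claim by domination. In the other, |grad h n| <= D / r n, while the Poincare
  inequality on the ball of radius 3 r n bounds w - c n by a multiple of r n, so this product stays
  bounded in L_p. It lives where |x| >= r n, and there the L_q integral of F tends to zero.\<close>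

lemma div_free_smooth:
 fixes F :: "real^'n => real^'n"
 assumes F[measurable]: "F : lmeas" and Ff: "lpn q UNIV F < inft"
  and q: "1 < q" "p = q / (q - 1)"
  and 0: "!!ps. c1_test UNIV ps ==> (LL x. F x \<bullet> grad ps x) = 0"
  and w: "Ck 1 w" and wf: "lpn p UNIV (grad w) < inft"
 shows "(LL x. F x \<bullet> grad w x) = 0"
proof -
 have p: "1 < p" by (rule dual_exponent(1)[OF q])
 obtain et :: "real^'n => real" where et: "Ck 1 et" "!!x. norm x <= 1 ==> et x = 1" "!!x. 3 <= norm x ==> et x = 0"
  using radial_cutoff by blast
 have etK: "\<forall>x. x ~: cball 0 3 --> et x = 0" using et(3) by auto
 obtain E where E: "E > 0" "!!x. \<bar>et x\<bar> <= E"
  using cont_supp_bounded[OF Ck1D(3)[OF et(1)] compact_cball etK] by blast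
 have gm[measurable]: "grad v : lmeas" if "Ck 1 v" for v :: "real^'n => real"
  using continuous_grad[OF that] by (rule cont_lmeas)
 have getK: "grad et x = 0" if "x ~: cball 0 3" for x
  using pd_support[OF closed_cball etK that] by (simp add: vec_eq_iff)
 have "bounded (grad et ` cball 0 3)"
  by (intro compact_imp_bounded compact_cont_image cont_subset[OF continuous_grad[OF et(1)]]) auto
 then obtain D where D: "D > 0" "!!x. x : cball 0 3 ==> norm (grad et x) <= D" by (auto simp: bounded_pos)
 have D': "norm (grad et x) <= D" for x using D getK[of x] by (cases "x : cball 0 3") auto
 have get0: "grad et x = 0" if "norm x < 1" for x
 proof -
  have "(et has_derivative (%h. 0)) (at x)"
   by (rule has_derivative_transform_within_open[of "%x. 1" _ _ _ "ball 0 1"]) (use that et(2) in auto)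
  then show ?thesis by (simp add: vec_eq_iff pd_eqI)
 qed
 define r where "r n = real (Suc n)" for n
 have r: "r n > 0" for n by (simp add: r_def)
 define m where "m n = measure lborel (ball (0::real^'n) (3 * r n))" for n
 define c where "c n = (LB y. w y * (ind (ball 0 (3 * r n)) y / m n))" for n
 define h where "h n x = et ((1 / r n) *R x)" for n x
 have h: "Ck 1 (h n)" "grad (h n) x = (1 / r n) *R grad et ((1 / r n) *R x)" for n x
  unfolding h_def using Ck_scale[OF et(1)] pd_scale[OF Ck1D(1)[OF et(1)]] by (auto simp: vec_eq_iff simp del: Ck.simps)
 have hout: "h n x = 0" if "3 * r n <= norm x" for n x
  unfolding h_def using that r[of n] by (intro et) (simp add: field_simps)
 have hin: "h n x = 1" if "norm x <= r n" for n x
  unfolding h_def using that r[of n] by (intro et) (simp add: field_simps)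
 have wc: "Ck 1 (%x. w x - c n)" for n by (rule Ck_diff[OF w Ck_const])
 have gwc: "grad (%x. w x - c n) = grad w" for n
  using pd_diff[OF Ck1D(1)[OF w], of "%x. c n"] by (auto simp: vec_eq_iff fun_eq_iff)
 have t: "c1_test UNIV (%x. (w x - c n) * h n x)" for n
  by (rule c1_testI[OF Ck_mult[OF wc h(1)] compact_cball[of 0 "3 * r n"]]) (use hout in auto)
 have gt: "grad (%x. (w x - c n) * h n x) x = h n x *R grad w x + (w x - c n) *R grad (h n) x" for n x
  using pd_mult[OF Ck1D(1)[OF wc] Ck1D(1)[OF h(1)]] fun_cong[OF gwc, of n x] by (simp add: vec_eq_iff)
 have [measurable]: "w : lmeas" "h n : lmeas" for n
  using Ck1D(3)[OF w] Ck1D(3)[OF h(1)] by (auto intro: cont_lmeas)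
 note [measurable] = gm[OF w] gm[OF h(1)]
 \<comment> \<open>The 6 is the factor 2 (3 r n) of the Poincare inequality divided by r n. The
   volumes cancel because the mean is over the whole ball, so A is independent of n.\<close>
 define A where "A = en (6 powr p * 2 ^ CARD('n) * D powr p) * lpn p UNIV (grad w)"
 have Af: "A < inft" unfolding A_def using wf by (simp add: ennreal_mult_less_top)
 have P: "lpn p UNIV (%x. (w x - c n) *R grad (h n) x) <= A" for n
 proof -
  have m0: "m n > 0" unfolding m_def using r content_ball_pos by simp
  have "lpn p UNIV (%x. (w x - c n) *R grad (h n) x) = lpn p (ball 0 (3 * r n)) (%x. (w x - c n) *R grad (h n) x)"
  proof -
   \<comment> \<open>The ball of the Poincare inequality is open. On its boundary sphere the
     gradient of the cut-off vanishes by continuity from outside.\<close>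
   have z: "grad (h n) x = 0" if "3 * r n <= norm x" for x
   proof (cases "3 * r n = norm x")
    case True
    have "et ((1 / r n) *R x) = 0" using hout[OF that] by (simp add: h_def)
    have "grad et y = 0" if y: "norm y = 3" for y
    proof -
     have "y : closure (- cball 0 3)"
      using y by (simp add: closure_complement)
     moreover have "closure (- cball 0 3) \<subseteq> {y. grad et y = 0}"
      by (intro closure_minimal closed_Collect_eq continuous_grad[OF et(1)] continuous_on_const) (use getK in auto)
     ultimately show ?thesis by auto
    qed
    then show ?thesis using True r[of n] unfolding h(2) by (simp add: field_simps)
   next
    case False
    then show ?thesis unfolding h(2) using that r[of n] by (subst getK) (auto simp: field_simps)
   qed
   show ?thesis unfolding lpn_def
    by (intro nn_integral_cong) (use z p in \<open>auto simp: indicator_def\<close>)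
  qed
  also have "... <= lpn p (ball 0 (3 * r n)) (%x. (D / r n) *R (w x - c n))"
  proof (rule lpn_mono)
   fix x :: "real^'n"
   have "norm ((w x - c n) *R grad (h n) x) = \<bar>w x - c n\<bar> * (norm (grad et ((1 / r n) *R x)) / r n)"
    unfolding h(2) using r[of n] by simp
   also have "... <= \<bar>w x - c n\<bar> * (D / r n)"
    using D'[of "(1 / r n) *R x"] r[of n] by (intro mult_left_mono divide_right_mono) auto
   finally show "x : ball 0 (3 * r n) ==> x : ball 0 (3 * r n) \<and> norm ((w x - c n) *R grad (h n) x) <= norm ((D / r n) *R (w x - c n))"
    using D(1) r[of n] by (simp add: mult.commute abs_mult)
  qed (use p in simp)
  also have "... = en ((D / r n) powr p) * lpn p (ball 0 (3 * r n)) (%x. w x - c n)"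
   using D(1) r[of n] p by (subst lpn_scaleR) auto
  also have "... <= en ((D / r n) powr p) * (en ((2 * (3 * r n)) powr p * 2 ^ CARD('n) * m n / m n) * lpn p (ball 0 (3 * r n)) (grad w))"
   unfolding c_def m_def by (intro mult_left_mono poincare_ball w p) (use r[of n] in auto)
  also have "... <= en ((D / r n) powr p) * (en ((2 * (3 * r n)) powr p * 2 ^ CARD('n)) * lpn p UNIV (grad w))"
   using m0 p by (intro mult_left_mono mult_mono lpn_mono) auto
  also have "... = A"
  proof -
   have "(D / r n) powr p * ((2 * (3 * r n)) powr p * 2 ^ CARD('n)) = ((D / r n) * (2 * (3 * r n))) powr p * 2 ^ CARD('n)"
    using D(1) r[of n] by (simp add: powr_mult powr_divide)
   also have "(D / r n) * (2 * (3 * r n)) = 6 * D" using r[of n] by simp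
   also have "(6 * D) powr p = 6 powr p * D powr p" using D(1) by (simp add: powr_mult)
   finally have "(D / r n) powr p * ((2 * (3 * r n)) powr p * 2 ^ CARD('n)) = 6 powr p * 2 ^ CARD('n) * D powr p" by simp
   then have "en ((D / r n) powr p) * en ((2 * (3 * r n)) powr p * 2 ^ CARD('n)) = en (6 powr p * 2 ^ CARD('n) * D powr p)"
    by (subst ennreal_mult[symmetric]) auto
   then show ?thesis unfolding A_def by (simp only: mult.assoc[symmetric])
  qed
  finally show ?thesis .
 qed
 have ib: "intg (%x. F x \<bullet> ((w x - c n) *R grad (h n) x))" for n
  by (rule integrable_inner_dual[OF _ _ q Ff]) (use P[of n] Af in auto)
 have ia: "intg (%x. F x \<bullet> grad w x)" by (rule integrable_inner_dual[OF _ _ q Ff wf]) measurable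
 have ia': "intg (%x. h n x * (F x \<bullet> grad w x))" for n
 proof (rule bi_bound)
  show "intg (%x. E * (F x \<bullet> grad w x))" using ia by simp
  show "AE x in lebesgue. norm (h n x * (F x \<bullet> grad w x)) <= norm (E * (F x \<bullet> grad w x))"
   using E by (intro AE_I2) (auto simp: abs_mult h_def intro!: mult_right_mono)
 qed measurable
 have eq: "(LL x. h n x * (F x \<bullet> grad w x)) + (LL x. F x \<bullet> ((w x - c n) *R grad (h n) x)) = 0" for n
  using 0[OF t[of n]] bi_int_add[OF ia'[of n] ib[of n]]
  unfolding gt by (simp add: inner_add_right)
 have l1: "(%n. LL x. h n x * (F x \<bullet> grad w x)) ~~> (LL x. F x \<bullet> grad w x)"
 proof (rule integral_dominated_convergence[where w = "%x. \<bar>E * (F x \<bullet> grad w x)\<bar>"])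
  show "AE x in lebesgue. (%n. h n x * (F x \<bullet> grad w x)) ~~> F x \<bullet> grad w x"
  proof (rule AE_I2, rule tendsto_eventually)
   fix x :: "real^'n"
   obtain N :: nat where "norm x < real N" using reals_Archimedean2 by blast
   then have "h n x = 1" if "n >= N" for n using that by (intro hin) (simp add: r_def)
   then show "\<forall>\<^sub>F n in sequentially. h n x * (F x \<bullet> grad w x) = F x \<bullet> grad w x"
    unfolding ev_seq by auto
  qed
  show "AE x in lebesgue. norm (h n x * (F x \<bullet> grad w x)) <= \<bar>E * (F x \<bullet> grad w x)\<bar>" for n
   using E by (intro AE_I2) (auto simp: abs_mult h_def intro!: mult_right_mono)
  show "intg (%x. \<bar>E * (F x \<bullet> grad w x)\<bar>)" using ia by auto
 qed measurable
 define S where "S n = {x::real^'n. norm x >= r n}" for n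
 have [measurable]: "S n : sets lebesgue" for n
 proof -
  have "closed (S n)" unfolding S_def by (intro closed_Collect_le continuous_intros)
  then show ?thesis by (intro sets_completionI_sets) simp
 qed
 have tail: "(%n. lpn q (S n) F) ~~> 0"
  unfolding lpn_def
 proof (rule nn_integral_tendsto_0)
  show "(NL x. ind UNIV x * en (norm (F x) powr q)) < inft" using Ff by (simp add: lpn_def)
  show "AE x in lebesgue. ind (S n) x * en (norm (F x) powr q) <= ind UNIV x * en (norm (F x) powr q)" for n
   by (intro AE_I2) (auto simp: indicator_def)
  show "AE x in lebesgue. (%n. ind (S n) x * en (norm (F x) powr q)) ~~> 0"
  proof (rule AE_I2, rule tendsto_eventually)
   fix x :: "real^'n"
   obtain N :: nat where "norm x < real N" using reals_Archimedean2 by blast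
   then have "x ~: S n" if "n >= N" for n using that by (simp add: r_def S_def)
   then show "\<forall>\<^sub>F n in sequentially. ind (S n) x * en (norm (F x) powr q) = 0"
    unfolding ev_seq by (intro exI[of _ N]) simp
  qed
 qed measurable
 have "(%n. en (norm (LL x. F x \<bullet> ((w x - c n) *R grad (h n) x)))) ~~> 0"
 proof (rule ennreal_tendsto_0I)
  fix e :: real assume e: "e > 0"
  obtain a where a: "A = en a" "a >= 0" using Af by (cases A) auto
  \<comment> \<open>The weight l comes first and reduces the bounded factor to e / 2; then n is
    taken large by \<open>tail\<close>.\<close>
  define l where "l = (e / (2 * (a + 1))) powr (- 1 / p)"
  have l: "l > 0" "l powr (- p) * a <= e / 2" using e a(2) p by (auto simp: l_def powr_powr field_simps)
  define d where "d = l powr q"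
  have d: "d > 0" using l by (simp add: d_def)
  have "\<forall>\<^sub>F n in sequentially. lpn q (S n) F < en (e / (2 * d))"
   by (rule ennreal_tendsto_0D[OF tail]) (use e d in simp)
  then have "\<forall>\<^sub>F n in sequentially. en (norm (LL x. F x \<bullet> ((w x - c n) *R grad (h n) x))) <= en e"
  proof eventually_elim
   case (elim n)
   have "en (norm (LL x. F x \<bullet> ((w x - c n) *R grad (h n) x))) <=
    (NL x. en (norm (F x \<bullet> ((w x - c n) *R grad (h n) x))))"
    by (rule integral_norm_bound_ennreal[OF ib])
   also have "... <= (NL x. ind (S n) x * en (norm (F x) * norm ((w x - c n) *R grad (h n) x)))"
   proof (rule nn_integral_mono)
    fix x :: "real^'n"
    show "en (norm (F x \<bullet> ((w x - c n) *R grad (h n) x))) <= ind (S n) x * en (norm (F x) * norm ((w x - c n) *R grad (h n) x))"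
    proof (cases "x : S n")
     case True
     then show ?thesis by (simp only: indicator_simps mult_1_left real_norm_def) (intro ennreal_leI Cauchy_Schwarz_ineq2)
    next
     case False
     then have "norm ((1 / r n) *R x) < 1" using r[of n] by (simp add: S_def field_simps)
     then have "grad (h n) x = 0" unfolding h(2) by (simp add: get0)
     then show ?thesis by simp
    qed
   qed
   also have "... <= en d * lpn q (S n) F + en (l powr (- p)) * lpn p (S n) (%x. (w x - c n) *R grad (h n) x)"
    unfolding d_def by (rule young_nn_integral) (use q l in auto)
   also have "... <= en d * en (e / (2 * d)) + en (l powr (- p)) * en a"
   proof (intro add_mono mult_left_mono)
    have "lpn p (S n) (%x. (w x - c n) *R grad (h n) x) <= lpn p UNIV (%x. (w x - c n) *R grad (h n) x)"
     using p by (intro lpn_mono) auto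
    then show "lpn p (S n) (%x. (w x - c n) *R grad (h n) x) <= en a" using P[of n] a by simp
   qed (use elim in auto)
   also have "... = en (d * (e / (2 * d)) + l powr (- p) * a)"
    using a d e by (simp only: ennreal_plus[symmetric] ennreal_mult[symmetric] less_imp_le
      add_nonneg_nonneg mult_nonneg_nonneg powr_ge_zero divide_nonneg_nonneg zero_le_numeral)
   also have "... <= en e" using l d by (intro ennreal_leI) simp
   finally show ?case .
  qed
  then show "\<exists>N. ALL n>=N. en (norm (LL x. F x \<bullet> ((w x - c n) *R grad (h n) x))) <= en e"
   by (simp add: ev_seq)
 qed
 then have "(%n. norm (LL x. F x \<bullet> ((w x - c n) *R grad (h n) x))) ~~> 0"
  by (simp flip: ennreal_0)
 then have l2: "(%n. LL x. F x \<bullet> ((w x - c n) *R grad (h n) x)) ~~> 0"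
  by (rule tendsto_norm_zero_cancel)
 have "(%n. 0) ~~> (LL x. F x \<bullet> grad w x) + 0"
  using tendsto_add[OF l1 l2] unfolding eq .
 then show ?thesis by (simp add: LIMSEQ_const_iff)
qed

lemma mollified_grad_tendsto:
 fixes g :: "real^'n => real^'n"
 assumes g: "has_weak_grad UNIV u g" "g : lmeas" "lpn p UNIV g < inft" and p: "1 < p"
 shows "(%n. lpn p UNIV (%x. grad (conv u (mol n)) x - g x)) ~~> 0" "Ck 1 (conv u (mol n))"
proof -
 have u: "u : L1_loc UNIV" using g(1) by (simp add: has_weak_grad_def)
 show c: "Ck 1 (conv u (mol n))" for n by (rule Ck_conv[OF u mol_test])
 have [measurable]: "grad (conv u (mol n)) : lmeas" for n
  by (rule cont_lmeas[OF continuous_grad[OF c]])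
 note [measurable] = g(2)
 have gim: "(%x. g x $ i) : lmeas" for i by (rule borel_measurable_nth[OF g(2)])
 have gif: "lpn p UNIV (%x. g x $ i) < inft" for i
  using lpn_componentwise(2)[OF g(2) _ , of UNIV p i] g(3) p by (auto intro: order_le_less_trans)
 have "(%n. lpn p UNIV (%x. conv (%x. g x $ i) (mol n) x - g x $ i)) ~~> 0" for i
  by (rule conv_Lp_tendsto[OF gim gif p])
 then have "(%n. lpn p UNIV (%x. (grad (conv u (mol n)) x - g x) $ i)) ~~> 0" for i
  by (simp add: pd_conv_weak[OF g(1) mol_test])
 then have s: "(%n. \<Sum>i\<in>UNIV. lpn p UNIV (%x. (grad (conv u (mol n)) x - g x) $ i)) ~~> 0"
  by (intro tendsto_null_sum)
 show "(%n. lpn p UNIV (%x. grad (conv u (mol n)) x - g x)) ~~> 0"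
  by (rule ennreal_tendsto_0_le[OF ennreal_tendsto_0_cmult[OF s, of "en (real CARD('n) powr p)"]])
   (use p in \<open>auto intro!: always_eventually lpn_componentwise(1) simp del: vector_minus_component\<close>)
qed

lemma lpn_finite_diffD:
 assumes "f : lmeas" "g : lmeas" "S : sets lebesgue" "1 < p"
  "lpn p S (%x. f x - g x) < inft" "lpn p S g < inft"
 shows "lpn p S f < inft"
proof -
 have "lpn p S (%x. (f x - g x) + g x) <= en (2 powr p) * (lpn p S (%x. f x - g x) + lpn p S g)"
  by (rule lpn_add_le2) (use assms in auto)
 also have "... < inft" using assms by (simp add: ennreal_mult_less_top)
 finally show ?thesis by simp
qed

lemma div_free_hatH1:
 fixes F g :: "real^'n => real^'n"
 assumes F: "F : lmeas" and Ff: "lpn q UNIV F < inft"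
  and q: "1 < q" "p = q / (q - 1)"
  and 0: "!!ps. c1_test UNIV ps ==> (LL x. F x \<bullet> grad ps x) = 0"
  and g: "has_weak_grad UNIV u g" "g : lmeas" "lpn p UNIV g < inft"
 shows "(LL x. F x \<bullet> g x) = 0"
proof -
 have p: "1 < p" by (rule dual_exponent(1)[OF q])
 note lim = mollified_grad_tendsto[OF g p]
 have gm: "grad (conv u (mol n)) : lmeas" for n
  by (rule cont_lmeas[OF continuous_grad[OF lim(2)]])
 \<comment> \<open>From N on, comparison with g shows that the mollified gradient has a finite L_p
   integral; the sequence is shifted accordingly.\<close>
 obtain N where N: "!!n. n >= N ==> lpn p UNIV (%x. grad (conv u (mol n)) x - g x) < en 1"
  using ennreal_tendsto_0D[OF lim(1), of 1] unfolding ev_seq by auto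
 have fin: "lpn p UNIV (grad (conv u (mol (n + N)))) < inft" for n
  by (rule lpn_finite_diffD[OF gm g(2) _ p _ g(3)]) (use N[of "n + N"] in \<open>auto intro: less_trans\<close>)
 have "(%n. LL x. F x \<bullet> grad (conv u (mol (n + N))) x) ~~> (LL x. F x \<bullet> g x)"
  by (rule inner_dual_tendsto[OF F gm g(2) q Ff g(3) fin LIMSEQ_ignore_initial_segment[OF lim(1)]])
 moreover have "(LL x. F x \<bullet> grad (conv u (mol (n + N))) x) = 0" for n
  by (rule div_free_smooth[OF F Ff q 0 lim(2) fin])
 ultimately show ?thesis by (simp add: LIMSEQ_const_iff)
qed

section \<open>Completeness and closedness of gradients\<close>

text \<open>The Riesz-Fischer argument with a prescribed rate. The weight 2^(pj) against the rate
  4^(-pj) leaves a convergent series of integrals, so almost everywhere on S the increments decay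
  like 2^(-j); Fatou's lemma gives the error bound. Writing the limit as \<open>lim\<close> makes it
  the same function for every S.\<close>

lemma lpn_complete:
 fixes v :: "nat => 'a::euclidean_space => 'b::euclidean_space"
 assumes v[measurable]: "!!j. v j : lmeas" and S[measurable]: "S : sets lebesgue"
  and p: "1 < p" and C: "0 <= C"
  and cauchy: "!!j l. j <= l ==> lpn p S (%x. v l x - v j x) <= en (C * 4 powr (- (p * real j)))"
 shows "lpn p S (%x. lim (%j. v j x) - v j x) <= en (C * 4 powr (- (p * real j)))"
proof -
 define D where "D j x = ind S x * en (2 powr (p * real j) * norm (v (Suc j) x - v j x) powr p)" for j x
 have [measurable]: "D j : lmeas" for j unfolding D_def by measurable
 have ID: "(NL x. D j x) <= en (C * (2 powr (- p)) ^ j)" for j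
 proof -
  have "(NL x. D j x) = en (2 powr (p * real j)) * lpn p S (%x. v (Suc j) x - v j x)"
   unfolding D_def lpn_def by (subst nn_integral_cmult[symmetric]) (auto simp: ennreal_mult mult_ac)
  also have "... <= en (2 powr (p * real j)) * en (C * 4 powr (- (p * real j)))"
   by (intro mult_left_mono cauchy) auto
  also have "... = en (2 powr (p * real j) * (C * 4 powr (- (p * real j))))"
   by (simp add: ennreal_mult')
  also have "2 powr (p * real j) * (C * 4 powr (- (p * real j))) = C * (2 powr (- p)) ^ j"
  proof -
   have "(4::real) powr (- (p * real j)) = 2 powr (- (p * real j)) * 2 powr (- (p * real j))"
    using powr_mult[of 2 2 "- (p * real j)"] by simp
   moreover have "2 powr (p * real j) * 2 powr (- (p * real j)) = (1::real)" by (simp flip: powr_add)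
   moreover have "(2 powr (- p)) ^ j = (2::real) powr (- (p * real j))" by (simp add: powr_powr flip: powr_realpow)
   ultimately show ?thesis by (metis mult.assoc mult.commute mult_1)
  qed
  finally show ?thesis .
 qed
 have geo: "summable (%j. C * (2 powr (- p)) ^ j)"
  using p by (intro summable_mult summable_geometric) (simp add: powr_less_one)
 have "(NL x. (\<Sum>j. D j x)) = (\<Sum>j. \<integral>\<^sup>+x. D j x \<partial>lebesgue)"
  by (rule nn_integral_suminf) measurable
 also have "... <= (\<Sum>j. en (C * (2 powr (- p)) ^ j))"
  by (intro suminf_le ID) auto
 also have "... = en (\<Sum>j. C * (2 powr (- p)) ^ j)"
  using C by (intro suminf_ennreal2 geo) auto
 also have "... < inft" by simp
 finally have "AE x in lebesgue. (\<Sum>j. D j x) ~= \<infinity>"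
  by (intro nn_integral_PInf_AE) auto
 then have conv: "AE x in lebesgue. x : S --> convergent (%j. v j x)"
 proof eventually_elim
  case (elim x)
  show ?case
  proof
   assume x: "x : S"
   obtain M where M: "(\<Sum>j. D j x) = en M" "M >= 0" using elim by (cases "\<Sum>j. D j x") auto
   define d where "d j = v (Suc j) x - v j x" for j
   have "norm (d j) <= M powr (1 / p) * (1 / 2) ^ j" for j
   proof -
    have "D j x <= (\<Sum>j. D j x)" using sum_le_suminf[of "%j. D j x" "{j}"] by simp
    then have "2 powr (p * real j) * norm (d j) powr p <= M"
     using x M by (simp add: D_def d_def)
    moreover have "2 powr (p * real j) * norm (d j) powr p = (2 ^ j * norm (d j)) powr p"
    proof -
     have "2 powr (p * real j) = (2 ^ j :: real) powr p" by (simp add: powr_powr mult.commute flip: powr_realpow)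
     then show ?thesis by (simp add: powr_mult)
    qed
    ultimately have "((2 ^ j * norm (d j)) powr p) powr (1 / p) <= M powr (1 / p)"
     using p by (intro powr_mono2) auto
    then have "2 ^ j * norm (d j) <= M powr (1 / p)" using p by (simp add: powr_powr)
    then show ?thesis by (simp add: field_simps power_divide)
   qed
   moreover have "summable (%j. M powr (1 / p) * (1 / 2) ^ j)"
    by (intro summable_mult summable_geometric) simp
   ultimately have "summable d" by (rule summable_comparison_test'[rotated])
   then have "convergent (%n. v 0 x + (\<Sum>j<n. d j))"
    by (intro convergent_add convergent_const) (simp add: summable_iff_convergent)
   moreover have "v 0 x + (\<Sum>j<n. d j) = v n x" for n
    unfolding d_def by (subst sum_lessThan_telescope) simp
   ultimately show "convergent (%j. v j x)" by simp
  qed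
 qed
 define u where "u x = lim (%j. v j x)" for x
 have [measurable]: "u : lmeas" unfolding u_def by (rule borel_measurable_lim_metric) measurable
 define f where "f l x = ind S x * en (norm (v l x - v j x) powr p)" for l x
 have [measurable]: "f l : lmeas" for l unfolding f_def by measurable
 have "lpn p S (%x. u x - v j x) = (NL x. liminf (%l. f l x))"
  unfolding lpn_def
 proof (rule nn_integral_cong_AE)
  show "AE x in lebesgue. ind S x * en (norm (u x - v j x) powr p) = liminf (%l. f l x)"
   using conv
  proof eventually_elim
   case (elim x)
   show ?case
   proof (cases "x : S")
    case True
    then have "(%l. v l x) ~~> u x" using elim by (simp add: u_def convergent_LIMSEQ_iff)
    then have "(%l. f l x) ~~> ind S x * en (norm (u x - v j x) powr p)"
     unfolding f_def using True p by (auto intro!: tendsto_intros tendsto_powr')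
    then show ?thesis by (simp add: lim_imp_Liminf)
   next
    case False
    then show ?thesis by (simp add: f_def Liminf_const)
   qed
  qed
 qed
 also have "... <= liminf (%l. \<integral>\<^sup>+x. f l x \<partial>lebesgue)" by (rule nn_integral_liminf) measurable
 also have "... <= en (C * 4 powr (- (p * real j)))"
 proof -
  have "\<forall>\<^sub>F l in sequentially. (NL x. f l x) <= en (C * 4 powr (- (p * real j)))"
   using cauchy[of j] unfolding ev_seq f_def lpn_def by blast
  then have "liminf (%l. \<integral>\<^sup>+x. f l x \<partial>lebesgue) <= liminf (%l::nat. en (C * 4 powr (- (p * real j))))"
   by (rule Liminf_mono)
  then show ?thesis by (simp add: Liminf_const)
 qed
 finally show ?thesis unfolding u_def .
qed

lemma four_powr_tendsto: "1 < p ==> (%j. en (C * 4 powr (- (p * real j)))) ~~> 0"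
proof -
 assume p: "1 < p"
 have "(4::real) powr (- (p * real j)) = (4 powr (- p)) ^ j" for j by (simp add: powr_powr flip: powr_realpow)
 then have "(%j. (4::real) powr (- (p * real j))) ~~> 0"
  using p LIMSEQ_power_zero[of "(4::real) powr (- p)"] by (simp add: powr_less_one)
 then have "(%j. en (C * 4 powr (- (p * real j)))) ~~> ennreal (C * 0)"
  by (intro tendsto_ennrealI tendsto_mult tendsto_const)
 then show ?thesis by simp
qed

text \<open>A limit of gradients still has to be given a potential. Mollification makes the
  approximants C^1, subtracting the mean over the unit ball fixes the additive constants, and the
  Poincare inequality on the balls of radius n + 1 turns the Cauchy property of the gradients into
  one of the potentials.\<close>

lemma weak_grads_closed:
 fixes g :: "real^'n => real^'n"
 assumes g[measurable]: "g : lmeas" and gf: "lpn p UNIV g < inft" and p: "1 < p"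
  and approx: "!!e::real. e > 0 ==> \<exists>u g'. has_weak_grad UNIV u g' \<and> g' : lmeas \<and>
   lpn p UNIV (%x. g' x - g x) <= en e"
 shows "\<exists>u. u : lmeas \<and> (\<forall>K. compact K --> lpn p K u < inft) \<and> has_weak_grad UNIV u g"
proof -
 have "\<exists>w. Ck 1 w \<and> lpn p UNIV (%x. grad w x - g x) <= en e" if e: "e > 0" for e :: real
 proof -
  define d where "d = e / (2 * 2 powr p)"
  have d: "d > 0" using e by (simp add: d_def)
  obtain u g' where u: "has_weak_grad UNIV u g'" "g' : lmeas" "lpn p UNIV (%x. g' x - g x) <= en d"
   using approx[OF d] by blast
  note [measurable] = u(2)
  have g'f: "lpn p UNIV g' < inft"
   by (rule lpn_finite_diffD[OF u(2) g _ p _ gf]) (use u(3) in \<open>auto intro: order_le_less_trans\<close>)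
  note lim = mollified_grad_tendsto[OF u(1,2) g'f p]
  obtain n where n: "lpn p UNIV (%x. grad (conv u (mol n)) x - g' x) < en d"
   using eventually_happens[OF ennreal_tendsto_0D[OF lim(1) d]] by auto
  have [measurable]: "grad (conv u (mol n)) : lmeas"
   by (rule cont_lmeas[OF continuous_grad[OF lim(2)]])
  have "lpn p UNIV (%x. grad (conv u (mol n)) x - g x) <= en (2 powr p) * (lpn p UNIV (%x. grad (conv u (mol n)) x - g' x) + lpn p UNIV (%x. g' x - g x))"
   by (rule lpn_triangle) (use p in auto)
  also have "... <= en (2 powr p) * (en d + en d)"
   using n u(3) by (intro mult_left_mono add_mono) auto
  also have "... = en (2 powr p * (d + d))"
   using d by (simp only: ennreal_plus[symmetric] ennreal_mult[symmetric] less_imp_le add_nonneg_nonneg powr_ge_zero)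
  also have "2 powr p * (d + d) = e" by (simp add: d_def)
  finally show ?thesis using lim(2) by blast
 qed
 then have "\<forall>j. \<exists>w. Ck 1 w \<and> lpn p UNIV (%x. grad w x - g x) <= en (4 powr (- (p * real j)))" by simp
 then obtain w where w: "!!j. Ck 1 (w j)" "!!j. lpn p UNIV (%x. grad (w j) x - g x) <= en (4 powr (- (p * real j)))"
  by metis
 have [measurable]: "grad (w j) : lmeas" "w j : lmeas" for j
  using continuous_grad[OF w(1)] Ck1D(3)[OF w(1)] by (auto intro: cont_lmeas)
 define m where "m = measure lborel (ball (0::real^'n) 1)"
 define c where "c j = (LB y. w j y * (ind (ball 0 1) y / m))" for j
 define v where "v j x = w j x - c j" for j x
 have vc: "Ck 1 (v j)" for j unfolding v_def by (rule Ck_diff[OF w(1) Ck_const])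
 have gv: "grad (v j) = grad (w j)" for j
  unfolding v_def using pd_diff[OF Ck1D(1)[OF w(1)], of "%x. c j"] by (auto simp: vec_eq_iff fun_eq_iff)
 have [measurable]: "v j : lmeas" for j unfolding v_def by measurable
 have iw: "integrable lborel (%y. w j y * (ind (ball 0 1) y / m))" for j
 proof -
  obtain b where b: "0 <= b" "!!x. x : cball 0 1 ==> \<bar>w j x\<bar> <= b"
   using cont_bounded[OF Ck1D(3)[OF w(1)] compact_cball] by blast
  show ?thesis
  proof (rule bi_bound)
   show "integrable lborel (%y::real^'n. (b / m) * ind (ball 0 1) y)"
    using emeasure_lborel_ball_finite[of "0::real^'n" 1] by (intro integrable_mult_right) simp
   have "w j : borel_measurable lborel" using cont_bmeas[OF Ck1D(3)[OF w(1)]] by simp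
   then show "(%y. w j y * (ind (ball 0 1) y / m)) : borel_measurable lborel"
    by (intro borel_measurable_times borel_measurable_divide borel_measurable_const borel_measurable_indicator) auto
   have "\<bar>w j y\<bar> / \<bar>m\<bar> <= b / \<bar>m\<bar>" if "y : ball 0 1" for y
    using b(2)[of y] that by (intro divide_right_mono) auto
   then show "AE y in lborel. norm (w j y * (ind (ball 0 1) y / m)) <= norm ((b / m) * ind (ball 0 1) y)"
    using b(1) by (intro AE_I2) (auto simp: indicator_def)
  qed
 qed
 define Q where "Q n = (2 * real (Suc n)) powr p * 2 ^ CARD('n) * measure lborel (ball (0::real^'n) (real (Suc n))) / m" for n
 have Q: "0 <= Q n" for n by (simp add: Q_def m_def)
 define E where "E n = Q n * (2 powr p * 2)" for n
 have cauchy: "lpn p (ball 0 (real (Suc n))) (%x. v l x - v j x) <= en (E n * 4 powr (- (p * real j)))"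
  if jl: "j <= l" for n j l
 proof -
  have d: "Ck 1 (%x. w l x - w j x)" by (rule Ck_diff[OF w(1) w(1)])
  have gd: "grad (%x. w l x - w j x) x = grad (w l) x - grad (w j) x" for x
   by (simp add: vec_eq_iff pd_diff[OF Ck1D(1)[OF w(1)] Ck1D(1)[OF w(1)]])
  have cc: "(LB y. (w l y - w j y) * (ind (ball 0 1) y / m)) = c l - c j"
   unfolding c_def left_diff_distrib by (rule bi_int_diff[OF iw iw])
  have "lpn p (ball 0 (real (Suc n))) (%x. v l x - v j x) = lpn p (ball 0 (real (Suc n))) (%x. (w l x - w j x) - (c l - c j))"
   by (simp add: v_def algebra_simps)
  also have "... <= en (Q n) * lpn p (ball 0 (real (Suc n))) (%x. grad (w l) x - grad (w j) x)"
   using poincare_ball[OF d p, of 1 "real (Suc n)"] unfolding cc[unfolded m_def] gd[abs_def] Q_def m_def by simp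
  also have "... <= en (Q n) * en (2 powr p * 2 * 4 powr (- (p * real j)))"
  proof (rule mult_left_mono)
   have "lpn p (ball 0 (real (Suc n))) (%x. grad (w l) x - grad (w j) x) <= lpn p UNIV (%x. grad (w l) x - grad (w j) x)"
    using p by (intro lpn_mono) auto
   also have "... <= en (2 powr p) * (lpn p UNIV (%x. grad (w l) x - g x) + lpn p UNIV (%x. g x - grad (w j) x))"
    by (rule lpn_triangle) (use p in auto)
   also have "... <= en (2 powr p) * (en (4 powr (- (p * real j))) + en (4 powr (- (p * real j))))"
   proof (intro mult_left_mono add_mono)
    have "(4::real) powr (- (p * real l)) <= 4 powr (- (p * real j))" using jl p by (intro powr_mono) auto
    then show "lpn p UNIV (%x. grad (w l) x - g x) <= en (4 powr (- (p * real j)))"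
     using w(2)[of l] by (meson ennreal_leI order_trans)
    show "lpn p UNIV (%x. g x - grad (w j) x) <= en (4 powr (- (p * real j)))"
     using w(2)[of j] unfolding lpn_diff_commute[of p UNIV g] .
   qed auto
   also have "... = en (2 powr p * 2 * 4 powr (- (p * real j)))"
   proof -
    have "en (2 powr p) * (en t + en t) = en (2 powr p * 2 * t)" if "0 <= t" for t
     using that by (subst ennreal_plus[symmetric]) (simp_all add: ennreal_mult'[symmetric] mult.assoc)
    then show ?thesis by simp
   qed
   finally show "lpn p (ball 0 (real (Suc n))) (%x. grad (w l) x - grad (w j) x) <= en (2 powr p * 2 * 4 powr (- (p * real j)))" .
  qed simp
  also have "... = en (E n * 4 powr (- (p * real j)))"
   using Q[of n] by (simp add: E_def mult.assoc flip: ennreal_mult)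
  finally show ?thesis .
 qed
 define u where "u x = lim (%j. v j x)" for x
 have um[measurable]: "u : lmeas" unfolding u_def by (rule borel_measurable_lim_metric) measurable
 have B: "lpn p (ball 0 (real (Suc n))) (%x. u x - v j x) <= en (E n * 4 powr (- (p * real j)))" for n j
  unfolding u_def by (rule lpn_complete[OF _ _ p _ cauchy]) (use Q[of n] in \<open>auto simp: E_def\<close>)
 have sub: "\<exists>n. K \<subseteq> ball 0 (real (Suc n))" if K: "compact K" for K :: "(real^'n) set"
 proof -
  obtain b where b: "!!x. x : K ==> norm x <= b" using compact_imp_bounded[OF K] unfolding bounded_iff by blast
  obtain n :: nat where "b < real n" using reals_Archimedean2 by blast
  then show ?thesis using b by (intro exI[of _ n]) force
 qed
 have lim: "(%j. lpn p K (%x. v j x - u x)) ~~> 0" if K: "compact K" for K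
 proof -
  obtain n where n: "K \<subseteq> ball 0 (real (Suc n))" using sub[OF K] by blast
  show ?thesis
  proof (rule ennreal_tendsto_0_le[OF four_powr_tendsto[OF p, of "E n"]], rule always_eventually, rule allI)
   fix j
   have "lpn p K (%x. v j x - u x) <= lpn p (ball 0 (real (Suc n))) (%x. u x - v j x)"
    using n p by (intro lpn_mono) (auto simp: norm_minus_commute abs_minus_commute)
   then show "lpn p K (%x. v j x - u x) <= en (E n * 4 powr (- (p * real j)))" using B order_trans by blast
  qed
 qed
 have uf: "lpn p K u < inft" if K: "compact K" for K
 proof -
  have [measurable]: "K : sets lebesgue" using lm_compact[OF K] by blast
  obtain n where n: "K \<subseteq> ball 0 (real (Suc n))" using sub[OF K] by blast
  have "lpn p K (%x. u x - v 0 x) <= lpn p (ball 0 (real (Suc n))) (%x. u x - v 0 x)"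
   using n p by (intro lpn_mono) auto
  also have "... < inft" using B[of n 0] by (rule order_le_less_trans) simp
  finally show ?thesis
   using lpn_continuous_finite[OF Ck1D(3)[OF vc] K] p by (intro lpn_finite_diffD[of u "v 0"]) auto
 qed
 have "has_weak_grad UNIV u g"
 proof (rule has_weak_grad_limit[where p = p and U = v and G = "%j. grad (v j)"])
  show "has_weak_grad UNIV (v j) (grad (v j))" for j
   using c1_weak_grad[OF vc, of UNIV] by (simp add: grad_def[abs_def])
  show "u : L1_loc UNIV" by (rule L1_locI_lpn[of _ _ p]) (use uf um p in \<open>auto intro: meas_restrict1\<close>)
  show "g : L1_loc UNIV" by (rule L1_loc_lpn_UNIV[OF g gf]) (use p in simp)
  show "(%j. lpn p K (%x. v j x - u x)) ~~> 0" if "compact K" for K by (rule lim[OF that])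
  show "(%j. lpn p K (%x. grad (v j) x $ i - g x $ i)) ~~> 0" if "compact K" for K i
  proof (rule ennreal_tendsto_0_le[OF four_powr_tendsto[OF p, of 1]], rule always_eventually, rule allI)
   fix j
   have "lpn p K (%x. grad (v j) x $ i - g x $ i) <= lpn p UNIV (%x. grad (w j) x - g x)"
    unfolding gv using p component_le_norm_cart[of "grad (w j) _ - g _" i] by (intro lpn_mono) auto
   then show "lpn p K (%x. grad (v j) x $ i - g x $ i) <= en (1 * 4 powr (- (p * real j)))"
    using w(2)[of j] by (simp add: order_trans)
  qed
 qed (use p in simp)
 with uf um show ?thesis by blast
qed

text \<open>The mollifications of u have zero gradient, so each is a constant c n. They converge to
  u locally in L_p, whence c n is a Cauchy sequence and its limit is u almost everywhere.\<close>

lemma weak_grad_zero_constant: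
 fixes u :: "real^'n => real"
 assumes g: "has_weak_grad UNIV u g" and g0: "AE x in lebesgue. g x = 0" and p: "1 < p"
  and uf: "!!K. compact K ==> lpn p K u < inft"
 shows "\<exists>c. AE x in lebesgue. u x = c"
proof -
 have u: "u : L1_loc UNIV" using g by (simp add: has_weak_grad_def)
 have um[measurable]: "u : lmeas" by (rule L1_loc_measurable[OF u])
 define c where "c n = conv u (mol n) 0" for n
 have c: "conv u (mol n) x = c n" for n x
 proof -
  have "pd i (conv u (mol n)) y = 0" for i y
   unfolding pd_conv_weak[OF g mol_test] conv_def
   using g0 by (intro integral_eq_zero_AE) (auto elim: eventually_mono)
  then have "(conv u (mol n) has_derivative (%h. 0)) (at y)" for y
   using has_derivative_pd[OF Ck1D(1)[OF Ck_conv[OF u mol_test]], of n y] by simp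
  then have "\<exists>c. \<forall>x\<in>UNIV. conv u (mol n) x = c"
   by (intro has_derivative_zero_constant[of UNIV]) auto
  then show ?thesis unfolding c_def by auto
 qed
 have lim: "(%n. lpn p (cball 0 R) (%x. c n - u x)) ~~> 0" for R :: real
 proof -
  \<comment> \<open>\<open>conv_Lp_tendsto\<close> asks for global integrability. Cutting u off at
    radius R + 1 changes nothing on the ball of radius R, because the kernels have radius at most
    1.\<close>
  define u1 where "u1 y = ind (cball 0 (R + 1)) y * u y" for y
  have [measurable]: "u1 : lmeas"
   unfolding u1_def by (intro borel_measurable_times borel_measurable_indicator um) simp
  have "lpn p UNIV u1 <= lpn p (cball 0 (R + 1)) u"
   unfolding lpn_def u1_def by (intro nn_integral_mono) (use p in \<open>auto simp: indicator_def\<close>)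
  also have "... < inft" by (rule uf) simp
  finally have "(%n. lpn p UNIV (%x. conv u1 (mol n) x - u1 x)) ~~> 0"
   by (intro conv_Lp_tendsto p) auto
  moreover have "conv u1 (mol n) x = c n" if x: "x : cball 0 R" for n x
  proof -
   have "u1 y * mol n (x - y) = u y * mol n (x - y)" for y
   proof (cases "y : cball 0 (R + 1)")
    case False
    then have "1 <= norm (x - y)" using x norm_triangle_sub[of y x] by (auto simp: norm_minus_commute)
    moreover have "inverse (real (Suc n)) <= 1" by (simp add: inverse_eq_divide)
    ultimately have "mol n (x - y) = 0" by (intro mol_zero) linarith
    then show ?thesis by simp
   qed (simp add: u1_def)
   then have "conv u1 (mol n) x = conv u (mol n) x" unfolding conv_def by presburger
   then show ?thesis using c[of n x] by simp
  qed
  then have "lpn p (cball 0 R) (%x. c n - u x) <= lpn p UNIV (%x. conv u1 (mol n) x - u1 x)" for n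
   using p by (intro lpn_mono) (auto simp: u1_def)
  ultimately show ?thesis by (elim ennreal_tendsto_0_le) (auto intro: always_eventually)
 qed
 have "Cauchy c"
  unfolding Cauchy_def dist_real_def
 proof (intro allI impI)
  fix e :: real assume e: "e > 0"
  define m where "m = measure lebesgue (cball (0::real^'n) 1)"
  have m: "m > 0" unfolding m_def using content_cball_pos[of 1 "0::real^'n"] by simp
  have em: "emeasure lebesgue (cball (0::real^'n) 1) = en m"
   using lm_compact[OF compact_cball[of "0::real^'n" 1]] by (simp add: m_def emeasure_eq_measure2)
  define d where "d = e powr p * m / (2 * 2 powr p)"
  have d: "d > 0" using e m by (simp add: d_def)
  obtain N where N: "!!n. n >= N ==> lpn p (cball 0 1) (%x. c n - u x) < en d"
   using ennreal_tendsto_0D[OF lim d] unfolding ev_seq by blast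
  have "\<bar>c k - c n\<bar> < e" if kn: "k >= N" "n >= N" for k n
  proof -
   have "en (\<bar>c k - c n\<bar> powr p * m) = lpn p (cball (0::real^'n) 1) (%x. c k - c n)"
    unfolding lpn_def using em m by (subst nn_integral_multc) (auto simp: ennreal_mult' mult.commute intro!: borel_measurable_indicator)
   also have "... <= en (2 powr p) * (lpn p (cball 0 1) (%x. c k - u x) + lpn p (cball 0 1) (%x. u x - c n))"
    by (rule lpn_triangle) (use p in auto)
   also have "... < en (2 powr p) * (en d + en d)"
    using N[OF kn(1)] N[OF kn(2)] unfolding lpn_diff_commute[of p _ u]
    by (intro ennreal_mult_strict_left_mono add_strict_mono) auto
   also have "... = en (2 powr p * (d + d))"
    using d by (simp only: ennreal_plus[symmetric] ennreal_mult[symmetric] less_imp_le add_nonneg_nonneg powr_ge_zero)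
   also have "2 powr p * (d + d) = e powr p * m" by (simp add: d_def)
   finally have "\<bar>c k - c n\<bar> powr p * m < e powr p * m" using m by (subst (asm) ennreal_less_iff) auto
   then have "\<bar>c k - c n\<bar> powr p < e powr p" using m by simp
   then show ?thesis using p e by (smt (verit) powr_mono2)
  qed
  then show "\<exists>N. ALL k>=N. ALL n>=N. \<bar>c k - c n\<bar> < e" by blast
 qed
 then obtain a where a: "c ~~> a" using Cauchy_convergent convergent_def by blast
 have "AE x in lebesgue. x : cball 0 (real k) --> u x = a" for k
 proof -
  have [measurable]: "cball (0::real^'n) (real k) : sets lebesgue" by simp
  have ul: "uniform_limit (cball (0::real^'n) (real k)) (%n x. c n) (%x. a) sequentially"
   using a unfolding uniform_limit_iff by (auto dest: tendstoD elim: eventually_mono)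
  have 1: "(%n. lpn p (cball (0::real^'n) (real k)) (%x. c n - a)) ~~> 0"
   by (rule uniform_imp_lpn_tendsto[OF lmeasurable_cball _ ul]) (use p in simp)
  have "(%n. en (2 powr p) * (lpn p (cball 0 (real k)) (%x. u x - c n) + lpn p (cball (0::real^'n) (real k)) (%x. c n - a))) ~~> 0"
   using tendsto_add[OF lim[of "real k"] 1] unfolding lpn_diff_commute[of p _ u]
   by (intro ennreal_tendsto_0_cmult) auto
  then have "(%n::nat. lpn p (cball 0 (real k)) (%x. u x - a)) ~~> 0"
   by (rule ennreal_tendsto_0_le) (use p in \<open>auto intro!: always_eventually lpn_triangle\<close>)
  then have "lpn p (cball 0 (real k)) (%x. u x - a) = 0" by (simp add: LIMSEQ_const_iff)
  then have "AE x in lebesgue. ind (cball 0 (real k)) x * en (norm (u x - a) powr p) = 0"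
   unfolding lpn_def by (subst (asm) nn_integral_0_iff_AE) auto
  then show ?thesis by eventually_elim (auto simp: indicator_def split: if_splits)
 qed
 then have "AE x in lebesgue. \<forall>k. x : cball 0 (real k) --> u x = a" unfolding AE_all_countable by blast
 then have "AE x in lebesgue. u x = a"
 proof eventually_elim
  case (elim x)
  obtain k :: nat where "norm x < real k" using reals_Archimedean2 by blast
  then show ?case using elim by (metis less_imp_le mem_cball_0)
 qed
 then show ?thesis by blast
qed

text \<open>A triangle inequality with factor 2^p would spoil the constant c.
  \<open>lpn_add_le\<close> with weight l costs l^(1-p) twice, and l tends to 1 after k has tended
  to infinity.\<close>

lemma lpn_bound_limit:
 fixes f :: "'a::euclidean_space => 'b::euclidean_space" and g :: "'a => 'c::euclidean_space"
 assumes [measurable]: "f : lmeas" "g : lmeas"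
   "!!k. F k : lmeas" "!!k. G k : lmeas" "S : sets lebesgue"
  and p: "1 < p" and c: "0 <= c" and le: "!!k. lpn p S (G k) <= en c * lpn p S (F k)"
  and lim: "(%k. lpn p S (%x. F k x - f x)) ~~> 0" "(%k. lpn p S (%x. G k x - g x)) ~~> 0"
 shows "lpn p S g <= en c * lpn p S f"
proof -
 have bound: "lpn p S g <= en (l powr (1 - p)) * (en c * (en (l powr (1 - p)) * lpn p S f))"
  if l: "0 < l" "l < 1" for l
 proof -
  define a where "a = en (l powr (1 - p))"
  define b where "b = en ((1 - l) powr (1 - p))"
  have "lpn p S g <= a * (en c * (a * lpn p S f)) + (a * (en c * (b * lpn p S (%x. F k x - f x))) + b * lpn p S (%x. G k x - g x))" for k
  proof -
   have "lpn p S (%x. G k x + (g x - G k x)) <= a * lpn p S (G k) + b * lpn p S (%x. g x - G k x)"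
    unfolding a_def b_def by (rule lpn_add_le) (use p l in auto)
   moreover have "lpn p S (%x. f x + (F k x - f x)) <= a * lpn p S f + b * lpn p S (%x. F k x - f x)"
    unfolding a_def b_def by (rule lpn_add_le) (use p l in auto)
   ultimately have "lpn p S g <= a * (en c * (a * lpn p S f + b * lpn p S (%x. F k x - f x))) + b * lpn p S (%x. G k x - g x)"
    using le[of k] unfolding lpn_diff_commute[of p S g]
    by (simp, meson add_right_mono mult_left_mono order_trans zero_le)
   then show ?thesis by (simp add: distrib_left add.assoc)
  qed
  moreover have "(%k. a * (en c * (a * lpn p S f)) + (a * (en c * (b * lpn p S (%x. F k x - f x))) + b * lpn p S (%x. G k x - g x)))
    ~~> a * (en c * (a * lpn p S f)) + (0 + 0)"
   by (intro tendsto_add tendsto_const ennreal_tendsto_0_cmult lim) (auto simp: a_def b_def)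
  ultimately have "lpn p S g <= a * (en c * (a * lpn p S f)) + (0 + 0)"
   by (intro tendsto_lowerbound[where F = sequentially]) auto
  then show ?thesis by (simp add: a_def)
 qed
 show ?thesis
 proof (cases "lpn p S f")
  case top
  show ?thesis
  proof (cases "c = 0")
   case True
   then show ?thesis using bound[of "1/2"] by simp
  next
   case False
   then show ?thesis using top c by (simp add: ennreal_mult_top)
  qed
 next
  case (real F0)
  define X where "X k = 1 - 1 / real (Suc (Suc k))" for k :: nat
  have X: "0 < X k" "X k < 1" for k by (auto simp: X_def)
  have "X ~~> 1 - 0" unfolding X_def
   by (intro tendsto_diff tendsto_const LIMSEQ_Suc[OF LIMSEQ_Suc[OF lim_1_over_n]])
  then have "(%k. X k powr (1 - p) * (c * (X k powr (1 - p) * F0))) ~~> 1 powr (1 - p) * (c * (1 powr (1 - p) * F0))"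
   by (intro tendsto_mult tendsto_powr tendsto_const) auto
  then have "(%k. en (X k powr (1 - p) * (c * (X k powr (1 - p) * F0)))) ~~> ennreal (c * F0)"
   by (intro tendsto_ennrealI) simp
  moreover have "lpn p S g <= en (X k powr (1 - p) * (c * (X k powr (1 - p) * F0)))" for k
   using bound[OF X] c real by (simp add: ennreal_mult')
  ultimately have "lpn p S g <= en (c * F0)"
   by (intro tendsto_lowerbound[where F = sequentially]) auto
  then show ?thesis using c real by (simp add: ennreal_mult')
 qed
qed

section \<open>Density of test functions\<close>

lemma Lp_dense_test:
 fixes u :: "real^'n => real"
 assumes u[measurable]: "u : lmeas" and fin: "lpn p UNIV u < inft" and p: "1 < p"
  and G: "open G" "!!x. x ~: G ==> u x = 0" and e: "0 < (e::real)"
 obtains ph where "test_fun G ph" "lpn p UNIV (%x. ph x - u x) < en e"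
proof -
 define d where "d = e / (2 * 2 powr p)"
 have d: "d > 0" using e by (simp add: d_def)
 obtain v K where v: "ctn v" and K: "compact K" "K \<subseteq> G" "\<forall>x. x ~: K --> v x = 0"
  and uv: "lpn p UNIV (%x. u x - v x) < en d"
  using Lp_dense_continuous[OF u fin p G d] by blast
 obtain L N where L: "compact L" "L \<subseteq> G" "K \<subseteq> L"
  "!!n v x. n >= N ==> \<forall>x. x ~: K --> v x = 0 ==> x ~: L ==> conv v (mol n) x = 0"
  using mollify_support[OF K(1,2) G(1)] by metis
 have vL: "v : L1_loc UNIV" by (rule continuous_L1_loc[OF v])
 have [measurable]: "v : lmeas" by (rule cont_lmeas[OF v])
 note [measurable] = conv_mol_measurable[OF vL]
 have lim: "(%n. lpn p L (%x. conv v (mol n) x - v x)) ~~> 0"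
  by (rule uniform_imp_lpn_tendsto[OF lm_compact[OF L(1)] _ uniform_limit_on_subset[OF mollify_uniform[OF v K(1,3)]]])
   (use p in auto)
 obtain M where M: "!!n. n >= M ==> lpn p L (%x. conv v (mol n) x - v x) < en d"
  using ennreal_tendsto_0D[OF lim d] unfolding ev_seq by blast
 define n where "n = max M N"
 have z: "!!x. x ~: L ==> conv v (mol n) x = 0" using L(4)[OF _ K(3), of n] by (simp add: n_def)
 have "lpn p UNIV (%x. conv v (mol n) x - v x) = lpn p L (%x. conv v (mol n) x - v x)"
  unfolding lpn_def
 proof (intro nn_integral_cong)
  fix x show "ind UNIV x * en (norm (conv v (mol n) x - v x) powr p) = ind L x * en (norm (conv v (mol n) x - v x) powr p)"
   using z[of x] K(3) L(3) p by (cases "x : L") auto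
 qed
 also have "... < en d" by (rule M) (simp add: n_def)
 finally have 1: "lpn p UNIV (%x. conv v (mol n) x - v x) < en d" .
 have "lpn p UNIV (%x. conv v (mol n) x - u x) <= en (2 powr p) * (lpn p UNIV (%x. conv v (mol n) x - v x) + lpn p UNIV (%x. v x - u x))"
  by (rule lpn_triangle) (use p in auto)
 also have "... < en (2 powr p) * (en d + en d)"
  using 1 uv unfolding lpn_diff_commute[of p _ v] by (intro ennreal_mult_strict_left_mono add_strict_mono) auto
 also have "... = en (2 powr p * (d + d))"
  using d by (simp only: ennreal_plus[symmetric] ennreal_mult[symmetric] less_imp_le add_nonneg_nonneg powr_ge_zero)
 also have "2 powr p * (d + d) = e" by (simp add: d_def)
 finally have "lpn p UNIV (%x. conv v (mol n) x - u x) < en e" .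
 then show ?thesis using that test_conv[OF vL L(1,2) z] by blast
qed

lemma Lp_dense_test_vec:
 fixes f :: "real^'n => real^'n"
 assumes f[measurable]: "f : lmeas" and fin: "lpn p UNIV f < inft" and p: "1 < p"
  and G: "open G" "!!x. x ~: G ==> f x = 0" and e: "0 < (e::real)"
 obtains h where "!!i. test_fun G (%x. h x $ i)" "lpn p UNIV (%x. h x - f x) < en e"
proof -
 define c where "c = real CARD('n) powr p * real CARD('n)"
 have c: "c > 0" by (simp add: c_def)
 define d where "d = e / (2 * c)"
 have d: "d > 0" using e c by (simp add: d_def)
 have "\<exists>ph. test_fun G ph \<and> lpn p UNIV (%x. ph x - f x $ i) < en d" for i
 proof -
  have m: "(%x. f x $ i) : lmeas" by (rule borel_measurable_nth[OF f])
  have fi: "lpn p UNIV (%x. f x $ i) < inft"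
   using lpn_componentwise(2)[OF f _ , of UNIV p i] fin p by (auto intro: order_le_less_trans)
  have "!!x. x ~: G ==> f x $ i = 0" using G(2) by simp
  from Lp_dense_test[OF m fi p G(1) this d] show ?thesis by blast
 qed
 then obtain ph where ph: "!!i. test_fun G (ph i)" "!!i. lpn p UNIV (%x. ph i x - f x $ i) < en d" by metis
 define h where "h x = (\<chi> i. ph i x)" for x
 have "ctn (ph i)" for i using ph(1)[of i] Ck_continuous unfolding test_fun_def by blast
 then have "ctn h" unfolding h_def by (intro continuous_on_vec_lambda)
 then have [measurable]: "h : lmeas" by (rule cont_lmeas)
 have "lpn p UNIV (%x. h x - f x) <= en (real CARD('n) powr p) * (\<Sum>i\<in>UNIV. lpn p UNIV (%x. (h x - f x) $ i))"
  by (rule lpn_componentwise) (use p in auto)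
 also have "... <= en (real CARD('n) powr p) * (\<Sum>i\<in>(UNIV::'n set). en d)"
  using ph(2) by (intro mult_left_mono sum_mono) (auto simp: h_def less_imp_le)
 also have "... = en (c * d)"
  using d by (simp add: c_def ennreal_mult' ennreal_of_nat_eq_real_of_nat mult_ac)
 also have "... < en e" using e c by (intro ennreal_lessI) (auto simp: d_def)
 finally have "lpn p UNIV (%x. h x - f x) < en e" .
 moreover have "test_fun G (%x. h x $ i)" for i using ph(1)[of i] by (simp add: h_def)
 ultimately show ?thesis using that by blast
qed

section \<open>Change of variables\<close>

text \<open>The change of variables theorem of the library needs a wellordered index type; a finite linear
 order is one, but not as an instance of the type class, whence this copy of the index type.\<close>

typedef 'a wo = "UNIV :: 'a set" morphisms of_wo to_wo ..

lemma of_wo_inject_iff [simp]: "of_wo x = of_wo y \<longleftrightarrow> x = y" by (rule of_wo_inject)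

lemma bij_of_wo: "bij of_wo"
 by (metis UNIV_I bijI' of_wo_inject to_wo_inverse)

lemma bij_to_wo: "bij to_wo"
 by (metis UNIV_I bijI' to_wo_inject of_wo_inverse)

instance wo :: (finite) finite
proof
 have "UNIV = range (to_wo :: 'a => 'a wo)" using bij_to_wo by (auto simp: bij_def)
 then show "finite (UNIV :: 'a wo set)" by (metis finite finite_imageI)
qed

instantiation wo :: (linorder) linorder
begin
definition "x <= y \<longleftrightarrow> of_wo x <= of_wo y"
definition "x < y \<longleftrightarrow> of_wo x < of_wo y"
instance by standard (auto simp: less_eq_wo_def less_wo_def less_le_not_le dest: order.antisym)
end

instance wo :: ("{finite,linorder}") wellorder
proof
 fix P :: "'a wo => bool" and a
 assume step: "!!x. (!!y. y < x ==> P y) ==> P x"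
 show "P a"
 proof (induction a rule: measure_induct_rule[of "%x. card {y. y < x}"])
  case (less x)
  show ?case
  proof (rule step)
   fix y assume "y < x"
   then have "{z. z < y} \<subset> {z. z < x}" by (auto dest: less_trans)
   then show "P y" by (intro less psubset_card_mono) auto
  qed
 qed
qed

definition vwo :: "real^'n::finite => real^('n wo)" where "vwo x = (\<chi> i. x $ of_wo i)"
definition vun :: "real^('n wo) => real^'n::finite" where "vun y = (\<chi> i. y $ to_wo i)"

lemma vwo_vun [simp]: "vwo (vun y) = y" "vun (vwo x) = x"
 by (simp_all add: vwo_def vun_def vec_eq_iff of_wo_inverse to_wo_inverse)

lemma bounded_linear_vun: "bounded_linear vun" and bounded_linear_vwo: "bounded_linear vwo"
 by (simp_all add: linear_conv_bounded_linear[symmetric] linear_iff vun_def vwo_def vec_eq_iff)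

lemma prod_Basis_cart: "(\<Prod>b\<in>Basis. (u - l) \<bullet> b) = (\<Prod>i\<in>UNIV. u $ i - l $ i)" for u l :: "real^'n"
 by (simp add: Basis_vec_def cart_eq_inner_axis axis_eq_axis prod.UNION_disjoint inner_diff_left)

lemma Basis_cart_le: "(\<forall>b\<in>Basis. l \<bullet> b <= u \<bullet> b) \<longleftrightarrow> (\<forall>i. l $ i <= u $ i)" for u l :: "real^'n"
 by (auto simp: Basis_vec_def inner_axis)

text \<open>Abstract because it is applied twice: to \<Phi>, and to its inverse when the normal is
  written as a function of y.\<close>

locale c1_diffeo =
 fixes \<Phi> :: "'n::{finite,linorder} rvec => 'n rvec" and M :: "'n rvec => 'n rmat"
 assumes bij: "bij \<Phi>"
  and der: "(\<Phi> has_derivative (%h. M x *v h)) (at x)"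
  and contM: "ctn M"
  and injM: "M x *v z = 0 ==> z = 0"
begin

definition Mw :: "'n rvec => real^('n wo)^('n wo)" where
 "Mw x = (\<chi> i j. M x $ of_wo i $ of_wo j)"

text \<open>Taken from the reindexed matrix, the form in which the change of variables theorem
  produces it.\<close>

definition jac :: "'n rvec => real" where
 "jac x = \<bar>det (Mw x)\<bar>"

lemma Mw_mult: "Mw x *v h = vwo (M x *v vun h)"
proof -
 have "(\<Sum>j\<in>UNIV. M x $ of_wo i $ of_wo j * h $ j) = (\<Sum>j\<in>UNIV. M x $ of_wo i $ j * h $ to_wo j)" for i
  by (rule sum.reindex_bij_betw[OF bij_of_wo, of "%j. M x $ of_wo i $ j * h $ to_wo j", simplified of_wo_inverse])
 then show ?thesis
  by (simp add: vec_eq_iff Mw_def vwo_def vun_def matrix_vector_mult_def)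
qed

lemma jac_pos: "0 < jac x"
proof -
 have "h = 0" if "Mw x *v h = 0" for h
 proof -
  have "vwo (M x *v vun h) = vwo 0" using that by (simp add: Mw_mult vwo_def vec_eq_iff)
  then have "M x *v vun h = 0" by (metis vwo_vun(2))
  then have "vun h = 0" by (rule injM)
  then have "vwo (vun h) = vwo 0" by simp
  moreover have "vwo 0 = (0 :: real^('n wo))" by (simp add: vwo_def vec_eq_iff)
  ultimately show ?thesis by simp
 qed
 then have "\<exists>B. B ** Mw x = mat 1" by (simp add: matrix_left_invertible_ker)
 then have "invertible (Mw x)" by (simp add: invertible_left_inverse)
 then show ?thesis by (simp add: jac_def invertible_det_nz)
qed

lemma jac_continuous: "ctn jac"
proof -
 have "ctn (%x. M x $ i $ j)" for i j
  by (intro continuous_on_component contM)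
 then show ?thesis unfolding jac_def det_def Mw_def
  by (auto intro!: continuous_on_prod continuous_on_sum continuous_on_mult continuous_on_const continuous_on_rabs)
qed

lemma \<Phi>_continuous: "ctn \<Phi>"
 using der by (auto intro!: continuous_at_imp_continuous_on has_derivative_continuous)

lemma measurable_\<Phi> [measurable]: "\<Phi> : bmeas"
 by (rule cont_bmeas[OF \<Phi>_continuous])

lemma measurable_jac [measurable]: "jac : bmeas"
 by (rule cont_bmeas[OF jac_continuous])

text \<open>The change of variables theorem for the indicator of a box, carried over to the index
  type \<open>wo\<close> and back. Boxes suffice, since by \<open>lborel_eqI\<close> they determine
  Lebesgue measure.\<close>

lemma jac_box:
 assumes "!!b. b : Basis ==> l \<bullet> b <= u \<bullet> b"
 shows "(NB x. en (jac x * ind (box l u) (\<Phi> x))) = (\<Prod>b\<in>Basis. (u - l) \<bullet> b)"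
proof -
 have lu: "\<forall>i. l $ i <= u $ i" using assms Basis_cart_le by blast
 define P where "P = (\<Prod>i\<in>UNIV. u $ i - l $ i)"
 have P: "P >= 0" unfolding P_def using lu by (intro prod_nonneg) auto
 define Fw where "Fw y = vwo (\<Phi> (vun y))" for y
 \<comment> \<open>The change of variables theorem concerns vector-valued functions;
   \<open>real^1\<close> carries the scalar case.\<close>
 define f :: "real^('n wo) => real^1" where "f y = vec (ind (box (vwo l) (vwo u)) y)" for y
 have Fder: "(Fw has_derivative (%h. Mw (vun y) *v h)) (at y within UNIV)" for y
 proof -
  have "((%y. \<Phi> (vun y)) has_derivative (%h. M (vun y) *v vun h)) (at y)"
   using diff_chain_at[OF bounded_linear_imp_has_derivative[OF bounded_linear_vun] der] by (simp add: o_def)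
  then show ?thesis unfolding Fw_def Mw_mult
   by (rule bounded_linear.has_derivative[OF bounded_linear_vwo])
 qed
 have bF: "bij Fw"
 proof (rule bijI')
  show "Fw x = Fw y \<longleftrightarrow> x = y" for x y
   unfolding Fw_def using bij by (metis bij_pointE vwo_vun)
  show "\<exists>x. y = Fw x" for y
   unfolding Fw_def using bij by (metis bij_pointE vwo_vun)
 qed
 have eq_box: "\<Phi> x : box l u \<longleftrightarrow> Fw (vwo x) : box (vwo l) (vwo u)" for x
 proof -
  have "(\<forall>i. l $ i < z $ i \<and> z $ i < u $ i) \<longleftrightarrow> (\<forall>i. l $ of_wo i < z $ of_wo i \<and> z $ of_wo i < u $ of_wo i)" for z
   by (metis UNIV_I to_wo_inverse)
  moreover have "Fw (vwo x) = vwo (\<Phi> x)" by (simp add: Fw_def)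
  ultimately show ?thesis by (simp add: mem_box_cart vwo_def)
 qed
 have "f absolutely_integrable_on Fw ` UNIV \<and> integral (Fw ` UNIV) f = vec P"
 proof -
  have ne: "cbox (vwo l) (vwo u) ~= {}"
   using lu unfolding interval_ne_empty_cart by (simp add: vwo_def)
  have "P = (\<Prod>i\<in>UNIV. vwo u $ i - vwo l $ i)"
   unfolding P_def vwo_def
   by (simp add: prod.reindex_bij_betw[OF bij_of_wo, of "%i. u $ i - l $ i"])
  then have cP: "measure lborel (box (vwo l) (vwo u)) = P"
   using content_cbox_cart[OF ne] by (simp add: measure_lborel_box_eq measure_lborel_cbox_eq)
  have i: "intg (ind (box (vwo l) (vwo u)) :: _ => real)"
   using lmeasurable_box[of "vwo l" "vwo u"] by (auto simp: fmeasurable_def)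
  then have a: "(ind (box (vwo l) (vwo u)) :: _ => real) absolutely_integrable_on UNIV"
   by (simp add: set_integrable_def)
  have "integral UNIV (ind (box (vwo l) (vwo u)) :: _ => real) = (LL x. ind (box (vwo l) (vwo u)) x)"
   using set_lebesgue_integral_eq_integral(2)[OF a] by (simp add: set_lebesgue_integral_def)
  also have "... = P" using cP by simp
  finally show ?thesis using a bF unfolding f_def bij_def
   by (simp add: absolutely_integrable_on_1_iff integral_on_1_eq)
 qed
 then have "(%y. \<bar>det (matrix (%h. Mw (vun y) *v h))\<bar> *R f (Fw y)) absolutely_integrable_on UNIV \<and>
  integral UNIV (%y. \<bar>det (matrix (%h. Mw (vun y) *v h))\<bar> *R f (Fw y)) = vec P"
  by (subst has_absolute_integral_change_of_variables[OF _ Fder]) (use bF in \<open>auto simp: bij_def\<close>)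
 then have a: "(%y. jac (vun y) * ind (box (vwo l) (vwo u)) (Fw y)) absolutely_integrable_on UNIV"
  and I: "integral UNIV (%y. jac (vun y) * ind (box (vwo l) (vwo u)) (Fw y)) = P"
  unfolding f_def jac_def by (auto simp: absolutely_integrable_on_1_iff integral_on_1_eq)
 define g where "g y = jac (vun y) * ind (box (vwo l) (vwo u)) (Fw y)" for y
 have gi: "intg g" using a by (simp add: g_def[abs_def] set_integrable_def)
 have "(LL y. g y) = P"
  using set_lebesgue_integral_eq_integral(2)[OF a] I by (simp add: g_def set_lebesgue_integral_def)
 then have nP: "(NL y. en (g y)) = en P"
  using nn_integral_eq_integral[OF gi] less_imp_le[OF jac_pos] by (simp add: g_def[abs_def])
 have d: "distr lborel borel (vwo :: 'n rvec => _) = lborel"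
 proof (rule lborel_eqI[symmetric])
  fix a b :: "real^('n wo)" assume ab: "!!k. k : Basis ==> a \<bullet> k <= b \<bullet> k"
  have pre: "vwo -` box a b = box (vun a) (vun b)"
  proof -
   have "(\<forall>i. a $ i < x $ of_wo i \<and> x $ of_wo i < b $ i) \<longleftrightarrow> (\<forall>i. a $ to_wo i < x $ i \<and> x $ i < b $ to_wo i)" for x
    by (metis UNIV_I to_wo_inverse of_wo_inverse)
   then show ?thesis by (auto simp: mem_box_cart vwo_def vun_def)
  qed
  have le: "vun a \<bullet> k <= vun b \<bullet> k" if "k : Basis" for k
  proof -
   have "\<forall>i. a $ i <= b $ i" using ab Basis_cart_le by blast
   then have "\<forall>i. vun a $ i <= vun b $ i" by (simp add: vun_def)
   then show ?thesis using that Basis_cart_le by blast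
  qed
  have [measurable]: "(vwo :: 'n rvec => _) : bmeas"
   by (intro cont_bmeas linear_continuous_on bounded_linear_vwo)
  have "emeasure (distr lborel borel (vwo :: 'n rvec => _)) (box a b) = emeasure lborel (box (vun a) (vun b))"
   by (subst emeasure_distr) (auto simp: pre)
  also have "... = (\<Prod>k\<in>Basis. (vun b - vun a) \<bullet> k)" by (rule emeasure_lborel_box[OF le])
  also have "(\<Prod>k\<in>Basis. (vun b - vun a) \<bullet> k) = (\<Prod>k\<in>Basis. (b - a) \<bullet> k)"
   unfolding prod_Basis_cart vun_def
   by (simp add: prod.reindex_bij_betw[OF bij_to_wo, of "%i. b $ i - a $ i"])
  finally show "emeasure (distr lborel borel (vwo :: 'n rvec => _)) (box a b) = (\<Prod>k\<in>Basis. (b - a) \<bullet> k)" .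
 qed simp
 have mv: "(vwo :: 'n rvec => _) : bmeas" "(vun :: _ => 'n rvec) : bmeas"
  by (intro cont_bmeas linear_continuous_on bounded_linear_vwo bounded_linear_vun)+
 note [measurable] = mv
 have [measurable]: "g : bmeas" unfolding g_def Fw_def by measurable
 have "(NB x. en (jac x * ind (box l u) (\<Phi> x))) = (NB x. en (g (vwo x)))"
  unfolding g_def by (intro nn_integral_cong) (simp add: indicator_def eq_box)
 also have "... = (\<integral>\<^sup>+y. en (g y) \<partial>distr lborel borel (vwo :: 'n rvec => _))"
  by (rule nn_integral_distr[symmetric]) measurable
 also have "... = en P" unfolding d using nP by (simp add: nn_integral_completion)
 finally show ?thesis by (simp add: P_def prod_Basis_cart)
qed

lemma lborel_eq_distr: "lborel = distr (density lborel (%x. en (jac x))) borel \<Phi>"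
proof (rule lborel_eqI)
 fix l u :: "'n rvec" assume le: "!!b. b : Basis ==> l \<bullet> b <= u \<bullet> b"
 have "emeasure (distr (density lborel (%x. en (jac x))) borel \<Phi>) (box l u) =
   (NB x. en (jac x) * ind (\<Phi> -` box l u) x)"
  by (subst emeasure_distr, simp, simp, subst emeasure_density) (auto intro: measurable_sets_borel[OF measurable_\<Phi>])
 also have "... = (NB x. en (jac x * ind (box l u) (\<Phi> x)))"
  by (intro nn_integral_cong) (simp add: indicator_def)
 also have "... = (\<Prod>b\<in>Basis. (u - l) \<bullet> b)" by (rule jac_box[OF le])
 finally show "emeasure (distr (density lborel (%x. en (jac x))) borel \<Phi>) (box l u) = (\<Prod>b\<in>Basis. (u - l) \<bullet> b)" .
qed simp

lemma nn_cov_borel: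
 assumes [measurable]: "f : bmeas"
 shows "(NB y. f y) = (NB x. en (jac x) * f (\<Phi> x))"
 by (subst lborel_eq_distr) (simp add: nn_integral_distr nn_integral_density)

text \<open>By the change of variables the preimage of a null set has weighted measure zero, and the
  weight \<open>jac\<close> is positive.\<close>

lemma AE_\<Phi>:
 assumes "AE y in lebesgue. P y" shows "AE x in lebesgue. P (\<Phi> x)"
proof -
 have "AE y in lborel. P y" using assms by (simp add: AE_completion_iff)
 then obtain N where N: "{y. \<not> P y} \<subseteq> N" "N : sets borel" "emeasure lborel N = 0" by (auto elim!: AE_E)
 note [measurable] = N(2)
 have "(NB x. en (jac x) * ind N (\<Phi> x)) = 0"
  using nn_cov_borel[of "ind N"] N by simp
 then have "AE x in lborel. en (jac x) * ind N (\<Phi> x) = 0"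
  by (subst (asm) nn_integral_0_iff_AE) auto
 then have "AE x in lborel. P (\<Phi> x)"
 proof eventually_elim
  case (elim x)
  then have "\<Phi> x ~: N" using jac_pos[of x] by (auto simp: indicator_def split: if_splits)
  then show ?case using N(1) by blast
 qed
 then show ?thesis by (rule AE_completion)
qed

text \<open>Composition with a Borel map need not preserve Lebesgue measurability. Here a preimage
  under f is Borel up to a null set, and \<open>AE_\<Phi>\<close> keeps the null part null.\<close>

lemma measurable_comp_\<Phi>:
 fixes f :: "'n rvec => 'b::{second_countable_topology, t2_space}"
 assumes "f : lmeas"
 shows "(%x. f (\<Phi> x)) : lmeas"
proof (rule measurableI)
 fix A :: "'b set" assume A: "A : sets borel"
 have "f -` A : sets lebesgue" using measurable_sets[OF assms A] by simp
 then obtain S N where SN: "f -` A = S \<union> N" "S : sets borel" "N \<subseteq> {y. y : N}" "AE y in lebesgue. y ~: N"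
 proof -
  assume *: "!!S N. f -` A = S \<union> N ==> S : sets borel ==> N \<subseteq> {y. y : N} ==> AE y in lebesgue. y ~: N ==> thesis"
  from \<open>f -` A : sets lebesgue\<close> obtain S N N' where "f -` A = S \<union> N" "N \<subseteq> N'" "N' : null_sets lborel" "S : sets lborel"
   by (auto elim: sets_completionE)
  moreover from this have "AE y in lborel. y ~: N" by (auto intro: AE_I'[of N'])
  ultimately show thesis by (intro *[of S N] AE_completion) auto
 qed
 have "AE x in lebesgue. \<Phi> x ~: N" by (rule AE_\<Phi>[OF SN(4)])
 then have nN: "\<Phi> -` N : null_sets lebesgue"
  unfolding eventually_ae_filter by (auto simp: vimage_def intro: completion.complete2)
 have "(%x. f (\<Phi> x)) -` A = \<Phi> -` S \<union> \<Phi> -` N" using SN(1) by auto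
 moreover have "\<Phi> -` S : sets lebesgue"
  using measurable_sets_borel[OF measurable_\<Phi> SN(2)] by (simp add: sets_completionI_sets)
 ultimately show "(%x. f (\<Phi> x)) -` A \<inter> space lebesgue : sets lebesgue"
  using nN by auto
qed simp

lemma nn_cov:
 assumes f: "f : lmeas"
 shows "(NL y. f y) = (NL x. en (jac x) * f (\<Phi> x))"
proof -
 obtain f' where f': "f' : borel_measurable lborel" "AE y in lborel. f y = f' y"
  using completion_ex_borel_measurable[OF f] by blast
 have ae: "AE y in lebesgue. f y = f' y" using f'(2) by (rule AE_completion)
 have "(NL y. f y) = (NL y. f' y)" using ae by (rule nn_integral_cong_AE)
 also have "... = (NL x. en (jac x) * f' (\<Phi> x))"
  using nn_cov_borel[of f'] f'(1) by (simp add: nn_integral_completion)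
 also have "... = (NL x. en (jac x) * f (\<Phi> x))"
  by (rule nn_integral_cong_AE) (use AE_\<Phi>[OF ae] in \<open>auto elim: eventually_mono\<close>)
 finally show ?thesis .
qed

lemma LINT_cov:
 fixes f :: "'n rvec => real"
 assumes f: "f : lmeas"
 shows "(LL y. f y) = (LL x. jac x * f (\<Phi> x))"
proof -
 obtain f' where f'[measurable]: "f' : bmeas" and ae0: "AE y in lborel. f y = f' y"
  using completion_ex_borel_measurable_real[OF f] by auto
 have ae: "AE y in lebesgue. f y = f' y" using ae0 by (rule AE_completion)
 have [measurable]: "f : lmeas" by fact
 have "(LL y. f y) = (LL y. f' y)"
  by (rule integral_cong_AE) (use ae in \<open>auto simp: measurable_completion\<close>)
 also have "... = (LB y. f' y)" by (rule integral_completion) simp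
 also have "... = (LB x. jac x * f' (\<Phi> x))"
  by (subst lborel_eq_distr) (simp add: integral_distr integral_density jac_pos less_imp_le)
 also have "... = (LL x. jac x * f' (\<Phi> x))" by (rule integral_completion[symmetric]) simp
 also have "... = (LL x. jac x * f (\<Phi> x))"
 proof (rule integral_cong_AE)
  show "(%x. jac x * f (\<Phi> x)) : lmeas"
   by (intro borel_measurable_times measurable_comp_\<Phi> f) (simp add: measurable_completion)
  show "(%x. jac x * f' (\<Phi> x)) : lmeas" by (simp add: measurable_completion)
  show "AE x in lebesgue. jac x * f' (\<Phi> x) = jac x * f (\<Phi> x)"
   using AE_\<Phi>[OF ae] by eventually_elim simp
 qed
 finally show ?thesis .
qed

end

section \<open>Disintegration along the last coordinate\<close>

abbreviation eN :: "'n::{finite,linorder} rvec" where "eN \<equiv> axis last_ix 1"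

text \<open>Integrals over the hyperplane x_N = 0 are written as N-dimensional integrals over the
  slab of functions of \<open>proj0 x\<close>. This avoids a measure in N - 1 variables and matches
  \<open>interface_measure\<close>.\<close>

definition slab :: "('n::{finite,linorder} rvec) set" where
 "slab = {x. 0 < x $ last_ix \<and> x $ last_ix < 1}"

definition proj0 :: "'n::{finite,linorder} rvec => 'n rvec" where
 "proj0 x = x - (x $ last_ix) *R eN"

lemma proj0_nth [simp]: "proj0 x $ last_ix = 0" by (simp add: proj0_def)

lemma proj0_shift [simp]: "proj0 (x + s *R eN) = proj0 x"
 by (simp add: proj0_def algebra_simps)

lemma proj0_decomp: "x = proj0 x + (x $ last_ix) *R eN" by (simp add: proj0_def)

lemma continuous_last: "continuous_on S (%x::'n::{finite,linorder} rvec. x $ last_ix)"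
 by (intro continuous_on_component continuous_on_id)

lemma continuous_proj0: "continuous_on S (proj0 :: 'n::{finite,linorder} rvec => _)"
 unfolding proj0_def by (intro continuous_intros)

lemma measurable_last [measurable]: "(%x::'n::{finite,linorder} rvec. x $ last_ix) : bmeas"
 by (rule cont_bmeas[OF continuous_last])

lemma measurable_proj0 [measurable]: "proj0 : bmeas"
 by (rule cont_bmeas[OF continuous_proj0])

lemma norm_proj0_le: "norm (proj0 x) <= norm x"
proof (rule norm_le_componentwise_cart)
 fix i show "norm (proj0 x $ i) <= norm (x $ i)"
  by (cases "i = last_ix") (auto simp: proj0_def axis_def)
qed

lemma slab_measurable [measurable]: "slab : sets borel"
 unfolding slab_def by measurable

lemma nn_integral_translate:
 fixes f :: "'a::euclidean_space => ennreal"
 assumes "f : bmeas"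
 shows "(NB x. f (x + a)) = (NB x. f x)"
 using nn_integral_affine[OF assms, of 1 a] by (simp add: add.commute)

text \<open>Fubini's theorem without splitting R^N: shifting s by x_N turns the point into x + u
  e_N, the integrals are exchanged, and x is translated. Each z is then counted for u in an interval
  of length 1, the thickness of the slab.\<close>

lemma nn_disintegration:
 fixes k :: "'n::{finite,linorder} rvec => ennreal"
 assumes [measurable]: "k : bmeas"
 shows "(NB x. ind slab x * (NB s. k (proj0 x + s *R eN))) = (NB z. k z)"
proof -
 have "(NB x. ind slab x * (NB s. k (proj0 x + s *R eN)))
  = (NB x. (NB u. ind slab x * k (x + u *R eN)))"
 proof (rule nn_integral_cong)
  fix x :: "'n rvec"
  have "(NB s. k (proj0 x + s *R eN)) = (NB u. k (proj0 x + (u + x $ last_ix) *R eN))"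
   by (rule nn_integral_translate[symmetric]) measurable
  also have "... = (NB u. k (x + u *R eN))" by (simp add: proj0_def algebra_simps)
  finally show "ind slab x * (NB s. k (proj0 x + s *R eN)) = (NB u. ind slab x * k (x + u *R eN))"
   by (simp add: nn_integral_cmult)
 qed
 also have "... = (NB u. (NB x. ind slab x * k (x + u *R eN)))"
  by (rule lborel_pair.Fubini') measurable
 also have "... = (NB u. (NB z. ind slab (z - u *R eN) * k z))"
 proof (rule nn_integral_cong)
  fix u :: real
  have "(NB x. ind slab ((x + u *R eN) - u *R eN) * k (x + u *R eN)) =
    (NB z. ind slab (z - u *R eN) * k z)"
   by (rule nn_integral_translate) measurable
  then show "(NB x. ind slab x * k (x + u *R eN)) = (NB z. ind slab (z - u *R eN) * k z)"
   by simp
 qed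
 also have "... = (NB z. (NB u. ind slab (z - u *R eN) * k z))"
  by (rule lborel_pair.Fubini') measurable
 also have "... = (NB z. k z)"
 proof (rule nn_integral_cong)
  fix z :: "'n rvec"
  have "(NB u. ind slab (z - u *R eN) * k z) = (NB u. k z * ind {z $ last_ix - 1 <..< z $ last_ix} u)"
   by (intro nn_integral_cong) (auto simp: indicator_def slab_def mult.commute)
  also have "... = k z" by (simp add: nn_integral_cmult_indicator)
  finally show "(NB u. ind slab (z - u *R eN) * k z) = k z" .
 qed
 finally show ?thesis .
qed

text \<open>The number c will be the signed width of a strip beside the hyperplane, which makes the
  second variable a rescaled depth. The proof is an equality of measures, and this transfers to the
  Bochner integral of every Borel f.\<close>

lemma LINT_disintegration:
 fixes f :: "'n::{finite,linorder} rvec => real"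
 assumes f[measurable]: "f : bmeas" and c: "c ~= 0"
 shows "inverse \<bar>c\<bar> * (LB z. f z) =
  (LB q. ind slab (fst q) * f (proj0 (fst q) + (c * snd q) *R eN))"
proof -
 define \<theta> :: "'n rvec \<times> real => 'n rvec" where "\<theta> q = proj0 (fst q) + (c * snd q) *R eN" for q
 have [measurable]: "\<theta> : bmeas"
  unfolding \<theta>_def by (intro cont_bmeas continuous_intros cont_comp2[OF continuous_proj0]) auto
 have [measurable]: "(%q::'n rvec \<times> real. ind slab (fst q) :: ennreal) : bmeas"
  "(%q::'n rvec \<times> real. ind slab (fst q) :: real) : bmeas"
  by (auto intro!: measurable_compose[OF cont_bmeas[OF continuous_on_fst[OF continuous_on_id]]] borel_measurable_indicator)
 have eq: "distr (density lborel (%q. ind slab (fst q))) borel \<theta> = density lborel (%z. en (inverse \<bar>c\<bar>))"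
 proof (rule measure_eqI)
  fix A assume "A : sets (distr (density lborel (%q. ind slab (fst q))) borel \<theta>)"
  then have [measurable]: "A : sets borel" by simp
  have "emeasure (distr (density lborel (%q. ind slab (fst q))) borel \<theta>) A =
    (NB q. ind slab (fst q) * ind A (\<theta> q))"
  proof -
   have "emeasure (distr (density lborel (%q. ind slab (fst q))) borel \<theta>) A =
    (\<integral>\<^sup>+y. ind A y \<partial>distr (density lborel (%q. ind slab (fst q))) borel \<theta>)" by simp
   also have "... = (NB q. ind slab (fst q) * ind A (\<theta> q))"
    by (subst nn_integral_distr) (auto simp: nn_integral_density)
   finally show ?thesis .
  qed
  also have "... = (NB x. (NB t. ind slab x * ind A (proj0 x + (c * t) *R eN)))"
  proof -
   have "(%q. ind slab (fst q) * ind A (\<theta> q) :: ennreal) : borel_measurable (lborel \<Otimes>\<^sub>M lborel)"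
    unfolding lborel_prod by measurable
   from lborel.nn_integral_fst[OF this] show ?thesis by (simp add: \<theta>_def lborel_prod)
  qed
  also have "... = (NB x. en (inverse \<bar>c\<bar>) * (ind slab x * (NB s. ind A (proj0 x + s *R eN))))"
  proof (rule nn_integral_cong)
   fix x :: "'n rvec"
   have "(NB s. ind A (proj0 x + s *R eN)) = en \<bar>c\<bar> * (NB t. ind A (proj0 x + (c * t) *R eN))"
    using nn_integral_real_affine[of "%s. ind A (proj0 x + s *R eN)" c 0] c by simp
   then have "en (inverse \<bar>c\<bar>) * (NB s. ind A (proj0 x + s *R eN)) =
     (en (inverse \<bar>c\<bar>) * en \<bar>c\<bar>) * (NB t. ind A (proj0 x + (c * t) *R eN))"
    by (simp add: mult.assoc)
   also have "en (inverse \<bar>c\<bar>) * en \<bar>c\<bar> = 1" using c by (simp flip: ennreal_mult)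
   finally show "(NB t. ind slab x * ind A (proj0 x + (c * t) *R eN)) =
    en (inverse \<bar>c\<bar>) * (ind slab x * (NB s. ind A (proj0 x + s *R eN)))"
    by (subst nn_integral_cmult) (auto simp: mult.left_commute)
  qed
  also have "... = en (inverse \<bar>c\<bar>) * (NB z. ind A z)"
   by (subst nn_integral_cmult) (auto simp: nn_disintegration)
  also have "... = emeasure (density lborel (%z. en (inverse \<bar>c\<bar>))) A"
   by (simp add: emeasure_density nn_integral_cmult_indicator)
  finally show "emeasure (distr (density lborel (%q. ind slab (fst q))) borel \<theta>) A =
   emeasure (density lborel (%z. en (inverse \<bar>c\<bar>))) A" .
 qed simp
 have "inverse \<bar>c\<bar> * (LB z. f z) = (LINT z|density lborel (%z. en (inverse \<bar>c\<bar>)). f z)"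
  by (subst integral_density) auto
 also have "... = (LINT q|density lborel (%q. en (ind slab (fst q))). f (\<theta> q))"
  unfolding eq[symmetric] by (subst integral_distr) (auto simp: ennreal_indicator)
 also have "... = (LB q. ind slab (fst q) * f (\<theta> q))"
  by (subst integral_density) auto
 finally show ?thesis unfolding \<theta>_def .
qed

section \<open>The geometry of a bent interface\<close>

lemma continuous_on_cartI:
 fixes f :: "'a::topological_space => ('b::topological_space)^'n"
 assumes "!!i. continuous_on S (%x. f x $ i)" shows "continuous_on S f"
 using continuous_on_vec_lambda[of S "%i x. f x $ i"] assms by simp

lemma norm_matrix_vector_le: "norm (Q *v z) <= norm Q * norm (z :: real^'n)" for Q :: "real^'n^'m"
proof -
 have "norm (Q *v z) = L2_set (%i. norm ((Q *v z) $ i)) UNIV" by (simp add: norm_vec_def)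
 also have "... <= L2_set (%i. norm (Q $ i) * norm z) UNIV"
 proof (rule L2_set_mono)
  fix i
  have "(Q *v z) $ i = Q $ i \<bullet> z" by (simp add: matrix_vector_mult_def inner_vec_def)
  then show "norm ((Q *v z) $ i) <= norm (Q $ i) * norm z" using Cauchy_Schwarz_ineq2 by simp
 qed simp
 also have "... = norm Q * norm z" by (simp add: norm_vec_def[of Q] flip: L2_set_right_distrib L2_set_left_distrib)
 finally show ?thesis .
qed

primrec sgnp :: "phase => real" where "sgnp Plus = 1" | "sgnp Minus = -1"

lemma sgnp_cases: "sgnp s = 1 \<or> sgnp s = -1" by (cases s) auto
lemma sgnp_sq [simp]: "sgnp s * sgnp s = 1" "sgnp s * (sgnp s * x) = x" "\<bar>sgnp s\<bar> = 1" by (cases s; simp)+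

lemma half_space_sgnp: "half_space s = {x. 0 < sgnp s * x $ last_ix}"
 by (cases s) auto

locale bent =
 fixes \<Phi> :: "'n::{finite,linorder} rvec => 'n rvec" and A A' :: "'n rmat" and B B' :: "'n rvec => 'n rmat"
  and M1 M2 r :: real
 assumes cfg: "bent_interface M1 M2 r \<Phi> A B A' B'" and M1: "M1 < 1 / 2"
begin

abbreviation "IM == interface_measure \<Phi>"
abbreviation "Om s == Omega \<Phi> s"

definition M :: "'n rvec => 'n rmat" where "M x = A + B x"
definition M' :: "'n rvec => 'n rmat" where "M' x = A' + B' x"
abbreviation Ps :: "'n rvec => 'n rvec" where "Ps \<equiv> inv \<Phi>"

lemma bij\<Phi>: "bij \<Phi>"
 and der\<Phi>: "(\<Phi> has_derivative (%h. M x *v h)) (at x)"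
 and contM: "ctn M"
 and derPs\<Phi>: "(Ps has_derivative (%h. M' x *v h)) (at (\<Phi> x))"
 using cfg unfolding bent_interface_def M_def M'_def by blast+

lemma Ps\<Phi> [simp]: "Ps (\<Phi> x) = x" and \<Phi>Ps [simp]: "\<Phi> (Ps y) = y"
 using bij\<Phi> by (simp_all add: bij_is_inj bij_is_surj surj_f_inv_f)

lemma derPs: "(Ps has_derivative (%h. M' (Ps y) *v h)) (at y)"
 using derPs\<Phi>[of "Ps y"] by simp

lemma M'M: "M' x *v (M x *v h) = h"
proof -
 have "((Ps \<circ> \<Phi>) has_derivative (%h. M' x *v h) \<circ> (%h. M x *v h)) (at x)"
  by (rule diff_chain_at[OF der\<Phi> derPs\<Phi>])
 moreover have "Ps \<circ> \<Phi> = (%x. x)" by auto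
 ultimately have "((%x. x) has_derivative (%h. M' x *v h) \<circ> (%h. M x *v h)) (at x)" by simp
 moreover have "((%x::'n rvec. x) has_derivative (%h. h)) (at x)" by (rule has_derivative_ident)
 ultimately have "(%h. M' x *v h) \<circ> (%h. M x *v h) = (%h. h)" by (rule has_derivative_unique)
 then show ?thesis by (metis comp_apply)
qed

lemma MM': "M x *v (M' x *v h) = h"
proof -
 have "M' x ** M x = mat 1" unfolding matrix_eq using M'M by (simp add: matrix_vector_mul_assoc[symmetric])
 then have "M x ** M' x = mat 1" by (simp add: matrix_left_right_inverse)
 then show ?thesis by (simp add: matrix_vector_mul_assoc)
qed

sublocale c1_diffeo \<Phi> M
proof
 show "M x *v z = 0 ==> z = 0" for x z using M'M[of x z] by simp
qed (rule bij\<Phi> der\<Phi> contM)+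

lemma Ps_continuous: "ctn Ps"
 using derPs by (auto intro!: continuous_at_imp_continuous_on has_derivative_continuous)

text \<open>\<open>bent_interface\<close> states continuity for the Jacobian of \<Phi>. It passes to
  the inverse matrices through M' x v - M' a v = M' x (M a - M x) M' a v, once M' x is bounded near
  a.\<close>

lemma M'_vec_continuous: "ctn (%x. M' x *v v)"
proof (intro continuous_at_imp_continuous_on ballI)
 fix a
 define K where "K = norm (M' a) + 1"
 have K: "K > 0" by (simp add: K_def add_nonneg_pos)
 have Kb: "norm (M' a *v z) <= K * norm z" for z
  using norm_matrix_vector_le[of "M' a" z] by (simp add: K_def distrib_right add_increasing2)
 have "(M \<longlongrightarrow> M a) (at a)" using contM continuous_on_eq_continuous_at open_UNIV continuous_at by blast
 then have lim: "((%x. norm (M x - M a)) \<longlongrightarrow> 0) (at a)" using Lim_null tendsto_norm_zero by blast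
 then have "\<forall>\<^sub>F x in at a. norm (M x - M a) < 1 / (2 * K)"
  using K by (intro order_tendstoD) auto
 then have ev: "\<forall>\<^sub>F x in at a. norm (M' x *v v - M' a *v v) <= 2 * K * (norm (M x - M a) * norm (M' a *v v))"
 proof eventually_elim
  case (elim x)
  \<comment> \<open>Close to a, the term with M x - M a contributes at most half of the norm of u,
    which is absorbed on the left.\<close>
  have le: "norm (M' x *v z) <= 2 * K * norm z" for z
  proof -
   define u where "u = M' x *v z"
   have u: "M x *v u = z" by (simp add: u_def MM')
   have "norm u = norm (M' a *v (M a *v u))" by (simp add: M'M)
   also have "... <= K * norm (M a *v u)" by (rule Kb)
   also have "M a *v u = z - (M x - M a) *v u" by (simp add: u[symmetric] matrix_vector_mult_diff_rdistrib)
   also have "K * norm (z - (M x - M a) *v u) <= K * (norm z + norm (M x - M a) * norm u)"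
    using norm_triangle_ineq4[of z "(M x - M a) *v u"] norm_matrix_vector_le[of "M x - M a" u] K
    by (intro mult_left_mono) auto
   also have "... <= K * norm z + K * (1 / (2 * K) * norm u)"
    proof -
     have "norm (M x - M a) * norm u <= 1 / (2 * K) * norm u" using elim by (intro mult_right_mono) auto
     then have "K * (norm (M x - M a) * norm u) <= K * (1 / (2 * K) * norm u)" using K by (intro mult_left_mono) auto
     then show ?thesis by (simp only: distrib_left add_left_mono)
    qed
   also have "... = K * norm z + norm u / 2" using K by simp
   finally show ?thesis by (simp add: u_def)
  qed
  have "M' x *v v - M' a *v v = M' x *v ((M a - M x) *v (M' a *v v))"
   by (simp add: matrix_vector_mult_diff_rdistrib matrix_vector_mult_diff_distrib M'M MM')
  then have "norm (M' x *v v - M' a *v v) <= 2 * K * norm ((M a - M x) *v (M' a *v v))" using le by simp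
  also have "... <= 2 * K * (norm (M x - M a) * norm (M' a *v v))"
   using norm_matrix_vector_le[of "M a - M x" "M' a *v v"] K by (intro mult_left_mono) (auto simp: norm_minus_commute)
  finally show ?case .
 qed
 have "((%x. 2 * K * (norm (M x - M a) * norm (M' a *v v))) \<longlongrightarrow> 2 * K * (0 * norm (M' a *v v))) (at a)"
  by (intro tendsto_intros lim)
 then have "((%x. M' x *v v - M' a *v v) \<longlongrightarrow> 0) (at a)"
  using ev by (intro Lim_null_comparison[OF ev]) simp
 then show "isCont (%x. M' x *v v) a" using Lim_null isCont_def by blast
qed

lemma M'_entry_continuous: "ctn (%x. M' x $ i $ j)"
proof -
 have "M' x $ i $ j = (M' x *v axis j 1) $ i" for x
  by (simp add: matrix_vector_mult_def axis_def if_distrib[of "(*) _"] cong: if_cong)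
 then show ?thesis using continuous_on_component[OF M'_vec_continuous] by simp
qed

text \<open>The unnormalised normal: minus the gradient of the last coordinate of \<open>Ps\<close>,
  as a function of x = \<open>Ps y\<close>.\<close>

definition wn :: "'n rvec => 'n rvec" where "wn x = - (M' x $ last_ix)"

lemma wn_nth: "wn x $ j = - (M' x $ last_ix $ j)" by (simp add: wn_def)

lemma wn_transpose: "transpose (M' x) *v (- axis last_ix 1) = wn x"
 by (simp add: vec_eq_iff wn_def matrix_vector_mult_def transpose_def axis_def if_distrib[of "(*) _"] if_distrib[of uminus] sum_negf cong: if_cong)

lemma bent_normal_eq: "bent_normal \<Phi> A' B' y = wn (Ps y) /\<^sub>R norm (wn (Ps y))"
 unfolding bent_normal_def M'_def[symmetric] wn_transpose Let_def ..

lemma wn_continuous: "ctn wn"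
 by (intro continuous_on_cartI) (simp add: wn_nth continuous_on_minus M'_entry_continuous)

lemma B'_entry_continuous: "ctn (%x. B' x $ i $ j)"
proof -
 have "B' x $ i $ j = M' x $ i $ j - A' $ i $ j" for x by (simp add: M'_def)
 then show ?thesis using M'_entry_continuous by (auto intro: continuous_intros)
qed

text \<open>The bound on \<open>B'\<close> holds almost everywhere, hence everywhere by continuity.
  The last row of the orthogonal matrix A' has norm 1, and that of \<open>B'\<close> at most M1 <
  1/2.\<close>

lemma norm_wn: "1 / 2 <= norm (wn x)"
proof -
 have c: "ctn B'"
  by (intro continuous_on_cartI B'_entry_continuous)
 have "AE x in lebesgue. x : {x. norm (B' x) <= M1}"
  using cfg unfolding bent_interface_def
  by (auto elim!: eventually_mono intro: order_trans[OF norm_snd_le])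
 moreover have "closed {x. norm (B' x) <= M1}" by (intro closed_Collect_le continuous_intros c)
 ultimately have b: "norm (B' x) <= M1" using mem_closed_if_AE_lebesgue by blast
 have "norm (A' $ last_ix) = 1"
 proof -
  have "A' ** transpose A' = mat 1" using cfg unfolding bent_interface_def orthogonal_matrix_def by blast
  then have "(A' ** transpose A') $ last_ix $ last_ix = 1" by (simp add: mat_def)
  then have "A' $ last_ix \<bullet> A' $ last_ix = 1" by (simp add: matrix_matrix_mult_def transpose_def inner_vec_def)
  then show ?thesis by (simp add: norm_eq_1)
 qed
 moreover have "norm (B' x $ last_ix) <= M1" by (rule order_trans[OF Finite_Cartesian_Product.norm_nth_le b])
 moreover have "norm (wn x) = norm (A' $ last_ix + B' x $ last_ix)" unfolding wn_def M'_def by (simp only: norm_minus_cancel vector_add_component)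
 ultimately show ?thesis using M1 norm_triangle_ineq2[of "A' $ last_ix" "- B' x $ last_ix"] by simp
qed

lemma pd_Ps: "pd i (%y. Ps y $ l) y = M' (Ps y) $ l $ i"
 using pd_eqI[OF bounded_linear.has_derivative[OF bounded_linear_vec_nth[of l] derPs], of i y]
 by (simp add: matrix_vector_mult_def axis_def if_distrib[of "(*) _"] cong: if_cong)

lemma Ck_Ps: "Ck 1 (%y. Ps y $ l)"
proof (rule Ck1I[OF bounded_linear.has_derivative[OF bounded_linear_vec_nth[of l] derPs]])
 fix i
 have "ctn (%y. M' (Ps y) *v axis i 1)"
  by (rule cont_comp2[OF M'_vec_continuous Ps_continuous]) simp
 then show "ctn (%y. (M' (Ps y) *v axis i 1) $ l)" by (rule continuous_on_component)
qed

lemma Omega_eq: "Om s = {y. 0 < sgnp s * Ps y $ last_ix}"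
 unfolding Omega_def half_space_sgnp by (auto intro!: image_eqI[where x = "Ps _"])

lemma \<Phi>_in_Omega: "\<Phi> z : Om s \<longleftrightarrow> z : half_space s"
 by (simp add: Omega_eq half_space_sgnp)

lemma open_Omega: "open (Om s)"
 unfolding Omega_eq
 by (intro open_Collect_less continuous_intros continuous_on_component Ps_continuous)

lemma Omega_lebesgue [measurable]: "Om s : sets lebesgue"
 using open_Omega by (simp add: borel_open sets_completionI_sets)

lemma Sigma_eq: "Sigma_tilde \<Phi> = {y. Ps y $ last_ix = 0}"
 unfolding Sigma_tilde_def by (auto intro!: image_eqI[where x = "Ps _"])

lemma Sigma_negligible: "negligible (Sigma_tilde \<Phi>)"
 unfolding Sigma_tilde_def
proof (rule negligible_differentiable_image_negligible)
 show "negligible {x::'n rvec. x $ last_ix = 0}" by (rule negligible_standard_hyperplane_cart)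
 show "\<Phi> differentiable_on {x. x $ last_ix = 0}"
  using der\<Phi> unfolding differentiable_on_def differentiable_def by (blast intro: has_derivative_at_withinI)
qed simp

lemma Omega_Un: "Om Plus \<union> Om Minus = UNIV - Sigma_tilde \<Phi>"
 unfolding Omega_eq Sigma_eq by auto

end

section \<open>Boundary values as limits of averages over strips\<close>

text \<open>Integrating the derivative from the hyperplane inwards bounds h at depth below d by its
  boundary value plus the integral of |h'| over depths up to 1. Integration over the depth yields
  the factor d, which later compensates a weight n + 1.\<close>

lemma strip_bound:
 fixes h h' :: "'n::{finite,linorder} rvec => real"
 assumes h: "ctn h" and h': "ctn h'"
  and der: "!!z s. ((%s. h (z + s *R eN)) has_real_derivative h' (z + s *R eN)) (at s)"
  and d: "0 < d" "d <= 1"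
 shows "(NB z. ind {z. 0 < sgnp sg * z $ last_ix \<and> sgnp sg * z $ last_ix < d \<and> norm (proj0 z) <= \<rho>} z * en \<bar>h z\<bar>)
  <= en d * ((NB x. ind slab x * (ind {x. norm (proj0 x) <= \<rho>} x * en \<bar>h (proj0 x)\<bar>))
   + (NB z. ind {z. 0 < sgnp sg * z $ last_ix \<and> sgnp sg * z $ last_ix < 1 \<and> norm (proj0 z) <= \<rho>} z * en \<bar>h' z\<bar>))"
proof -
 have [measurable]: "h : bmeas" "h' : bmeas"
  using h h' by (auto intro: cont_bmeas)
 define P where "P = {x::'n rvec. norm (proj0 x) <= \<rho>}"
 define I :: "real => real set" where "I e = {s. 0 < sgnp sg * s \<and> sgnp sg * s < e}" for e
 have [measurable]: "P : sets borel" unfolding P_def by measurable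
 have [measurable]: "I e : sets borel" for e unfolding I_def by measurable
 have mI: "emeasure lborel (I e) = en e" if "e > 0" for e
 proof (cases sg)
  case Plus
  then have "I e = {0<..<e}" by (auto simp: I_def)
  then show ?thesis using that by simp
 next
  case Minus
  then have "I e = {-e<..<0}" by (auto simp: I_def)
  then show ?thesis using that by simp
 qed
 define H where "H x = (NB t. ind (I 1) t * en \<bar>h' (proj0 x + t *R eN)\<bar>)" for x
 have [measurable]: "H : bmeas" unfolding H_def by measurable
 have step: "en \<bar>h (proj0 x + s *R eN)\<bar> <= en \<bar>h (proj0 x)\<bar> + H x" if s: "s : I d" for x s
 proof -
  define f where "f t = h' (proj0 x + t *R eN)" for t
  define F where "F t = h (proj0 x + t *R eN)" for t
  define a b where "a = min 0 s" and "b = max 0 s"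
  have ab: "a <= b" by (simp add: a_def b_def)
  have cf: "ctn f" unfolding f_def
   by (intro cont_comp2[OF h'] continuous_intros) auto
  have FTC: "(LB t. f t * ind {a..b} t) = F b - F a"
   using ab der cf unfolding F_def f_def by (intro integral_FTC_Icc_real) (auto simp: continuous_on_eq_continuous_at)
  have int: "integrable lborel (%t. f t * ind {a..b} t)"
   using borel_integrable_atLeastAtMost'[of a b f] cont_subset[OF cf]
   by (simp add: set_integrable_def mult.commute)
  have "\<bar>F s - F 0\<bar> = \<bar>F b - F a\<bar>" by (simp add: a_def b_def min_def max_def abs_minus_commute)
  then have "en \<bar>F s - F 0\<bar> <= (NB t. en \<bar>f t * ind {a..b} t\<bar>)"
   using integral_norm_bound_ennreal[OF int] unfolding FTC by simp
  also have "... <= H x" unfolding H_def f_def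
  proof (rule nn_integral_mono_AE)
   \<comment> \<open>The closed interval contains the endpoint 0, which \<open>I 1\<close> omits; a
     single point is discarded.\<close>
   have "AE t in lborel. t ~= (0::real)" by (rule AE_lborel_singleton)
   then show "AE t in lborel. en \<bar>h' (proj0 x + t *R eN) * ind {a..b} t\<bar> <= ind (I 1) t * en \<bar>h' (proj0 x + t *R eN)\<bar>"
   proof eventually_elim
    case (elim t)
    have "t : I 1" if "t : {a..b}"
     using that s d elim by (cases sg) (auto simp: I_def a_def b_def min_def max_def split: if_splits)
    then show ?case by (auto simp: indicator_def)
   qed
  qed
  finally have le: "en \<bar>F s - F 0\<bar> <= H x" .
  have "en \<bar>F s\<bar> <= en (\<bar>F 0\<bar> + \<bar>F s - F 0\<bar>)" by (intro ennreal_leI) linarith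
  also have "... = en \<bar>F 0\<bar> + en \<bar>F s - F 0\<bar>" by (rule ennreal_plus) auto
  finally have "en \<bar>F s\<bar> <= en \<bar>F 0\<bar> + en \<bar>F s - F 0\<bar>" .
  also have "... <= en \<bar>F 0\<bar> + H x" using le by (rule add_left_mono)
  finally show ?thesis by (simp add: F_def)
 qed
 have dis: "(NB z. ind {z. 0 < sgnp sg * z $ last_ix \<and> sgnp sg * z $ last_ix < e \<and> norm (proj0 z) <= \<rho>} z * en \<bar>k z\<bar>)
  = (NB x. ind slab x * (ind P x * (NB s. ind (I e) s * en \<bar>k (proj0 x + s *R eN)\<bar>)))"
  if [measurable]: "k : bmeas" for k :: "'n rvec => real" and e
 proof -
  have "{z. 0 < sgnp sg * z $ last_ix \<and> sgnp sg * z $ last_ix < e \<and> norm (proj0 z) <= \<rho>} : sets (borel :: 'n rvec measure)"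
   by measurable
  then have "(%z. ind {z. 0 < sgnp sg * z $ last_ix \<and> sgnp sg * z $ last_ix < e \<and> norm (proj0 z) <= \<rho>} z * en \<bar>k z\<bar>) : bmeas"
   by measurable
  from nn_disintegration[OF this] show ?thesis
  proof (rule trans[OF sym], intro nn_integral_cong arg_cong2[of _ _ _ _ "(*)"] refl)
   fix x :: "'n rvec"
   have "(NB s. ind {z. 0 < sgnp sg * z $ last_ix \<and> sgnp sg * z $ last_ix < e \<and> norm (proj0 z) <= \<rho>} (proj0 x + s *R eN) * en \<bar>k (proj0 x + s *R eN)\<bar>)
    = (NB s. ind P x * (ind (I e) s * en \<bar>k (proj0 x + s *R eN)\<bar>))"
   proof (rule nn_integral_cong)
    fix s :: real
    have "proj0 (proj0 x) = proj0 x" by (simp add: proj0_def[of "proj0 x"])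
    then show "ind {z. 0 < sgnp sg * z $ last_ix \<and> sgnp sg * z $ last_ix < e \<and> norm (proj0 z) <= \<rho>} (proj0 x + s *R eN) * en \<bar>k (proj0 x + s *R eN)\<bar>
     = ind P x * (ind (I e) s * en \<bar>k (proj0 x + s *R eN)\<bar>)"
     by (auto simp: indicator_def P_def I_def)
   qed
   then show "(NB s. ind {z. 0 < sgnp sg * z $ last_ix \<and> sgnp sg * z $ last_ix < e \<and> norm (proj0 z) <= \<rho>} (proj0 x + s *R eN) * en \<bar>k (proj0 x + s *R eN)\<bar>)
    = ind P x * (NB s. ind (I e) s * en \<bar>k (proj0 x + s *R eN)\<bar>)"
    by (simp add: nn_integral_cmult)
  qed
 qed
 have "(NB x. ind slab x * (ind P x * (NB s. ind (I d) s * en \<bar>h (proj0 x + s *R eN)\<bar>)))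
  <= (NB x. en d * (ind slab x * (ind P x * en \<bar>h (proj0 x)\<bar>) + ind slab x * (ind P x * H x)))"
 proof (rule nn_integral_mono)
  fix x :: "'n rvec"
  have "(NB s. ind (I d) s * en \<bar>h (proj0 x + s *R eN)\<bar>) <= (NB s. (en \<bar>h (proj0 x)\<bar> + H x) * ind (I d) s)"
   using step by (intro nn_integral_mono) (auto simp: indicator_def)
  also have "... = en d * (en \<bar>h (proj0 x)\<bar> + H x)"
   using d by (subst nn_integral_cmult_indicator) (auto simp: mI mult.commute)
  finally show "ind slab x * (ind P x * (NB s. ind (I d) s * en \<bar>h (proj0 x + s *R eN)\<bar>))
   <= en d * (ind slab x * (ind P x * en \<bar>h (proj0 x)\<bar>) + ind slab x * (ind P x * H x))"
   by (auto simp: indicator_def)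
 qed
 also have "... = en d * ((NB x. ind slab x * (ind P x * en \<bar>h (proj0 x)\<bar>)) + (NB x. ind slab x * (ind P x * H x)))"
  by (subst nn_integral_cmult, measurable, subst nn_integral_add, measurable)
 finally show ?thesis unfolding dis[OF \<open>h : bmeas\<close>] dis[OF \<open>h' : bmeas\<close>] H_def P_def .
qed

section \<open>Strips along the interface\<close>

lemma lpn1_add_le:
 assumes [measurable]: "f : lmeas" "g : lmeas" "S : sets lebesgue"
 shows "lpn 1 S (%x. f x + g x) <= lpn 1 S f + lpn 1 S g"
proof -
 have "lpn 1 S (%x. f x + g x) <= (NL x. ind S x * en (norm (f x) powr 1) + ind S x * en (norm (g x) powr 1))"
  unfolding lpn_def
  by (intro nn_integral_mono) (auto simp: indicator_def norm_triangle_ineq intro!: ennreal_leI simp flip: ennreal_plus)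
 also have "... = lpn 1 S f + lpn 1 S g" unfolding lpn_def by (rule nn_integral_add) measurable
 finally show ?thesis .
qed

lemma lpn1_triangle:
 assumes [measurable]: "f : lmeas" "g : lmeas" "h : lmeas" "S : sets lebesgue"
 shows "lpn 1 S (%x. f x - h x) <= lpn 1 S (%x. f x - g x) + lpn 1 S (%x. h x - g x)"
 using lpn1_add_le[of "%x. f x - g x" "%x. g x - h x" S] lpn_diff_commute[of 1 S g h] by simp

lemma Lq_norm1_tendsto:
 fixes U :: "nat => real^'n => 'b::euclidean_space"
 assumes G: "G : sets lebesgue" and U: "!!k. U k : Lq 1 G" and lim: "(%k. Lq_norm 1 G (U k)) ~~> 0"
 shows "(%k. lpn 1 G (U k)) ~~> 0"
proof -
 have "lpn 1 G (U k) = en (Lq_norm 1 G (U k))" for k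
  using Lq_norm_powr[OF G U[of k]] by (simp add: Lq_norm_nonneg)
 then show ?thesis using tendsto_ennrealI[OF lim] by simp
qed

lemma continuous_Lq_bounded:
 fixes u :: "real^'n => 'b::euclidean_space"
 assumes u: "ctn u" and G: "G : sets lebesgue" "bounded G" and p: "0 <= p"
 shows "u : Lq p G"
proof -
 obtain b where b: "G \<subseteq> cball 0 b" using G(2) unfolding bounded_iff by (auto simp: subset_iff)
 have "lpn p G u <= lpn p (cball 0 b) (%x. norm (u x))" using b p by (intro lpn_mono) auto
 also have "... < inft" using u p by (intro lpn_continuous_finite) (auto intro: continuous_on_norm)
 finally show ?thesis using G(1) cont_lmeas[OF u]
  by (simp add: Lq_iff_lpn meas_restrict1)
qed

lemma Lq1_diff:
 fixes f g :: "real^'n => 'b::euclidean_space"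
 assumes G: "G : sets lebesgue" and "f : Lq 1 G" "g : Lq 1 G"
 shows "(%x. f x - g x) : Lq 1 G"
proof -
 have "integrable (lebesgue_on G) f" "integrable (lebesgue_on G) g"
  using assms(2,3) by (auto simp: Lq_def integrable_norm_iff)
 then have "integrable (lebesgue_on G) (%x. f x - g x)" by (rule bi_diff)
 then show ?thesis by (auto simp: Lq_def)
qed

lemma tendsto_uniform_approx:
 fixes a L :: "real" and x :: "nat => real"
 assumes "!!e. e > 0 ==> \<exists>b l. (\<forall>n. \<bar>x n - b n\<bar> <= e) \<and> \<bar>l - L\<bar> <= e \<and> b ~~> l"
 shows "x ~~> L"
proof (rule metric_LIMSEQ_I)
 fix e :: real assume e: "e > 0"
 obtain b l where b: "!!n. \<bar>x n - b n\<bar> <= e / 4" "\<bar>l - L\<bar> <= e / 4" "b ~~> l"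
  using assms[of "e / 4"] e by auto
 obtain N where N: "!!n. n >= N ==> dist (b n) l < e / 4" using metric_LIMSEQ_D[OF b(3), of "e / 4"] e by auto
 have "dist (x n) L < e" if "n >= N" for n
  using b(1)[of n] b(2) N[OF that] e unfolding dist_real_def by linarith
 then show "\<exists>N. ALL n>=N. dist (x n) L < e" by blast
qed

lemma (in c1_diffeo) cov_bound:
 fixes f :: "'n rvec => 'b::euclidean_space"
 assumes f: "f : lmeas" and G: "G : sets lebesgue"
  and j: "0 < j" "!!z. z : U ==> j <= jac z" and U: "!!z. z : U ==> \<Phi> z : G" and p: "0 <= p"
 shows "(NL z. ind U z * en (norm (f (\<Phi> z)) powr p)) <= en (1 / j) * lpn p G f"
proof -
 note [measurable] = f G
 define k where "k y = ind G y * en (norm (f y) powr p)" for y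
 have k[measurable]: "k : lmeas" unfolding k_def by measurable
 have "(NL z. ind U z * en (norm (f (\<Phi> z)) powr p)) <= (NL z. en (1 / j) * (en (jac z) * k (\<Phi> z)))"
 proof (rule nn_integral_mono)
  fix z
  show "ind U z * en (norm (f (\<Phi> z)) powr p) <= en (1 / j) * (en (jac z) * k (\<Phi> z))"
  proof (cases "z : U")
   case True
   have "1 <= en (1 / j * jac z)"
    using j(1) j(2)[OF True] ennreal_leI[of 1 "1 / j * jac z"] by (simp add: le_divide_eq)
   then have "1 * k (\<Phi> z) <= en (1 / j * jac z) * k (\<Phi> z)" by (rule mult_right_mono) simp
   also have "en (1 / j * jac z) = en (1 / j) * en (jac z)"
    using j(1) by (intro ennreal_mult') simp
   finally show ?thesis using True U[OF True] by (simp add: k_def mult.assoc)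
  qed simp
 qed
 also have "... = en (1 / j) * (NL z. en (jac z) * k (\<Phi> z))"
  by (rule nn_integral_cmult) (intro borel_measurable_times_ennreal measurable_comp_\<Phi> k; simp add: measurable_completion)
 also have "(NL z. en (jac z) * k (\<Phi> z)) = lpn p G f"
  unfolding nn_cov[OF k, symmetric] lpn_def by (rule nn_integral_cong) (simp add: k_def)
 finally show ?thesis .
qed

context bent
begin

lemma W_normal_derivative:
 assumes W: "Ck 1 W"
 shows "((%s. W (\<Phi> (z + s *R eN))) has_real_derivative (grad W (\<Phi> (z + s *R eN)) \<bullet> (M (z + s *R eN) *v eN))) (at s)"
proof -
 have 1: "((%s. z + s *R eN) has_derivative (%t. t *R eN)) (at s)" by (auto intro!: derivative_eq_intros)
 have 2: "((%s. \<Phi> (z + s *R eN)) has_derivative (%t. M (z + s *R eN) *v (t *R eN))) (at s)"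
  using diff_chain_at[OF 1 der\<Phi>] by (simp add: o_def)
 have "((%s. W (\<Phi> (z + s *R eN))) has_derivative
  (%t. \<Sum>i\<in>UNIV. pd i W (\<Phi> (z + s *R eN)) * (M (z + s *R eN) *v (t *R eN)) $ i)) (at s)"
  using diff_chain_at[OF 2 has_derivative_pd[OF Ck1D(1)[OF W]]] by (simp add: o_def)
 moreover have "(%t. \<Sum>i\<in>UNIV. pd i W (\<Phi> (z + s *R eN)) * (M (z + s *R eN) *v (t *R eN)) $ i) =
  (*) (grad W (\<Phi> (z + s *R eN)) \<bullet> (M (z + s *R eN) *v eN))"
  by (rule ext) (simp add: inner_vec_def matrix_vector_mult_scaleR sum_distrib_left sum_distrib_right mult_ac)
 ultimately show ?thesis by (simp add: has_field_derivative_def)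
qed

lemma continuous_MeN: "ctn (%z. M z *v eN)"
proof (rule continuous_on_cartI)
 fix i
 have "(M z *v eN) $ i = M z $ i $ last_ix" for z
  by (simp add: matrix_vector_mult_def axis_def if_distrib[of "(*) _"] cong: if_cong)
 then show "ctn (%z. (M z *v eN) $ i)" by (simp add: continuous_on_component contM)
qed

lemma interface_measure_eq: "IM = distr (restrict_space lborel slab) borel (%x. \<Phi> (proj0 x))"
 unfolding interface_measure_def slab_def proj0_def ..

lemma nn_integral_interface:
 assumes [measurable]: "f : bmeas"
 shows "(\<integral>\<^sup>+y. f y \<partial>IM) = (NB x. ind slab x * f (\<Phi> (proj0 x)))"
proof -
 have [measurable]: "(%x. \<Phi> (proj0 x)) : borel_measurable (restrict_space lborel slab)"
  by (intro meas_restrict1) measurable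
 show ?thesis unfolding interface_measure_eq
  by (subst nn_integral_distr) (auto simp: nn_integral_restrict_space mult.commute)
qed

lemma sets_interface [simp]: "sets (IM) = sets borel"
 by (simp add: interface_measure_def)

lemma AE_interface:
 assumes P: "AE y in IM. P y"
 shows "AE x in lborel. x : slab --> P (\<Phi> (proj0 x))"
proof -
 obtain N where N: "{y : space (IM). \<not> P y} \<subseteq> N" "emeasure (IM) N = 0" "N : sets borel"
  using P by (auto elim!: AE_E)
 note [measurable] = N(3)
 have sp: "space (IM) = UNIV" by (simp add: interface_measure_def)
 have "(\<integral>\<^sup>+y. ind N y \<partial>IM) = 0" using N by simp
 then have "(NB x. ind slab x * ind N (\<Phi> (proj0 x))) = 0"
  using nn_integral_interface[of "ind N"] by simp
 then have "AE x in lborel. ind slab x * ind N (\<Phi> (proj0 x)) = (0::ennreal)"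
  by (subst (asm) nn_integral_0_iff_AE) auto
 then show ?thesis by eventually_elim (use N(1) sp in \<open>auto simp: indicator_def split: if_splits\<close>)
qed

lemma interface_ball_finite: "emeasure (IM) (ball 0 R) < inft"
proof -
 have "bounded (Ps ` cball 0 R)"
  by (intro compact_imp_bounded compact_cont_image cont_subset[OF Ps_continuous]) auto
 then obtain b where b: "!!y. y : cball 0 R ==> norm (Ps y) <= b" unfolding bounded_iff by blast
 have [measurable]: "ball (0::'n rvec) R : sets borel" by simp
 have "emeasure (IM) (ball 0 R) = (\<integral>\<^sup>+y. ind (ball 0 R) y \<partial>IM)" by simp
 also have "... = (NB x. ind slab x * ind (ball 0 R) (\<Phi> (proj0 x)))"
  by (rule nn_integral_interface) measurable
 also have "... <= (\<integral>\<^sup>+x. ind (cball 0 (b + 1)) x \<partial>(lborel :: 'n rvec measure))"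
 proof (rule nn_integral_mono)
  fix x :: "'n rvec"
  have "norm x <= b + 1" if "x : slab" "\<Phi> (proj0 x) : ball 0 R"
  proof -
   have "norm (Ps (\<Phi> (proj0 x))) <= b" using that(2) by (intro b) auto
   then have "norm (proj0 x) <= b" by simp
   moreover have "norm ((x $ last_ix) *R eN) <= 1" using that(1) by (simp add: slab_def)
   ultimately show ?thesis using norm_triangle_ineq[of "proj0 x" "(x $ last_ix) *R eN"] proj0_decomp[of x] by simp
  qed
  then show "ind slab x * ind (ball 0 R) (\<Phi> (proj0 x)) <= (ind (cball 0 (b + 1)) x :: ennreal)"
   by (auto simp: indicator_def)
 qed
 also have "... < inft" using emeasure_lborel_cball_finite by simp
 finally show ?thesis .
qed

lemma trace_measurable:
 assumes gi: "!!R. set_integrable (IM) (ball 0 R) g"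
 shows "g : bmeas"
proof (rule borel_measurable_LIMSEQ_metric)
 show "(%y. ind (ball 0 (real n)) y *R g y) : bmeas" for n
  using borel_measurable_integrable[OF gi[of "real n", unfolded set_integrable_def]]
  by (simp add: measurable_def[of "IM"] measurable_def[of borel] interface_measure_def)
 show "(%n. ind (ball 0 (real n)) y *R g y) ~~> g y" for y
 proof (rule tendsto_eventually)
  obtain N :: nat where "norm y < real N" using reals_Archimedean2 by blast
  then show "\<forall>\<^sub>F n in sequentially. ind (ball 0 (real n)) y *R g y = g y"
   unfolding ev_seq by (intro exI[of _ N]) auto
 qed
qed

lemma has_trace_integrable: "has_trace \<Phi> s w g ==> set_integrable (IM) (ball 0 R) g"
 unfolding has_trace_def by blast

text \<open>With a C^1 approximant \<open>W k\<close> in place of w, the rescaled strip integrals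
  converge by dominated convergence. The error of this replacement is uniform in n, because |W k -
  w| integrates over a strip of width d to at most d times E k; and E k, which combines the errors
  of the boundary values and of the gradients, tends to zero.\<close>

theorem strip_limit:
 fixes w g be :: "'n rvec => real" and m :: "real => real"
 assumes tr: "has_trace \<Phi> sg w g"
  and be: "ctn be" "!!z. \<rho> < norm z ==> be z = 0"
  and m: "ctn m" "!!t. t <= 0 \<or> 1 <= t ==> m t = 0"
 shows "(%n. real (Suc n) * (LL z. ind (half_space sg) z *
      (m (real (Suc n) * (sgnp sg * z $ last_ix)) * (be z * w (\<Phi> z)))))
   ~~> (LB q. ind slab (fst q) * (m (snd q) * (be (proj0 (fst q)) * g (\<Phi> (proj0 (fst q))))))"
proof -
 \<comment> \<open>A ball containing all the strips in use, since their width is at most 1.\<close>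
 define Kz where "Kz = cball (0::'n rvec) (\<bar>\<rho>\<bar> + 1)"
 have Kz: "compact Kz" by (simp add: Kz_def)
 have inKz: "z : Kz" if "norm (proj0 z) <= \<rho>" "\<bar>z $ last_ix\<bar> <= 1" for z
 proof -
  have "norm z <= norm (proj0 z) + norm ((z $ last_ix) *R (eN :: 'n rvec))"
   using norm_triangle_ineq[of "proj0 z" "(z $ last_ix) *R eN"] proj0_decomp[of z] by simp
  then show ?thesis using that by (simp add: Kz_def)
 qed
 have "bounded (\<Phi> ` Kz)"
  by (intro compact_imp_bounded compact_cont_image cont_subset[OF \<Phi>_continuous] Kz) auto
 then obtain R0 where R0: "!!z. z : Kz ==> norm (\<Phi> z) <= R0" unfolding bounded_iff by blast
 define R where "R = R0 + 1"
 have R: "\<Phi> z : ball 0 R" if "z : Kz" for z using R0[OF that] by (simp add: R_def)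
 define G where "G = Omega \<Phi> sg \<inter> ball 0 R"
 have GS[measurable]: "G : sets lebesgue" unfolding G_def by (intro sets.Int Omega_lebesgue) simp
 have Gb: "bounded G" unfolding G_def by (rule bounded_subset[OF bounded_ball]) auto
 obtain j where j: "j > 0" "!!z. z : Kz ==> j <= jac z"
 proof -
  have "Kz ~= {}" by (simp add: Kz_def)
  then obtain z0 where "z0 : Kz" "!!z. z : Kz ==> jac z0 <= jac z"
   using continuous_attains_inf[OF Kz _ cont_subset[OF jac_continuous]] by auto
  then show ?thesis using that[of "jac z0"] jac_pos by auto
 qed
 obtain D where D: "D > 0" "!!z. z : Kz ==> norm (M z *v eN) <= D"
 proof -
  have "bounded ((%z. M z *v eN) ` Kz)"
   by (intro compact_imp_bounded compact_cont_image cont_subset[OF continuous_MeN] Kz) auto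
  then show ?thesis using that by (auto simp: bounded_pos)
 qed
 obtain dw W where w: "w : Lq_loc_closure 1 (Omega \<Phi> sg)" and dw: "dw : Lq_loc_closure 1 (Omega \<Phi> sg)"
  and gi: "!!R. set_integrable (IM) (ball 0 R) g"
  and W: "!!k::nat. Ck 1 (W k)"
  and q0: "!!R. (%k. Lq_norm 1 (Omega \<Phi> sg \<inter> ball 0 R) (%x. W k x - w x)) ~~> 0"
  and r0: "!!R. (%k. Lq_norm 1 (Omega \<Phi> sg \<inter> ball 0 R) (%x. (\<chi> i. pd i (W k) x) - dw x)) ~~> 0"
  and p0: "!!R. (%k. LINT y:ball 0 R|IM. \<bar>W k y - g y\<bar>) ~~> 0"
  using tr unfolding has_trace_def by blast
 have LqG: "f : Lq 1 G" if "f : Lq_loc_closure 1 (Omega \<Phi> sg)" for f :: "'n rvec => 'b::euclidean_space"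
 proof -
  define K where "K = closure (Omega \<Phi> sg) \<inter> cball 0 R"
  have K: "compact K" unfolding K_def by (simp add: closed_Int_compact)
  then have KS: "K : sets lebesgue" using lm_compact by blast
  have "f : Lq 1 (Omega \<Phi> sg \<inter> K)" using that K unfolding Lq_loc_closure_def K_def by blast
  moreover have "G \<subseteq> Omega \<Phi> sg \<inter> K" unfolding G_def K_def using closure_subset by fastforce
  ultimately show ?thesis using sets.Int[OF Omega_lebesgue KS] by (intro Lq_cmult_indicator(1)[OF _ _ _ GS]) auto
 qed
 have WLq: "W k : Lq 1 G" "grad (W k) : Lq 1 G" for k
  by (intro continuous_Lq_bounded GS Gb Ck1D(3)[OF W] continuous_grad[OF W]; simp)+
 have q: "(%k. lpn 1 G (%x. W k x - w x)) ~~> 0"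
  using q0[of R] unfolding G_def[symmetric] by (intro Lq_norm1_tendsto[OF GS] Lq1_diff GS WLq LqG w)
 have r: "(%k. lpn 1 G (%x. grad (W k) x - dw x)) ~~> 0"
  using r0[of R] unfolding G_def[symmetric] grad_def[symmetric] by (intro Lq_norm1_tendsto[OF GS] Lq1_diff GS WLq LqG dw)
 \<comment> \<open>Outside G the values of w and dw are arbitrary; extended by zero they are
   measurable on the whole space and can be composed with \<Phi>.\<close>
 define w0 where "w0 x = ind G x *R w x" for x
 define dw0 where "dw0 x = ind G x *R dw x" for x
 have w0m[measurable]: "w0 : lmeas" and dw0m[measurable]: "dw0 : lmeas"
  using LqG[OF w] LqG[OF dw] unfolding w0_def dw0_def Lq_iff_lpn[OF GS] LINT_lebesgue_on(3)[OF GS] by auto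
 have lw0: "lpn 1 G (%x. W k x - w x) = lpn 1 G (%x. W k x - w0 x)" for k by (intro lpn_cong) (simp add: w0_def)
 have ldw0: "lpn 1 G (%x. grad (W k) x - dw x) = lpn 1 G (%x. grad (W k) x - dw0 x)" for k by (intro lpn_cong) (simp add: dw0_def)
 have Wm[measurable]: "W k : lmeas" "grad (W k) : lmeas" for k
  by (intro cont_lmeas Ck1D(3)[OF W] continuous_grad[OF W])+
 have Wb[measurable]: "W k : bmeas" for k by (rule cont_bmeas[OF Ck1D(3)[OF W]])
 have gb[measurable]: "g : bmeas" by (rule trace_measurable[OF gi])
 define P where "P = {x::'n rvec. norm (proj0 x) <= \<rho>}"
 have [measurable]: "P : sets borel" unfolding P_def by measurable
 define p where "p k = (NB x. ind slab x * (ind P x * en \<bar>W k (\<Phi> (proj0 x)) - g (\<Phi> (proj0 x))\<bar>))" for k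
 have PR: "\<Phi> (proj0 x) : ball 0 R" if "x : P" for x
  using that by (intro R inKz) (simp_all add: P_def proj0_def[of "proj0 x"])
 have iWg: "set_integrable (IM) (ball 0 R) (%y. \<bar>W k y - g y\<bar>)" for k
 proof -
  have "set_integrable (IM) (ball 0 R) (W k)"
  proof -
   obtain b where b: "0 <= b" "!!x. x : cball 0 R ==> \<bar>W k x\<bar> <= b"
    using cont_bounded[OF Ck1D(3)[OF W] compact_cball] by blast
   show ?thesis unfolding set_integrable_def
   proof (rule bi_bound)
    show "integrable (IM) (%y. b * ind (ball 0 R) y)"
     using interface_ball_finite[of R] by (intro integrable_mult_right) (simp add: interface_measure_def)
    show "(%y. ind (ball 0 R) y *R W k y) : borel_measurable (IM)"
     using cont_bmeas[OF Ck1D(3)[OF W[of k]]]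
     by (simp add: measurable_cong_sets[OF sets_interface refl] borel_measurable_times borel_measurable_indicator)
    show "AE y in IM. norm (ind (ball 0 R) y *R W k y) <= norm (b * ind (ball 0 R) y)"
     using b by (intro AE_I2) (auto simp: indicator_def)
   qed
  qed
  from set_integral_diff(1)[OF this gi[of R]] show ?thesis by (rule set_integrable_abs)
 qed
 have plim: "p ~~> 0"
 proof (rule ennreal_tendsto_0_le)
  have "(%k. en (LINT y:ball 0 R|IM. \<bar>W k y - g y\<bar>)) ~~> ennreal 0"
   by (intro tendsto_ennrealI p0)
  then show "(%k. en (LINT y:ball 0 R|IM. \<bar>W k y - g y\<bar>)) ~~> 0" by simp
  show "\<forall>\<^sub>F k in sequentially. p k <= en (LINT y:ball 0 R|IM. \<bar>W k y - g y\<bar>)"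
  proof (rule always_eventually, rule allI)
   fix k
   have "en (LINT y:ball 0 R|IM. \<bar>W k y - g y\<bar>) =
     (\<integral>\<^sup>+y. en (ind (ball 0 R) y * \<bar>W k y - g y\<bar>) \<partial>IM)"
    using iWg[of k] unfolding set_lebesgue_integral_def set_integrable_def
    by (subst nn_integral_eq_integral) auto
   also have "... = (NB x. ind slab x * en (ind (ball 0 R) (\<Phi> (proj0 x)) * \<bar>W k (\<Phi> (proj0 x)) - g (\<Phi> (proj0 x))\<bar>))"
   proof (rule nn_integral_interface)
    have [measurable]: "ball (0::'n rvec) R : sets borel" by simp
    have "(%x. W k x - g x) : bmeas" by (rule borel_measurable_diff[OF Wb gb])
    then show "(%y. en (ind (ball 0 R) y * \<bar>W k y - g y\<bar>)) : bmeas" by measurable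
   qed
   also have "p k <= ..."
    unfolding p_def using PR by (intro nn_integral_mono) (auto simp: indicator_def)
   finally show "p k <= en (LINT y:ball 0 R|IM. \<bar>W k y - g y\<bar>)" .
  qed
 qed

 \<comment> \<open>The distance between w and its approximants, integrated over thin strips\<close>
 define U where "U d = {z :: 'n rvec. 0 < sgnp sg * z $ last_ix \<and> sgnp sg * z $ last_ix < d \<and> norm (proj0 z) <= \<rho>}" for d
 have [measurable]: "U d : sets borel" for d unfolding U_def by measurable
 have UK: "z : Kz" and UG: "\<Phi> z : G" if "z : U d" "d <= 1" for z d
 proof -
  show zK: "z : Kz" using that by (intro inKz) (cases sg; auto simp: U_def)+
  show "\<Phi> z : G" unfolding G_def using R[OF zK] that by (simp add: \<Phi>_in_Omega half_space_sgnp U_def)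
 qed
 define X where "X k d = (NL z. ind (U d) z * en \<bar>W k (\<Phi> z) - w0 (\<Phi> z)\<bar>)" for k d
 define E where "E k = p k + en (D / j) * lpn 1 G (%x. grad (W k) x - dw0 x)" for k
 have covU: "(NL z. ind (U d) z * en (norm (f (\<Phi> z)))) <= en (1 / j) * lpn 1 G f"
  if f: "f : lmeas" and d: "d <= 1" for f :: "'n rvec => 'b::euclidean_space" and d
  using cov_bound[OF f GS j(1), of "U d" 1] j(2) UK UG d by simp
 have X: "X k d <= en d * E k" if d: "0 < d" "d <= 1" for k d
 proof -
  \<comment> \<open>\<open>strip_bound\<close> applies to the C^1 difference of two approximants.
    The function w is reached as l tends to infinity: the last term lacks the factor d but vanishes
    in that limit.\<close>
  have "X k d <= en d * (E k + E l) + en (1 / j) * lpn 1 G (%x. W l x - w0 x)" for l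
  proof -
   define h where "h z = W k (\<Phi> z) - W l (\<Phi> z)" for z
   define V where "V x = W k x - W l x" for x
   have V: "Ck 1 V" unfolding V_def by (rule Ck_diff[OF W W])
   define h' where "h' z = grad V (\<Phi> z) \<bullet> (M z *v eN)" for z
   have gV: "grad V x = grad (W k) x - grad (W l) x" for x
    unfolding V_def by (simp add: vec_eq_iff pd_diff[OF Ck1D(1)[OF W] Ck1D(1)[OF W]])
   have ch: "ctn h" unfolding h_def
    by (intro continuous_intros cont_comp2[OF Ck1D(3)[OF W] \<Phi>_continuous]) auto
   have ch': "ctn h'" unfolding h'_def
    by (intro continuous_intros cont_comp2[OF continuous_grad[OF V] \<Phi>_continuous] continuous_MeN) auto
   have [measurable]: "h : bmeas" "h' : bmeas"
    using ch ch' by (auto intro: cont_bmeas)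
   have SB: "(NB z. ind (U d) z * en \<bar>h z\<bar>) <=
    en d * ((NB x. ind slab x * (ind P x * en \<bar>h (proj0 x)\<bar>)) + (NB z. ind (U 1) z * en \<bar>h' z\<bar>))"
    unfolding U_def P_def
    using W_normal_derivative[OF V] unfolding h'_def[symmetric]
    by (intro strip_bound ch ch' d) (simp add: h_def V_def)
   have 1: "(NB x. ind slab x * (ind P x * en \<bar>h (proj0 x)\<bar>)) <= p k + p l"
   proof -
    have "(NB x. ind slab x * (ind P x * en \<bar>h (proj0 x)\<bar>)) <=
     (NB x. ind slab x * (ind P x * en \<bar>W k (\<Phi> (proj0 x)) - g (\<Phi> (proj0 x))\<bar>)
      + ind slab x * (ind P x * en \<bar>W l (\<Phi> (proj0 x)) - g (\<Phi> (proj0 x))\<bar>))"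
     unfolding h_def by (intro nn_integral_mono) (auto simp: indicator_def intro!: ennreal_leI simp flip: ennreal_plus)
    also have "... = p k + p l" unfolding p_def by (rule nn_integral_add) measurable
    finally show ?thesis .
   qed
   have 2: "(NB z. ind (U 1) z * en \<bar>h' z\<bar>) <= en (D / j) * (lpn 1 G (%x. grad (W k) x - dw0 x) + lpn 1 G (%x. grad (W l) x - dw0 x))"
   proof -
    have gVm: "grad V : lmeas" by (rule cont_lmeas[OF continuous_grad[OF V]])
    have "(NB z. ind (U 1) z * en \<bar>h' z\<bar>) = (NL z. ind (U 1) z * en \<bar>h' z\<bar>)"
     by (simp add: nn_integral_completion)
    also have "... <= (NL z. en D * (ind (U 1) z * en (norm (grad V (\<Phi> z)))))"
    proof (rule nn_integral_mono)
     fix z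
     have "\<bar>h' z\<bar> <= D * norm (grad V (\<Phi> z))" if "z : U 1"
     proof -
      have "\<bar>h' z\<bar> <= norm (grad V (\<Phi> z)) * norm (M z *v eN)" unfolding h'_def by (rule Cauchy_Schwarz_ineq2)
      also have "... <= norm (grad V (\<Phi> z)) * D" using D(2)[OF UK[OF that]] by (intro mult_left_mono) auto
      finally show ?thesis by (simp add: mult.commute)
     qed
     then show "ind (U 1) z * en \<bar>h' z\<bar> <= en D * (ind (U 1) z * en (norm (grad V (\<Phi> z))))"
      using D(1) by (auto simp: indicator_def ennreal_leI simp flip: ennreal_mult')
    qed
    also have "... = en D * (NL z. ind (U 1) z * en (norm (grad V (\<Phi> z))))"
    proof (rule nn_integral_cmult)
     have [measurable]: "(%z. grad V (\<Phi> z)) : lmeas" by (rule measurable_comp_\<Phi>[OF gVm])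
     have [measurable]: "U 1 : sets lebesgue" by (simp add: sets_completionI_sets)
     show "(%z. ind (U 1) z * en (norm (grad V (\<Phi> z)))) : lmeas" by measurable
    qed
    also have "... <= en D * (en (1 / j) * lpn 1 G (grad V))"
     by (intro mult_left_mono covU gVm) auto
    also have "... = en (D / j) * lpn 1 G (%x. grad (W k) x - grad (W l) x)"
     using D(1) j(1) by (simp add: mult.assoc[symmetric] gV[abs_def] flip: ennreal_mult')
    also have "... <= en (D / j) * (lpn 1 G (%x. grad (W k) x - dw0 x) + lpn 1 G (%x. grad (W l) x - dw0 x))"
     by (intro mult_left_mono lpn1_triangle) auto
    finally show ?thesis .
   qed
   have Wlw: "(%y. W l y - w0 y) : lmeas" by measurable
   have hm: "h : lmeas" using ch by (rule cont_lmeas)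
   have US[measurable]: "U d : sets lebesgue" by (simp add: sets_completionI_sets)
   have "X k d <= (NL z. ind (U d) z * en \<bar>h z\<bar> + ind (U d) z * en (norm (W l (\<Phi> z) - w0 (\<Phi> z))))"
    unfolding X_def h_def
    by (intro nn_integral_mono) (auto simp: indicator_def intro!: ennreal_leI simp flip: ennreal_plus)
   also have "... = (NL z. ind (U d) z * en \<bar>h z\<bar>) + (NL z. ind (U d) z * en (norm (W l (\<Phi> z) - w0 (\<Phi> z))))"
   proof (rule nn_integral_add)
    show "(%z. ind (U d) z * en \<bar>h z\<bar>) : lmeas" using hm by measurable
    have "(%z. W l (\<Phi> z) - w0 (\<Phi> z)) : lmeas" using measurable_comp_\<Phi>[OF Wlw] .
    then show "(%z. ind (U d) z * en (norm (W l (\<Phi> z) - w0 (\<Phi> z)))) : lmeas" by measurable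
   qed
   also have "... <= en d * ((p k + p l) + en (D / j) * (lpn 1 G (%x. grad (W k) x - dw0 x) + lpn 1 G (%x. grad (W l) x - dw0 x)))
     + en (1 / j) * lpn 1 G (%x. W l x - w0 x)"
   proof (rule add_mono)
    show "(NL z. ind (U d) z * en \<bar>h z\<bar>) <= en d * ((p k + p l) + en (D / j) * (lpn 1 G (%x. grad (W k) x - dw0 x) + lpn 1 G (%x. grad (W l) x - dw0 x)))"
     unfolding nn_integral_completion by (rule order_trans[OF SB]) (intro mult_left_mono add_mono 1 2; simp)
    show "(NL z. ind (U d) z * en (norm (W l (\<Phi> z) - w0 (\<Phi> z)))) <= en (1 / j) * lpn 1 G (%x. W l x - w0 x)"
     by (rule covU[OF Wlw d(2)])
   qed
   finally show ?thesis unfolding E_def by (simp add: distrib_left add_ac)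
  qed
  moreover have "(%l. en d * (E k + E l) + en (1 / j) * lpn 1 G (%x. W l x - w0 x)) ~~> ennreal d * (E k + 0) + 0"
  proof -
   have "E ~~> 0 + 0" unfolding E_def
    by (intro tendsto_add plim ennreal_tendsto_0_cmult r[unfolded ldw0]) simp
   then have "(%l. E k + E l) ~~> E k + 0" by (intro tendsto_add tendsto_const) simp
   then have "(%l. en d * (E k + E l)) ~~> ennreal d * (E k + 0)" by (intro ennreal_tendsto_cmult) simp
   then show ?thesis by (intro tendsto_add ennreal_tendsto_0_cmult q[unfolded lw0]) simp_all
  qed
  ultimately have "X k d <= en d * (E k + 0) + 0" by (intro tendsto_lowerbound[where F = sequentially]) auto
  then show ?thesis by simp
 qed

 \<comment> \<open>The error of replacing w by an approximant, uniformly in the strip width\<close>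
 have beK: "\<forall>z. z ~: cball 0 \<rho> --> be z = 0" using be(2) by auto
 obtain Cb where Cb: "Cb > 0" "!!z. \<bar>be z\<bar> <= Cb" using cont_supp_bounded[OF be(1) compact_cball beK] by blast
 have mK: "\<forall>t. t ~: {0..1} --> m t = 0" using m(2) by auto
 obtain Cm where Cm: "Cm > 0" "!!t. \<bar>m t\<bar> <= Cm" using cont_supp_bounded[OF m(1) compact_Icc mK] by blast
 define C where "C = Cm * Cb"
 have C: "C > 0" using Cm Cb by (simp add: C_def)
 define a where "a n z = ind (half_space sg) z * (m (real (Suc n) * (sgnp sg * z $ last_ix)) * be z)" for n z
 have aU: "a n z = 0" if zU: "z ~: U (inverse (real (Suc n)))" for n z
 proof -
  consider "z ~: half_space sg" | "inverse (real (Suc n)) <= sgnp sg * z $ last_ix" | "\<rho> < norm (proj0 z)"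
   using zU unfolding U_def half_space_sgnp by fastforce
  then show ?thesis
  proof cases
   case 2
   then have "1 <= real (Suc n) * (sgnp sg * z $ last_ix)"
    using mult_left_mono[OF 2, of "real (Suc n)"] by simp
   then show ?thesis by (simp add: a_def m(2))
  next
   case 3
   then have "be z = 0" using norm_proj0_le[of z] by (intro be(2)) simp
   then show ?thesis by (simp add: a_def)
  qed (simp add: a_def)
 qed
 have aC: "\<bar>a n z\<bar> <= C" for n z
  unfolding a_def C_def abs_mult using Cm Cb
  by (auto simp: indicator_def intro!: mult_mono)
 have hs: "half_space sg : sets (borel :: 'n rvec measure)" unfolding half_space_sgnp by measurable
 have [measurable]: "m : bmeas" "be : bmeas"
  using m(1) be(1) by (auto intro: cont_bmeas)
 have am[measurable]: "a n : bmeas" for n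
  unfolding a_def using hs by measurable
 define I where "I n v = real (Suc n) * (LL z. a n z * v (\<Phi> z))" for n v
 define L where "L v = (LB q. ind slab (fst q) * (m (snd q) * (be (proj0 (fst q)) * v (\<Phi> (proj0 (fst q))))))" for v
 have inv1: "0 < inverse (real (Suc n))" "inverse (real (Suc n)) <= 1" for n by (auto simp: inverse_eq_divide)
 have intd: "intg (%z. a n z * (W k (\<Phi> z) - w0 (\<Phi> z)))"
  and Id: "\<bar>I n w0 - I n (W k)\<bar> <= C * enn2real (E k)" if Ef: "E k < inft" for n k
 proof -
  have mW: "(%z. W k (\<Phi> z) - w0 (\<Phi> z)) : lmeas"
   by (rule measurable_comp_\<Phi>[of "%y. W k y - w0 y"]) measurable
  have am': "a n : lmeas" using am by (simp add: measurable_completion)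
  have US[measurable]: "U d : sets lebesgue" for d by (simp add: sets_completionI_sets)
  have B: "(NL z. en (norm (a n z * (W k (\<Phi> z) - w0 (\<Phi> z))))) <= en (C * inverse (real (Suc n)) * enn2real (E k))"
  proof -
   have "(NL z. en (norm (a n z * (W k (\<Phi> z) - w0 (\<Phi> z))))) <=
    (NL z. en C * (ind (U (inverse (real (Suc n)))) z * en \<bar>W k (\<Phi> z) - w0 (\<Phi> z)\<bar>))"
   proof (rule nn_integral_mono)
    fix z
    show "en (norm (a n z * (W k (\<Phi> z) - w0 (\<Phi> z)))) <= en C * (ind (U (inverse (real (Suc n)))) z * en \<bar>W k (\<Phi> z) - w0 (\<Phi> z)\<bar>)"
    proof (cases "z : U (inverse (real (Suc n)))")
     case True
     then show ?thesis using mult_right_mono[OF aC[of n z], of "\<bar>W k (\<Phi> z) - w0 (\<Phi> z)\<bar>"] C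
      by (simp add: abs_mult ennreal_leI flip: ennreal_mult')
    qed (simp add: aU)
   qed
   also have "... = en C * X k (inverse (real (Suc n)))"
    unfolding X_def by (rule nn_integral_cmult) (use mW in measurable)
   also have "... <= en C * (en (inverse (real (Suc n))) * E k)" by (intro mult_left_mono X inv1) simp
   also have "... = en (C * inverse (real (Suc n)) * enn2real (E k))"
    using Ef C by (cases "E k") (auto simp: ennreal_mult' mult.assoc)
   finally show ?thesis .
  qed
  show int: "intg (%z. a n z * (W k (\<Phi> z) - w0 (\<Phi> z)))"
   by (rule integrableI_bounded[OF borel_measurable_times[OF am' mW]]) (rule order_le_less_trans[OF B], simp)
  have iW: "intg (%z. a n z * W k (\<Phi> z))"
  proof -
   obtain b where b: "0 <= b" "!!z. z : Kz ==> \<bar>W k (\<Phi> z)\<bar> <= b"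
    using cont_bounded[OF cont_comp2[OF Ck1D(3)[OF W] \<Phi>_continuous subset_UNIV] Kz] by blast
   show ?thesis
   proof (rule supp_int[OF _ Kz])
   show "(%z. a n z * W k (\<Phi> z)) : lmeas"
    by (intro borel_measurable_times am' measurable_comp_\<Phi>) measurable
   show "\<forall>z. z ~: Kz --> a n z * W k (\<Phi> z) = 0"
    using aU[of _ n] UK[OF _ inv1(2)[of n]] by (metis mult_zero_left)
   show "\<bar>a n z * W k (\<Phi> z)\<bar> <= C * b" for z
   proof (cases "z : Kz")
    case True
    then show ?thesis unfolding abs_mult using aC b C by (intro mult_mono) auto
   next
    case False
    then have "a n z = 0" using aU[of z n] UK[OF _ inv1(2)[of n]] by blast
    then show ?thesis using C b by simp
   qed
   qed
  qed
  have "I n w0 = I n (W k) - real (Suc n) * (LL z. a n z * (W k (\<Phi> z) - w0 (\<Phi> z)))"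
  proof -
   have "(LL z. a n z * w0 (\<Phi> z)) = (LL z. a n z * W k (\<Phi> z) - a n z * (W k (\<Phi> z) - w0 (\<Phi> z)))"
    by (intro bi_cong) (auto simp: algebra_simps)
   also have "... = (LL z. a n z * W k (\<Phi> z)) - (LL z. a n z * (W k (\<Phi> z) - w0 (\<Phi> z)))"
    using iW int by (rule bi_int_diff)
   finally show ?thesis unfolding I_def by (simp only: right_diff_distrib)
  qed
  then have "\<bar>I n w0 - I n (W k)\<bar> = real (Suc n) * \<bar>LL z. a n z * (W k (\<Phi> z) - w0 (\<Phi> z))\<bar>"
   by (simp add: abs_mult)
  also have "... <= real (Suc n) * (C * inverse (real (Suc n)) * enn2real (E k))"
  proof (rule mult_left_mono)
   have "en \<bar>LL z. a n z * (W k (\<Phi> z) - w0 (\<Phi> z))\<bar> <= en (C * inverse (real (Suc n)) * enn2real (E k))"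
    using order_trans[OF integral_norm_bound_ennreal[OF int] B] by simp
   then show "\<bar>LL z. a n z * (W k (\<Phi> z) - w0 (\<Phi> z))\<bar> <= C * inverse (real (Suc n)) * enn2real (E k)"
    using C by (subst (asm) ennreal_le_iff) auto
  qed simp
  also have "... = C * enn2real (E k)" by (simp add: field_simps del: of_nat_Suc)
  finally show "\<bar>I n w0 - I n (W k)\<bar> <= C * enn2real (E k)" .
 qed

 \<comment> \<open>The limiting boundary integral as an integral over base points and rescaled
   depths\<close>
 define SP :: "('n rvec \<times> real) set" where "SP = (slab \<inter> P) \<times> {0..1}"
 have SPm[measurable]: "SP : sets borel" unfolding SP_def borel_prod[symmetric] by measurable
 have SPf: "emeasure lborel SP < inft"
 proof -
  have "bounded (slab \<inter> P)"
  proof (rule bounded_subset[OF compact_imp_bounded[OF Kz]], rule subsetI)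
   fix x :: "'n rvec" assume "x : slab \<inter> P"
   then show "x : Kz" by (intro inKz) (auto simp: slab_def P_def)
  qed
  then have "bounded SP" unfolding SP_def by (intro bounded_Times) auto
  then obtain b where "SP \<subseteq> cball 0 b" unfolding bounded_iff by (auto simp: subset_iff)
  then have "emeasure lborel SP <= emeasure lborel (cball (0 :: 'n rvec \<times> real) b)" by (intro emeasure_mono) auto
  also have "... < inft" by (rule emeasure_lborel_cball_finite)
  finally show ?thesis .
 qed
 have fst_m[measurable]: "(%q::'n rvec \<times> real. k (fst q)) : bmeas" if "k : bmeas" for k :: "'n rvec => 'b::topological_space"
  using that by (auto intro: measurable_compose[OF cont_bmeas[OF continuous_on_fst[OF continuous_on_id]]])
 have snd_m[measurable]: "(%q::'n rvec \<times> real. k (snd q)) : bmeas" if "k : bmeas" for k :: "real => 'b::topological_space"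
  using that by (auto intro: measurable_compose[OF cont_bmeas[OF continuous_on_snd[OF continuous_on_id]]])
 have slabm: "(%q::'n rvec \<times> real. ind slab (fst q) :: real) : bmeas"
  by (rule fst_m) measurable
 define b where "b v q = ind slab (fst q) * (m (snd q) * (be (proj0 (fst q)) * v (\<Phi> (proj0 (fst q)))))" for v and q :: "'n rvec \<times> real"
 have bm[measurable]: "b v : bmeas" if [measurable]: "v : bmeas" for v
  unfolding b_def
  by (intro borel_measurable_times slabm snd_m[of m] fst_m[of "%x. be (proj0 x)"] fst_m[of "%x. v (\<Phi> (proj0 x))"]) measurable
 have bSP: "b v q = 0" if qS: "q ~: SP" for v q
 proof -
  consider "fst q ~: slab" | "\<rho> < norm (proj0 (fst q))" | "snd q ~: {0..1}"
   using qS unfolding SP_def P_def by (cases q) auto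
  then show ?thesis by cases (use mK be(2) in \<open>auto simp: b_def\<close>)
 qed
 have bC: "\<bar>b v q\<bar> <= C * \<bar>v (\<Phi> (proj0 (fst q)))\<bar>" for v q
 proof -
  have "\<bar>m (snd q)\<bar> * \<bar>be (proj0 (fst q))\<bar> <= C" unfolding C_def using Cm Cb by (intro mult_mono) auto
  then have "\<bar>m (snd q)\<bar> * \<bar>be (proj0 (fst q))\<bar> * \<bar>v (\<Phi> (proj0 (fst q)))\<bar> <= C * \<bar>v (\<Phi> (proj0 (fst q)))\<bar>" by (intro mult_right_mono) auto
  then show ?thesis using C by (auto simp: b_def indicator_def abs_mult mult.assoc)
 qed
 have iW: "integrable lborel (b (W k))" for k
 proof -
  obtain c where c: "0 <= c" "!!z. z : Kz ==> \<bar>W k (\<Phi> z)\<bar> <= c"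
   using cont_bounded[OF cont_comp2[OF Ck1D(3)[OF W] \<Phi>_continuous subset_UNIV] Kz] by blast
  show ?thesis
  proof (rule bi_bound)
   show "integrable lborel (%q. C * c * ind SP q)" using SPf by (intro integrable_mult_right) simp
   show "b (W k) : borel_measurable lborel" by simp
   show "AE q in lborel. norm (b (W k) q) <= norm (C * c * ind SP q)"
   proof (rule AE_I2)
    fix q
    show "norm (b (W k) q) <= norm (C * c * ind SP q)"
    proof (cases "q : SP")
     case True
     then have "proj0 (fst q) : Kz" unfolding SP_def P_def by (intro inKz) (auto simp: proj0_def[of "proj0 _"])
     then have "C * \<bar>W k (\<Phi> (proj0 (fst q)))\<bar> <= C * c" using C by (intro mult_left_mono c) auto
     then show ?thesis using order_trans[OF bC[of "W k" q]] True C c(1) by (simp add: abs_mult)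
    qed (simp add: bSP)
   qed
  qed
 qed
 have Ld: "\<bar>L (W k) - L g\<bar> <= C * enn2real (p k)" if pf: "p k < inft" for k
 proof -
  have [measurable]: "(%y. W k y - g y) : bmeas" by measurable
  have B: "(NB q. en (norm (b (%y. W k y - g y) q))) <= en (C * enn2real (p k))"
  proof -
   define f where "f x = ind slab x * (ind P x * en \<bar>W k (\<Phi> (proj0 x)) - g (\<Phi> (proj0 x))\<bar>)" for x
   have [measurable]: "f : bmeas" unfolding f_def by measurable
   have "(NB q. en (norm (b (%y. W k y - g y) q))) <= (NB q. en C * (f (fst q) * ind {0..1::real} (snd q)))"
   proof (rule nn_integral_mono)
    fix q :: "'n rvec \<times> real"
    show "en (norm (b (%y. W k y - g y) q)) <= en C * (f (fst q) * ind {0..1::real} (snd q))"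
    proof (cases "q : SP")
     case True
     then show ?thesis using bC[of "%y. W k y - g y" q] C
      by (cases q) (auto simp: SP_def f_def ennreal_leI simp flip: ennreal_mult')
    qed (simp add: bSP)
   qed
   also have "... = (NB x. (NB t. en C * (f x * ind {0..1::real} t)))"
   proof -
    have "(%q. en C * (f (fst q) * ind {0..1::real} (snd q))) : borel_measurable (lborel \<Otimes>\<^sub>M lborel)"
     by measurable
    from lborel.nn_integral_fst[OF this] show ?thesis by (simp add: lborel_prod)
   qed
   also have "... = (NB x. en C * f x)"
    by (intro nn_integral_cong) (simp add: mult.assoc[symmetric] nn_integral_cmult_indicator)
   also have "... = en C * p k" unfolding p_def f_def[symmetric] by (rule nn_integral_cmult) measurable
   also have "... = en (C * enn2real (p k))" using pf C by (cases "p k") (auto simp: ennreal_mult')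
   finally show ?thesis .
  qed
  have int: "integrable lborel (b (%y. W k y - g y))"
   by (rule integrableI_bounded) (simp, rule order_le_less_trans[OF B], simp)
  have "L g = L (W k) - (LB q. b (%y. W k y - g y) q)"
  proof -
   have "b g q = b (W k) q - b (%y. W k y - g y) q" for q by (simp add: b_def algebra_simps)
   then show ?thesis unfolding L_def b_def[symmetric] using iW int by simp
  qed
  then have "\<bar>L (W k) - L g\<bar> = \<bar>LB q. b (%y. W k y - g y) q\<bar>" by simp
  also have "... <= C * enn2real (p k)"
   using order_trans[OF integral_norm_bound_ennreal[OF int] B] C by (simp add: ennreal_le_iff)
  finally show ?thesis .
 qed

 \<comment> \<open>Shrinking strips for a fixed approximant\<close>
 have IW: "(%n. I n (W k)) ~~> L (W k)" for k
 proof -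
  have [measurable]: "(%z. a n z * W k (\<Phi> z)) : bmeas" for n by measurable
  \<comment> \<open>The signed width for \<open>LINT_disintegration\<close>; its sign selects the
    side of the interface.\<close>
  define c where "c n = sgnp sg * inverse (real (Suc n))" for n
  have c: "c n ~= 0" "inverse \<bar>c n\<bar> = real (Suc n)" for n
   using sgnp_cases[of sg] by (auto simp: c_def abs_mult)
  define b' where "b' n q = ind slab (fst q) * (m (snd q) * (be (proj0 (fst q) + (c n * snd q) *R eN) * W k (\<Phi> (proj0 (fst q) + (c n * snd q) *R eN))))" for n q
  have "I n (W k) = (LB q. b' n q)" for n
  proof -
   have "I n (W k) = inverse \<bar>c n\<bar> * (LB z. a n z * W k (\<Phi> z))"
    unfolding I_def c(2) by (simp add: integral_completion)
   also have "... = (LB q. ind slab (fst q) * (a n (proj0 (fst q) + (c n * snd q) *R eN) * W k (\<Phi> (proj0 (fst q) + (c n * snd q) *R eN))))"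
    by (rule LINT_disintegration[OF _ c(1)]) measurable
   also have "... = (LB q. b' n q)"
   proof (rule bi_cong[OF refl])
    fix q :: "'n rvec \<times> real"
    have zl: "(proj0 (fst q) + (c n * snd q) *R eN) $ last_ix = c n * snd q" by simp
    have "real (Suc n) * (sgnp sg * (c n * snd q)) = snd q"
     unfolding c_def by (simp add: mult.assoc[symmetric] del: of_nat_Suc)
    then have mz: "m (real (Suc n) * (sgnp sg * (proj0 (fst q) + (c n * snd q) *R eN) $ last_ix)) = m (snd q)"
     unfolding zl by (rule arg_cong)
    have "m (snd q) = 0" if "proj0 (fst q) + (c n * snd q) *R eN ~: half_space sg"
    proof -
     have "\<not> 0 < sgnp sg * (c n * snd q)" using that by (simp add: half_space_sgnp)
     then have "snd q <= 0" unfolding c_def by (simp add: mult.assoc zero_less_mult_iff not_less del: of_nat_Suc)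
     then show ?thesis using m(2) by blast
    qed
    then have "a n (proj0 (fst q) + (c n * snd q) *R eN) = m (snd q) * be (proj0 (fst q) + (c n * snd q) *R eN)"
     unfolding a_def mz by (cases "proj0 (fst q) + (c n * snd q) *R eN : half_space sg") auto
    then show "ind slab (fst q) * (a n (proj0 (fst q) + (c n * snd q) *R eN) * W k (\<Phi> (proj0 (fst q) + (c n * snd q) *R eN))) = b' n q"
     by (simp add: b'_def mult.assoc)
   qed
   finally show ?thesis .
  qed
  moreover have "(%n. LB q. b' n q) ~~> (LB q. b (W k) q)"
  proof -
   obtain d where d: "0 <= d" "!!z. z : Kz ==> \<bar>W k (\<Phi> z)\<bar> <= d"
    using cont_bounded[OF cont_comp2[OF Ck1D(3)[OF W] \<Phi>_continuous subset_UNIV] Kz] by blast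
   have cpos: "ctn (%q::'n rvec \<times> real. proj0 (fst q) + (c n * snd q) *R eN)" for n
    by (intro continuous_intros cont_comp2[OF continuous_proj0]) auto
   have cbW: "ctn (%z. be z * W k (\<Phi> z))"
    by (intro continuous_intros be cont_comp2[OF Ck1D(3)[OF W] \<Phi>_continuous]) auto
   show ?thesis
   proof (rule integral_dominated_convergence[where w = "%q. C * d * ind SP q"])
    show "b (W k) : borel_measurable lborel" by simp
    show "b' n : borel_measurable lborel" for n
    proof -
     have "(%q::'n rvec \<times> real. be (proj0 (fst q) + (c n * snd q) *R eN) * W k (\<Phi> (proj0 (fst q) + (c n * snd q) *R eN))) : bmeas"
      by (intro cont_bmeas cont_comp2[OF cbW cpos]) auto
     then show ?thesis unfolding b'_def using borel_measurable_times[OF slabm borel_measurable_times[OF snd_m[OF cont_bmeas[OF m(1)]]]] by simp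
    qed
    show "integrable lborel (%q. C * d * ind SP q)" using SPf by (intro integrable_mult_right) simp
    show "AE q in lborel. (%n. b' n q) ~~> b (W k) q"
    proof (rule AE_I2)
     fix q :: "'n rvec \<times> real"
     have "(%n. sgnp sg * inverse (real (Suc n))) ~~> sgnp sg * 0"
      by (intro tendsto_mult tendsto_const LIMSEQ_inverse_real_of_nat)
     then have "(%n. proj0 (fst q) + (c n * snd q) *R eN) ~~> proj0 (fst q) + (0 * snd q) *R eN"
      unfolding c_def[symmetric] by (intro tendsto_add tendsto_scaleR tendsto_mult tendsto_const) simp
     then have l: "(%n. proj0 (fst q) + (c n * snd q) *R eN) ~~> proj0 (fst q)" by simp
     have "isCont (%z. be z * W k (\<Phi> z)) (proj0 (fst q))"
      using cbW continuous_on_eq_continuous_at open_UNIV by blast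
     from isCont_tendsto_compose[OF this l] show "(%n. b' n q) ~~> b (W k) q"
      unfolding b'_def b_def by (intro tendsto_mult_left)
    qed
    show "AE q in lborel. norm (b' n q) <= C * d * ind SP q" for n
    proof (rule AE_I2)
     fix q :: "'n rvec \<times> real"
     define z where "z = proj0 (fst q) + (c n * snd q) *R eN"
     have pz: "proj0 z = proj0 (fst q)" unfolding z_def by (simp add: proj0_def[of "proj0 _"])
     have bz: "b' n q = ind slab (fst q) * (m (snd q) * (be z * W k (\<Phi> z)))" by (simp add: b'_def z_def)
     show "norm (b' n q) <= C * d * ind SP q"
     proof (cases "q : SP")
      case True
      have "\<bar>c n\<bar> <= 1" unfolding c_def using inv1(2)[of n] by (simp add: abs_mult)
      then have "\<bar>c n * snd q\<bar> <= 1" using True by (auto simp: SP_def abs_mult intro: mult_le_one)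
      then have "\<bar>z $ last_ix\<bar> <= 1" by (simp add: z_def)
      then have zK: "z : Kz" using True pz by (intro inKz) (auto simp: SP_def P_def)
      have "\<bar>m (snd q)\<bar> * (\<bar>be z\<bar> * \<bar>W k (\<Phi> z)\<bar>) <= Cm * (Cb * d)"
       using Cm Cb d(2)[OF zK] d(1) by (intro mult_mono) auto
      then show ?thesis using True unfolding bz C_def by (auto simp: SP_def abs_mult mult.assoc)
     next
      case False
      then consider "fst q ~: slab" | "\<rho> < norm (proj0 (fst q))" | "snd q ~: {0..1}"
       unfolding SP_def P_def by (cases q) auto
      then have "b' n q = 0"
      proof cases
       case 2
       then have "\<rho> < norm z" using norm_proj0_le[of z] pz by simp
       then show ?thesis using be(2) by (simp add: bz)
      qed (use mK in \<open>auto simp: bz\<close>)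
      then show ?thesis using False by simp
     qed
    qed
   qed
  qed
  ultimately show ?thesis unfolding L_def b_def[symmetric] by simp
 qed

 \<comment> \<open>Exchange of the limits in the approximant and in the strip width\<close>
 have "(%n. I n w0) ~~> L g"
 proof (rule tendsto_uniform_approx)
  fix e :: real assume e: "e > 0"
  have Elim: "E ~~> 0 + 0" unfolding E_def
   by (intro tendsto_add plim ennreal_tendsto_0_cmult r[unfolded ldw0]) simp
  have "\<forall>\<^sub>F k in sequentially. E k < en (e / C)"
   by (rule ennreal_tendsto_0D) (use Elim e C in auto)
  then obtain k where k: "E k < en (e / C)" using eventually_happens trivial_limit_sequentially by blast
  have pE: "p k <= E k" by (simp add: E_def)
  have fin: "E k < inft" "p k < inft" using k pE by (auto intro: less_trans order_le_less_trans)
  have "enn2real (E k) <= e / C" using k e C by (intro enn2real_leI) auto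
  then have 1: "C * enn2real (E k) <= e" using C by (simp add: field_simps)
  have "enn2real (p k) <= e / C" using k pE e C by (intro enn2real_leI) auto
  then have 2: "C * enn2real (p k) <= e" using C by (simp add: field_simps)
  show "\<exists>b l. (\<forall>n. \<bar>I n w0 - b n\<bar> <= e) \<and> \<bar>l - L g\<bar> <= e \<and> b ~~> l"
   using Id[OF fin(1)] Ld[OF fin(2)] IW[of k] 1 2
   by (intro exI[of _ "%n. I n (W k)"] exI[of _ "L (W k)"]) (auto intro: order_trans)
 qed
 moreover have "I n w0 = real (Suc n) * (LL z. ind (half_space sg) z *
      (m (real (Suc n) * (sgnp sg * z $ last_ix)) * (be z * w (\<Phi> z))))" for n
  unfolding I_def
 proof (rule arg_cong[where f = "%i. real (Suc n) * i"], rule bi_cong[OF refl])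
  fix z
  have "a n z * w0 (\<Phi> z) = a n z * w (\<Phi> z)"
   using aU[of z n] UG[OF _ inv1(2)[of n], of z] by (cases "z : U (inverse (real (Suc n)))") (auto simp: w0_def)
  then show "a n z * w0 (\<Phi> z) = ind (half_space sg) z *
      (m (real (Suc n) * (sgnp sg * z $ last_ix)) * (be z * w (\<Phi> z)))"
   by (simp add: a_def mult.assoc)
 qed
 ultimately show ?thesis unfolding L_def by simp
qed

end

section \<open>The Gauss formula\<close>

lemma max0_sq_derivative: "((%t. (max 0 t)\<^sup>2) has_real_derivative 2 * max 0 t) (at (t::real))"
 unfolding has_field_derivative_def
proof (rule has_derivativeI_sandwich[where e = 1 and H = "%y. \<bar>y - t\<bar>"])
 fix y :: real assume y: "y ~= t"
 have "\<bar>(max 0 y)\<^sup>2 - (max 0 t)\<^sup>2 - 2 * max 0 t * (y - t)\<bar> <= (y - t)\<^sup>2"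
 proof -
  consider "0 <= t" "0 <= y" | "0 <= t" "y < 0" | "t < 0" "0 <= y" | "t < 0" "y < 0" by linarith
  then show ?thesis
  proof cases
   case 1
   have "y\<^sup>2 - t\<^sup>2 - 2 * t * (y - t) = (y - t)\<^sup>2" by (simp add: power2_eq_square algebra_simps)
   then show ?thesis using 1 by simp
  next
   case 2
   have "t * y <= 0" using 2 by (simp add: mult_nonneg_nonpos)
   moreover have "(max 0 y)\<^sup>2 - (max 0 t)\<^sup>2 - 2 * max 0 t * (y - t) = t * t - 2 * (t * y)"
    using 2 by (simp add: power2_eq_square algebra_simps)
   moreover have "(y - t)\<^sup>2 = y * y - 2 * (t * y) + t * t" by (simp add: power2_eq_square algebra_simps)
   ultimately show ?thesis using zero_le_square[of t] zero_le_square[of y] by linarith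
  next
   case 3
   have "t * y <= 0" using 3 by (simp add: mult_nonpos_nonneg)
   then show ?thesis using 3 by (simp add: power2_eq_square algebra_simps)
  qed (auto simp: max_def)
 qed
 then have "\<bar>(max 0 y)\<^sup>2 - (max 0 t)\<^sup>2 - 2 * max 0 t * (y - t)\<bar> / \<bar>y - t\<bar> <= (y - t)\<^sup>2 / \<bar>y - t\<bar>"
  by (rule divide_right_mono) simp
 then show "norm ((max 0 y)\<^sup>2 - (max 0 t)\<^sup>2 - 2 * max 0 t * (y - t)) / norm (y - t) <= \<bar>y - t\<bar>"
 proof -
  have "(y - t)\<^sup>2 = \<bar>y - t\<bar> * \<bar>y - t\<bar>" by (simp add: power2_eq_square)
  moreover have "\<bar>y - t\<bar> * \<bar>y - t\<bar> / \<bar>y - t\<bar> = \<bar>y - t\<bar>" using y by (intro nonzero_mult_div_cancel_right) simp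
  ultimately show "\<bar>(max 0 y)\<^sup>2 - (max 0 t)\<^sup>2 - 2 * max 0 t * (y - t)\<bar> / \<bar>y - t\<bar> <= (y - t)\<^sup>2 / \<bar>y - t\<bar> ==>
   norm ((max 0 y)\<^sup>2 - (max 0 t)\<^sup>2 - 2 * max 0 t * (y - t)) / norm (y - t) <= \<bar>y - t\<bar>"
   by (simp only: real_norm_def)
 qed
next
 have "((%y. \<bar>y - t\<bar>) \<longlongrightarrow> \<bar>t - t\<bar>) (at t)" by (intro tendsto_intros)
 then show "((%y. \<bar>y - t\<bar>) \<longlongrightarrow> 0) (at t)" by simp
qed (simp_all add: bounded_linear_mult_right)

text \<open>The integral of the tent function \<open>hstep'\<close> with nodes 1/3, 1/2 and 2/3: a
  C^1 step from 0 to 1. It is constant near 0 and near 1, so its derivative is a weight as required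
  by \<open>strip_limit\<close>.\<close>

definition hstep :: "real => real" where
 "hstep t = 2 * (max 0 (3 * t - 1))\<^sup>2 - 4 * (max 0 (3 * t - 3 / 2))\<^sup>2 + 2 * (max 0 (3 * t - 2))\<^sup>2"

definition hstep' :: "real => real" where
 "hstep' t = 12 * max 0 (3 * t - 1) - 24 * max 0 (3 * t - 3 / 2) + 12 * max 0 (3 * t - 2)"

lemma hstep_derivative: "(hstep has_real_derivative hstep' t) (at t)"
proof -
 have 1: "((%t. (max 0 (3 * t - c))\<^sup>2) has_real_derivative 6 * max 0 (3 * t - c)) (at t)" for c
 proof -
  have "((%t. 3 * t - c) has_real_derivative 3) (at t)" by (auto intro!: derivative_eq_intros)
  from DERIV_chain2[OF max0_sq_derivative this] show ?thesis by (simp add: mult_ac)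
 qed
 show ?thesis unfolding hstep_def[abs_def] hstep'_def
  using DERIV_add[OF DERIV_diff[OF DERIV_cmult[OF 1[of 1], of 2] DERIV_cmult[OF 1[of "3/2"], of 4]] DERIV_cmult[OF 1[of 2], of 2]]
  by simp
qed

lemma hstep_0: "t <= 1 / 3 ==> hstep t = 0"
 by (simp add: hstep_def max_def)

lemma hstep_1: "2 / 3 <= t ==> hstep t = 1"
 by (simp add: hstep_def max_def power2_eq_square algebra_simps)

lemma hstep'_0: "t <= 1 / 3 ==> hstep' t = 0" "2 / 3 <= t ==> hstep' t = 0"
 by (simp_all add: hstep'_def max_def)

lemma continuous_hstep': "ctn hstep'"
 unfolding hstep'_def[abs_def] by (intro continuous_intros)

lemma continuous_hstep: "ctn hstep"
 unfolding hstep_def[abs_def] by (intro continuous_intros)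

lemma hstep_bounded: "\<exists>B. \<forall>t. \<bar>hstep t\<bar> <= B"
proof -
 obtain B where B: "0 <= B" "!!t. t : {0..1} ==> \<bar>hstep t\<bar> <= B"
  using cont_bounded[OF continuous_hstep compact_Icc] by blast
 have "\<bar>hstep t\<bar> <= B + 1" for t
 proof -
  consider "t < 0" | "t : {0..1}" | "1 < t" by fastforce
  then show ?thesis
  proof cases
   case 2 then show ?thesis using B(2)[of t] by simp
  qed (use B(1) hstep_0[of t] hstep_1[of t] in auto)
 qed
 then show ?thesis by blast
qed

lemma Ck1_comp_real:
 assumes f: "Ck 1 f" and h: "!!t. (h has_real_derivative h' t) (at t)" "ctn h'"
 shows "Ck 1 (%x. h (f x))" "pd i (%x. h (f x)) x = h' (f x) * pd i f x"
proof -
 show "pd i (%x. h (f x)) x = h' (f x) * pd i f x" by (rule pd_comp_real(2)[OF Ck1D(1)[OF f] h(1)])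
 show "Ck 1 (%x. h (f x))"
 proof (rule Ck1I[OF pd_comp_real(1)[OF Ck1D(1)[OF f] h(1)]])
  fix i
  have "ctn (%x. h' (f x) * (\<Sum>j\<in>UNIV. pd j f x * axis i 1 $ j))"
   by (intro continuous_intros Ck1D[OF f] cont_comp2[OF h(2) Ck1D(3)[OF f]]) auto
  then show "ctn (%x. h' (f x) * (\<Sum>j\<in>UNIV. pd j f x * axis i 1 $ j))" .
 qed
qed

lemma Lq_loc_closureD:
 assumes "f : Lq_loc_closure q G" "compact K"
 shows "f : Lq q (G \<inter> K)"
proof -
 have "compact (closure G \<inter> K)" using assms(2) by (simp add: closed_Int_compact)
 then have "f : Lq q (G \<inter> (closure G \<inter> K))" using assms(1) unfolding Lq_loc_closure_def by blast
 moreover have "G \<inter> (closure G \<inter> K) = G \<inter> K" using closure_subset[of G] by blast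
 ultimately show ?thesis by simp
qed

lemma Lq1_integrable:
 fixes f :: "real^'n => 'b::euclidean_space"
 assumes "f : Lq 1 G" "G : sets lebesgue"
 shows "intg (%x. ind G x *R f x)"
proof -
 have "integrable (lebesgue_on G) f" using assms(1) by (auto simp: Lq_def integrable_norm_iff)
 then show ?thesis using LINT_lebesgue_on(2)[OF assms(2)] by blast
qed

lemma integrable_mult_bounded:
 fixes f g :: "'a => real"
 assumes "integrable M f" "g : borel_measurable M" "!!x. \<bar>g x\<bar> <= B"
 shows "integrable M (%x. g x * f x)"
proof (rule bi_bound)
 show "integrable M (%x. B * f x)" using assms(1) by simp
 show "(%x. g x * f x) : borel_measurable M" using assms by measurable
 show "AE x in M. norm (g x * f x) <= norm (B * f x)"
 proof (rule AE_I2)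
  fix x
  have "\<bar>g x\<bar> * \<bar>f x\<bar> <= B * \<bar>f x\<bar>" using assms(3) by (intro mult_right_mono) auto
  moreover have "0 <= B" using assms(3)[of x] by linarith
  ultimately show "norm (g x * f x) <= norm (B * f x)" by (simp add: abs_mult)
 qed
qed

context bent
begin

text \<open>It depends on y only through the last coordinate of \<open>Ps y\<close>. Its gradient is
  thus parallel to the normal, and testing a divergence with it exposes the normal component of the
  field alone.\<close>

definition cut :: "nat => phase => 'n rvec => real" where
 "cut n s y = hstep (real (Suc n) * (sgnp s * Ps y $ last_ix))"

lemma cut_c1: "Ck 1 (cut n s)"
 and pd_cut: "pd i (cut n s) y = hstep' (real (Suc n) * (sgnp s * Ps y $ last_ix)) * (real (Suc n) * (sgnp s * M' (Ps y) $ last_ix $ i))"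
proof -
 have C: "Ck 1 (%y. real (Suc n) * (sgnp s * Ps y $ last_ix))" by (intro Ck_cmult Ck_Ps)
 show "Ck 1 (cut n s)" unfolding cut_def[abs_def] by (rule Ck1_comp_real(1)[OF C hstep_derivative continuous_hstep'])
 have "pd i (%y. real (Suc n) * (sgnp s * Ps y $ last_ix)) y = real (Suc n) * (sgnp s * M' (Ps y) $ last_ix $ i)"
  by (simp only: pd_cmult Ck1D(1)[OF Ck_Ps] Ck1D(1)[OF Ck_cmult[OF Ck_Ps]] pd_Ps)
 then show "pd i (cut n s) y = hstep' (real (Suc n) * (sgnp s * Ps y $ last_ix)) * (real (Suc n) * (sgnp s * M' (Ps y) $ last_ix $ i))"
  unfolding cut_def[abs_def] by (simp only: Ck1_comp_real(2)[OF C hstep_derivative continuous_hstep'])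
qed

lemma cut_outside:
 assumes "y ~: Om s"
 shows "cut n s y = 0" "hstep' (real (Suc n) * (sgnp s * Ps y $ last_ix)) = 0"
proof -
 have "real (Suc n) * (sgnp s * Ps y $ last_ix) <= 0"
  using assms by (intro mult_nonneg_nonpos[of "real (Suc n)"]) (auto simp: Omega_eq)
 then show "cut n s y = 0" "hstep' (real (Suc n) * (sgnp s * Ps y $ last_ix)) = 0"
  unfolding cut_def by (intro hstep_0 hstep'_0; linarith)+
qed

lemma cut_tendsto:
 assumes "y : Om s"
 shows "(%n. cut n s y) ~~> 1"
proof (rule tendsto_eventually)
 have p: "0 < sgnp s * Ps y $ last_ix" using assms by (simp add: Omega_eq)
 obtain m :: nat where m: "1 < real m * (sgnp s * Ps y $ last_ix)" using reals_Archimedean3[OF p] by blast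
 have "cut n s y = 1" if "m <= n" for n
 proof -
  have "real m * (sgnp s * Ps y $ last_ix) <= real (Suc n) * (sgnp s * Ps y $ last_ix)"
   using that p by (intro mult_right_mono) auto
  then show ?thesis unfolding cut_def using m by (intro hstep_1) linarith
 qed
 then show "\<forall>\<^sub>F n in sequentially. cut n s y = 1" unfolding ev_seq by blast
qed

lemma cut_test:
 assumes ph: "c1_test UNIV ph"
 shows "c1_test (Om s) (%y. cut n s y * ph y)"
proof -
 obtain K where K: "compact K" "\<forall>x. x ~: K --> ph x = 0" using c1_testD(1)[OF ph] by blast
 define L where "L = {y. 1 / 3 <= real (Suc n) * (sgnp s * Ps y $ last_ix)}"
 have "closed L" unfolding L_def
  by (intro closed_Collect_le continuous_intros continuous_on_component Ps_continuous)
 then have 1: "compact (K \<inter> L)" using K(1) by (simp add: compact_Int_closed)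
 have 2: "K \<inter> L \<subseteq> Om s"
 proof
  fix y assume "y : K \<inter> L"
  then have "0 < real (Suc n) * (sgnp s * Ps y $ last_ix)" by (simp add: L_def)
  then show "y : Om s" unfolding Omega_eq by (simp add: zero_less_mult_iff)
 qed
 have 3: "\<forall>y. y ~: K \<inter> L --> cut n s y * ph y = 0"
  using K(2) by (auto simp: L_def cut_def not_le intro!: hstep_0)
 show ?thesis by (rule c1_testI[OF Ck_mult[OF cut_c1 c1_testD(2)[OF ph]] 1 2 3])
qed

text \<open>The divergence of ph F when d is that of F, extended by zero from the domain.\<close>

definition flux :: "phase => ('n rvec => 'n rvec) => ('n rvec => real) => ('n rvec => real) => 'n rvec => real" where
 "flux s F d ph y = ind (Om s) y * (F y \<bullet> grad ph y + d y * ph y)"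

lemma flux_integrable:
 assumes F: "F : Lq_loc_closure 1 (Om s)" and d: "d : Lq_loc_closure 1 (Om s)"
  and ph: "c1_test UNIV ph"
 shows "intg (flux s F d ph)"
proof -
 obtain K where K: "compact K" "\<forall>x. x ~: K --> ph x = 0" using c1_testD(1)[OF ph] by blast
 note C = Ck1D[OF c1_testD(2)[OF ph]]
 have pK: "\<forall>x. x ~: K --> pd i ph x = 0" for i using pd_support[OF cmp_closed[OF K(1)] K(2)] by blast
 have KS: "Om s \<inter> K : sets lebesgue"
  using sets.Int[OF Omega_lebesgue[of s]] lm_compact[OF K(1)] by blast
 have iF: "intg (%x. ind (Om s \<inter> K) x * F x $ i)" for i
  using integrable_bounded_linear[OF bounded_linear_vec_nth[of i] Lq1_integrable[OF Lq_loc_closureD[OF F K(1)] KS]] by simp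
 have id: "intg (%x. ind (Om s \<inter> K) x * d x)"
  using Lq1_integrable[OF Lq_loc_closureD[OF d K(1)] KS] by simp
 have 1: "intg (%x. pd i ph x * (ind (Om s \<inter> K) x * F x $ i))" for i
 proof -
  obtain B where "!!x. \<bar>pd i ph x\<bar> <= B" using cont_supp_bounded[OF C(2) K(1) pK] by blast
  then show ?thesis by (intro integrable_mult_bounded[OF iF cont_lmeas[OF C(2)]])
 qed
 have 2: "intg (%x. ph x * (ind (Om s \<inter> K) x * d x))"
 proof -
  obtain B where "!!x. \<bar>ph x\<bar> <= B" using cont_supp_bounded[OF C(3) K(1,2)] by blast
  then show ?thesis by (intro integrable_mult_bounded[OF id cont_lmeas[OF C(3)]])
 qed
 have "flux s F d ph = (%x. (\<Sum>i\<in>UNIV. pd i ph x * (ind (Om s \<inter> K) x * F x $ i)) + ph x * (ind (Om s \<inter> K) x * d x))"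
 proof
  fix x
  show "flux s F d ph x = (\<Sum>i\<in>UNIV. pd i ph x * (ind (Om s \<inter> K) x * F x $ i)) + ph x * (ind (Om s \<inter> K) x * d x)"
   using K(2) pK by (cases "x : K"; cases "x : Om s") (auto simp: flux_def inner_vec_def mult_ac)
 qed
 then show ?thesis using 1 2 by simp
qed

text \<open>The weak divergence is tested with \<open>cut n s\<close> times ph. The gradient of the
  cut-off contributes a strip integral with weight n + 1, which the change of variables by \<Phi>
  brings into the form of \<open>strip_limit\<close>.\<close>

lemma flux_cutoff:
 assumes F: "F : Lq_loc_closure 1 (Om s)" and d: "d : Lq_loc_closure 1 (Om s)"
  and Fd: "has_weak_div (Om s) F d" and ph: "c1_test UNIV ph"
  and a: "!!z. z : half_space s ==> F (\<Phi> z) \<bullet> (M' z $ last_ix) = a z * ps (\<Phi> z)"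
 shows "(LL y. cut n s y * flux s F d ph y) = - sgnp s * (real (Suc n) * (LL z. ind (half_space s) z *
  (hstep' (real (Suc n) * (sgnp s * z $ last_ix)) * ((jac z * a z * ph (\<Phi> z)) * ps (\<Phi> z)))))"
proof -
 note C = Ck1D[OF c1_testD(2)[OF ph]] and D = Ck1D[OF cut_c1]
 define P where "P y = ind (Om s) y * (hstep' (real (Suc n) * (sgnp s * Ps y $ last_ix)) * ((F y \<bullet> (M' (Ps y) $ last_ix)) * ph y))" for y
 have pw: "(\<Sum>i\<in>UNIV. F y $ i * pd i (%y. cut n s y * ph y) y) + d y * (cut n s y * ph y) =
   cut n s y * flux s F d ph y + sgnp s * (real (Suc n) * P y)" for y
 proof (cases "y : Om s")
  case True
  have "pd i (%y. cut n s y * ph y) y = cut n s y * pd i ph y + hstep' (real (Suc n) * (sgnp s * Ps y $ last_ix)) * (real (Suc n) * (sgnp s * M' (Ps y) $ last_ix $ i)) * ph y" for i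
   by (simp only: pd_mult[OF D(1) C(1)] pd_cut)
  then have "(\<Sum>i\<in>UNIV. F y $ i * pd i (%y. cut n s y * ph y) y) =
   (\<Sum>i\<in>UNIV. cut n s y * (F y $ i * pd i ph y) + sgnp s * (real (Suc n) * (hstep' (real (Suc n) * (sgnp s * Ps y $ last_ix)) * ((F y $ i * M' (Ps y) $ last_ix $ i) * ph y))))"
   by (intro sum.cong refl) (simp only: algebra_simps)
  also have "... = cut n s y * (F y \<bullet> grad ph y) + sgnp s * (real (Suc n) * (hstep' (real (Suc n) * (sgnp s * Ps y $ last_ix)) * ((F y \<bullet> (M' (Ps y) $ last_ix)) * ph y)))"
   by (simp only: sum.distrib sum_distrib_left[symmetric] sum_distrib_right[symmetric] inner_vec_def inner_real_def grad_nth)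
  finally show ?thesis using True by (simp only: flux_def P_def indicator_simps mult_1 algebra_simps)
 next
  case False
  have "cut n s y * ph y = 0" using cut_outside[OF False] by simp
  moreover have "pd i (%y. cut n s y * ph y) y = 0" for i
   by (simp add: pd_mult[OF D(1) C(1)] pd_cut cut_outside[OF False] del: of_nat_Suc)
  ultimately show ?thesis using False by (simp add: flux_def P_def)
 qed
 note T = weak_div_c1[OF Fd open_Omega cut_test[OF ph], of n, unfolded pw]
 obtain B where B: "!!t. \<bar>hstep t\<bar> <= B" using hstep_bounded by blast
 have i1: "intg (%y. cut n s y * flux s F d ph y)"
  by (rule integrable_mult_bounded[OF flux_integrable[OF F d ph] cont_lmeas[OF D(3)], of _ _ B]) (simp add: cut_def B)
 have i2: "intg (%y. sgnp s * (real (Suc n) * P y))"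
  using bi_diff[OF T(2) i1] by simp
 \<comment> \<open>Undoing the constant factors gives the measurability of P that the change of
   variables requires.\<close>
 have "intg (%y. (sgnp s * inverse (real (Suc n))) * (sgnp s * (real (Suc n) * P y)))"
  by (rule integrable_mult_right[OF i2])
 then have Pm: "P : lmeas"
  using borel_measurable_integrable[of lebesgue P] sgnp_cases[of s] by (auto simp: mult.assoc simp del: of_nat_Suc)
 have "(LL y. P y) = (LL z. jac z * P (\<Phi> z))" by (rule LINT_cov[OF Pm])
 also have "... = (LL z. ind (half_space s) z *
  (hstep' (real (Suc n) * (sgnp s * z $ last_ix)) * ((jac z * a z * ph (\<Phi> z)) * ps (\<Phi> z))))"
  by (rule bi_cong) (auto simp: P_def \<Phi>_in_Omega indicator_def a)
 finally have PL: "(LL y. P y) = ..." .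
 have "0 = (LL y. cut n s y * flux s F d ph y) + sgnp s * (real (Suc n) * (LL y. P y))"
  using T(1) bi_int_add[OF i1 i2] by simp
 then show ?thesis unfolding PL by simp
qed

text \<open>An integral over the interface, parametrised by \<Phi> over the hyperplane, in the slab
  form of \<open>interface_measure\<close>. All density factors are collected in be.\<close>

definition bdry :: "('n rvec => real) => ('n rvec => real) => real" where
 "bdry be g = (LB x. ind slab x * (be (proj0 x) * g (\<Phi> (proj0 x))))"

lemma bdry_measurable:
 fixes be g :: "'n rvec => real"
 assumes be: "ctn be" and [measurable]: "g : bmeas"
 shows "(%x. ind slab x * (be (proj0 x) * g (\<Phi> (proj0 x)))) : bmeas"
proof -
 have [measurable]: "be : bmeas" by (rule cont_bmeas[OF be])
 show ?thesis by measurable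
qed

lemma bdry_integrable:
 fixes be g :: "'n rvec => real"
 assumes g: "!!R. set_integrable (IM) (ball 0 R) g"
  and be: "ctn be" "compact K" "\<forall>z. z ~: K --> be z = 0"
 shows "integrable lborel (%x. ind slab x * (be (proj0 x) * g (\<Phi> (proj0 x))))"
proof (rule integrableI_bounded)
 have gm[measurable]: "g : bmeas" by (rule trace_measurable[OF g])
 have bm[measurable]: "be : bmeas" by (rule cont_bmeas[OF be(1)])
 have pm[measurable]: "Ps : bmeas" by (rule cont_bmeas[OF Ps_continuous])
 show "(%x. ind slab x * (be (proj0 x) * g (\<Phi> (proj0 x)))) : borel_measurable lborel"
  using bdry_measurable[OF be(1) gm] by simp
 obtain B where B: "B > 0" "!!z. \<bar>be z\<bar> <= B" using cont_supp_bounded[OF be] by blast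
 have "bounded (\<Phi> ` K)"
  by (intro compact_imp_bounded compact_cont_image cont_subset[OF \<Phi>_continuous] be(2)) auto
 then obtain R where R: "!!z. z : K ==> norm (\<Phi> z) <= R" unfolding bounded_iff by blast
 have "(NB x. en (norm (ind slab x * (be (proj0 x) * g (\<Phi> (proj0 x)))))) =
  (NB x. ind slab x * en (norm (be (Ps (\<Phi> (proj0 x))) * g (\<Phi> (proj0 x)))))"
  by (intro nn_integral_cong) (auto simp: indicator_def)
 also have "... = (\<integral>\<^sup>+y. en (norm (be (Ps y) * g y)) \<partial>IM)"
  by (rule nn_integral_interface[symmetric]) measurable
 also have "... <= (\<integral>\<^sup>+y. en (norm (B * (ind (ball 0 (R + 1)) y *R g y))) \<partial>IM)"
 proof (rule nn_integral_mono)
  fix y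
  show "en (norm (be (Ps y) * g y)) <= en (norm (B * (ind (ball 0 (R + 1)) y *R g y)))"
  proof (cases "Ps y : K")
   case True
   then have "norm y <= R" using R[of "Ps y"] by simp
   moreover have "\<bar>be (Ps y)\<bar> * \<bar>g y\<bar> <= B * \<bar>g y\<bar>" using B by (intro mult_right_mono) auto
   ultimately show ?thesis using B(1) by (intro ennreal_leI) (simp add: abs_mult)
  next
   case False
   then have "be (Ps y) = 0" using be(3) by blast
   then show ?thesis by simp
  qed
 qed
 also have "... < inft"
 proof -
  have "integrable (IM) (%y. B * (ind (ball 0 (R + 1)) y *R g y))"
   using g[of "R + 1"] unfolding set_integrable_def by (rule integrable_mult_right)
  then show ?thesis unfolding integrable_iff_bounded by blast
 qed
 finally show "(NB x. en (norm (ind slab x * (be (proj0 x) * g (\<Phi> (proj0 x)))))) < inft" .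
qed

text \<open>In the limit, base point and depth separate, so Fubini's theorem factors the integral
  delivered by \<open>strip_limit\<close>.\<close>

lemma bdry_product:
 assumes g: "!!R. set_integrable (IM) (ball 0 R) g"
  and be: "ctn be" "compact K" "\<forall>z. z ~: K --> be z = 0"
 shows "(LB q. ind slab (fst q) * (hstep' (snd q) * (be (proj0 (fst q)) * g (\<Phi> (proj0 (fst q)))))) =
  bdry be g * (LB t. hstep' t)"
proof -
 define k where "k x = ind slab x * (be (proj0 x) * g (\<Phi> (proj0 x)))" for x
 have k: "integrable lborel k" unfolding k_def[abs_def] by (rule bdry_integrable[OF g be])
 then have km[measurable]: "k : bmeas" using borel_measurable_integrable by fastforce
 have hm[measurable]: "hstep' : bmeas" by (rule cont_bmeas[OF continuous_hstep'])
 have h0: "hstep' t = 0" if "t ~: {0..1}" for t using that hstep'_0[of t] by fastforce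
 have h: "integrable lborel hstep'"
 proof -
  have si: "set_integrable lborel {0..1} hstep'"
   by (intro borel_integrable_atLeastAtMost' cont_subset[OF continuous_hstep']) auto
  have eq: "ind {0..1} t *R hstep' t = hstep' t" for t
   by (cases "t : {0..1}") (simp_all add: h0 del: atLeastAtMost_iff)
  show ?thesis using si unfolding set_integrable_def eq .
 qed
 have m2: "(%q. k (fst q) * hstep' (snd q)) : borel_measurable (lborel \<Otimes>\<^sub>M lborel)" by measurable
 have i2: "integrable (lborel \<Otimes>\<^sub>M lborel) (%(x, t). k x * hstep' t)"
 proof (rule lborel_pair.Fubini_integrable)
  show "(%(x, t). k x * hstep' t) : borel_measurable (lborel \<Otimes>\<^sub>M lborel)" by measurable
  show "integrable lborel (%x. LB t. norm (case (x, t) of (x, t) => k x * hstep' t))"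
   using k by (simp add: abs_mult)
  show "AE x in lborel. integrable lborel (%t. case (x, t) of (x, t) => k x * hstep' t)" using h by simp
 qed
 have "(LB q. ind slab (fst q) * (hstep' (snd q) * (be (proj0 (fst q)) * g (\<Phi> (proj0 (fst q)))))) =
  (LINT q|(lborel \<Otimes>\<^sub>M lborel). (case q of (x, t) => k x * hstep' t))"
  by (simp add: lborel_prod k_def split_beta mult_ac)
 also have "... = (LB x. LB t. k x * hstep' t)"
  using lborel_pair.integral_fst'[OF i2] by simp
 also have "... = bdry be g * (LB t. hstep' t)" by (simp add: bdry_def k_def)
 finally show ?thesis .
qed

lemma weight_support:
 assumes "c1_test UNIV ph" "ctn a"
 shows "ctn (%z. jac z * a z * ph (\<Phi> z))" "\<exists>K. compact K \<and> (\<forall>z. z ~: K --> jac z * a z * ph (\<Phi> z) = 0)"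
proof -
 show "ctn (%z. jac z * a z * ph (\<Phi> z))"
  using jac_continuous assms(2) Ck1D(3)[OF c1_testD(2)[OF assms(1)]] \<Phi>_continuous
  by (auto intro!: continuous_on_mult cont_comp2[of UNIV ph UNIV \<Phi>])
 obtain K where K: "compact K" "\<forall>x. x ~: K --> ph x = 0" using c1_testD(1)[OF assms(1)] by blast
 have "compact (Ps ` K)" by (intro compact_cont_image cont_subset[OF Ps_continuous] K) auto
 moreover have "jac z * a z * ph (\<Phi> z) = 0" if "z ~: Ps ` K" for z
 proof -
  have "\<Phi> z ~: K" using that Ps\<Phi>[of z] by (metis imageI)
  then show ?thesis using K(2) by simp
 qed
 ultimately show "\<exists>K. compact K \<and> (\<forall>z. z ~: K --> jac z * a z * ph (\<Phi> z) = 0)" by blast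
qed

text \<open>As the strips shrink, dominated convergence removes the cut-off on the left and
  \<open>strip_limit\<close> identifies the right. The normal component only has to be a continuous
  multiple a of a function ps with a trace. This covers the field v e_i with ps = v, and a field
  whose component along \<open>bent_normal\<close> is ps. The integral of \<open>hstep'\<close> is
  1, but is carried along as a factor common to both phases.\<close>

theorem gauss:
 assumes F: "F : Lq_loc_closure 1 (Om s)" and d: "d : Lq_loc_closure 1 (Om s)"
  and Fd: "has_weak_div (Om s) F d" and ph: "c1_test UNIV ph" and tr: "has_trace \<Phi> s ps g"
  and a: "ctn a" "!!z. z : half_space s ==> F (\<Phi> z) \<bullet> (M' z $ last_ix) = a z * ps (\<Phi> z)"
 shows "(LL y. flux s F d ph y) = - sgnp s * (bdry (%z. jac z * a z * ph (\<Phi> z)) g * (LB t. hstep' t))"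
proof -
 define be where "be z = jac z * a z * ph (\<Phi> z)" for z
 obtain K where b: "ctn be" and K: "compact K" "\<forall>z. z ~: K --> be z = 0"
  using weight_support[OF ph a(1)] unfolding be_def by blast
 obtain \<rho> where \<rho>: "!!z. z : K ==> norm z <= \<rho>" using compact_imp_bounded[OF K(1)] unfolding bounded_iff by blast
 have b0: "be z = 0" if "\<rho> < norm z" for z using that K(2) \<rho>[of z] by fastforce
 have m0: "hstep' t = 0" if "t <= 0 \<or> 1 <= t" for t using that hstep'_0[of t] by fastforce
 have e: "(LL y. cut n s y * flux s F d ph y) = - sgnp s * (real (Suc n) * (LL z. ind (half_space s) z *
  (hstep' (real (Suc n) * (sgnp s * z $ last_ix)) * (be z * ps (\<Phi> z)))))" for n
  unfolding be_def by (rule flux_cutoff[OF F d Fd ph a(2)])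
 have lim: "(%n. LL y. cut n s y * flux s F d ph y) ~~> - sgnp s * (bdry be g * (LB t. hstep' t))"
  unfolding e bdry_product[OF has_trace_integrable[OF tr] b K, symmetric]
  by (intro tendsto_mult_left strip_limit[OF tr b b0 continuous_hstep' m0])
 obtain B where B: "!!t. \<bar>hstep t\<bar> <= B" using hstep_bounded by blast
 have iT: "intg (flux s F d ph)" by (rule flux_integrable[OF F d ph])
 have cm: "cut n s : lmeas" for n by (rule cont_lmeas[OF Ck1D(3)[OF cut_c1]])
 have "(%n. LL y. cut n s y * flux s F d ph y) ~~> (LL y. flux s F d ph y)"
 proof (rule integral_dominated_convergence[where w = "%y. B * \<bar>flux s F d ph y\<bar>"])
  show "flux s F d ph : lmeas" by (rule borel_measurable_integrable[OF iT])
  show "(%y. cut n s y * flux s F d ph y) : lmeas" for n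
   by (intro borel_measurable_times cm borel_measurable_integrable[OF iT])
  show "intg (%y. B * \<bar>flux s F d ph y\<bar>)" using iT by (intro integrable_mult_right integrable_abs)
  show "AE y in lebesgue. (%n. cut n s y * flux s F d ph y) ~~> flux s F d ph y"
  proof (rule AE_I2)
   fix y
   show "(%n. cut n s y * flux s F d ph y) ~~> flux s F d ph y"
   proof (cases "y : Om s")
    case True
    from tendsto_mult_right[OF cut_tendsto[OF True], of "flux s F d ph y"] show ?thesis by simp
   qed (simp add: flux_def)
  qed
  show "AE y in lebesgue. norm (cut n s y * flux s F d ph y) <= B * \<bar>flux s F d ph y\<bar>" for n
   by (intro AE_I2) (simp add: abs_mult cut_def B mult_right_mono)
 qed
 from LIMSEQ_unique[OF this lim] show ?thesis unfolding be_def .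
qed

lemma bdry_cmult: "bdry be (%y. c * g y) = c * bdry be g"
proof -
 have "(%x. ind slab x * (be (proj0 x) * (c * g (\<Phi> (proj0 x))))) = (%x. c * (ind slab x * (be (proj0 x) * g (\<Phi> (proj0 x)))))"
  by (auto simp: mult_ac)
 then show ?thesis unfolding bdry_def by simp
qed

lemma bdry_cong_AE:
 assumes be: "ctn be" and g: "g : bmeas" "h : bmeas"
  and ae: "AE y in IM. g y = h y"
 shows "bdry be g = bdry be h"
 unfolding bdry_def
proof (rule integral_cong_AE)
 show "AE x in lborel. ind slab x * (be (proj0 x) * g (\<Phi> (proj0 x))) = ind slab x * (be (proj0 x) * h (\<Phi> (proj0 x)))"
  using AE_interface[OF ae] by eventually_elim (auto simp: indicator_def)
qed (use bdry_measurable[OF be] g in simp_all)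

lemma bdry_jump:
 assumes g: "!!s R. set_integrable (IM) (ball 0 R) (g s)" "!!s R. set_integrable (IM) (ball 0 R) (h s)"
  and be: "ctn be" "compact K" "\<forall>z. z ~: K --> be z = 0"
  and ae: "AE y in IM. g Plus y - g Minus y = h Plus y - h Minus y"
 shows "bdry be (g Plus) - bdry be (g Minus) = bdry be (h Plus) - bdry be (h Minus)"
proof -
 have d: "bdry be (k Plus) - bdry be (k Minus) = bdry be (%y. k Plus y - k Minus y)"
  if k: "!!s R. set_integrable (IM) (ball 0 R) (k s)" for k :: "phase => 'n rvec => real"
  unfolding bdry_def
  using bdry_integrable[OF k be, of Plus] bdry_integrable[OF k be, of Minus]
  by (simp add: right_diff_distrib)
 have m: "(%y. g Plus y - g Minus y) : bmeas" "(%y. h Plus y - h Minus y) : bmeas"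
  by (intro borel_measurable_diff trace_measurable g)+
 show ?thesis unfolding d[of g, OF g(1)] d[of h, OF g(2)] by (rule bdry_cong_AE[OF be(1) m ae])
qed

end

section \<open>Smooth right-hand sides\<close>

lemma test_fun_outside: "test_fun G ph ==> x ~: G ==> ph x = 0"
 using c1_testD(1)[OF test_fun_c1] by blast

lemma has_weak_grad_mono:
 assumes g: "has_weak_grad G u g" and H: "H \<subseteq> G" "H : sets lebesgue" "G : sets lebesgue"
 shows "has_weak_grad H u g"
proof -
 have "(LINT x|lebesgue_on H. v x * ph x) = (LINT x|lebesgue_on G. v x * ph x)" if "test_fun H ph" for v ph
 proof -
  have "(%x. ind H x *R (v x * ph x)) = (%x. ind G x *R (v x * ph x))"
   using test_fun_outside[OF that] H(1) by (auto simp: indicator_def fun_eq_iff)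
  then show ?thesis unfolding LINT_lebesgue_on(1)[OF H(2)] LINT_lebesgue_on(1)[OF H(3)] by (rule arg_cong)
 qed
 note e = this
 have "u : L1_loc H" "g : L1_loc H" using g H(1) unfolding has_weak_grad_def L1_loc_def by blast+
 moreover have "(LINT x|lebesgue_on H. u x * pd i ph x) = - (LINT x|lebesgue_on H. g x $ i * ph x)" if "test_fun H ph" for ph i
  using g test_fun_mono[OF that H(1)] unfolding e[OF that] e[OF test_fun_pd[OF that]] has_weak_grad_def by blast
 ultimately show ?thesis unfolding has_weak_grad_def by blast
qed

lemma borel_measurable_vec_lambda:
 fixes g :: "'n::finite => 'a => real"
 assumes "!!i. g i : borel_measurable M"
 shows "(%x. \<chi> i. g i x) : borel_measurable M"
 unfolding borel_measurable_euclidean_space[of "%x. \<chi> i. g i x"] using assms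
 by (auto simp: Basis_vec_def inner_axis)

lemma lpn_outside:
 assumes "!!x. x : S ==> x ~: K ==> f x = 0"
 shows "lpn p S f <= lpn p K f"
 unfolding lpn_def using assms by (intro nn_integral_mono) (fastforce simp: indicator_def)

lemma lpn_finite_sum:
 fixes f :: "'i => 'a::euclidean_space => real"
 assumes "finite I" "!!i. i : I ==> f i : lmeas" "K : sets lebesgue" "1 < p"
  "!!i. i : I ==> lpn p K (f i) < inft"
 shows "lpn p K (%x. \<Sum>i\<in>I. f i x) < inft"
 using assms
proof (induction I)
 case empty then show ?case by (simp add: lpn_def)
next
 case (insert i I)
 have "lpn p K (%x. f i x + (\<Sum>i\<in>I. f i x)) <= en (2 powr p) * (lpn p K (f i) + lpn p K (%x. \<Sum>i\<in>I. f i x))"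
  using insert by (intro lpn_add_le2 borel_measurable_sum) auto
 also have "... < inft" using insert by (auto simp: ennreal_mult_less_top)
 finally show ?case using insert by simp
qed

lemma c1_approx_ex_const: "0 <= p ==> \<exists>g. c1_approx p (%x. c) g"
 using c1_approx_c1[OF Ck_const] by blast

lemma c1_approx_ex_mult: "\<exists>g. c1_approx p u g ==> \<exists>g. c1_approx p v g ==> 1 < p ==> \<exists>g. c1_approx p (%x. u x * v x) g"
 using c1_approx_mult by blast

lemma c1_approx_ex_add: "\<exists>g. c1_approx p u g ==> \<exists>g. c1_approx p v g ==> 1 < p ==> \<exists>g. c1_approx p (%x. u x + v x) g"
 using c1_approx_add by blast

lemma c1_approx_ex_sum:
 assumes "finite I" "!!j. j : I ==> \<exists>g. c1_approx p (u j) g" "1 < p"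
 shows "\<exists>g. c1_approx p (%x. \<Sum>j\<in>I. u j x) g"
proof -
 obtain g where g: "!!j. j : I ==> c1_approx p (u j) (g j)" using assms(2) by metis
 have "c1_approx p (%x. \<Sum>j\<in>I. u j x) (%i x. \<Sum>j\<in>I. g j i x)" by (rule c1_approx_sum[OF assms(1) _ assms(3)]) (rule g)
 then show ?thesis by blast
qed

text \<open>A \<open>C\<^sup>1\<close> function on the whole line that agrees with \<open>1 / sqrt t\<close> for \<open>t >= 1 / 4\<close>.\<close>

definition rsq :: "real => real" where
 "rsq t = t + 2 * (max 0 (1 / 4 - t))\<^sup>2"

lemma rsq_ge: "1 / 8 <= rsq t"
proof (cases "t <= 1 / 4")
 case True
 have "0 <= 2 * t\<^sup>2" by simp
 moreover have "rsq t = 1 / 8 + 2 * t\<^sup>2" using True by (simp add: rsq_def power2_eq_square algebra_simps)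
 ultimately show ?thesis by linarith
qed (simp add: rsq_def)

lemma rsq_derivative: "(rsq has_real_derivative (1 - 4 * max 0 (1 / 4 - t))) (at t)"
proof -
 have "((%t. 1 / 4 - t) has_real_derivative - 1) (at t)" by (auto intro!: derivative_eq_intros)
 from DERIV_add[OF DERIV_ident DERIV_cmult[OF DERIV_chain2[OF max0_sq_derivative this], of 2]]
 show ?thesis unfolding rsq_def[abs_def] by simp
qed

lemma continuous_rsq: "ctn rsq"
 unfolding rsq_def[abs_def] by (intro continuous_intros)

lemma inverse_sqrt_rsq_derivative:
 "((%t. inverse (sqrt (rsq t))) has_real_derivative
  - (inverse (sqrt (rsq t)) * (inverse (sqrt (rsq t)) / 2 * (1 - 4 * max 0 (1 / 4 - t))) * inverse (sqrt (rsq t)))) (at t)"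
proof (rule DERIV_inverse'[OF DERIV_chain2[OF DERIV_real_sqrt rsq_derivative]])
 show "0 < rsq t" "sqrt (rsq t) ~= 0" using rsq_ge[of t] by auto
qed

lemma continuous_inverse_sqrt_rsq_derivative:
 "ctn (%t. - (inverse (sqrt (rsq t)) * (inverse (sqrt (rsq t)) / 2 * (1 - 4 * max 0 (1 / 4 - t))) * inverse (sqrt (rsq t))))"
proof -
 have "sqrt (rsq t) ~= 0" for t using rsq_ge[of t] by auto
 then show ?thesis by (intro continuous_intros continuous_rsq) auto
qed

lemma continuous_support_Lq:
 fixes u :: "real^'n => 'b::euclidean_space"
 assumes u: "ctn u" and K: "compact K" "!!x. x ~: K ==> u x = 0" and G: "G : sets lebesgue" and p: "0 <= p"
 shows "u : Lq p G"
proof -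
 have KS: "K : sets lebesgue" using lm_compact[OF K(1)] by blast
 have "u : Lq p K" by (rule continuous_Lq_bounded[OF u KS compact_imp_bounded[OF K(1)] p])
 then have "lpn p K u < inft" using Lq_iff_lpn[OF KS] by blast
 then have "lpn p G u < inft" using lpn_outside[of G K u p] K(2) by (auto intro: order_le_less_trans)
 then show ?thesis using cont_lmeas[OF u] G by (simp add: Lq_iff_lpn meas_restrict1)
qed

lemma weak_grads_imp_div:
 assumes g: "!!i. has_weak_grad G (%x. F x $ i) (h i)" and G: "open G"
 shows "has_weak_div G F (%x. \<Sum>i\<in>UNIV. h i x $ i)"
proof -
 have GS: "G : sets lebesgue" using G by (simp add: borel_open)
 have l: "(%x. F x $ i) : L1_loc G" "(%x. h i x $ i) : L1_loc G" for i
  using g[of i] by (auto simp: has_weak_grad_def L1_loc_vec_iff)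
 have L: "F : L1_loc G" "(%x. \<Sum>i\<in>UNIV. h i x $ i) : L1_loc G"
  using l by (auto simp: L1_loc_vec_iff) (auto simp: L1_loc_def)
 have "(LINT x|lebesgue_on G. (\<Sum>i\<in>UNIV. F x $ i * pd i ph x)) = - (LINT x|lebesgue_on G. (\<Sum>i\<in>UNIV. h i x $ i) * ph x)"
  if ph: "test_fun G ph" for ph
 proof -
  obtain K where K: "compact K" "K \<subseteq> G" "\<forall>x. x ~: K --> ph x = 0" using c1_testD(1)[OF test_fun_c1[OF ph]] by blast
  note D = Ck1D[OF c1_testD(2)[OF test_fun_c1[OF ph]]]
  have pK: "\<forall>x. x ~: K --> pd i ph x = 0" for i using pd_support[OF cmp_closed[OF K(1)] K(3)] by blast
  have int: "integrable (lebesgue_on G) (%x. a x * b x)"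
   if a: "a : L1_loc G" and b: "ctn b" "\<forall>x. x ~: K --> b x = 0" for a b :: "real^'a => real"
  proof -
   have "intg (%x. a x * b x)"
    by (rule L1_loc_cont_int[OF a K(1,2) b(2) b(1)])
   then show ?thesis using integrable_mult_indicator[OF GS] by (simp only: LINT_lebesgue_on(2)[OF GS])
  qed
  have "(LINT x|lebesgue_on G. (\<Sum>i\<in>UNIV. F x $ i * pd i ph x)) = (\<Sum>i\<in>UNIV. LINT x|lebesgue_on G. F x $ i * pd i ph x)"
   by (rule bi_int_sum) (rule int[OF l(1) D(2) pK])
  also have "... = (\<Sum>i\<in>UNIV. - (LINT x|lebesgue_on G. h i x $ i * ph x))"
   using g ph unfolding has_weak_grad_def by (intro sum.cong refl) blast
  also have "... = - (LINT x|lebesgue_on G. (\<Sum>i\<in>UNIV. h i x $ i * ph x))"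
   unfolding sum_negf by (subst bi_int_sum) (rule int[OF l(2) D(3) K(3)], rule refl)
  finally show ?thesis by (simp only: sum_distrib_right)
 qed
 then show ?thesis using L unfolding has_weak_div_def by blast
qed

lemma weak_div_of_test:
 fixes f :: "real^'n => real^'n"
 assumes f: "!!i. Ck 1 (%x. f x $ i)" and G: "open G"
 shows "has_weak_div G f (%x. \<Sum>i\<in>UNIV. pd i (%x. f x $ i) x)"
proof -
 have "G : sets lebesgue" using G by (simp add: borel_open)
 from weak_grads_imp_div[OF c1_weak_grad[OF f this] G] show ?thesis by simp
qed

context bent
begin

interpretation Psi: c1_diffeo Ps "%y. M' (Ps y)"
proof
 show "bij Ps" by (rule bij_imp_bij_inv[OF bij\<Phi>])
 show "(Ps has_derivative (%h. M' (Ps y) *v h)) (at y)" for y by (rule derPs)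
 show "ctn (%y. M' (Ps y))"
 proof (intro continuous_on_cartI)
  show "ctn (%y. M' (Ps y) $ i $ j)" for i j
   by (rule cont_comp2[OF M'_entry_continuous Ps_continuous]) auto
 qed
 show "z = 0" if "M' (Ps y) *v z = 0" for y z using MM'[of "Ps y" z] that by simp
qed

lemma lpn_comp_Psi_le:
 assumes K: "compact K" and p: "0 <= p"
 shows "EX C>=0. \<forall>h :: 'n rvec => real. h : lmeas --> lpn p K (%y. h (Ps y)) <= en C * lpn p (Ps ` K) h"
proof -
 obtain j where j: "j > 0" "!!z. z : K ==> j <= Psi.jac z"
 proof (cases "K = {}")
  case True
  then show ?thesis using that[of 1] by auto
 next
  case False
  then obtain z0 where "z0 : K" "!!z. z : K ==> Psi.jac z0 <= Psi.jac z"
   using continuous_attains_inf[OF K _ cont_subset[OF Psi.jac_continuous]] by auto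
  then show ?thesis using that[of "Psi.jac z0"] Psi.jac_pos by auto
 qed
 have S: "Ps ` K : sets lebesgue"
  using lm_compact[OF compact_cont_image[OF cont_subset[OF Ps_continuous] K]] by auto
 have "lpn p K (%y. h (Ps y)) <= en (1 / j) * lpn p (Ps ` K) h" if "h : lmeas" for h :: "'n rvec => real"
  using Psi.cov_bound[OF that S j(1) j(2) _ p, of K] unfolding lpn_def by auto
 then show ?thesis using j(1) by (intro exI[of _ "1 / j"]) simp
qed

lemma Ck1_comp_Psi:
 assumes U: "Ck 1 U"
 shows "Ck 1 (%y. U (Ps y))" "pd i (%y. U (Ps y)) y = (\<Sum>l\<in>UNIV. pd l U (Ps y) * M' (Ps y) $ l $ i)"
proof -
 have 1: "((%y. U (Ps y)) has_derivative (%h. \<Sum>l\<in>UNIV. pd l U (Ps y) * (M' (Ps y) *v h) $ l)) (at y)" for y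
  using diff_chain_at[OF derPs has_derivative_pd[OF Ck1D(1)[OF U]]] by (simp add: o_def)
 have 2: "(M' x *v axis i 1) $ l = M' x $ l $ i" for x i l
  by (simp add: matrix_vector_mult_def axis_def if_distrib[of "(*) _"] cong: if_cong)
 show "pd i (%y. U (Ps y)) y = (\<Sum>l\<in>UNIV. pd l U (Ps y) * M' (Ps y) $ l $ i)"
  by (subst pd_eqI[OF 1]) (simp add: 2)
 show "Ck 1 (%y. U (Ps y))"
 proof (rule Ck1I[OF 1])
  show "ctn (%y. \<Sum>l\<in>UNIV. pd l U (Ps y) * (M' (Ps y) *v axis i 1) $ l)" for i
   unfolding 2 by (intro continuous_on_sum continuous_on_mult cont_comp2[OF Ck1D(2)[OF U] Ps_continuous]
    cont_comp2[OF M'_entry_continuous Ps_continuous]) auto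
 qed
qed

text \<open>The chain rule holds for each C^1 approximant. On compact sets the entries of
  \<open>M'\<close> are bounded and composition with \<open>Ps\<close> is bounded in L_p, so it
  passes to the limit.\<close>

lemma c1_approx_comp_Psi:
 assumes u: "c1_approx p u g" and p: "1 < p"
 shows "c1_approx p (%y. u (Ps y)) (%i y. \<Sum>l\<in>UNIV. M' (Ps y) $ l $ i * g l (Ps y))"
proof -
 obtain U where U: "!!k. Ck 1 (U k)" "!!K. compact K ==> uniform_limit K U u sequentially"
  "!!i K. compact K ==> (%k. lpn p K (%x. pd i (U k) x - g i x)) ~~> 0"
  by (rule c1_approxE[OF u]) (rule that)
 have cu: "ctn u" and gm: "g i : lmeas" and gf: "compact K ==> lpn p K (g i) < inft" for i K
  using u by (simp_all add: c1_approx_def)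
 have cM: "ctn (%y. M' (Ps y) $ l $ i)" for l i
  by (rule cont_comp2[OF M'_entry_continuous Ps_continuous]) auto
 have Mm[measurable]: "(%y. M' (Ps y) $ l $ i) : lmeas" for l i by (rule cont_lmeas[OF cM])
 have gP[measurable]: "(%y. g l (Ps y)) : lmeas" for l by (rule Psi.measurable_comp_\<Phi>[OF gm])
 have Um: "pd l (U k) : lmeas" for l k by (rule cont_lmeas[OF Ck1D(2)[OF U(1)]])
 have cK: "compact (Ps ` K)" if "compact K" for K
  by (rule compact_cont_image[OF cont_subset[OF Ps_continuous] that]) simp
 have fin: "lpn p K (%y. \<Sum>l\<in>UNIV. M' (Ps y) $ l $ i * g l (Ps y)) < inft" if K: "compact K" for K i
 proof (rule lpn_finite_sum)
  show KS: "K : sets lebesgue" using lm_compact[OF K] by blast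
  fix l :: 'n
  obtain C where C: "0 <= C" "lpn p K (%y. g l (Ps y)) <= en C * lpn p (Ps ` K) (g l)"
   using lpn_comp_Psi_le[OF K, of p] p gm[of l] by auto
  obtain B where B: "0 <= B" "!!x. x : K ==> \<bar>M' (Ps x) $ l $ i\<bar> <= B" using cont_bounded[OF cM K] by blast
  have "lpn p K (%y. M' (Ps y) $ l $ i * g l (Ps y)) <= en (B powr p) * lpn p K (%y. g l (Ps y))"
   using p by (intro lpn_mult_le[OF gP KS B(2) B(1)]) auto
  also have "... < inft" using C(2) gf[OF cK[OF K], of l] by (auto simp: ennreal_mult_less_top intro: order_le_less_trans)
  finally show "lpn p K (%y. M' (Ps y) $ l $ i * g l (Ps y)) < inft" .
 qed (use p in auto)
 have lim: "(%k. lpn p K (%y. pd i (%y. U k (Ps y)) y - (\<Sum>l\<in>UNIV. M' (Ps y) $ l $ i * g l (Ps y)))) ~~> 0"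
  if K: "compact K" for K i
 proof -
  have KS: "K : sets lebesgue" using lm_compact[OF K] by blast
  obtain C where C: "0 <= C" "!!h :: 'n rvec => real. h : lmeas ==> lpn p K (%y. h (Ps y)) <= en C * lpn p (Ps ` K) h"
   using lpn_comp_Psi_le[OF K, of p] p by auto
  have dm[measurable]: "(%y. pd l (U k) (Ps y) - g l (Ps y)) : lmeas" for l k
   by (intro borel_measurable_diff gP Psi.measurable_comp_\<Phi>[OF Um])
  have "(%k. lpn p K (%y. \<Sum>l\<in>UNIV. M' (Ps y) $ l $ i * (pd l (U k) (Ps y) - g l (Ps y)))) ~~> 0"
  proof (rule lpn_tendsto_sum[OF _ _ KS p])
   fix l :: 'n
   obtain B where B: "0 <= B" "!!x. x : K ==> \<bar>M' (Ps x) $ l $ i\<bar> <= B" using cont_bounded[OF cM K] by blast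
   show "(%k. lpn p K (%y. M' (Ps y) $ l $ i * (pd l (U k) (Ps y) - g l (Ps y)))) ~~> 0"
   proof (rule ennreal_tendsto_0_le)
    show "(%k. en (B powr p) * (en C * lpn p (Ps ` K) (%x. pd l (U k) x - g l x))) ~~> 0"
     by (intro ennreal_tendsto_0_cmult U(3) cK K) simp_all
    show "\<forall>\<^sub>F k in sequentially. lpn p K (%y. M' (Ps y) $ l $ i * (pd l (U k) (Ps y) - g l (Ps y))) <=
      en (B powr p) * (en C * lpn p (Ps ` K) (%x. pd l (U k) x - g l x))"
    proof (rule always_eventually, rule allI)
     fix k
     have "lpn p K (%y. M' (Ps y) $ l $ i * (pd l (U k) (Ps y) - g l (Ps y))) <= en (B powr p) * lpn p K (%y. pd l (U k) (Ps y) - g l (Ps y))"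
      using p by (intro lpn_mult_le[OF dm KS B(2) B(1)]) auto
     also have "... <= en (B powr p) * (en C * lpn p (Ps ` K) (%x. pd l (U k) x - g l x))"
      by (intro mult_left_mono C(2) borel_measurable_diff Um gm) simp
     finally show "lpn p K (%y. M' (Ps y) $ l $ i * (pd l (U k) (Ps y) - g l (Ps y))) <=
      en (B powr p) * (en C * lpn p (Ps ` K) (%x. pd l (U k) x - g l x))" .
    qed
   qed
  qed (auto intro!: borel_measurable_times)
  moreover have "pd i (%y. U k (Ps y)) y - (\<Sum>l\<in>UNIV. M' (Ps y) $ l $ i * g l (Ps y)) =
    (\<Sum>l\<in>UNIV. M' (Ps y) $ l $ i * (pd l (U k) (Ps y) - g l (Ps y)))" for k y
   by (simp only: Ck1_comp_Psi(2)[OF U(1)] right_diff_distrib sum_subtractf mult.commute)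
  ultimately show ?thesis by simp
 qed
 have ul: "uniform_limit K (%k y. U k (Ps y)) (%y. u (Ps y)) sequentially" if "compact K" for K
  using U(2)[OF cK[OF that]] unfolding uniform_limit_iff by simp
 show ?thesis unfolding c1_approx_def
 proof (intro conjI allI impI exI[of _ "%k y. U k (Ps y)"])
  show "ctn (%y. u (Ps y))" by (rule cont_comp2[OF cu Ps_continuous]) auto
 qed (use fin lim ul Ck1_comp_Psi(1)[OF U(1)] in \<open>auto simp del: Ck.simps\<close>)
qed

text \<open>Up to sign the entries of \<open>wn\<close> are constants plus entries of
  \<open>B'\<close>, which \<open>c1_approx_H1\<close> covers. By \<open>norm_wn\<close> its squared
  length is at least 1/4, where \<open>rsq\<close> is the identity, so normalising amounts to
  composition with a C^1 function.\<close>

lemma normal_c1_approx: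
 assumes q: "1 < q" "q <= r"
 shows "\<exists>g. c1_approx q (%y. bent_normal \<Phi> A' B' y $ j) g"
proof -
 have q0: "0 <= q" using q by simp
 have w: "\<exists>g. c1_approx q (%x. wn x $ j) g" for j
 proof -
  have "(%x. B' x $ last_ix $ j) : H1 r UNIV" using cfg unfolding bent_interface_def by blast
  then obtain g where g: "has_weak_grad UNIV (%x. B' x $ last_ix $ j) g" "g : Lq r UNIV" unfolding H1_def by blast
  have "\<exists>h. c1_approx q (%x. B' x $ last_ix $ j) h"
   using c1_approx_H1[OF B'_entry_continuous g q] by blast
  then have "\<exists>g. c1_approx q (%x. (-1) * (A' $ last_ix $ j + B' x $ last_ix $ j)) g"
   by (intro c1_approx_ex_mult c1_approx_ex_add c1_approx_ex_const q0 q(1))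
  moreover have "(-1) * (A' $ last_ix $ j + B' x $ last_ix $ j) = wn x $ j" for x by (simp add: wn_nth M'_def)
  ultimately show ?thesis by simp
 qed
 then have wP: "\<exists>g. c1_approx q (%y. wn (Ps y) $ j) g" for j using c1_approx_comp_Psi[OF _ q(1), of "%x. wn x $ j"] by blast
 have "\<exists>g. c1_approx q (%y. \<Sum>i\<in>UNIV. wn (Ps y) $ i * wn (Ps y) $ i) g"
  by (intro c1_approx_ex_sum c1_approx_ex_mult wP q(1)) simp
 then obtain g where g: "c1_approx q (%y. \<Sum>i\<in>UNIV. wn (Ps y) $ i * wn (Ps y) $ i) g" by blast
 have gg: "\<exists>g. c1_approx q (%y. inverse (sqrt (rsq (\<Sum>i\<in>UNIV. wn (Ps y) $ i * wn (Ps y) $ i)))) g"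
  using c1_approx_comp[OF g q(1) inverse_sqrt_rsq_derivative continuous_inverse_sqrt_rsq_derivative] by blast
 have "\<exists>g. c1_approx q (%y. inverse (sqrt (rsq (\<Sum>i\<in>UNIV. wn (Ps y) $ i * wn (Ps y) $ i))) * wn (Ps y) $ j) g"
  by (intro c1_approx_ex_mult gg wP q(1))
 moreover have "inverse (sqrt (rsq (\<Sum>i\<in>UNIV. wn (Ps y) $ i * wn (Ps y) $ i))) * wn (Ps y) $ j = bent_normal \<Phi> A' B' y $ j" for y
 proof -
  have e: "(\<Sum>i\<in>UNIV. wn (Ps y) $ i * wn (Ps y) $ i) = norm (wn (Ps y)) ^ 2" by (simp add: power2_norm_eq_inner inner_vec_def)
  have "(1 / 2) ^ 2 <= norm (wn (Ps y)) ^ 2" using norm_wn[of "Ps y"] by (intro power_mono) auto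
  then have "rsq (norm (wn (Ps y)) ^ 2) = norm (wn (Ps y)) ^ 2" by (simp add: rsq_def power2_eq_square)
  then show ?thesis unfolding e by (simp add: bent_normal_eq)
 qed
 ultimately show ?thesis by simp
qed

text \<open>The delicate part is the normal component, because the normal field has only local
  Sobolev regularity. The compact support of f makes the integrability of the product and of its
  gradient global.\<close>

theorem test_in_F_space:
 assumes f: "!!i. test_fun (Om s) (%x. f x $ i)" and q: "1 < q" "q <= r"
 shows "f : F_space q (Om s) (bent_normal \<Phi> A' B')"
proof -
 have q0: "0 <= q" using q by simp
 note GS = Omega_lebesgue[of s]
 have "\<forall>i. \<exists>K. compact K \<and> (\<forall>x. x ~: K --> f x $ i = 0)" using c1_testD(1)[OF test_fun_c1[OF f]] by blast
 from choice[OF this] obtain Ki where Ki: "!!i. compact (Ki i)" "!!i x. x ~: Ki i ==> f x $ i = 0" by blast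
 define K where "K = (\<Union>i. Ki i)"
 have K: "compact K" unfolding K_def using Ki(1) by (intro compact_UN) auto
 have KS: "K : sets lebesgue" using lm_compact[OF K] by blast
 have fK: "f x $ i = 0" if "x ~: K" for x i using that Ki(2) unfolding K_def by blast
 then have f0: "f x = 0" if "x ~: K" for x using that by (simp add: vec_eq_iff)
 note C1 = c1_testD(2)[OF test_fun_c1[OF f]]
 note C = Ck1D[OF C1]
 have pK: "pd j (%x. f x $ i) x = 0" if "x ~: K" for x i j
  using pd_support[OF cmp_closed[OF K], of "%x. f x $ i"] fK that by blast
 have cf: "ctn f" by (rule continuous_on_cartI[OF C(3)])
 have "f : Lq q (Om s)" by (rule continuous_support_Lq[OF cf K f0 GS q0])
 moreover have "has_weak_div (Om s) f (%x. \<Sum>i\<in>UNIV. pd i (%x. f x $ i) x)" by (rule weak_div_of_test[OF C1 open_Omega])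
 moreover have "(%x. \<Sum>i\<in>UNIV. pd i (%x. f x $ i) x) : Lq q (Om s)"
  by (rule continuous_support_Lq[OF continuous_on_sum[OF C(2)] K _ GS q0]) (simp add: pK)
 ultimately have E: "f : E_space q (Om s)" unfolding E_space_def by blast
 let ?n = "bent_normal \<Phi> A' B'"
 have "\<forall>j. \<exists>g. c1_approx q (%y. ?n y $ j) g" using normal_c1_approx[OF q] by blast
 from choice[OF this] obtain gn where gn: "!!j. c1_approx q (%y. ?n y $ j) (gn j)" by blast
 define w where "w x = (\<Sum>j\<in>UNIV. ?n x $ j * f x $ j)" for x
 define gw where "gw i x = (\<Sum>j\<in>UNIV. ?n x $ j * pd i (%x. f x $ j) x + f x $ j * gn j i x)" for i x
 have cw: "c1_approx q w gw"
  unfolding w_def[abs_def] gw_def[abs_def] by (intro c1_approx_sum c1_approx_mult gn c1_approx_c1 C1 q(1) q0) simp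
 have "ctn w" using cw by (simp add: c1_approx_def)
 then have wL: "w : Lq q (Om s)" by (rule continuous_support_Lq[OF _ K _ GS q0]) (simp add: w_def fK)
 have wg: "has_weak_grad (Om s) w (%x. \<chi> i. gw i x)"
  using GS by (intro has_weak_grad_mono[OF c1_approx_weak_grad[OF cw q(1)]]) auto
 have gm[measurable]: "gw i : lmeas" and gf: "lpn q K (gw i) < inft" for i
  using cw K by (simp_all add: c1_approx_def)
 have gm': "(%x. \<chi> i. gw i x) : lmeas" by (rule borel_measurable_vec_lambda[OF gm])
 have "lpn q (Om s) (%x. \<chi> i. gw i x) <= lpn q K (%x. \<chi> i. gw i x)"
  by (rule lpn_outside) (simp add: gw_def fK pK vec_eq_iff)
 also have "... <= en (real CARD('n) powr q) * (\<Sum>i\<in>UNIV. lpn q K (%x. (\<chi> i. gw i x) $ i))"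
  by (rule lpn_componentwise(1)[OF gm' KS q0])
 also have "... < inft" using gf by (simp add: ennreal_mult_less_top)
 finally have "(%x. \<chi> i. gw i x) : Lq q (Om s)"
  using gm' GS by (simp add: Lq_iff_lpn meas_restrict1)
 then have "w : H1 q (Om s)" using wL wg unfolding H1_def by blast
 moreover have "w = (%x. ?n x \<bullet> f x)" by (simp add: fun_eq_iff w_def inner_vec_def)
 ultimately show ?thesis using E unfolding F_space_def by simp
qed

end

section \<open>Strong solutions as weak solutions\<close>

lemma has_weak_div_cong:
 assumes Fd: "has_weak_div G F d" and G: "open G"
  and ae: "AE x in lebesgue_on G. F x = F' x" "AE x in lebesgue_on G. d x = d' x"
  and l: "F' : L1_loc G" "d' : L1_loc G"
 shows "has_weak_div G F' d'"
proof -
 have GS: "G : sets lebesgue" using G by (simp add: borel_open)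
 have m: "v : borel_measurable (lebesgue_on G)" if "v : L1_loc G" for v :: "real^'a => real"
  using L1_loc_indicator_measurable[OF that G] by (simp add: LINT_lebesgue_on(3)[OF GS])
 have l0: "F : L1_loc G" "d : L1_loc G" using Fd by (simp_all add: has_weak_div_def)
 have Fm: "(%x. F x $ i) : borel_measurable (lebesgue_on G)" "(%x. F' x $ i) : borel_measurable (lebesgue_on G)" for i
  using l0(1) l(1) by (auto simp: L1_loc_vec_iff intro: m)
 have "(LINT x|lebesgue_on G. (\<Sum>i\<in>UNIV. F' x $ i * pd i ph x)) = - (LINT x|lebesgue_on G. d' x * ph x)" if ph: "test_fun G ph" for ph
 proof -
  note C = Ck1D[OF c1_testD(2)[OF test_fun_c1[OF ph]]]
  have [measurable]: "ph : borel_measurable (lebesgue_on G)" "pd i ph : borel_measurable (lebesgue_on G)" for i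
   using C by (auto intro!: meas_restrict1 cont_lmeas)
  note [measurable] = Fm m[OF l0(2)] m[OF l(2)]
  have "(LINT x|lebesgue_on G. (\<Sum>i\<in>UNIV. F' x $ i * pd i ph x)) = (LINT x|lebesgue_on G. (\<Sum>i\<in>UNIV. F x $ i * pd i ph x))"
  proof (rule integral_cong_AE)
   show "AE x in lebesgue_on G. (\<Sum>i\<in>UNIV. F' x $ i * pd i ph x) = (\<Sum>i\<in>UNIV. F x $ i * pd i ph x)"
    using ae(1) by eventually_elim simp
  qed measurable
  also have "... = - (LINT x|lebesgue_on G. d x * ph x)" using Fd ph unfolding has_weak_div_def by blast
  also have "(LINT x|lebesgue_on G. d x * ph x) = (LINT x|lebesgue_on G. d' x * ph x)"
  proof (rule integral_cong_AE)
   show "AE x in lebesgue_on G. d x * ph x = d' x * ph x" using ae(2) by eventually_elim simp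
  qed measurable
  finally show ?thesis .
 qed
 then show ?thesis using l unfolding has_weak_div_def by blast
qed

lemma Lq_imp_loc1:
 fixes f :: "real^'n => 'b::euclidean_space"
 assumes f: "f : Lq q G" and G: "G : sets lebesgue" and q: "1 <= q"
 shows "f : Lq_loc_closure 1 G"
 unfolding Lq_loc_closure_def
proof (safe)
 fix K :: "(real^'n) set" assume K: "compact K"
 have KL: "K : lmeasurable" by (rule lm_compact[OF K])
 have GK: "G \<inter> K : sets lebesgue" using G KL by auto
 have GKL: "G \<inter> K : lmeasurable" using fmeasurable_Int_fmeasurable[OF KL G] by (simp add: Int_commute)
 have fm: "(%x. ind G x *R f x) : lmeas" and ff: "lpn q G f < inft"
  using f unfolding Lq_iff_lpn[OF G] LINT_lebesgue_on(3)[OF G] by auto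
 have "f : Lq q (G \<inter> K)" by (rule Lq_cmult_indicator(1)[OF f _ G GK]) (use q in auto)
 then have m: "f : borel_measurable (lebesgue_on (G \<inter> K))" and fin: "lpn q (G \<inter> K) f < inft" using Lq_iff_lpn[OF GK] by blast+
 have e: "lpn s (G \<inter> K) (%x. ind G x *R f x) = lpn s (G \<inter> K) f" for s by (intro lpn_cong) simp
 have "lpn 1 (G \<inter> K) (%x. ind G x *R f x) < inft"
  using q fin by (intro lpn_lower_finite[OF fm GKL, of 1 q]) (simp_all add: e)
 then show "f : Lq 1 (G \<inter> K)" using m unfolding Lq_iff_lpn[OF GK] e by simp
qed

lemma Lq_cong_AE:
 fixes f g :: "real^'n => 'b::euclidean_space"
 assumes "AE x in lebesgue_on G. g x = f x" "f : Lq q G" "g : borel_measurable (lebesgue_on G)"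
 shows "g : Lq q G"
proof -
 have [measurable]: "f : borel_measurable (lebesgue_on G)" using assms(2) by (simp add: Lq_def)
 note [measurable] = assms(3)
 have "integrable (lebesgue_on G) (%x. norm (g x) powr q) \<longleftrightarrow> integrable (lebesgue_on G) (%x. norm (f x) powr q)"
  using assms(1) by (intro integrable_cong_AE) auto
 then show ?thesis using assms by (simp add: Lq_def)
qed

lemma L1_loc_measurable_on:
 fixes v :: "real^'n => real^'m"
 assumes "v : L1_loc G" "open G" shows "v : borel_measurable (lebesgue_on G)"
proof -
 have GS: "G : sets lebesgue" using assms(2) by (simp add: borel_open)
 have 1: "(%x. v x $ i) : borel_measurable (lebesgue_on G)" for i
  using L1_loc_indicator_measurable[of "%x. v x $ i", OF _ assms(2)] assms(1)
  by (simp add: LINT_lebesgue_on(3)[OF GS] L1_loc_vec_iff)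
 show ?thesis using borel_measurable_vec_lambda[of "%i x. v x $ i", OF 1] by simp
qed

lemma wgrad_Lq:
 assumes v: "v : hatH1 q G" and G: "open G"
 shows "has_weak_grad G v (wgrad G v)" "wgrad G v : Lq q G"
proof -
 obtain g where g: "has_weak_grad G v g" "g : Lq q G" using v unfolding hatH1_def by blast
 show 1: "has_weak_grad G v (wgrad G v)" by (rule wgrad_works(1)[OF G g(1)])
 have "wgrad G v : L1_loc G" using 1 unfolding has_weak_grad_def by blast
 then show "wgrad G v : Lq q G" by (intro Lq_cong_AE[OF wgrad_works(2)[OF G g(1)] g(2)] L1_loc_measurable_on G)
qed

text \<open>Both x = a and x = b satisfy x^q <= x (a + b)^(q-1). In \<open>nice_solution\<close>
  this joins the two phases into the factor \<rho>_+ + \<rho>_-.\<close>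

lemma powr_add_le:
 assumes "0 <= a" "0 <= (b::real)" "1 <= q"
 shows "a powr q + b powr q <= (a + b) powr q"
proof -
 have 1: "x powr q <= x * (a + b) powr (q - 1)" if "0 <= x" "x <= a + b" for x
 proof -
  have "x powr (q - 1) <= (a + b) powr (q - 1)" using that assms(3) by (intro powr_mono2) auto
  then have "x * x powr (q - 1) <= x * (a + b) powr (q - 1)" using that by (intro mult_left_mono) auto
  then show ?thesis using powr_mult_base[OF that(1), of "q - 1"] by simp
 qed
 have "a powr q + b powr q <= (a + b) * (a + b) powr (q - 1)"
  using 1[of a] 1[of b] assms by (simp add: distrib_right)
 then show ?thesis using powr_mult_base[of "a + b" "q - 1"] assms by simp
qed

context bent
begin

definition glue :: "(phase => 'n rvec => 'b::real_vector) => 'n rvec => 'b" where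
 "glue f x = ind (Om Plus) x *R f Plus x + ind (Om Minus) x *R f Minus x"

lemma Omega_other: "x : Om Plus ==> x ~: Om Minus" "x : Om Minus ==> x ~: Om Plus"
 by (simp_all add: Omega_eq)

lemma glue_Omega: "x : Om s ==> glue f x = f s x"
 by (cases s) (auto simp: glue_def Omega_other)

lemma glue_outside: "x ~: Om Plus ==> x ~: Om Minus ==> glue f x = 0"
 by (auto simp: glue_def)

lemma glue_measurable:
 fixes f :: "phase => 'n rvec => 'b::euclidean_space"
 assumes "!!s. f s : borel_measurable (lebesgue_on (Om s))"
 shows "glue f : lmeas"
proof -
 have "(%x. ind (Om s) x *R f s x) : lmeas" for s
  using assms[of s] LINT_lebesgue_on(3)[OF Omega_lebesgue] by blast
 then show ?thesis unfolding glue_def[abs_def] by (intro borel_measurable_add)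
qed

lemma lpn_glue:
 fixes f :: "phase => 'n rvec => 'b::euclidean_space"
 assumes m: "!!s. f s : borel_measurable (lebesgue_on (Om s))" and K[measurable]: "K : sets lebesgue"
 shows "lpn p K (glue f) = lpn p (Om Plus \<inter> K) (f Plus) + lpn p (Om Minus \<inter> K) (f Minus)"
proof -
 have e: "lpn p (Om s \<inter> K) (f s) = lpn p (Om s \<inter> K) (glue f)" for s
  by (intro lpn_cong) (auto simp: glue_Omega[of _ s])
 note [measurable] = glue_measurable[OF m, simplified] Omega_lebesgue
 have S: "Om s \<inter> K : sets lebesgue" for s by (rule sets.Int[OF Omega_lebesgue K])
 note [measurable] = S
 have "lpn p K (glue f) = (NL x. ind (Om Plus \<inter> K) x * en (norm (glue f x) powr p) + ind (Om Minus \<inter> K) x * en (norm (glue f x) powr p))"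
  unfolding lpn_def
 proof (rule nn_integral_cong)
  fix x
  show "ind K x * en (norm (glue f x) powr p) = ind (Om Plus \<inter> K) x * en (norm (glue f x) powr p) + ind (Om Minus \<inter> K) x * en (norm (glue f x) powr p)"
   using Omega_other[of x] glue_outside[of x f] by (auto simp: indicator_def)
 qed
 also have "... = lpn p (Om Plus \<inter> K) (glue f) + lpn p (Om Minus \<inter> K) (glue f)"
  unfolding lpn_def by (rule nn_integral_add) measurable
 finally show ?thesis unfolding e[of Plus] e[of Minus] .
qed

lemma normal_flux:
 "F (\<Phi> z) \<bullet> (M' z $ last_ix) = - norm (wn z) * (bent_normal \<Phi> A' B' (\<Phi> z) \<bullet> F (\<Phi> z))"
proof -
 have n0: "norm (wn z) ~= 0" using norm_wn[of z] by linarith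
 have "bent_normal \<Phi> A' B' (\<Phi> z) = wn z /\<^sub>R norm (wn z)" by (simp add: bent_normal_eq)
 then have "- norm (wn z) * (bent_normal \<Phi> A' B' (\<Phi> z) \<bullet> F (\<Phi> z)) = - (wn z \<bullet> F (\<Phi> z))" using n0 by simp
 also have "... = F (\<Phi> z) \<bullet> (M' z $ last_ix)" by (simp add: wn_def inner_commute)
 finally show ?thesis ..
qed

text \<open>Apply \<open>gauss\<close> to the fields v e_i. Differentiation across the interface
  produces the difference of the traces of \<rho> v from the two sides, which vanishes.\<close>

lemma glue_weak_grad:
 assumes q: "1 < q" and v: "!!s. v s : hatH1 q (Om s)"
  and tr: "!!s. has_trace \<Phi> s (v s) (g s)" and ae: "AE y in IM. \<rho> Plus * g Plus y = \<rho> Minus * g Minus y"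
 defines "u \<equiv> glue (%s x. \<rho> s * v s x)" and "G \<equiv> glue (%s x. \<rho> s *R wgrad (Om s) (v s) x)"
 shows "u : lmeas" "!!K. compact K ==> lpn q K u < inft" "G : lmeas"
  "lpn q UNIV G < inft" "has_weak_grad UNIV u G"
proof -
 let ?\<Omega> = "Omega \<Phi>"
 note wg = wgrad_Lq[OF v open_Omega]
 have vl: "v s : L1_loc (?\<Omega> s)" and gl: "wgrad (?\<Omega> s) (v s) : L1_loc (?\<Omega> s)" for s
  using wg(1)[of s] by (simp_all add: has_weak_grad_def)
 have vm: "v s : borel_measurable (lebesgue_on (?\<Omega> s))" for s
  using L1_loc_indicator_measurable[OF vl open_Omega] by (simp add: LINT_lebesgue_on(3)[OF Omega_lebesgue])
 have gm: "wgrad (?\<Omega> s) (v s) : borel_measurable (lebesgue_on (?\<Omega> s))" for s by (rule L1_loc_measurable_on[OF gl open_Omega])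
 have um': "(%x. \<rho> s * v s x) : borel_measurable (lebesgue_on (?\<Omega> s))" for s using vm[of s] by (intro borel_measurable_times) auto
 have Gm': "(%x. \<rho> s *R wgrad (?\<Omega> s) (v s) x) : borel_measurable (lebesgue_on (?\<Omega> s))" for s using gm[of s] by (intro borel_measurable_scaleR) auto
 show um: "u : lmeas" unfolding u_def by (rule glue_measurable[OF um'])
 show Gm: "G : lmeas" unfolding G_def by (rule glue_measurable[OF Gm'])
 have sc: "lpn q S (%x. \<rho> s *R w x) < inft" if "w : Lq q S" "S : sets lebesgue" for w :: "'n rvec => 'b::euclidean_space" and S s
 proof -
  have "integrable (lebesgue_on S) (%x. \<bar>\<rho> s\<bar> powr q * norm (w x) powr q)" using that by (auto simp: Lq_def)
  then have "(%x. \<rho> s *R w x) : Lq q S" using that by (auto simp: Lq_def powr_mult intro!: borel_measurable_scaleR)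
  then show ?thesis using Lq_iff_lpn[OF that(2)] by blast
 qed
 show uf: "lpn q K u < inft" if K: "compact K" for K
 proof -
  have KS: "K : sets lebesgue" using lm_compact[OF K] by blast
  have "v s : Lq q (?\<Omega> s \<inter> K)" for s using v[of s] by (intro Lq_loc_closureD[OF _ K]) (simp add: hatH1_def)
  then have "lpn q (?\<Omega> s \<inter> K) (%x. \<rho> s * v s x) < inft" for s
   using sc[of "v s" "?\<Omega> s \<inter> K" s] sets.Int[OF Omega_lebesgue KS] by simp
  then show ?thesis unfolding u_def lpn_glue[OF um' KS] by simp
 qed
 show Gf: "lpn q UNIV G < inft"
 proof -
  have U1: "UNIV : sets lebesgue" by simp
  show ?thesis unfolding G_def lpn_glue[OF Gm' U1] using sc[OF wg(2) Omega_lebesgue] by simp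
 qed
 have ul: "u : L1_loc UNIV"
  by (rule L1_locI_lpn[of _ _ q]) (use um uf q in \<open>auto intro: meas_restrict1\<close>)
 have Gl: "G : L1_loc UNIV" by (rule L1_loc_lpn_UNIV[OF Gm Gf]) (use q in simp)
 have "(LL x. u x * pd i ph x) = - (LL x. G x $ i * ph x)" if ph: "test_fun UNIV ph" for ph i
 proof -
  have c1: "c1_test UNIV ph" by (rule test_fun_c1[OF ph])
  obtain K where K: "compact K" "\<forall>x. x ~: K --> ph x = 0" using c1_testD(1)[OF c1] by blast
  note D = Ck1D[OF c1_testD(2)[OF c1]]
  have pK: "\<forall>x. x ~: K --> pd i ph x = 0" using pd_support[OF cmp_closed[OF K(1)] K(2)] by blast
  note int = L1_loc_cont_int[OF _ K(1) subset_UNIV]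
  have i1: "intg (%x. u x * pd i ph x)" by (rule int[OF ul pK D(2)])
  have i2: "intg (%x. G x $ i * ph x)" by (rule int[OF _ K(2) D(3)]) (use Gl in \<open>simp add: L1_loc_vec_iff\<close>)
  define F where "F s x = v s x *R (axis i 1 :: 'n rvec)" for s x
  define d where "d s x = wgrad (?\<Omega> s) (v s) x $ i" for s x
  have vL: "v s : Lq_loc_closure 1 (?\<Omega> s)" for s using tr[of s] by (simp add: has_trace_def)
  have FL: "F s : Lq_loc_closure 1 (?\<Omega> s)" for s
   using vL[of s] unfolding Lq_loc_closure_def Lq_def F_def by (auto intro!: borel_measurable_scaleR)
  have gL: "wgrad (?\<Omega> s) (v s) : Lq_loc_closure 1 (?\<Omega> s)" for s by (rule Lq_imp_loc1[OF wg(2) Omega_lebesgue]) (use q in simp)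
  have dL: "d s : Lq_loc_closure 1 (?\<Omega> s)" for s
   unfolding Lq_loc_closure_def
  proof (safe)
   fix K :: "'n rvec set" assume K: "compact K"
   have S: "?\<Omega> s \<inter> K : sets lebesgue" using sets.Int[OF Omega_lebesgue[of s]] lm_compact[OF K] by blast
   have w: "wgrad (?\<Omega> s) (v s) : Lq 1 (?\<Omega> s \<inter> K)" by (rule Lq_loc_closureD[OF gL K])
   have "lpn 1 (?\<Omega> s \<inter> K) (d s) <= lpn 1 (?\<Omega> s \<inter> K) (wgrad (?\<Omega> s) (v s))"
    unfolding d_def by (intro lpn_mono) (auto simp: component_le_norm_cart)
   also have "... < inft" using w Lq_iff_lpn[OF S] by blast
   finally have "lpn 1 (?\<Omega> s \<inter> K) (d s) < inft" .
   moreover have "d s : borel_measurable (lebesgue_on (?\<Omega> s \<inter> K))"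
    unfolding d_def using w by (intro borel_measurable_nth) (simp add: Lq_def)
   ultimately show "d s : Lq 1 (?\<Omega> s \<inter> K)" using Lq_iff_lpn[OF S] by auto
  qed
  have Fd: "has_weak_div (?\<Omega> s) (F s) (d s)" for s unfolding F_def d_def by (rule weak_grad_imp_div[OF wg(1)])
  define a where "a z = M' z $ last_ix $ i" for z
  have ca: "ctn a" unfolding a_def by (rule M'_entry_continuous)
  define be where "be z = jac z * a z * ph (\<Phi> z)" for z
  have b: "ctn be" using weight_support(1)[OF c1 ca] by (simp add: be_def[abs_def])
  define I where "I = (LB t. hstep' t)"
  have ga: "(LL y. flux s (F s) (d s) ph y) = - sgnp s * (bdry be (g s) * I)" for s
   unfolding be_def[abs_def] I_def
   by (rule gauss[OF FL dL Fd c1 tr ca]) (simp add: F_def a_def inner_axis' mult.commute)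
  have fi: "intg (flux s (F s) (d s) ph)" for s by (rule flux_integrable[OF FL dL c1])
  have "(LL x. u x * pd i ph x) + (LL x. G x $ i * ph x) = (LL x. u x * pd i ph x + G x $ i * ph x)"
   by (rule bi_int_add[OF i1 i2, symmetric])
  also have "... = (LL x. \<rho> Plus * flux Plus (F Plus) (d Plus) ph x + \<rho> Minus * flux Minus (F Minus) (d Minus) ph x)"
   by (rule bi_cong[OF refl])
    (simp add: u_def G_def glue_def flux_def F_def d_def inner_axis' algebra_simps)
  also have "... = \<rho> Plus * (LL x. flux Plus (F Plus) (d Plus) ph x) + \<rho> Minus * (LL x. flux Minus (F Minus) (d Minus) ph x)"
   by (simp add: fi)
  also have "... = - I * (bdry be (%y. \<rho> Plus * g Plus y) - bdry be (%y. \<rho> Minus * g Minus y))"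
   unfolding ga bdry_cmult by (simp add: algebra_simps)
  also have "... = 0"
  proof -
   have gm: "g s : bmeas" for s by (rule trace_measurable[OF has_trace_integrable[OF tr]])
   have "bdry be (%y. \<rho> Plus * g Plus y) = bdry be (%y. \<rho> Minus * g Minus y)"
    by (rule bdry_cong_AE[OF b _ _ ae]) (intro borel_measurable_times gm borel_measurable_const)+
   then show ?thesis by simp
  qed
  finally show ?thesis by simp
 qed
 then show "has_weak_grad UNIV u G" using ul Gl unfolding has_weak_grad_def by (simp add: lebesgue_on_UNIV_eq)
qed

text \<open>On each phase w and f share the weak divergence d, so the difference of their fluxes is
  the inner product of w - f with grad ph. \<open>gauss\<close> turns it into boundary terms, which
  cancel because the normal jumps agree.\<close>

lemma glue_div_free:
 assumes tg: "!!s. has_trace \<Phi> s (%x. bent_normal \<Phi> A' B' x \<bullet> w s x) (g s)"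
  and th: "!!s. has_trace \<Phi> s (%x. bent_normal \<Phi> A' B' x \<bullet> f s x) (h s)"
  and ae: "AE y in IM. g Plus y - g Minus y = h Plus y - h Minus y"
  and L: "!!s. w s : Lq_loc_closure 1 (Om s)" "!!s. f s : Lq_loc_closure 1 (Om s)" "!!s. d s : Lq_loc_closure 1 (Om s)"
  and dv: "!!s. has_weak_div (Om s) (w s) (d s)" "!!s. has_weak_div (Om s) (f s) (d s)"
  and ph: "c1_test UNIV ph"
 shows "(LL x. glue (%s x. w s x - f s x) x \<bullet> grad ph x) = 0"
proof -
 define a where "a z = - norm (wn z)" for z
 have ca: "ctn a" unfolding a_def by (intro continuous_intros wn_continuous)
 define be where "be z = jac z * a z * ph (\<Phi> z)" for z
 obtain K where b: "ctn be" "compact K" "\<forall>z. z ~: K --> be z = 0"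
  using weight_support[OF ph ca] unfolding be_def by blast
 define I where "I = (LB t. hstep' t)"
 have gw: "(LL y. flux s (w s) (d s) ph y) = - sgnp s * (bdry be (g s) * I)" for s
  unfolding be_def[abs_def] I_def by (rule gauss[OF L(1,3) dv(1) ph tg ca]) (simp only: a_def normal_flux)
 have gf: "(LL y. flux s (f s) (d s) ph y) = - sgnp s * (bdry be (h s) * I)" for s
  unfolding be_def[abs_def] I_def by (rule gauss[OF L(2,3) dv(2) ph th ca]) (simp only: a_def normal_flux)
 have fi: "intg (flux s (w s) (d s) ph)" "intg (flux s (f s) (d s) ph)" for s
  by (rule flux_integrable[OF L(1,3) ph], rule flux_integrable[OF L(2,3) ph])
 have "(LL x. glue (%s x. w s x - f s x) x \<bullet> grad ph x) =
  (LL x. (flux Plus (w Plus) (d Plus) ph x - flux Plus (f Plus) (d Plus) ph x) + (flux Minus (w Minus) (d Minus) ph x - flux Minus (f Minus) (d Minus) ph x))"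
  by (rule bi_cong[OF refl]) (simp add: glue_def flux_def inner_add_left inner_diff_left algebra_simps)
 also have "... = - I * ((bdry be (g Plus) - bdry be (g Minus)) - (bdry be (h Plus) - bdry be (h Minus)))"
  by (simp add: fi gw gf algebra_simps)
 also have "... = 0"
  using bdry_jump[of g h be K, OF has_trace_integrable[OF tg] has_trace_integrable[OF th] b ae] by simp
 finally show ?thesis .
qed

text \<open>On the interface the density is 0 and \<open>inverse 0\<close> is 0, so that this is a
  glued function without exceptional points.\<close>

definition idens :: "(phase => real) => 'n rvec => real" where
 "idens \<rho> x = inverse (piecewise_density \<rho> \<Phi> x)"

lemma idens_glue: "idens \<rho> x = glue (%s x. inverse (\<rho> s)) x"
 using Omega_other[of x] by (auto simp: idens_def piecewise_density_def glue_def indicator_def)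

lemma idens_measurable [measurable]: "idens \<rho> : lmeas"
 unfolding idens_glue[abs_def] by (rule glue_measurable) simp

text \<open>The gradient G is an explicit argument because \<open>wgrad\<close> is an arbitrary
  representative. C' comes without a sign, hence the maximum; a negative C' forces vanishing data,
  and the last conjunct records this so that C' itself can be restored at the end.\<close>

definition weak_sol :: "(phase => real) => real => real => ('n rvec => 'n rvec) => ('n rvec => real) => ('n rvec => 'n rvec) => bool" where
 "weak_sol \<rho> q C' f u G \<longleftrightarrow> u : lmeas \<and> (\<forall>K. compact K --> lpn q K u < inft) \<and>
  G : lmeas \<and> lpn q UNIV G < inft \<and> has_weak_grad UNIV u G \<and>
  (\<forall>ph. c1_test UNIV ph --> (LL x. (idens \<rho> x *R G x - f x) \<bullet> grad ph x) = 0) \<and>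
  lpn q UNIV G <= en ((2 * max 0 C' * (\<rho> Plus + \<rho> Minus)) powr q) * lpn q UNIV f \<and>
  (C' < 0 --> lpn q UNIV f = 0)"

lemma weak_solD:
 assumes "weak_sol \<rho> q C' f u G"
 shows "u : lmeas" "compact K ==> lpn q K u < inft" "G : lmeas" "lpn q UNIV G < inft"
  "has_weak_grad UNIV u G" "c1_test UNIV ph ==> (LL x. (idens \<rho> x *R G x - f x) \<bullet> grad ph x) = 0"
  "lpn q UNIV G <= en ((2 * max 0 C' * (\<rho> Plus + \<rho> Minus)) powr q) * lpn q UNIV f" "C' < 0 ==> lpn q UNIV f = 0"
 using assms by (simp_all add: weak_sol_def)

text \<open>Multiplication of v_s by \<rho>_s removes the jump of the potential, and division of the
  glued gradient by the density gives back grad v_s, whose normal jump is that of f.\<close>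

lemma nice_solution:
 assumes \<rho>: "!!s. 0 < \<rho> s" and q: "1 < q" "q <= r"
  and ex: "strong_existence q \<rho> \<Phi> (bent_normal \<Phi> A' B') C C'"
  and f: "!!s i. test_fun (Om s) (%x. f s x $ i)"
 shows "\<exists>u G. weak_sol \<rho> q C' (glue f) u G"
proof -
 let ?n = "bent_normal \<Phi> A' B'" and ?\<Omega> = "Omega \<Phi>"
 have F: "f s : F_space q (?\<Omega> s) ?n" for s by (rule test_in_F_space[OF f q])
 then obtain v where sol: "strong_solution q \<rho> \<Phi> ?n f v"
  and bd: "!!s. Lq_norm q (?\<Omega> s) (wgrad (?\<Omega> s) (v s)) <= C' * (\<Sum>t\<in>{Plus, Minus}. Lq_norm q (?\<Omega> t) (f t))"
  using ex unfolding strong_existence_def by blast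
 have v1: "v s : hatH1 q (?\<Omega> s)" and v2: "v s : hatH2 q (?\<Omega> s)"
  and lap: "AE x in lebesgue_on (?\<Omega> s). lapl (?\<Omega> s) (v s) x = wdiv (?\<Omega> s) (f s) x" for s
  using sol unfolding strong_solution_def by blast+
 obtain g0 where g0: "!!s. has_trace \<Phi> s (v s) (g0 s)" "AE y in IM. \<rho> Plus * g0 Plus y = \<rho> Minus * g0 Minus y"
  using sol unfolding strong_solution_def by blast
 define w where "w s = wgrad (?\<Omega> s) (v s)" for s
 obtain g h where g: "!!s. has_trace \<Phi> s (%x. ?n x \<bullet> w s x) (g s)" and h: "!!s. has_trace \<Phi> s (%x. ?n x \<bullet> f s x) (h s)"
  and gh: "AE y in IM. g Plus y - g Minus y = h Plus y - h Minus y"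
  using sol unfolding strong_solution_def w_def by blast
 have ww: "has_weak_grad (?\<Omega> s) (v s) (w s)" "w s : Lq q (?\<Omega> s)" for s
  using wgrad_Lq[OF v1 open_Omega] unfolding w_def by blast+
 have fL: "f s : Lq q (?\<Omega> s)" for s using F[of s] unfolding F_space_def E_space_def by blast
 have "\<forall>s. \<exists>d. has_weak_div (?\<Omega> s) (f s) d \<and> d : Lq q (?\<Omega> s)" using F unfolding F_space_def E_space_def by blast
 from choice[OF this] obtain d where d: "!!s. has_weak_div (?\<Omega> s) (f s) (d s)" "!!s. d s : Lq q (?\<Omega> s)" by blast
 \<comment> \<open>\<open>lapl\<close> and \<open>wdiv\<close> are choices of representatives. The
   second derivatives from \<open>hatH2\<close> first show that w has a weak divergence; then
   \<open>lap\<close> identifies it with d.\<close>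
 have wd: "has_weak_div (?\<Omega> s) (w s) (d s)" for s
 proof -
  obtain g where g: "has_weak_grad (?\<Omega> s) (v s) g" "!!i. (%x. g x $ i) : hatH1 q (?\<Omega> s)"
   using v2[of s] unfolding hatH2_def by blast
  have wl: "w s : L1_loc (?\<Omega> s)" using ww(1)[of s] by (simp add: has_weak_grad_def)
  have dg: "has_weak_div (?\<Omega> s) g (%x. \<Sum>i\<in>UNIV. wgrad (?\<Omega> s) (%x. g x $ i) x $ i)"
   by (rule weak_grads_imp_div[OF wgrad_Lq(1)[OF g(2) open_Omega] open_Omega])
  have "has_weak_div (?\<Omega> s) (w s) (%x. \<Sum>i\<in>UNIV. wgrad (?\<Omega> s) (%x. g x $ i) x $ i)"
   by (rule has_weak_div_cong[OF dg open_Omega weak_grad_unique[OF open_Omega g(1) ww(1)] _ wl])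
    (use dg in \<open>auto simp: has_weak_div_def\<close>)
  from wdiv_works(1)[OF open_Omega this] have 1: "has_weak_div (?\<Omega> s) (w s) (lapl (?\<Omega> s) (v s))" unfolding lapl_def w_def .
  have ae: "AE x in lebesgue_on (?\<Omega> s). lapl (?\<Omega> s) (v s) x = d s x"
   using lap[of s] wdiv_works(2)[OF open_Omega d(1)[of s]] by eventually_elim simp
  show ?thesis by (rule has_weak_div_cong[OF 1 open_Omega _ ae wl]) (use d(1)[of s] in \<open>auto simp: has_weak_div_def\<close>)
 qed
 define u where "u = glue (%s x. \<rho> s * v s x)"
 define G where "G = glue (%s x. \<rho> s *R w s x)"
 note U = glue_weak_grad[OF q(1) v1 g0(1) g0(2), folded w_def, folded u_def G_def]
 have loc: "w s : Lq_loc_closure 1 (?\<Omega> s)" "f s : Lq_loc_closure 1 (?\<Omega> s)" "d s : Lq_loc_closure 1 (?\<Omega> s)" for s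
  using q(1) by (intro Lq_imp_loc1[OF ww(2) Omega_lebesgue] Lq_imp_loc1[OF fL Omega_lebesgue] Lq_imp_loc1[OF d(2) Omega_lebesgue]; simp)+
 have eq: "idens \<rho> x *R G x - glue f x = glue (%s x. w s x - f s x) x" for x
 proof -
  consider s where "x : ?\<Omega> s" | "x ~: ?\<Omega> Plus" "x ~: ?\<Omega> Minus" by blast
  then show ?thesis
  proof cases
   case 1
   then show ?thesis using \<rho>[of s] by (simp add: idens_glue G_def glue_Omega[OF 1])
  qed (simp add: G_def glue_outside)
 qed
 define S where "S = Lq_norm q (?\<Omega> Plus) (f Plus) + Lq_norm q (?\<Omega> Minus) (f Minus)"
 have S0: "0 <= S" by (simp add: S_def Lq_norm_nonneg)
 have bd': "Lq_norm q (?\<Omega> s) (w s) <= C' * S" for s using bd[of s] by (simp add: S_def w_def)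
 have CS: "0 <= C' * S" using bd'[of Plus] Lq_norm_nonneg[of q "?\<Omega> Plus" "w Plus"] by linarith
 have fm: "f s : borel_measurable (lebesgue_on (?\<Omega> s))" "w s : borel_measurable (lebesgue_on (?\<Omega> s))" for s
  using fL[of s] ww(2)[of s] by (auto simp: Lq_def)
 have q0: "0 < q" using q by simp
 have U1: "UNIV : sets lebesgue" by simp
 have lf: "lpn q UNIV (glue f) = en (Lq_norm q (?\<Omega> Plus) (f Plus) powr q) + en (Lq_norm q (?\<Omega> Minus) (f Minus) powr q)"
  unfolding lpn_glue[OF fm(1) U1] Int_UNIV_right using Lq_norm_powr[OF Omega_lebesgue fL q0] by simp
 have lG: "lpn q UNIV G <= en (((\<rho> Plus + \<rho> Minus) * (C' * S)) powr q)"
 proof -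
  have m: "(%x. \<rho> s *R w s x) : borel_measurable (lebesgue_on (?\<Omega> s))" for s using fm(2)[of s] by (intro borel_measurable_scaleR) auto
  have "lpn q (?\<Omega> s) (%x. \<rho> s *R w s x) <= en ((\<rho> s * (C' * S)) powr q)" for s
  proof -
   have "lpn q (?\<Omega> s) (%x. \<rho> s *R w s x) = lpn q (?\<Omega> s) (%x. \<rho> s *R (ind (?\<Omega> s) x *R w s x))"
    by (intro lpn_cong) simp
   also have "... = en (\<bar>\<rho> s\<bar> powr q) * lpn q (?\<Omega> s) (%x. ind (?\<Omega> s) x *R w s x)"
    by (rule lpn_scaleR) (use fm(2)[of s] q0 Omega_lebesgue in \<open>auto simp: LINT_lebesgue_on(3)[OF Omega_lebesgue]\<close>)
   also have "lpn q (?\<Omega> s) (%x. ind (?\<Omega> s) x *R w s x) = en (Lq_norm q (?\<Omega> s) (w s) powr q)"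
    by (subst Lq_norm_powr[OF Omega_lebesgue ww(2) q0, symmetric]) (intro lpn_cong, simp)
   also have "... <= en ((C' * S) powr q)" using bd'[of s] q0 by (intro ennreal_leI powr_mono2 Lq_norm_nonneg) auto
   finally have "lpn q (?\<Omega> s) (%x. \<rho> s *R w s x) <= en (\<bar>\<rho> s\<bar> powr q) * en ((C' * S) powr q)"
    by (simp add: mult_left_mono)
   also have "... = en ((\<rho> s * (C' * S)) powr q)" using \<rho>[of s] CS by (simp add: powr_mult flip: ennreal_mult)
   finally show ?thesis .
  qed
  then have "lpn q UNIV G <= en ((\<rho> Plus * (C' * S)) powr q) + en ((\<rho> Minus * (C' * S)) powr q)"
   unfolding G_def lpn_glue[OF m U1] Int_UNIV_right by (intro add_mono)
  also have "... = en ((\<rho> Plus * (C' * S)) powr q + (\<rho> Minus * (C' * S)) powr q)" by simp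
  also have "... <= en ((\<rho> Plus * (C' * S) + \<rho> Minus * (C' * S)) powr q)"
   using \<rho>[of Plus] \<rho>[of Minus] q by (intro ennreal_leI powr_add_le mult_nonneg_nonneg[OF _ CS]) auto
  finally show ?thesis by (simp only: distrib_right)
 qed
 \<comment> \<open>The estimate bounds a norm by C' S, so C' S is nonnegative and a negative C'
   leaves only S = 0.\<close>
 have C0: "S = 0" if "C' < 0" using CS S0 that by (simp add: zero_le_mult_iff)
 have zero: "lpn q UNIV (glue f) = 0" if "C' < 0"
  using C0[OF that] Lq_norm_nonneg[of q "?\<Omega> Plus" "f Plus"] Lq_norm_nonneg[of q "?\<Omega> Minus" "f Minus"]
  unfolding lf S_def by simp
 have bound: "lpn q UNIV G <= en ((2 * max 0 C' * (\<rho> Plus + \<rho> Minus)) powr q) * lpn q UNIV (glue f)"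
 proof -
  \<comment> \<open>T is the L_q norm of f over both phases together. It dominates the norm on each
    phase, so S <= 2 T: the origin of the factor 2.\<close>
  define T where "T = (enn2real (lpn q UNIV (glue f))) powr (1 / q)"
  have fin: "lpn q UNIV (glue f) < inft" unfolding lf by simp
  have T: "lpn q UNIV (glue f) = en (T powr q)" "0 <= T"
   using fin q0 unfolding T_def by (simp_all add: powr_powr)
  have "Lq_norm q (?\<Omega> s) (f s) <= T" for s
  proof (rule Lq_norm_leI[OF Omega_lebesgue fL q0 _ T(2)])
   show "lpn q (?\<Omega> s) (f s) <= en (T powr q)"
    unfolding T(1)[symmetric] lf using Lq_norm_powr[OF Omega_lebesgue fL[of s] q0] by (cases s) simp_all
  qed
  from this[of Plus] this[of Minus] have ST: "S <= 2 * T" by (simp add: S_def)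
  have "C' * S <= max 0 C' * (2 * T)"
  proof (cases "C' < 0")
   case True
   then show ?thesis using C0 by simp
  next
   case False
   then show ?thesis using ST by (simp add: mult_left_mono)
  qed
  then have "(\<rho> Plus + \<rho> Minus) * (C' * S) <= (2 * max 0 C' * (\<rho> Plus + \<rho> Minus)) * T"
   using mult_left_mono[of "C' * S" "max 0 C' * (2 * T)" "\<rho> Plus + \<rho> Minus"] \<rho>[of Plus] \<rho>[of Minus] by (simp add: mult_ac)
  then have "((\<rho> Plus + \<rho> Minus) * (C' * S)) powr q <= ((2 * max 0 C' * (\<rho> Plus + \<rho> Minus)) * T) powr q"
   using \<rho>[of Plus] \<rho>[of Minus] CS q0 by (intro powr_mono2) auto
  also have "... = (2 * max 0 C' * (\<rho> Plus + \<rho> Minus)) powr q * T powr q" by (rule powr_mult)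
  finally have "lpn q UNIV G <= en ((2 * max 0 C' * (\<rho> Plus + \<rho> Minus)) powr q * T powr q)"
   using lG by (auto intro: order_trans ennreal_leI)
  then show ?thesis unfolding T(1) by (simp add: ennreal_mult')
 qed
 have "(LL x. (idens \<rho> x *R G x - glue f x) \<bullet> grad ph x) = 0" if "c1_test UNIV ph" for ph
  unfolding eq by (rule glue_div_free[OF g h gh loc wd d(1) that])
 then have "weak_sol \<rho> q C' (glue f) u G" unfolding weak_sol_def using U bound zero by simp
 then show ?thesis by blast
qed

end

section \<open>Uniqueness and general right-hand sides\<close>

lemma lpn_diff_finite:
 assumes [measurable]: "f : lmeas" "g : lmeas" "S : sets lebesgue"
  and p: "1 < p" and fin: "lpn p S f < inft" "lpn p S g < inft"
 shows "lpn p S (%x. f x - g x) < inft"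
proof -
 have e: "lpn p S (%x. - g x) = lpn p S g" by (intro lpn_cong) simp
 have "lpn p S (%x. f x + - g x) <= en (2 powr p) * (lpn p S f + lpn p S g)"
  unfolding e[symmetric] using p by (intro lpn_add_le2) auto
 also have "... < inft" using fin by (simp add: ennreal_mult_less_top)
 finally show ?thesis by simp
qed

lemma has_weak_grad_diff:
 assumes u: "has_weak_grad UNIV u g" and v: "has_weak_grad UNIV v h"
 shows "has_weak_grad UNIV (%x. u x - v x) (%x. g x - h x)"
proof -
 have l: "u : L1_loc UNIV" "v : L1_loc UNIV" "(%x. g x $ i) : L1_loc UNIV" "(%x. h x $ i) : L1_loc UNIV" for i
  using u v by (simp_all add: has_weak_grad_def L1_loc_vec_iff)
 have "(%x. (g x - h x) $ i) : L1_loc UNIV" for i using L1_loc_diff[OF l(3,4)] by simp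
 then have L: "(%x. u x - v x) : L1_loc UNIV" "(%x. g x - h x) : L1_loc UNIV"
  using L1_loc_diff[OF l(1,2)] L1_loc_vec_iff[of "%x. g x - h x"] by auto
 have "(LL x. (u x - v x) * pd i ph x) = - (LL x. (g x - h x) $ i * ph x)" if ph: "test_fun UNIV ph" for ph i
 proof -
  obtain K where K: "compact K" "\<forall>x. x ~: K --> ph x = 0" using c1_testD(1)[OF test_fun_c1[OF ph]] by blast
  note D = Ck1D[OF c1_testD(2)[OF test_fun_c1[OF ph]]]
  have pK: "\<forall>x. x ~: K --> pd i ph x = 0" using pd_support[OF cmp_closed[OF K(1)] K(2)] by blast
  note int = L1_loc_cont_int[OF _ K(1) subset_UNIV]
  have e: "(LL x. u x * pd i ph x) = - (LL x. g x $ i * ph x)" "(LL x. v x * pd i ph x) = - (LL x. h x $ i * ph x)"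
   using u v ph by (simp_all add: has_weak_grad_def lebesgue_on_UNIV_eq)
  show ?thesis
   using int[OF l(1) pK D(2)] int[OF l(2) pK D(2)] int[OF l(3) K(2) D(3)] int[OF l(4) K(2) D(3)] e
   by (simp add: left_diff_distrib)
 qed
 then show ?thesis using L unfolding has_weak_grad_def by (simp add: lebesgue_on_UNIV_eq)
qed

lemma test_fun_diff:
 assumes "test_fun G f" "test_fun G g" shows "test_fun G (%x. f x - g x)"
proof -
 obtain K where K: "compact K" "K \<subseteq> G" "\<forall>x. x ~: K --> f x = 0" using c1_testD(1)[OF test_fun_c1[OF assms(1)]] by blast
 obtain L where L: "compact L" "L \<subseteq> G" "\<forall>x. x ~: L --> g x = 0" using c1_testD(1)[OF test_fun_c1[OF assms(2)]] by blast
 show ?thesis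
  by (rule test_funI[OF Ck_diff compact_Un[OF K(1) L(1)]]) (use assms K L in \<open>auto simp: test_fun_def\<close>)
qed

lemma test_fun_zero: "test_fun G (%x. 0)"
 by (rule test_funI[of _ "{}"]) (auto intro: Ck_const)

lemma c1_test_grad:
 assumes ph: "c1_test UNIV ph" and p: "1 < p"
 shows "has_weak_grad UNIV ph (grad ph)" "grad ph : Lq p UNIV" "ph : hatH1 p UNIV"
proof -
 obtain K where K: "compact K" "\<forall>x. x ~: K --> ph x = 0" using c1_testD(1)[OF ph] by blast
 note C = Ck1D[OF c1_testD(2)[OF ph]]
 have pK: "\<forall>x. x ~: K --> pd i ph x = 0" for i using pd_support[OF cmp_closed[OF K(1)] K(2)] by blast
 show 1: "has_weak_grad UNIV ph (grad ph)"
  unfolding grad_def[abs_def] by (rule c1_weak_grad[OF c1_testD(2)[OF ph]]) simp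
 show 2: "grad ph : Lq p UNIV"
  by (rule continuous_support_Lq[OF continuous_grad[OF c1_testD(2)[OF ph]] K(1)]) (use p pK in \<open>auto simp: vec_eq_iff\<close>)
 have "ph : Lq_loc_closure p UNIV" unfolding Lq_loc_closure_def
 proof (safe)
  fix L :: "(real^'a) set" assume "compact L"
  then have "L : sets lebesgue" using lm_compact by blast
  then show "ph : Lq p (UNIV \<inter> L)"
   using continuous_support_Lq[OF C(3) K(1), of L p] K(2) p by simp
 qed
 then show "ph : hatH1 p UNIV" using 1 2 unfolding hatH1_def by blast
qed

context bent
begin

lemma idens_outside: "x : Sigma_tilde \<Phi> ==> idens \<rho> x = 0"
 using Omega_Un glue_outside[of x "%s x. inverse (\<rho> s)"] by (auto simp: idens_glue)

lemma lpn_idens_le: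
 fixes G :: "'n rvec => 'n rvec"
 assumes [measurable]: "G : lmeas" and q: "0 <= q"
 shows "lpn q UNIV (%x. idens \<rho> x *R G x) <= en ((\<bar>inverse (\<rho> Plus)\<bar> + \<bar>inverse (\<rho> Minus)\<bar>) powr q) * lpn q UNIV G"
proof -
 define B where "B = \<bar>inverse (\<rho> Plus)\<bar> + \<bar>inverse (\<rho> Minus)\<bar>"
 have B: "\<bar>idens \<rho> x\<bar> <= B" for x unfolding idens_glue glue_def B_def using Omega_other[of x] by (auto simp: indicator_def)
 have B0: "0 <= B" by (simp add: B_def)
 have "lpn q UNIV (%x. idens \<rho> x *R G x) <= lpn q UNIV (%x. B *R G x)"
  using q B B0 by (intro lpn_mono) (auto intro!: mult_right_mono)
 also have "... = en (B powr q) * lpn q UNIV G" using B0 q by (subst lpn_scaleR) auto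
 finally show ?thesis unfolding B_def .
qed

lemma lpn_idens_finite:
 fixes G :: "'n rvec => 'n rvec"
 assumes "G : lmeas" "0 <= q" "lpn q UNIV G < inft"
 shows "lpn q UNIV (%x. idens \<rho> x *R G x) < inft"
 using lpn_idens_le[OF assms(1,2), of \<rho>] assms(3) by (auto simp: ennreal_mult_less_top intro: order_le_less_trans)

lemma test_Lq:
 assumes f: "!!i. test_fun G (%x. f x $ i)" and q: "0 <= q" and S: "S : sets lebesgue"
 shows "f : Lq q S" "f : lmeas"
proof -
 have "\<forall>i. \<exists>K. compact K \<and> (\<forall>x. x ~: K --> f x $ i = 0)" using c1_testD(1)[OF test_fun_c1[OF f]] by blast
 from choice[OF this] obtain Ki where Ki: "!!i. compact (Ki i)" "!!i x. x ~: Ki i ==> f x $ i = 0" by blast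
 have K: "compact (\<Union>i. Ki i)" using Ki(1) by (intro compact_UN) auto
 have cf: "ctn f" by (rule continuous_on_cartI[OF Ck1D(3)[OF c1_testD(2)[OF test_fun_c1[OF f]]]])
 show "f : Lq q S" by (rule continuous_support_Lq[OF cf K _ S q]) (use Ki(2) in \<open>auto simp: vec_eq_iff\<close>)
 show "f : lmeas" by (rule cont_lmeas[OF cf])
qed

lemma glue_test:
 assumes f: "!!s i. test_fun (Om s) (%x. f s x $ i)" and q: "0 <= q"
 shows "glue f : lmeas" "lpn q UNIV (glue f) < inft"
proof -
 have m: "f s : borel_measurable (lebesgue_on (Om s))" for s
  using test_Lq(2)[OF f q Omega_lebesgue] by (intro meas_restrict1)
 show "glue f : lmeas" by (rule glue_measurable[OF m])
 have U1: "UNIV : sets lebesgue" by simp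
 have "lpn q (Om s) (f s) < inft" for s
  using test_Lq(1)[OF f q Omega_lebesgue, of s s] Lq_iff_lpn[OF Omega_lebesgue] by blast
 then show "lpn q UNIV (glue f) < inft" unfolding lpn_glue[OF m U1] by simp
qed

text \<open>Let H be the gradient of the weak solution for the exponent p and smooth data f
  supported in one phase. The integral of f against G equals that of \<open>idens\<close> H against
  G, since u is an admissible test there. By symmetry this is the integral of \<open>idens\<close> G
  against H, which is zero because the potential of H is an admissible test for G. As f is
  arbitrary, G vanishes on both phases, and the interface is a null set.\<close>

lemma weak_homogeneous_zero:
 assumes \<rho>: "!!s. 0 < \<rho> s" and q: "1 < q" "p = q / (q - 1)" and pr: "p <= r"
  and ex: "strong_existence p \<rho> \<Phi> (bent_normal \<Phi> A' B') C C'"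
  and G: "G : lmeas" "lpn q UNIV G < inft" "has_weak_grad UNIV u G"
  and 0: "!!ph. c1_test UNIV ph ==> (LL x. (idens \<rho> x *R G x) \<bullet> grad ph x) = 0"
 shows "AE x in lebesgue. G x = 0"
proof -
 note p = dual_exponent[OF q]
 have q0: "0 <= q" and p0: "0 <= p" using q(1) p(1) by simp_all
 note Gm[measurable] = G(1)
 have key: "(LINT x|lebesgue_on (Om s). G x $ i * ph x) = 0" if ph: "test_fun (Om s) ph" for s i ph
 proof -
  define f where "f t x = (if t = s then ph x *R (axis i 1 :: 'n rvec) else 0)" for t x
  have f: "test_fun (Om t) (%x. f t x $ j)" for t j
  proof (cases "t = s \<and> j = i")
   case True
   then have "(%x. f t x $ j) = ph" by (simp add: f_def fun_eq_iff)
   then show ?thesis using True ph by simp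
  next
   case False
   then have "(%x. f t x $ j) = (%x. 0)" by (auto simp: f_def fun_eq_iff axis_def)
   then show ?thesis by (simp add: test_fun_zero)
  qed
  note fm[measurable] = glue_test(1)[OF f p0] and ff = glue_test(2)[OF f p0]
  obtain w H where "weak_sol \<rho> p C' (glue f) w H" using nice_solution[where f = f, OF \<rho> p(1) pr ex f] by blast
  note H[measurable] = weak_solD(3)[OF this] and Hf = weak_solD(4)[OF this] and wH = weak_solD(5)[OF this] and eq = weak_solD(6)[OF this]
  have iHm: "(%x. idens \<rho> x *R H x) : lmeas" by measurable
  have iHf: "lpn p UNIV (%x. idens \<rho> x *R H x) < inft" by (rule lpn_idens_finite[OF H p0 Hf])
  have dm: "(%x. idens \<rho> x *R H x - glue f x) : lmeas" by measurable
  have df: "lpn p UNIV (%x. idens \<rho> x *R H x - glue f x) < inft"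
   by (rule lpn_diff_finite[OF iHm fm _ p(1) iHf ff]) simp
  have 1: "(LL x. (idens \<rho> x *R H x - glue f x) \<bullet> G x) = 0"
   by (rule div_free_hatH1[OF dm df p(1) p(3) eq G(3,1,2)])
  have iGm: "(%x. idens \<rho> x *R G x) : lmeas" by measurable
  have 2: "(LL x. (idens \<rho> x *R G x) \<bullet> H x) = 0"
   by (rule div_free_hatH1[OF iGm lpn_idens_finite[OF G(1) q0 G(2)] q 0 wH H Hf])
  have i1: "intg (%x. (idens \<rho> x *R H x) \<bullet> G x)" by (rule integrable_inner_dual[OF iHm G(1) p(1) p(3) iHf G(2)])
  have i2: "intg (%x. glue f x \<bullet> G x)" by (rule integrable_inner_dual[OF fm G(1) p(1) p(3) ff G(2)])
  have "(LL x. (idens \<rho> x *R H x) \<bullet> G x) = 0" using 2 by (simp add: inner_commute)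
  moreover have "(LL x. (idens \<rho> x *R H x - glue f x) \<bullet> G x) = (LL x. (idens \<rho> x *R H x) \<bullet> G x) - (LL x. glue f x \<bullet> G x)"
   unfolding inner_diff_left by (rule bi_int_diff[OF i1 i2])
  ultimately have 3: "(LL x. glue f x \<bullet> G x) = 0" using 1 by simp
  have "glue f x \<bullet> G x = ind (Om s) x *R (G x $ i * ph x)" for x
   by (cases s) (auto simp: glue_def f_def inner_axis' indicator_def mult.commute Omega_other)
  then show ?thesis using 3 by (simp add: LINT_lebesgue_on(1)[OF Omega_lebesgue])
 qed
 have Gl: "(%x. G x $ i) : L1_loc (Om s)" for i s
 proof -
  have "G : L1_loc UNIV" using G(3) by (simp add: has_weak_grad_def)
  then have "(%x. G x $ i) : L1_loc UNIV" using L1_loc_vec_iff by blast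
  then show ?thesis by (simp add: L1_loc_def)
 qed
 have ae: "AE x in lebesgue. \<forall>i. x : Om s --> G x $ i = 0" for s
  by (rule eventually_all_finite) (rule du_bois_reymond[OF Gl open_Omega key])
 have "AE x in lebesgue. x ~: Sigma_tilde \<Phi>"
  using Sigma_negligible by (simp add: negligible_iff_null_sets AE_not_in)
 then show ?thesis using ae[of Plus] ae[of Minus]
 proof eventually_elim
  case (elim x)
  then have "x : Om Plus \<or> x : Om Minus" using Omega_Un by blast
  then show ?case using elim by (auto simp: vec_eq_iff)
 qed
qed

text \<open>The approximation is made on each phase separately. Since f vanishes on the interface,
  gluing its restrictions gives f at every point.\<close>

lemma nice_dense:
 fixes f :: "'n rvec => 'n rvec"
 assumes f[measurable]: "f : lmeas" and ff: "lpn q UNIV f < inft" and f0: "!!x. x : Sigma_tilde \<Phi> ==> f x = 0"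
  and q: "1 < q" and e: "0 < (e::real)"
 shows "\<exists>h. (\<forall>s i. test_fun (Om s) (%x. h s x $ i)) \<and> lpn q UNIV (%x. glue h x - f x) <= en e"
proof -
 have "\<exists>h. (\<forall>i. test_fun (Om s) (%x. h x $ i)) \<and> lpn q UNIV (%x. h x - ind (Om s) x *R f x) < en (e / 2)" for s
 proof -
  have m: "(%x. ind (Om s) x *R f x) : lmeas" by measurable
  have fin: "lpn q UNIV (%x. ind (Om s) x *R f x) < inft"
   using ff q by (intro order_le_less_trans[OF lpn_mono ff]) (auto simp: indicator_def)
  have e2: "0 < e / 2" using e by simp
  have z: "ind (Om s) x *R f x = 0" if "x ~: Om s" for x using that by simp
  obtain h where "!!i. test_fun (Om s) (%x. h x $ i)" "lpn q UNIV (%x. h x - ind (Om s) x *R f x) < en (e / 2)"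
   by (rule Lp_dense_test_vec[OF m fin q open_Omega[of s] z e2], assumption, rule that)
  then show ?thesis by blast
 qed
 then have "\<forall>s. \<exists>h. (\<forall>i. test_fun (Om s) (%x. h x $ i)) \<and> lpn q UNIV (%x. h x - ind (Om s) x *R f x) < en (e / 2)" by blast
 from choice[OF this] obtain h where h: "!!s i. test_fun (Om s) (%x. h s x $ i)"
  and hf: "!!s. lpn q UNIV (%x. h s x - ind (Om s) x *R f x) < en (e / 2)" by blast
 have q0: "0 <= q" using q(1) by simp
 have hm: "(%x. h s x - f x) : borel_measurable (lebesgue_on (Om s))" for s
  using test_Lq(2)[OF h q0 Omega_lebesgue] by (intro meas_restrict1 borel_measurable_diff f)
 have U1: "UNIV : sets lebesgue" by simp
 have "lpn q (Om s) (%x. h s x - f x) <= en (e / 2)" for s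
 proof -
  have "lpn q (Om s) (%x. h s x - f x) <= lpn q UNIV (%x. h s x - ind (Om s) x *R f x)"
   using q0 by (intro lpn_mono) auto
  then show ?thesis using hf[of s] by simp
 qed
 then have "lpn q UNIV (glue (%s x. h s x - f x)) <= en (e / 2) + en (e / 2)"
  unfolding lpn_glue[OF hm U1] Int_UNIV_right by (intro add_mono)
 also have "... = en e" using e by (simp flip: ennreal_plus)
 also have "glue (%s x. h s x - f x) = (%x. glue h x - f x)"
 proof
  fix x
  consider s where "x : Om s" | "x ~: Om Plus" "x ~: Om Minus" by blast
  then show "glue (%s x. h s x - f x) x = glue h x - f x"
  proof cases
   case 1 then show ?thesis by (simp add: glue_Omega[OF 1])
  next
   case 2
   then have "x : Sigma_tilde \<Phi>" using Omega_Un by blast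
   then show ?thesis using 2 by (simp add: glue_outside f0)
  qed
 qed
 finally show ?thesis using h by blast
qed

text \<open>The solutions for the approximating data are chosen independently of each other.
  \<open>weak_homogeneous_zero\<close> shows that G l - G j agrees almost everywhere with the
  gradient H of the solution for the difference of the data, and the estimate for H gives the Cauchy
  property. The rate 4^(-qk) is the one required by \<open>lpn_complete\<close>.\<close>

lemma weak_solution:
 assumes \<rho>: "!!s. 0 < \<rho> s" and q: "1 < q" "p = q / (q - 1)" and qr: "q <= r" "p <= r"
  and ex: "strong_existence q \<rho> \<Phi> (bent_normal \<Phi> A' B') C C'" and ex2: "strong_existence p \<rho> \<Phi> (bent_normal \<Phi> A' B') C2 C2'"
  and f[measurable]: "f : lmeas" and ff: "lpn q UNIV f < inft" and f0: "!!x. x : Sigma_tilde \<Phi> ==> f x = 0"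
 shows "\<exists>u G. weak_sol \<rho> q C' f u G"
proof -
 note p = dual_exponent[OF q]
 have q0: "0 <= q" using q(1) by simp
 have U1: "UNIV : sets (lebesgue :: 'n rvec measure)" by simp
 define Q where "Q = (2 * max 0 C' * (\<rho> Plus + \<rho> Minus)) powr q"
 have Q0: "0 <= Q" by (simp add: Q_def)
 have "\<forall>k::nat. \<exists>h. (\<forall>s i. test_fun (Om s) (%x. h s x $ i)) \<and> lpn q UNIV (%x. glue h x - f x) <= en (4 powr (- (q * real k)))"
  by (intro allI nice_dense f ff f0 q) simp_all
 from choice[OF this] obtain h where h: "!!k s i. test_fun (Om s) (%x. h k s x $ i)"
  and hf: "!!k::nat. lpn q UNIV (%x. glue (h k) x - f x) <= en (4 powr (- (q * real k)))" by blast
 define fk where "fk k = glue (h k)" for k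
 have fkm[measurable]: "fk k : lmeas" and fkf: "lpn q UNIV (fk k) < inft" for k
  unfolding fk_def by (rule glue_test[OF h q0])+
 have lim0: "(%k. en (1 * 4 powr (- (q * real k)))) ~~> 0" by (rule four_powr_tendsto[OF q(1)])
 have flim: "(%k. lpn q UNIV (%x. fk k x - f x)) ~~> 0"
  by (rule ennreal_tendsto_0_le[OF lim0]) (use hf in \<open>simp add: fk_def\<close>)
 have "\<forall>k. \<exists>uG. weak_sol \<rho> q C' (fk k) (fst uG) (snd uG)"
  unfolding fk_def using nice_solution[where f = "h _", OF \<rho> q(1) qr(1) ex h] by simp
 from choice[OF this] obtain uG where uG: "!!k. weak_sol \<rho> q C' (fk k) (fst (uG k)) (snd (uG k))" by blast
 define u where "u k = fst (uG k)" for k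
 define G where "G k = snd (uG k)" for k
 have ws: "weak_sol \<rho> q C' (fk k) (u k) (G k)" for k using uG by (simp add: u_def G_def)
 note Gm[measurable] = weak_solD(3)[OF ws] and Gf = weak_solD(4)[OF ws] and uw = weak_solD(5)[OF ws]
  and eqk = weak_solD(6)[OF ws] and Gb = weak_solD(7)[OF ws, folded Q_def] and Cneg = weak_solD(8)[OF ws]
 have integ: "intg (%x. F x \<bullet> grad ph x)" if "F : lmeas" "lpn q UNIV F < inft" "c1_test UNIV ph"
  for F :: "'n rvec => 'n rvec" and ph
 proof -
  have "grad ph : lmeas" "lpn p UNIV (grad ph) < inft"
   using c1_test_grad(2)[OF that(3) p(1)] unfolding Lq_iff_lpn[OF U1] by (simp_all add: lebesgue_on_UNIV_eq)
  then show ?thesis using integrable_inner_dual[OF that(1) _ q that(2)] by blast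
 qed
 have iG: "intg (%x. (idens \<rho> x *R F x - g x) \<bullet> grad ph x)"
  if F: "F : lmeas" "lpn q UNIV F < inft" and g: "g : lmeas" "lpn q UNIV g < inft" and ph: "c1_test UNIV ph" for F g ph
 proof -
  note [measurable] = F(1) g(1)
  have m: "(%x. idens \<rho> x *R F x) : lmeas" by measurable
  have m2: "(%x. idens \<rho> x *R F x - g x) : lmeas" by measurable
  show ?thesis by (rule integ[OF m2 lpn_diff_finite[OF m g(1) U1 q(1) lpn_idens_finite[OF F(1) q0 F(2)] g(2)] ph])
 qed
 have cauchy: "lpn q UNIV (%x. G l x - G j x) <= en (Q * 2 powr q * 2 * 4 powr (- (q * real j)))" if jl: "j <= l" for j l
 proof -
  have hd: "test_fun (Om s) (%x. (h l s x - h j s x) $ i)" for s i using test_fun_diff[OF h[of s l i] h[of s j i]] by simp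
  have gd: "glue (%s x. h l s x - h j s x) = (%x. fk l x - fk j x)"
   by (rule ext) (simp add: fk_def glue_def algebra_simps)
  obtain w H where wsH: "weak_sol \<rho> q C' (%x. fk l x - fk j x) w H"
   using nice_solution[where f = "%s x. h l s x - h j s x", OF \<rho> q(1) qr(1) ex hd] unfolding gd by blast
  note H[measurable] = weak_solD(3)[OF wsH] and Hf = weak_solD(4)[OF wsH] and wH = weak_solD(5)[OF wsH]
   and eq = weak_solD(6)[OF wsH] and Hb = weak_solD(7)[OF wsH, folded Q_def]
  define D where "D x = H x - (G l x - G j x)" for x
  have Dm: "D : lmeas" unfolding D_def[abs_def] by measurable
  have GGm: "(%x. G l x - G j x) : lmeas" by measurable
  have Df: "lpn q UNIV D < inft" unfolding D_def[abs_def]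
   by (rule lpn_diff_finite[OF H GGm U1 q(1) Hf lpn_diff_finite[OF Gm Gm U1 q(1) Gf Gf]])
  have Dw: "has_weak_grad UNIV (%x. w x - (u l x - u j x)) D" unfolding D_def[abs_def]
   by (rule has_weak_grad_diff[OF wH has_weak_grad_diff[OF uw uw]])
  have "AE x in lebesgue. D x = 0"
  proof (rule weak_homogeneous_zero[OF \<rho> q qr(2) ex2 Dm Df Dw])
   fix ph :: "'n rvec => real" assume ph: "c1_test UNIV ph"
   have fdm: "(%x. fk l x - fk j x) : lmeas" by measurable
   note fdf = lpn_diff_finite[OF fkm fkm U1 q(1) fkf fkf, of l j]
   note i1 = iG[OF H Hf fdm fdf ph] and i2 = iG[OF Gm Gf fkm fkf ph, of l l] and i3 = iG[OF Gm Gf fkm fkf ph, of j j]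
   have "(LL x. (idens \<rho> x *R D x) \<bullet> grad ph x) = (LL x. (idens \<rho> x *R H x - (fk l x - fk j x)) \<bullet> grad ph x -
     ((idens \<rho> x *R G l x - fk l x) \<bullet> grad ph x - (idens \<rho> x *R G j x - fk j x) \<bullet> grad ph x))"
    by (rule bi_cong[OF refl]) (simp add: D_def inner_diff_left algebra_simps)
   also have "... = 0"
    using eq[OF ph] eqk[OF ph, of l] eqk[OF ph, of j]
    by (simp only: bi_int_diff[OF i1 bi_diff[OF i2 i3]] bi_int_diff[OF i2 i3])
   finally show "(LL x. (idens \<rho> x *R D x) \<bullet> grad ph x) = 0" .
  qed
  then have "AE x in lebesgue. x : UNIV --> norm (G l x - G j x) = norm (H x)" by eventually_elim (simp add: D_def)
  then have "lpn q UNIV (%x. G l x - G j x) = lpn q UNIV H" by (rule lpn_cong_AE)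
  also have "... <= en Q * (en (2 powr q) * (lpn q UNIV (%x. fk l x - f x) + lpn q UNIV (%x. f x - fk j x)))"
   using Hb mult_left_mono[OF lpn_triangle[OF fkm f fkm U1 q(1), of l j]] by (meson order_trans zero_le)
  also have "... <= en Q * (en (2 powr q) * (en (4 powr (- (q * real j))) + en (4 powr (- (q * real j)))))"
  proof (intro mult_left_mono add_mono)
   show "lpn q UNIV (%x. f x - fk j x) <= en (4 powr (- (q * real j)))"
    using hf[of j] lpn_diff_commute[of q UNIV f "fk j"] by (simp add: fk_def)
   have "lpn q UNIV (%x. fk l x - f x) <= en (4 powr (- (q * real l)))" using hf[of l] by (simp add: fk_def)
   also have "... <= en (4 powr (- (q * real j)))" using jl q by (intro ennreal_leI powr_mono) (auto intro!: mult_left_mono)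
   finally show "lpn q UNIV (%x. fk l x - f x) <= en (4 powr (- (q * real j)))" .
  qed auto
  also have "... = en (Q * 2 powr q * 2 * 4 powr (- (q * real j)))"
  proof -
   have "en (4 powr (- (q * real j))) + en (4 powr (- (q * real j))) = en (2 * 4 powr (- (q * real j)))"
    by (simp flip: ennreal_plus)
   then show ?thesis using Q0 by (simp add: mult.assoc flip: ennreal_mult)
  qed
  finally show ?thesis .
 qed
 define Gl where "Gl x = lim (%j. G j x)" for x
 have Glm[measurable]: "Gl : lmeas" unfolding Gl_def[abs_def] by (rule borel_measurable_lim_metric[OF Gm])
 have K0: "0 <= Q * 2 powr q * 2" using Q0 by simp
 have Gle: "lpn q UNIV (%x. Gl x - G j x) <= en (Q * 2 powr q * 2 * 4 powr (- (q * real j)))" for j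
  unfolding Gl_def by (rule lpn_complete[OF Gm U1 q(1) K0 cauchy])
 have "(%j. lpn q UNIV (%x. Gl x - G j x)) ~~> 0"
  by (rule ennreal_tendsto_0_le[OF four_powr_tendsto[OF q(1), of "Q * 2 powr q * 2"]]) (use Gle in simp)
 then have Glim: "(%j. lpn q UNIV (%x. G j x - Gl x)) ~~> 0" unfolding lpn_diff_commute[of q UNIV _ Gl] .
 have Glf: "lpn q UNIV Gl < inft"
 proof -
  have "lpn q UNIV (%x. (Gl x - G 0 x) + G 0 x) <= en (2 powr q) * (lpn q UNIV (%x. Gl x - G 0 x) + lpn q UNIV (G 0))"
   using q by (intro lpn_add_le2) auto
  also have "... < inft" using Gle[of 0] Gf[of 0] by (auto simp: ennreal_mult_less_top intro: order_le_less_trans)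
  finally show ?thesis by simp
 qed
 have "\<exists>u. u : lmeas \<and> (\<forall>K. compact K --> lpn q K u < inft) \<and> has_weak_grad UNIV u Gl"
 proof (rule weak_grads_closed[OF Glm Glf q(1)])
  fix e :: real assume e: "e > 0"
  have "\<forall>\<^sub>F j in sequentially. lpn q UNIV (%x. G j x - Gl x) < en e" using ennreal_tendsto_0D[OF Glim] e by simp
  then obtain j where "lpn q UNIV (%x. G j x - Gl x) < en e" using eventually_happens trivial_limit_sequentially by blast
  then show "\<exists>u g'. has_weak_grad UNIV u g' \<and> g' : lmeas \<and> lpn q UNIV (%x. g' x - Gl x) <= en e"
   using uw[of j] Gm[of j] less_imp_le by blast
 qed
 then obtain ul where ul: "ul : lmeas" "!!K. compact K ==> lpn q K ul < inft" "has_weak_grad UNIV ul Gl" by blast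
 have lim_eq: "(LL x. (idens \<rho> x *R Gl x - f x) \<bullet> grad ph x) = 0" if ph: "c1_test UNIV ph" for ph
 proof -
  have gm: "grad ph : lmeas" and gf: "lpn p UNIV (grad ph) < inft"
   using c1_test_grad(2)[OF ph p(1)] unfolding Lq_iff_lpn[OF U1] by (simp_all add: lebesgue_on_UNIV_eq)
  have m1: "(%x. idens \<rho> x *R G n x) : lmeas" for n by measurable
  have m2: "(%x. idens \<rho> x *R Gl x) : lmeas" by measurable
  have m3: "(%x. idens \<rho> x *R G n x - fk n x) : lmeas" for n by measurable
  have m4: "(%x. idens \<rho> x *R Gl x - f x) : lmeas" by measurable
  have f3: "lpn q UNIV (%x. idens \<rho> x *R G n x - fk n x) < inft" for n
   by (rule lpn_diff_finite[OF m1 fkm U1 q(1) lpn_idens_finite[OF Gm q0 Gf] fkf])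
  have f4: "lpn q UNIV (%x. idens \<rho> x *R Gl x - f x) < inft"
   by (rule lpn_diff_finite[OF m2 f U1 q(1) lpn_idens_finite[OF Glm q0 Glf] ff])
  have "(%n. lpn q UNIV (%x. (idens \<rho> x *R G n x - fk n x) - (idens \<rho> x *R Gl x - f x))) ~~> 0"
  proof -
   have a: "(%n. lpn q UNIV (%x. idens \<rho> x *R (G n x - Gl x))) ~~> 0"
   proof (rule ennreal_tendsto_0_le)
    show "(%n. en ((\<bar>inverse (\<rho> Plus)\<bar> + \<bar>inverse (\<rho> Minus)\<bar>) powr q) * lpn q UNIV (%x. G n x - Gl x)) ~~> 0"
     by (rule ennreal_tendsto_0_cmult[OF Glim]) simp
    show "\<forall>\<^sub>F n in sequentially. lpn q UNIV (%x. idens \<rho> x *R (G n x - Gl x)) <=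
      en ((\<bar>inverse (\<rho> Plus)\<bar> + \<bar>inverse (\<rho> Minus)\<bar>) powr q) * lpn q UNIV (%x. G n x - Gl x)"
     using q0 by (intro always_eventually allI lpn_idens_le) measurable
   qed
   have b: "(%n. lpn q UNIV (%x. f x - fk n x)) ~~> 0" using flim unfolding lpn_diff_commute[of q UNIV f] .
   have am: "(%x. idens \<rho> x *R (G n x - Gl x)) : lmeas" "(%x. f x - fk n x) : lmeas" for n by measurable
   have "(%n. lpn q UNIV (%x. idens \<rho> x *R (G n x - Gl x) + (f x - fk n x))) ~~> 0"
    by (rule lpn_tendsto_add[OF am U1 q(1) a b])
   then show ?thesis by (simp add: algebra_simps)
  qed
  from inner_dual_tendsto[OF gm m3 m4 p(1) p(3) gf f4 f3 this]
  have "(%n. LL x. grad ph x \<bullet> (idens \<rho> x *R G n x - fk n x)) ~~> (LL x. grad ph x \<bullet> (idens \<rho> x *R Gl x - f x))" .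
  then have "(%n. 0) ~~> (LL x. (idens \<rho> x *R Gl x - f x) \<bullet> grad ph x)"
   using eqk[OF ph] by (simp add: inner_commute)
  then show ?thesis by (simp add: LIMSEQ_const_iff)
 qed
 \<comment> \<open>\<open>lpn_bound_limit\<close> retains exactly the constant of the smooth
   case.\<close>
 have bound: "lpn q UNIV Gl <= en Q * lpn q UNIV f"
  by (rule lpn_bound_limit[OF f Glm fkm Gm U1 q(1) Q0 Gb flim Glim])
 have zero: "lpn q UNIV f = 0" if "C' < 0"
 proof -
  have m0: "(%x. 0 :: real) : borel_measurable (lebesgue :: 'n rvec measure)" by simp
  have z: "lpn q UNIV (fk k) <= en 0 * lpn q UNIV (%x. 0 :: real)" for k using Cneg[OF that, of k] by simp
  have l: "(%k::nat. lpn q UNIV (%x::'n rvec. (0::real) - 0)) ~~> 0" by (simp add: lpn_def)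
  \<comment> \<open>The same lemma with constant 0 passes the vanishing of the data to their
    limit.\<close>
  have "lpn q UNIV f <= en 0 * lpn q UNIV (%x::'n rvec. 0 :: real)"
   by (rule lpn_bound_limit[OF m0 f m0 fkm U1 q(1) order_refl z l flim])
  then show ?thesis by simp
 qed
 have "weak_sol \<rho> q C' f ul Gl" unfolding weak_sol_def using ul Glm Glf lim_eq bound zero by (simp add: Q_def)
 then show ?thesis by blast
qed

end

theorem theorem4p9:
  fixes \<rho> :: "phase \<Rightarrow> real" and q q' r M1 M2 C' :: real
    and \<Phi> :: "'n::{finite,linorder} rvec \<Rightarrow> 'n rvec"
    and A A' :: "'n rmat" and B B' :: "'n rvec \<Rightarrow> 'n rmat"
  assumes "CARD('n) \<ge> 2"
    and "\<rho> Plus > 0" and "\<rho> Minus > 0"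
    and "1 < q" and "q' = q / (q - 1)"
    and "real CARD('n) < r" and "max q q' \<le> r"
    and "0 < M1" and "M1 < 1 / 2"
    and "admissible_constants TYPE('n) \<rho> q M1 C'"
    and "\<exists>C''. admissible_constants TYPE('n) \<rho> q' M1 C''"
    and "1 \<le> M2"
    and "bent_interface M1 M2 r \<Phi> A B A' B'"
  shows
    "(\<forall>f :: 'n rvec \<Rightarrow> 'n rvec. f \<in> Lq q (UNIV - Sigma_tilde \<Phi>) \<longrightarrow>
       (\<exists>u \<in> hatH1 q UNIV.
         (\<forall>\<phi> \<in> hatH1 q' UNIV.
            pairing (UNIV - Sigma_tilde \<Phi>)
              (\<lambda>x. inverse (piecewise_density \<rho> \<Phi> x) *\<^sub>R wgrad UNIV u x) (wgrad UNIV \<phi>)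
            = pairing (UNIV - Sigma_tilde \<Phi>) f (wgrad UNIV \<phi>)) \<and>
         Lq_norm q UNIV (wgrad UNIV u)
           \<le> 2 * C' * (\<rho> Plus + \<rho> Minus) * Lq_norm q (UNIV - Sigma_tilde \<Phi>) f)) \<and>
     (\<forall>u \<in> hatH1 q UNIV.
        (\<forall>\<phi> \<in> hatH1 q' UNIV.
           pairing (UNIV - Sigma_tilde \<Phi>)
             (\<lambda>x. inverse (piecewise_density \<rho> \<Phi> x) *\<^sub>R wgrad UNIV u x) (wgrad UNIV \<phi>) = 0) \<longrightarrow>
        (\<exists>c. AE x in lebesgue. u x = c))"
proof -
 note q = assms(4,5)
 note p = dual_exponent[OF q]
 have q0: "0 < q" "0 <= q" using q(1) by simp_all
 have qr: "q <= r" "q' <= r" using assms(7) by simp_all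
 have \<rho>: "0 < \<rho> s" for s using assms(2,3) by (cases s) auto
 interpret bent \<Phi> A A' B B' M1 M2 r by unfold_locales fact+
 \<comment> \<open>The exponent dual to q' is q, so the one bound on r serves both families of
   constants.\<close>
 have mr: "max q (q / (q - 1)) <= r" "max q' (q' / (q' - 1)) <= r"
  unfolding q(2)[symmetric] p(3)[symmetric] using qr by simp_all
 obtain C where ex: "strong_existence q \<rho> \<Phi> (bent_normal \<Phi> A' B') C C'"
  using assms(10)[unfolded admissible_constants_def, rule_format, of r M2] assms(6,12,13) mr(1) by blast
 obtain C'' where "admissible_constants TYPE('n) \<rho> q' M1 C''" using assms(11) by blast
 then obtain C2 where ex2: "strong_existence q' \<rho> \<Phi> (bent_normal \<Phi> A' B') C2 C''"
  unfolding admissible_constants_def using assms(6,12,13) mr(2) by blast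
 have U1: "UNIV : sets (lebesgue :: 'n rvec measure)" by simp
 define S where "S = UNIV - Sigma_tilde \<Phi>"
 have SS: "S : sets lebesgue" using sets.Un[OF Omega_lebesgue[of Plus] Omega_lebesgue[of Minus]] unfolding Omega_Un S_def .
 have wg: "has_weak_grad UNIV v (wgrad UNIV v)" "wgrad UNIV v : lmeas" "lpn e UNIV (wgrad UNIV v) < inft"
  if "v : hatH1 e UNIV" for v :: "'n rvec => real" and e
  using wgrad_Lq[OF that open_UNIV] unfolding Lq_iff_lpn[OF U1] by (simp_all add: lebesgue_on_UNIV_eq)
 \<comment> \<open>\<open>idens\<close> vanishes on the interface, so the pairing over its
   complement is an integral over the whole space.\<close>
 have pair: "pairing S (%x. inverse (piecewise_density \<rho> \<Phi> x) *R g x) k = (LL x. (idens \<rho> x *R g x) \<bullet> k x)" for g k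
 proof -
  have "ind S x *R ((idens \<rho> x *R g x) \<bullet> k x) = (idens \<rho> x *R g x) \<bullet> k x" for x
   using idens_outside[of x \<rho>] by (auto simp: S_def indicator_def)
  then show ?thesis unfolding pairing_def idens_def[symmetric] LINT_lebesgue_on(1)[OF SS] by (simp only:)
 qed
 have "\<exists>u\<in>hatH1 q UNIV. (\<forall>ph\<in>hatH1 q' UNIV.
      pairing S (%x. inverse (piecewise_density \<rho> \<Phi> x) *R wgrad UNIV u x) (wgrad UNIV ph) = pairing S f (wgrad UNIV ph)) \<and>
    Lq_norm q UNIV (wgrad UNIV u) <= 2 * C' * (\<rho> Plus + \<rho> Minus) * Lq_norm q S f"
  if f: "f : Lq q S" for f :: "'n rvec => 'n rvec"
 proof -
  define f0 where "f0 x = ind S x *R f x" for x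
  have f0m[measurable]: "f0 : lmeas"
   using f unfolding Lq_iff_lpn[OF SS] LINT_lebesgue_on(3)[OF SS] f0_def by blast
  have "lpn q UNIV f0 = lpn q S f" unfolding lpn_def f0_def by (intro nn_integral_cong) (auto simp: indicator_def)
  then have lf: "lpn q UNIV f0 = en (Lq_norm q S f powr q)" using Lq_norm_powr[OF SS f q0(1)] by simp
  then have f0f: "lpn q UNIV f0 < inft" by simp
  have f0S: "f0 x = 0" if "x : Sigma_tilde \<Phi>" for x using that by (simp add: f0_def S_def)
  obtain u G where ws: "weak_sol \<rho> q C' f0 u G" using weak_solution[OF \<rho> q qr ex ex2 f0m f0f f0S] by blast
  note u = weak_solD(1,2)[OF ws] and G = weak_solD(3-5)[OF ws] and eq = weak_solD(6)[OF ws] and bd = weak_solD(7)[OF ws] and Cn = weak_solD(8)[OF ws]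
  have uH: "u : hatH1 q UNIV"
  proof -
   have "u : Lq q (UNIV \<inter> K)" if "compact K" for K
    using u that lm_compact[OF that] by (simp add: Lq_iff_lpn meas_restrict1 fmeasurableD)
   moreover have "G : Lq q UNIV" using G by (simp add: Lq_iff_lpn[OF U1] lebesgue_on_UNIV_eq)
   ultimately show ?thesis using G(3) unfolding hatH1_def Lq_loc_closure_def by blast
  qed
  note W = wg[OF uH]
  note [measurable] = W(2) G(1)
  have ae: "AE x in lebesgue. wgrad UNIV u x = G x" using weak_grad_unique[OF open_UNIV W(1) G(3)] unfolding lebesgue_on_UNIV_eq .
  have Fm: "(%x. idens \<rho> x *R wgrad UNIV u x) : lmeas" by measurable
  have Ff: "lpn q UNIV (%x. idens \<rho> x *R wgrad UNIV u x) < inft" by (rule lpn_idens_finite[OF W(2) q0(2) W(3)])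
  have Dm: "(%x. idens \<rho> x *R wgrad UNIV u x - f0 x) : lmeas" by measurable
  have Df: "lpn q UNIV (%x. idens \<rho> x *R wgrad UNIV u x - f0 x) < inft"
   by (rule lpn_diff_finite[OF Fm f0m U1 q(1) Ff f0f])
  \<comment> \<open>\<open>wgrad\<close> and the G of the weak solution agree only almost
    everywhere, so the tested identity has to be transferred.\<close>
  have De: "(LL x. (idens \<rho> x *R wgrad UNIV u x - f0 x) \<bullet> grad ph x) = 0" if ph: "c1_test UNIV ph" for ph
  proof -
   have [measurable]: "grad ph : lmeas" by (rule cont_lmeas[OF continuous_grad[OF c1_testD(2)[OF ph]]])
   have "(LL x. (idens \<rho> x *R wgrad UNIV u x - f0 x) \<bullet> grad ph x) = (LL x. (idens \<rho> x *R G x - f0 x) \<bullet> grad ph x)"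
   proof (rule integral_cong_AE)
    show "AE x in lebesgue. (idens \<rho> x *R wgrad UNIV u x - f0 x) \<bullet> grad ph x = (idens \<rho> x *R G x - f0 x) \<bullet> grad ph x"
     using ae by eventually_elim simp
   qed measurable
   then show ?thesis using eq[OF ph] by simp
  qed
  have "pairing S (%x. inverse (piecewise_density \<rho> \<Phi> x) *R wgrad UNIV u x) (wgrad UNIV ph) = pairing S f (wgrad UNIV ph)"
   if ph: "ph : hatH1 q' UNIV" for ph
  proof -
   note H = wg[OF ph]
   have 1: "(LL x. (idens \<rho> x *R wgrad UNIV u x - f0 x) \<bullet> wgrad UNIV ph x) = 0"
    by (rule div_free_hatH1[OF Dm Df q De H])
   have i1: "intg (%x. (idens \<rho> x *R wgrad UNIV u x) \<bullet> wgrad UNIV ph x)" by (rule integrable_inner_dual[OF Fm H(2) q Ff H(3)])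
   have i2: "intg (%x. f0 x \<bullet> wgrad UNIV ph x)" by (rule integrable_inner_dual[OF f0m H(2) q f0f H(3)])
   have "(LL x. (idens \<rho> x *R wgrad UNIV u x) \<bullet> wgrad UNIV ph x) = (LL x. f0 x \<bullet> wgrad UNIV ph x)"
    using 1 unfolding inner_diff_left bi_int_diff[OF i1 i2] by simp
   also have "... = pairing S f (wgrad UNIV ph)"
    unfolding pairing_def LINT_lebesgue_on(1)[OF SS] f0_def by simp
   finally show ?thesis unfolding pair .
  qed
  moreover have "Lq_norm q UNIV (wgrad UNIV u) <= 2 * C' * (\<rho> Plus + \<rho> Minus) * Lq_norm q S f"
  proof -
   define Q where "Q = 2 * max 0 C' * (\<rho> Plus + \<rho> Minus)"
   have Q0: "0 <= Q" using \<rho>[of Plus] \<rho>[of Minus] by (simp add: Q_def)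
   have "lpn q UNIV (wgrad UNIV u) = lpn q UNIV G" using ae by (intro lpn_cong_AE) auto
   also have "... <= en (Q powr q) * en (Lq_norm q S f powr q)" using bd unfolding Q_def lf .
   also have "... = en ((Q * Lq_norm q S f) powr q)" using Q0 Lq_norm_nonneg[of q S f] by (simp add: powr_mult flip: ennreal_mult)
   finally have "Lq_norm q UNIV (wgrad UNIV u) <= Q * Lq_norm q S f"
    using Q0 q0(1) Lq_norm_nonneg[of q S f] wgrad_Lq(2)[OF uH open_UNIV] by (intro Lq_norm_leI[OF U1]) auto
   \<comment> \<open>For negative C' both sides are zero, because the data vanish.\<close>
   moreover have "Q * Lq_norm q S f = 2 * C' * (\<rho> Plus + \<rho> Minus) * Lq_norm q S f"
   proof (cases "C' < 0")
    case True
    then have "Lq_norm q S f = 0" using Cn lf by simp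
    then show ?thesis by simp
   qed (simp add: Q_def)
   ultimately show ?thesis by simp
  qed
  ultimately show ?thesis using uH by blast
 qed
 moreover have "\<exists>c. AE x in lebesgue. u x = c"
  if u: "u : hatH1 q UNIV" and 0: "\<forall>ph\<in>hatH1 q' UNIV. pairing S (%x. inverse (piecewise_density \<rho> \<Phi> x) *R wgrad UNIV u x) (wgrad UNIV ph) = 0" for u
 proof -
  note W = wg[OF u]
  note [measurable] = W(2)
  have "(LL x. (idens \<rho> x *R wgrad UNIV u x) \<bullet> grad ph x) = 0" if ph: "c1_test UNIV ph" for ph
  proof -
   have H: "ph : hatH1 q' UNIV" by (rule c1_test_grad(3)[OF ph p(1)])
   note [measurable] = wg(2)[OF H]
   have [measurable]: "grad ph : lmeas" by (rule cont_lmeas[OF continuous_grad[OF c1_testD(2)[OF ph]]])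
   have ae: "AE x in lebesgue. grad ph x = wgrad UNIV ph x"
    using weak_grad_unique[OF open_UNIV c1_test_grad(1)[OF ph p(1)] wg(1)[OF H]] unfolding lebesgue_on_UNIV_eq .
   have "(LL x. (idens \<rho> x *R wgrad UNIV u x) \<bullet> grad ph x) = (LL x. (idens \<rho> x *R wgrad UNIV u x) \<bullet> wgrad UNIV ph x)"
   proof (rule integral_cong_AE)
    show "AE x in lebesgue. (idens \<rho> x *R wgrad UNIV u x) \<bullet> grad ph x = (idens \<rho> x *R wgrad UNIV u x) \<bullet> wgrad UNIV ph x"
     using ae by eventually_elim simp
   qed measurable
   also have "... = 0" using 0 H unfolding pair by blast
   finally show ?thesis .
  qed
  then have G0: "AE x in lebesgue. wgrad UNIV u x = 0" by (rule weak_homogeneous_zero[OF \<rho> q qr(2) ex2 W(2) W(3) W(1)])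
  have "lpn q K u < inft" if K: "compact K" for K
  proof -
   have "u : Lq q (UNIV \<inter> K)" using u K unfolding hatH1_def by (intro Lq_loc_closureD) auto
   then show ?thesis using Lq_iff_lpn[OF fmeasurableD[OF lm_compact[OF K]], of u q] by simp
  qed
  then show ?thesis by (rule weak_grad_zero_constant[OF W(1) G0 q(1)])
 qed
 ultimately show ?thesis unfolding S_def by blast
qed

end
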